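(* Let $(K\to M,C,\mathcal U,g,\kappa,h,D,\mathcal Q)$ be a $CV\oplus$-structure satisfying the unfolding condition. Then the hermitian forms $h^{end}$, $h^F$ and $h^M$ are automatically positive definite. Let $\circ$ and $e$ be the multiplication and the unit field of the induced $F$-manifold structure on $M$. (a) The holomorphic sectional curvature of $h^M$ is non-positive: $$R^{sect}(X):=\frac{h^M(R^M(X,\bar X)X,X)}{h^M(X,X)^2}\le 0\qquad\text{for all } X\in TM\setminus\{0\},$$ and it vanishes in the direction of $e$: $R^{sect}(e)=0$. (b) Let $t\in M$ be such that $(T_tM,\circ_t,e_t)$ is an irreducible algebra. Then the decomposition $T_tM=\mathbb C e_t\oplus I^{max}(T_tM)$ into the line $\mathbb C e_t$ and the maximal ideal $I^{max}(T_tM)$ extends, in a neighbourhood $V$ of $t$, to a decomposition: for every $\tilde t\in V$ there is a subset $U_{\tilde t}\subset T_{\tilde t}M$ with $$T_{\tilde t}M=\mathbb C e_{\tilde t}+U_{\tilde t},\qquad \mathbb C e_{\tilde t}\cap U_{\tilde t}=\{0\},$$ such that the following hold: (i) for every $\tilde t\in V$, $U_{\tilde t}$ is a cone in $T_{\tilde t}M$ (that is, $r\cdot U_{\tilde t}\subset U_{\tilde t}$ for all real $r\ge 0$), and $I^{max}(T_tM)\subset U_t$; (ii) there is $k_0>0$ such that $R^{sect}(X)<-k_0$ for all $\tilde t\in V$ and all $X\in U_{\tilde t}\setminus\{0\}$; (iii) for every $\lambda_0>0$ there is $k_1>0$ such that $R^{sect}(X)<-k_1$ for all $\tilde t\in V$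 and all $X\in T_{\tilde t}V$ with $X-e_{\tilde t}\in U_{\tilde t}\setminus\{0\}$ and $h^M(X-e_{\tilde t},X-e_{\tilde t})>\lambda_0\,h^M(X,X)$.
   Context: $M$ is a complex manifold, $TM$ its holomorphic tangent bundle, $\mathcal T_M$ the sheaf of holomorphic vector fields, $\mathcal O(K)$ the sheaf of holomorphic sections of a holomorphic vector bundle $K$. **CV-structure.** A CV-structure is a tuple $(K\to M,C,\mathcal U,g,\kappa,h,D,\mathcal Q)$ where: - $K\to M$ is a holomorphic vector bundle, $C\in\Omega^1_M\otimes\mathcal O(\mathrm{End}K)$ and $\mathcal U\in\mathcal O(\mathrm{End}K)$ are holomorphic, $g$ is a holomorphic symmetric non-degenerate bilinear form on $K$, with $C_XC_Y=C_YC_X$, $[C_X,\mathcal U]=0$, $g(C_Xa,b)=g(a,C_Xb)$, $g(\mathcal U a,b)=g(a,\mathcal U b)$; - $\kappa:K\to K$ is a smooth fibrewise $\mathbb C$-antilinear bundle map, $\kappa^2=\mathrm{id}$, $g(\kappa a,\kappa b)=\overline{g(a,b)}$; - $h:=g(\cdot,\kappa\cdot)$ is a non-degenerate (possibly indefinite) hermitian form, linear in the first and conjugate linear in the second argument, and its Chern connection $D$ satisfies, for $X,Y\in\mathcal T_M$: $D(\kappa)=0$ (i.e. $D_X(\kappa a)=\kappa D_{\bar X}a$), $D_X(C_Y)-D_Y(C_X)-C_{[X,Y]}=0$, and $R^D(X,\bar Y)+[C_X,\kappa C_Y\kappa]=0$, where $R^D$ is the curvature of $D$; - $\mathcal Q$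 is a smooth endomorphism of $K$ with $g(\mathcal Qa,b)=-g(a,\mathcal Qb)$, $h(\mathcal Qa,b)=h(a,\mathcal Qb)$, and for $X\in\mathcal T_M$: $D_X(\mathcal U)-[C_X,\mathcal Q]+C_X=0$, $D_X(\mathcal Q)+[C_X,\kappa\,\mathcal U\kappa]=0$. It is a $CV\oplus$-structure if $h$ is positive definite. **Unfolding condition.** There is a section $\zeta\in\mathcal O(K)$ such that $TM\to K$, $X\mapsto -C_X(\zeta)$, is an isomorphism. Then $M$ carries an induced $F$-manifold structure: a commutative associative multiplication $\circ$ on $TM$ with unit field $e$ and an Euler field $E$, determined by $C_{X\circ Y}=-C_XC_Y$, $C_e=-\mathrm{id}$, $C_E=-\mathcal U$. An algebra $(T_tM,\circ_t,e_t)$ is irreducible if it is not a direct sum of two non-zero algebras (equivalently, it is a local algebra); $I^{max}(T_tM)$ is then its unique maximal ideal. **The metric $h^M$.** $h^{end}$ is the hermitian form on $\mathrm{End}(K)$ induced by $h$: $h^{end}(A,B)=\sum_i h(A(e_i),B(e_i^* ))$, where $\{e_i\}$ is a basis of $K$ and $\{e_i^*\}$ the $h$-dual basis, $h(e_i,e_j^* )=\delta_{ij}$. Let $F:=\{C_X : X\in TM\}\subset\mathrm{End}(K)$, a holomorphic subbundle isomorphic to $TM$ via $X\mapsto -C_X$; $h^F:=h^{end}|_F$ and $h^M$ is the hermitian form on $TM$ corresponding to $h^F$ under this isomorphism, i.e. $h^M(X,Y)=h^{end}(C_X,C_Y)$. $R^M$ is the curvature of the Chern connection of $h^M$ on $TM$.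 *)

theory Defs
  imports "HOL-Analysis.Analysis" "HOL-Library.Function_Algebras"
begin

section \<open>Smooth and holomorphic functions on open subsets of \<open>\<complex>\<^sup>m\<close>\<close>

primrec Ck_on :: "nat \<Rightarrow> (complex^'m::finite) set \<Rightarrow> (complex^'m \<Rightarrow> complex) \<Rightarrow> bool" where
  "Ck_on 0 S f \<longleftrightarrow> continuous_on S f"
| "Ck_on (Suc k) S f \<longleftrightarrow> (\<forall>x\<in>S. f differentiable (at x)) \<and>
     (\<forall>v. Ck_on k S (\<lambda>x. frechet_derivative f (at x) v))"

definition smooth_on :: "(complex^'m::finite) set \<Rightarrow> (complex^'m \<Rightarrow> complex) \<Rightarrow> bool" where
  "smooth_on S f \<longleftrightarrow> (\<forall>k. Ck_on k S f)"

text \<open>As usual in several complex variables: smooth, with complex linear differential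
  (i.e. \<open>\<partial>\<close>-bar of the function vanishes).\<close>

definition hol_on :: "(complex^'m::finite) set \<Rightarrow> (complex^'m \<Rightarrow> complex) \<Rightarrow> bool" where
  "hol_on S f \<longleftrightarrow> smooth_on S f \<and>
     (\<forall>x\<in>S. \<forall>z v. frechet_derivative f (at x) (z *s v) = z * frechet_derivative f (at x) v)"

section \<open>Complex manifolds\<close>

text \<open>A chart is its (open) domain together with the coordinate map; the values of the map
  outside the domain are irrelevant. The manifold is the union of the domains.\<close>

type_synonym ('a, 'm) chart = "'a set \<times> ('a \<Rightarrow> complex^'m)"

definition chart_inv :: "('a, 'm::finite) chart \<Rightarrow> complex^'m \<Rightarrow> 'a" where
  "chart_inv c = inv_into (fst c) (snd c)"

definition mfd :: "('a, 'm::finite) chart set \<Rightarrow> 'a set" where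
  "mfd A = (\<Union>c\<in>A. fst c)"

definition complex_manifold ::
    "('a::{t2_space, second_countable_topology}, 'm::finite) chart set \<Rightarrow> bool" where
  "complex_manifold A \<longleftrightarrow>
     (\<forall>c\<in>A. open (fst c) \<and> open (snd c ` fst c) \<and>
        homeomorphism (fst c) (snd c ` fst c) (snd c) (chart_inv c)) \<and>
     (\<forall>c\<in>A. \<forall>d\<in>A. \<forall>i. hol_on (snd c ` (fst c \<inter> fst d)) (\<lambda>x. snd d (chart_inv c x) $ i))"

definition open_in :: "('a::topological_space, 'm::finite) chart set \<Rightarrow> 'a set \<Rightarrow> bool" where
  "open_in A W \<longleftrightarrow> open W \<and> W \<subseteq> mfd A"

definition smooth_fun :: "('a, 'm::finite) chart set \<Rightarrow> 'a set \<Rightarrow> ('a \<Rightarrow> complex) \<Rightarrow> bool" where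
  "smooth_fun A W f \<longleftrightarrow> (\<forall>c\<in>A. smooth_on (snd c ` (W \<inter> fst c)) (f \<circ> chart_inv c))"

definition hol_fun :: "('a, 'm::finite) chart set \<Rightarrow> 'a set \<Rightarrow> ('a \<Rightarrow> complex) \<Rightarrow> bool" where
  "hol_fun A W f \<longleftrightarrow> (\<forall>c\<in>A. hol_on (snd c ` (W \<inter> fst c)) (f \<circ> chart_inv c))"

section \<open>Holomorphic vector bundles\<close>

text \<open>The fibres are complex subspaces of one ambient complex vector space
  (for an abstract bundle one may take the direct sum of all its fibres), and
  \<open>trivs\<close> is a set of local trivialisations \<open>(V, \<psi>)\<close>, where \<open>\<psi> p\<close> maps
  the fibre over \<open>p \<in> V\<close> to \<open>\<complex>\<^sup>n\<close>.\<close>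

record ('a, 'k, 'n) vbundle =
  fib :: "'a \<Rightarrow> 'k set"
  scl :: "complex \<Rightarrow> 'k \<Rightarrow> 'k"
  trivs :: "('a set \<times> ('a \<Rightarrow> 'k \<Rightarrow> complex^'n)) set"

definition holo_bundle ::
    "('a::topological_space, 'm::finite) chart set \<Rightarrow> ('a, 'k::ab_group_add, 'n::finite) vbundle \<Rightarrow> bool" where
  "holo_bundle A B \<longleftrightarrow>
     vector_space (scl B) \<and>
     (\<forall>p\<in>mfd A. module.subspace (scl B) (fib B p)) \<and>
     (\<forall>(V, \<psi>)\<in>trivs B. open_in A V \<and>
        (\<forall>p\<in>V. bij_betw (\<psi> p) (fib B p) UNIV \<and>
           (\<forall>a\<in>fib B p. \<forall>b\<in>fib B p. \<psi> p (a + b) = \<psi> p a + \<psi> p b) \<and>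
           (\<forall>z. \<forall>a\<in>fib B p. \<psi> p (scl B z a) = z *s \<psi> p a))) \<and>
     mfd A = (\<Union>(V, \<psi>)\<in>trivs B. V) \<and>
     (\<forall>(V, \<psi>)\<in>trivs B. \<forall>(W, \<phi>)\<in>trivs B. \<forall>y i.
        hol_fun A (V \<inter> W) (\<lambda>p. \<phi> p (inv_into (fib B p) (\<psi> p) y) $ i))"

definition smooth_sec ::
    "('a, 'm::finite) chart set \<Rightarrow> ('a, 'k, 'n::finite) vbundle \<Rightarrow> 'a set \<Rightarrow> ('a \<Rightarrow> 'k) \<Rightarrow> bool" where
  "smooth_sec A B W s \<longleftrightarrow> (\<forall>p\<in>W. s p \<in> fib B p) \<and>
     (\<forall>(V, \<psi>)\<in>trivs B. \<forall>i. smooth_fun A (W \<inter> V) (\<lambda>p. \<psi> p (s p) $ i))"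

definition hol_sec ::
    "('a, 'm::finite) chart set \<Rightarrow> ('a, 'k, 'n::finite) vbundle \<Rightarrow> 'a set \<Rightarrow> ('a \<Rightarrow> 'k) \<Rightarrow> bool" where
  "hol_sec A B W s \<longleftrightarrow> (\<forall>p\<in>W. s p \<in> fib B p) \<and>
     (\<forall>(V, \<psi>)\<in>trivs B. \<forall>i. hol_fun A (W \<inter> V) (\<lambda>p. \<psi> p (s p) $ i))"

text \<open>Endomorphisms of a fibre are extended by 0 to the ambient space, so that
  equality of endomorphisms is equality of functions.\<close>

definition fib_end :: "('a, 'k::ab_group_add, 'n::finite) vbundle \<Rightarrow> 'a \<Rightarrow> ('k \<Rightarrow> 'k) set" where
  "fib_end B p = {\<Phi>. (\<forall>a\<in>fib B p. \<Phi> a \<in> fib B p) \<and>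
     (\<forall>a\<in>fib B p. \<forall>b\<in>fib B p. \<Phi> (a + b) = \<Phi> a + \<Phi> b) \<and>
     (\<forall>z. \<forall>a\<in>fib B p. \<Phi> (scl B z a) = scl B z (\<Phi> a)) \<and>
     (\<forall>a. a \<notin> fib B p \<longrightarrow> \<Phi> a = 0)}"

definition end_scl :: "('a, 'k, 'n::finite) vbundle \<Rightarrow> complex \<Rightarrow> ('k \<Rightarrow> 'k) \<Rightarrow> 'k \<Rightarrow> 'k" where
  "end_scl B z \<Phi> = (\<lambda>a. scl B z (\<Phi> a))"

section \<open>The holomorphic tangent bundle\<close>

text \<open>A tangent vector at \<open>p\<close> is the family of its coordinate vectors in all charts
  around \<open>p\<close>, related by the Jacobians of the coordinate changes.\<close>

type_synonym ('a, 'm) tvec = "('a, 'm) chart \<Rightarrow> complex^'m"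

definition tspace :: "('a, 'm::finite) chart set \<Rightarrow> 'a \<Rightarrow> ('a, 'm) tvec set" where
  "tspace A p = {X. (\<forall>c. \<not> (c \<in> A \<and> p \<in> fst c) \<longrightarrow> X c = 0) \<and>
     (\<forall>c\<in>A. \<forall>d\<in>A. p \<in> fst c \<and> p \<in> fst d \<longrightarrow>
        X d = frechet_derivative (snd d \<circ> chart_inv c) (at (snd c p)) (X c))}"

definition tscl :: "complex \<Rightarrow> ('a, 'm::finite) tvec \<Rightarrow> ('a, 'm) tvec" where
  "tscl z X = (\<lambda>c. z *s X c)"

definition tbundle :: "('a, 'm::finite) chart set \<Rightarrow> ('a, ('a, 'm) tvec, 'm) vbundle" where
  "tbundle A = \<lparr>fib = tspace A, scl = tscl, trivs = {(fst c, \<lambda>p X. X c) | c. c \<in> A}\<rparr>"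

text \<open>The derivatives \<open>X f\<close> and \<open>X\<close>-bar \<open>f\<close> at \<open>p\<close> of a smooth function
  (Wirtinger derivatives in any chart around \<open>p\<close>).\<close>

definition der10 :: "('a, 'm::finite) chart set \<Rightarrow> ('a \<Rightarrow> complex) \<Rightarrow> 'a \<Rightarrow> ('a, 'm) tvec \<Rightarrow> complex" where
  "der10 A f p X =
     (let c = (SOME c. c \<in> A \<and> p \<in> fst c);
          d = frechet_derivative (f \<circ> chart_inv c) (at (snd c p))
      in (d (X c) - \<i> * d (\<i> *s X c)) / 2)"

definition der01 :: "('a, 'm::finite) chart set \<Rightarrow> ('a \<Rightarrow> complex) \<Rightarrow> 'a \<Rightarrow> ('a, 'm) tvec \<Rightarrow> complex" where
  "der01 A f p X =
     (let c = (SOME c. c \<in> A \<and> p \<in> fst c);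
          d = frechet_derivative (f \<circ> chart_inv c) (at (snd c p))
      in (d (X c) + \<i> * d (\<i> *s X c)) / 2)"

definition lie_bracket ::
    "('a, 'm::finite) chart set \<Rightarrow> ('a \<Rightarrow> ('a, 'm) tvec) \<Rightarrow> ('a \<Rightarrow> ('a, 'm) tvec) \<Rightarrow> 'a \<Rightarrow> ('a, 'm) tvec" where
  "lie_bracket A X Y p = (\<lambda>c. if c \<in> A \<and> p \<in> fst c
     then frechet_derivative (\<lambda>x. Y (chart_inv c x) c) (at (snd c p)) (X p c)
        - frechet_derivative (\<lambda>x. X (chart_inv c x) c) (at (snd c p)) (Y p c)
     else 0)"

section \<open>Connections\<close>

text \<open>\<open>d10 D s p X\<close> and \<open>d01 D s p X\<close> are the derivatives of the section \<open>s\<close> at \<open>p\<close>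
  in direction \<open>X\<close> and \<open>X\<close>-bar, for \<open>X\<close> in the holomorphic tangent space at \<open>p\<close>.
  Only their values on sections that are smooth near \<open>p\<close> matter.\<close>

record ('a, 't, 'k) conn =
  d10 :: "('a \<Rightarrow> 'k) \<Rightarrow> 'a \<Rightarrow> 't \<Rightarrow> 'k"
  d01 :: "('a \<Rightarrow> 'k) \<Rightarrow> 'a \<Rightarrow> 't \<Rightarrow> 'k"

definition connection ::
    "('a::topological_space, 'm::finite) chart set \<Rightarrow> ('a, 'k::ab_group_add, 'n::finite) vbundle \<Rightarrow>
     ('a, ('a, 'm) tvec, 'k) conn \<Rightarrow> bool" where
  "connection A B D \<longleftrightarrow> (\<forall>W s. open_in A W \<and> smooth_sec A B W s \<longrightarrow>
     (\<forall>X. smooth_sec A (tbundle A) W X \<longrightarrow>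
        smooth_sec A B W (\<lambda>p. d10 D s p (X p)) \<and> smooth_sec A B W (\<lambda>p. d01 D s p (X p))) \<and>
     (\<forall>p\<in>W. \<forall>X\<in>tspace A p. \<forall>Y\<in>tspace A p.
        d10 D s p (X + Y) = d10 D s p X + d10 D s p Y \<and>
        d01 D s p (X + Y) = d01 D s p X + d01 D s p Y) \<and>
     (\<forall>p\<in>W. \<forall>X\<in>tspace A p. \<forall>z.
        d10 D s p (tscl z X) = scl B z (d10 D s p X) \<and>
        d01 D s p (tscl z X) = scl B (cnj z) (d01 D s p X)) \<and>
     (\<forall>s'. smooth_sec A B W s' \<longrightarrow> (\<forall>p\<in>W. \<forall>X\<in>tspace A p.
        d10 D (\<lambda>q. s q + s' q) p X = d10 D s p X + d10 D s' p X \<and>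
        d01 D (\<lambda>q. s q + s' q) p X = d01 D s p X + d01 D s' p X)) \<and>
     (\<forall>s'. (\<forall>q\<in>W. s' q = s q) \<longrightarrow> (\<forall>p\<in>W. \<forall>X\<in>tspace A p.
        d10 D s' p X = d10 D s p X \<and> d01 D s' p X = d01 D s p X)) \<and>
     (\<forall>f. smooth_fun A W f \<longrightarrow> (\<forall>p\<in>W. \<forall>X\<in>tspace A p.
        d10 D (\<lambda>q. scl B (f q) (s q)) p X = scl B (der10 A f p X) (s p) + scl B (f p) (d10 D s p X) \<and>
        d01 D (\<lambda>q. scl B (f q) (s q)) p X = scl B (der01 A f p X) (s p) + scl B (f p) (d01 D s p X))))"

text \<open>The Chern connection of a hermitian form: the metric connection whose (0,1)-part is
  the Cauchy-Riemann operator of the holomorphic bundle, i.e. annihilates the holomorphic sections.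
  The two compatibility equations are \<open>d (h s s') = h (D s) s' + h s (D s')\<close> evaluated
  on \<open>X\<close> and \<open>X\<close>-bar; \<open>h\<close> is conjugate linear in the second argument.\<close>

definition chern_connection ::
    "('a::topological_space, 'm::finite) chart set \<Rightarrow> ('a, 'k::ab_group_add, 'n::finite) vbundle \<Rightarrow>
     ('a \<Rightarrow> 'k \<Rightarrow> 'k \<Rightarrow> complex) \<Rightarrow> ('a, ('a, 'm) tvec, 'k) conn \<Rightarrow> bool" where
  "chern_connection A B h D \<longleftrightarrow> connection A B D \<and>
     (\<forall>W s s'. open_in A W \<and> smooth_sec A B W s \<and> smooth_sec A B W s' \<longrightarrow>
        (\<forall>p\<in>W. \<forall>X\<in>tspace A p.
           der10 A (\<lambda>q. h q (s q) (s' q)) p X = h p (d10 D s p X) (s' p) + h p (s p) (d01 D s' p X) \<and>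
           der01 A (\<lambda>q. h q (s q) (s' q)) p X = h p (d01 D s p X) (s' p) + h p (s p) (d10 D s' p X))) \<and>
     (\<forall>W s. open_in A W \<and> hol_sec A B W s \<longrightarrow> (\<forall>p\<in>W. \<forall>X\<in>tspace A p. d01 D s p X = 0))"

text \<open>The curvature \<open>R(X, Y\<close>-bar\<open>)\<close> for holomorphic vector fields \<open>X\<close>, \<open>Y\<close>,
  applied to a section; there is no third term because \<open>[X, Y\<close>-bar\<open>] = 0\<close>.\<close>

definition curv_sec ::
    "('a, 't, 'k::ab_group_add) conn \<Rightarrow> ('a \<Rightarrow> 't) \<Rightarrow> ('a \<Rightarrow> 't) \<Rightarrow> ('a \<Rightarrow> 'k) \<Rightarrow> 'a \<Rightarrow> 'k" where
  "curv_sec D X Y s p =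
     d10 D (\<lambda>q. d01 D s q (Y q)) p (X p) - d01 D (\<lambda>q. d10 D s q (X q)) p (Y p)"

text \<open>The value of the curvature tensor on vectors at \<open>p\<close>, by extending them to
  local holomorphic vector fields and a local smooth section.\<close>

definition curv ::
    "('a::topological_space, 'm::finite) chart set \<Rightarrow> ('a, 'k::ab_group_add, 'n::finite) vbundle \<Rightarrow>
     ('a, ('a, 'm) tvec, 'k) conn \<Rightarrow> 'a \<Rightarrow> ('a, 'm) tvec \<Rightarrow> ('a, 'm) tvec \<Rightarrow> 'k \<Rightarrow> 'k" where
  "curv A B D p X Y a = (THE r. \<exists>W X' Y' s. open_in A W \<and> p \<in> W \<and>
     hol_sec A (tbundle A) W X' \<and> hol_sec A (tbundle A) W Y' \<and> smooth_sec A B W s \<and>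
     X' p = X \<and> Y' p = Y \<and> s p = a \<and> r = curv_sec D X' Y' s p)"

definition end_der ::
    "('a, 't, 'k::ab_group_add) conn \<Rightarrow> ('a \<Rightarrow> 'k \<Rightarrow> 'k) \<Rightarrow> ('a \<Rightarrow> 'k) \<Rightarrow> 'a \<Rightarrow> 't \<Rightarrow> 'k" where
  \<comment> \<open>\<open>(D\<^sub>X \<Phi>) s = D\<^sub>X (\<Phi> s) - \<Phi> (D\<^sub>X s)\<close>\<close>
  "end_der D \<Phi> s p X = d10 D (\<lambda>q. \<Phi> q (s q)) p X - \<Phi> p (d10 D s p X)"

section \<open>Hermitian forms\<close>

definition hermitian_form ::
    "(complex \<Rightarrow> 'v \<Rightarrow> 'v) \<Rightarrow> 'v::ab_group_add set \<Rightarrow> ('v \<Rightarrow> 'v \<Rightarrow> complex) \<Rightarrow> bool" where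
  "hermitian_form sc V H \<longleftrightarrow>
     (\<forall>a\<in>V. \<forall>b\<in>V. \<forall>c\<in>V. H (a + b) c = H a c + H b c) \<and>
     (\<forall>z. \<forall>a\<in>V. \<forall>b\<in>V. H (sc z a) b = z * H a b) \<and>
     (\<forall>a\<in>V. \<forall>b\<in>V. H b a = cnj (H a b))"

definition pos_def_form ::
    "(complex \<Rightarrow> 'v \<Rightarrow> 'v) \<Rightarrow> 'v::ab_group_add set \<Rightarrow> ('v \<Rightarrow> 'v \<Rightarrow> complex) \<Rightarrow> bool" where
  "pos_def_form sc V H \<longleftrightarrow> hermitian_form sc V H \<and> (\<forall>a\<in>V - {0}. Re (H a a) > 0)"

section \<open>CV-structures\<close>

locale CV_structure =
  fixes A :: "('a::{t2_space, second_countable_topology}, 'm::finite) chart set"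
    and K :: "('a, 'k::ab_group_add, 'n::finite) vbundle"
    and C :: "'a \<Rightarrow> ('a, 'm) tvec \<Rightarrow> 'k \<Rightarrow> 'k"
    and \<U> :: "'a \<Rightarrow> 'k \<Rightarrow> 'k"
    and g :: "'a \<Rightarrow> 'k \<Rightarrow> 'k \<Rightarrow> complex"
    and \<kappa> :: "'a \<Rightarrow> 'k \<Rightarrow> 'k"
    and h :: "'a \<Rightarrow> 'k \<Rightarrow> 'k \<Rightarrow> complex"
    and D :: "('a, ('a, 'm) tvec, 'k) conn"
    and \<Q> :: "'a \<Rightarrow> 'k \<Rightarrow> 'k"
  assumes M: "complex_manifold A"
    and K: "holo_bundle A K"
    \<comment> \<open>the holomorphic objects \<open>C\<close>, \<open>\<U>\<close>, \<open>g\<close>\<close>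
    and C_end: "\<lbrakk>p \<in> mfd A; X \<in> tspace A p\<rbrakk> \<Longrightarrow> C p X \<in> fib_end K p"
    and C_add: "\<lbrakk>p \<in> mfd A; X \<in> tspace A p; Y \<in> tspace A p\<rbrakk> \<Longrightarrow> C p (X + Y) = C p X + C p Y"
    and C_scl: "\<lbrakk>p \<in> mfd A; X \<in> tspace A p\<rbrakk> \<Longrightarrow> C p (tscl z X) = end_scl K z (C p X)"
    and C_hol: "\<lbrakk>open_in A W; hol_sec A (tbundle A) W \<xi>; hol_sec A K W s\<rbrakk>
        \<Longrightarrow> hol_sec A K W (\<lambda>p. C p (\<xi> p) (s p))"
    and U_end: "p \<in> mfd A \<Longrightarrow> \<U> p \<in> fib_end K p"
    and U_hol: "\<lbrakk>open_in A W; hol_sec A K W s\<rbrakk> \<Longrightarrow> hol_sec A K W (\<lambda>p. \<U> p (s p))"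
    and g_add: "\<lbrakk>p \<in> mfd A; a \<in> fib K p; b \<in> fib K p; c \<in> fib K p\<rbrakk> \<Longrightarrow> g p (a + b) c = g p a c + g p b c"
    and g_scl: "\<lbrakk>p \<in> mfd A; a \<in> fib K p; b \<in> fib K p\<rbrakk> \<Longrightarrow> g p (scl K z a) b = z * g p a b"
    and g_sym: "\<lbrakk>p \<in> mfd A; a \<in> fib K p; b \<in> fib K p\<rbrakk> \<Longrightarrow> g p a b = g p b a"
    and g_nondeg: "\<lbrakk>p \<in> mfd A; a \<in> fib K p; \<forall>b\<in>fib K p. g p a b = 0\<rbrakk> \<Longrightarrow> a = 0"
    and g_hol: "\<lbrakk>open_in A W; hol_sec A K W s; hol_sec A K W s'\<rbrakk> \<Longrightarrow> hol_fun A W (\<lambda>p. g p (s p) (s' p))"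
    and C_comm: "\<lbrakk>p \<in> mfd A; X \<in> tspace A p; Y \<in> tspace A p\<rbrakk> \<Longrightarrow> C p X \<circ> C p Y = C p Y \<circ> C p X"
    and CU_comm: "\<lbrakk>p \<in> mfd A; X \<in> tspace A p\<rbrakk> \<Longrightarrow> C p X \<circ> \<U> p = \<U> p \<circ> C p X"
    and C_g: "\<lbrakk>p \<in> mfd A; X \<in> tspace A p; a \<in> fib K p; b \<in> fib K p\<rbrakk> \<Longrightarrow> g p (C p X a) b = g p a (C p X b)"
    and U_g: "\<lbrakk>p \<in> mfd A; a \<in> fib K p; b \<in> fib K p\<rbrakk> \<Longrightarrow> g p (\<U> p a) b = g p a (\<U> p b)"
    \<comment> \<open>the real structure \<open>\<kappa>\<close>\<close>
    and kappa_fib: "\<lbrakk>p \<in> mfd A; a \<in> fib K p\<rbrakk> \<Longrightarrow> \<kappa> p a \<in> fib K p"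
    and kappa_add: "\<lbrakk>p \<in> mfd A; a \<in> fib K p; b \<in> fib K p\<rbrakk> \<Longrightarrow> \<kappa> p (a + b) = \<kappa> p a + \<kappa> p b"
    and kappa_scl: "\<lbrakk>p \<in> mfd A; a \<in> fib K p\<rbrakk> \<Longrightarrow> \<kappa> p (scl K z a) = scl K (cnj z) (\<kappa> p a)"
    and kappa_smooth: "\<lbrakk>open_in A W; smooth_sec A K W s\<rbrakk> \<Longrightarrow> smooth_sec A K W (\<lambda>p. \<kappa> p (s p))"
    and kappa_invol: "\<lbrakk>p \<in> mfd A; a \<in> fib K p\<rbrakk> \<Longrightarrow> \<kappa> p (\<kappa> p a) = a"
    and kappa_g: "\<lbrakk>p \<in> mfd A; a \<in> fib K p; b \<in> fib K p\<rbrakk> \<Longrightarrow> g p (\<kappa> p a) (\<kappa> p b) = cnj (g p a b)"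
    \<comment> \<open>the hermitian form \<open>h\<close> and its Chern connection \<open>D\<close>\<close>
    and h_def: "\<lbrakk>p \<in> mfd A; a \<in> fib K p; b \<in> fib K p\<rbrakk> \<Longrightarrow> h p a b = g p a (\<kappa> p b)"
    and h_hermitian: "p \<in> mfd A \<Longrightarrow> hermitian_form (scl K) (fib K p) (h p)"
    and h_nondeg: "\<lbrakk>p \<in> mfd A; a \<in> fib K p; \<forall>b\<in>fib K p. h p a b = 0\<rbrakk> \<Longrightarrow> a = 0"
    and D_chern: "chern_connection A K h D"
    and D_kappa: "\<lbrakk>open_in A W; smooth_sec A K W s; p \<in> W; X \<in> tspace A p\<rbrakk>
        \<Longrightarrow> d10 D (\<lambda>q. \<kappa> q (s q)) p X = \<kappa> p (d01 D s p X)"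
    and D_C: "\<lbrakk>open_in A W; hol_sec A (tbundle A) W \<xi>; hol_sec A (tbundle A) W \<eta>; smooth_sec A K W s; p \<in> W\<rbrakk>
        \<Longrightarrow> end_der D (\<lambda>q. C q (\<eta> q)) s p (\<xi> p) - end_der D (\<lambda>q. C q (\<xi> q)) s p (\<eta> p)
            - C p (lie_bracket A \<xi> \<eta> p) (s p) = 0"
    and D_curv: "\<lbrakk>open_in A W; hol_sec A (tbundle A) W \<xi>; hol_sec A (tbundle A) W \<eta>; smooth_sec A K W s; p \<in> W\<rbrakk>
        \<Longrightarrow> curv_sec D \<xi> \<eta> s p
            + (C p (\<xi> p) (\<kappa> p (C p (\<eta> p) (\<kappa> p (s p)))) - \<kappa> p (C p (\<eta> p) (\<kappa> p (C p (\<xi> p) (s p))))) = 0"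
    \<comment> \<open>the endomorphism \<open>\<Q>\<close>\<close>
    and Q_end: "p \<in> mfd A \<Longrightarrow> \<Q> p \<in> fib_end K p"
    and Q_smooth: "\<lbrakk>open_in A W; smooth_sec A K W s\<rbrakk> \<Longrightarrow> smooth_sec A K W (\<lambda>p. \<Q> p (s p))"
    and Q_g: "\<lbrakk>p \<in> mfd A; a \<in> fib K p; b \<in> fib K p\<rbrakk> \<Longrightarrow> g p (\<Q> p a) b = - g p a (\<Q> p b)"
    and Q_h: "\<lbrakk>p \<in> mfd A; a \<in> fib K p; b \<in> fib K p\<rbrakk> \<Longrightarrow> h p (\<Q> p a) b = h p a (\<Q> p b)"
    and D_U: "\<lbrakk>open_in A W; smooth_sec A K W s; p \<in> W; X \<in> tspace A p\<rbrakk>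
        \<Longrightarrow> end_der D \<U> s p X - (C p X (\<Q> p (s p)) - \<Q> p (C p X (s p))) + C p X (s p) = 0"
    and D_Q: "\<lbrakk>open_in A W; smooth_sec A K W s; p \<in> W; X \<in> tspace A p\<rbrakk>
        \<Longrightarrow> end_der D \<Q> s p X
            + (C p X (\<kappa> p (\<U> p (\<kappa> p (s p)))) - \<kappa> p (\<U> p (\<kappa> p (C p X (s p))))) = 0"

locale CV_plus_structure = CV_structure +
  assumes h_pos: "p \<in> mfd A \<Longrightarrow> pos_def_form (scl K) (fib K p) (h p)"

text \<open>Since \<open>C\<close> and \<open>\<zeta>\<close> are holomorphic, bijectivity on the fibres makes
  \<open>X \<mapsto> - C\<^sub>X \<zeta>\<close> an isomorphism of holomorphic vector bundles.\<close>

definition unfolding_condition ::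
    "('a, 'm::finite) chart set \<Rightarrow> ('a, 'k::ab_group_add, 'n::finite) vbundle \<Rightarrow>
     ('a \<Rightarrow> ('a, 'm) tvec \<Rightarrow> 'k \<Rightarrow> 'k) \<Rightarrow> bool" where
  "unfolding_condition A K C \<longleftrightarrow> (\<exists>\<zeta>. hol_sec A K (mfd A) \<zeta> \<and>
     (\<forall>p\<in>mfd A. bij_betw (\<lambda>X. - C p X (\<zeta> p)) (tspace A p) (fib K p)))"

section \<open>The induced multiplication on the tangent spaces\<close>

definition cv_mult ::
    "('a, 'm::finite) chart set \<Rightarrow> ('a, 'k::ab_group_add, 'n::finite) vbundle \<Rightarrow>
     ('a \<Rightarrow> ('a, 'm) tvec \<Rightarrow> 'k \<Rightarrow> 'k) \<Rightarrow> 'a \<Rightarrow> ('a, 'm) tvec \<Rightarrow> ('a, 'm) tvec \<Rightarrow> ('a, 'm) tvec" where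
  "cv_mult A K C p X Y =
     (THE Z. Z \<in> tspace A p \<and> (\<forall>a\<in>fib K p. C p Z a = - C p X (C p Y a)))"

definition cv_unit ::
    "('a, 'm::finite) chart set \<Rightarrow> ('a, 'k::ab_group_add, 'n::finite) vbundle \<Rightarrow>
     ('a \<Rightarrow> ('a, 'm) tvec \<Rightarrow> 'k \<Rightarrow> 'k) \<Rightarrow> 'a \<Rightarrow> ('a, 'm) tvec" where
  "cv_unit A K C p = (THE e. e \<in> tspace A p \<and> (\<forall>a\<in>fib K p. C p e a = - a))"

text \<open>A commutative algebra with underlying vector space \<open>V\<close>.\<close>

definition irreducible_algebra ::
    "(complex \<Rightarrow> 'v \<Rightarrow> 'v) \<Rightarrow> 'v::ab_group_add set \<Rightarrow> ('v \<Rightarrow> 'v \<Rightarrow> 'v) \<Rightarrow> bool" where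
  "irreducible_algebra sc V m \<longleftrightarrow>
     \<not> (\<exists>I J. module.subspace sc I \<and> module.subspace sc J \<and> I \<noteq> {0} \<and> J \<noteq> {0} \<and>
          V = {x + y | x y. x \<in> I \<and> y \<in> J} \<and> I \<inter> J = {0} \<and>
          (\<forall>x\<in>I. \<forall>x'\<in>I. m x x' \<in> I) \<and> (\<forall>y\<in>J. \<forall>y'\<in>J. m y y' \<in> J) \<and>
          (\<forall>x\<in>I. \<forall>y\<in>J. m x y = 0 \<and> m y x = 0))"

definition alg_ideal ::
    "(complex \<Rightarrow> 'v \<Rightarrow> 'v) \<Rightarrow> 'v::ab_group_add set \<Rightarrow> ('v \<Rightarrow> 'v \<Rightarrow> 'v) \<Rightarrow> 'v set \<Rightarrow> bool" where
  "alg_ideal sc V m I \<longleftrightarrow> module.subspace sc I \<and> I \<subseteq> V \<and> (\<forall>x\<in>V. \<forall>y\<in>I. m x y \<in> I)"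

definition max_ideal ::
    "(complex \<Rightarrow> 'v \<Rightarrow> 'v) \<Rightarrow> 'v::ab_group_add set \<Rightarrow> ('v \<Rightarrow> 'v \<Rightarrow> 'v) \<Rightarrow> 'v set" where
  "max_ideal sc V m = (THE I. alg_ideal sc V m I \<and> I \<noteq> V \<and>
     (\<forall>J. alg_ideal sc V m J \<and> I \<subseteq> J \<and> J \<noteq> V \<longrightarrow> J = I))"

section \<open>The metric \<open>h\<^sup>M\<close> and its holomorphic sectional curvature\<close>

definition fib_basis :: "('a, 'k::ab_group_add, 'n::finite) vbundle \<Rightarrow> 'a \<Rightarrow> ('n \<Rightarrow> 'k) \<Rightarrow> bool" where
  "fib_basis B p b \<longleftrightarrow> inj b \<and> \<not> module.dependent (scl B) (range b) \<and>
     module.span (scl B) (range b) = fib B p"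

definition h_end ::
    "('a, 'k::ab_group_add, 'n::finite) vbundle \<Rightarrow> ('a \<Rightarrow> 'k \<Rightarrow> 'k \<Rightarrow> complex) \<Rightarrow>
     'a \<Rightarrow> ('k \<Rightarrow> 'k) \<Rightarrow> ('k \<Rightarrow> 'k) \<Rightarrow> complex" where
  "h_end K h p \<Phi> \<Psi> = (THE r. \<exists>b b'. fib_basis K p b \<and> fib_basis K p b' \<and>
     (\<forall>i j. h p (b i) (b' j) = (if i = j then 1 else 0)) \<and>
     r = (\<Sum>i\<in>UNIV. h p (\<Phi> (b i)) (\<Psi> (b' i))))"

definition h_M ::
    "('a, 'k::ab_group_add, 'n::finite) vbundle \<Rightarrow> ('a \<Rightarrow> ('a, 'm) tvec \<Rightarrow> 'k \<Rightarrow> 'k) \<Rightarrow>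
     ('a \<Rightarrow> 'k \<Rightarrow> 'k \<Rightarrow> complex) \<Rightarrow> 'a \<Rightarrow> ('a, 'm::finite) tvec \<Rightarrow> ('a, 'm) tvec \<Rightarrow> complex" where
  "h_M K C h p X Y = h_end K h p (C p X) (C p Y)"

text \<open>The choice of the Chern connection is irrelevant: it is unique on smooth sections.\<close>

definition R_M ::
    "('a::topological_space, 'm::finite) chart set \<Rightarrow> ('a, 'k::ab_group_add, 'n::finite) vbundle \<Rightarrow>
     ('a \<Rightarrow> ('a, 'm) tvec \<Rightarrow> 'k \<Rightarrow> 'k) \<Rightarrow> ('a \<Rightarrow> 'k \<Rightarrow> 'k \<Rightarrow> complex) \<Rightarrow>
     'a \<Rightarrow> ('a, 'm) tvec \<Rightarrow> ('a, 'm) tvec \<Rightarrow> ('a, 'm) tvec \<Rightarrow> ('a, 'm) tvec" where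
  "R_M A K C h = curv A (tbundle A) (SOME D. chern_connection A (tbundle A) (h_M K C h) D)"

definition R_sect ::
    "('a::topological_space, 'm::finite) chart set \<Rightarrow> ('a, 'k::ab_group_add, 'n::finite) vbundle \<Rightarrow>
     ('a \<Rightarrow> ('a, 'm) tvec \<Rightarrow> 'k \<Rightarrow> 'k) \<Rightarrow> ('a \<Rightarrow> 'k \<Rightarrow> 'k \<Rightarrow> complex) \<Rightarrow>
     'a \<Rightarrow> ('a, 'm) tvec \<Rightarrow> complex" where
  "R_sect A K C h p X = h_M K C h p (R_M A K C h p X X X) X / (h_M K C h p X X)\<^sup>2"

end

theory Submission
  imports Defs "HOL-Computational_Algebra.Fundamental_Theorem_Algebra"
begin

text \<open>
  The adjoint of \<open>C\<^sub>X\<close> is \<open>\<kappa> C\<^sub>X \<kappa>\<close>, so the curvature equation of the CV-structure says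
  \<open>R(X, X\<close>-bar\<open>) = - [C\<^sub>X, C\<^sub>X\<^sup>*]\<close>. Curvature decreases in holomorphic subbundles: writing
  \<open>T = D\<^sub>X C\<^sub>X\<close> and \<open>Z\<close> for its projection to \<open>F\<close>, one gets
  \<open>h\<^sup>M(R\<^sup>M(X, X\<close>-bar\<open>) X, X) = \<bar>Z\<bar>\<^sup>2 - \<bar>T\<bar>\<^sup>2 - \<bar>[C\<^sub>X, C\<^sub>X\<^sup>*]\<bar>\<^sup>2 \<le> - \<bar>[C\<^sub>X, C\<^sub>X\<^sup>*]\<bar>\<^sup>2\<close>.
  If the algebra at \<open>t\<close> is irreducible, its maximal ideal consists of the \<open>X\<close> with \<open>C\<^sub>X\<close> nilpotent, and a
  non-zero nilpotent endomorphism is not normal, so the bound is negative on the ideal; by homogeneity and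
  compactness of the unit sphere it persists near \<open>t\<close>. Since the commutator does not change when \<open>e\<close> is
  added to \<open>X\<close>, the same bound controls the affine cone.
\<close>

section \<open>Calculus on open subsets of \<open>\<complex>\<^sup>m\<close>\<close>

text \<open>The curvature in the statement is a value picked by \<open>SOME\<close> and
  \<open>THE\<close>, so nothing can be computed before Chern connections are known to exist and
  curvature is known to be tensorial. Both are proved for arbitrary positive definite hermitian
  holomorphic bundles and then used for the tangent bundle with \<open>h_M\<close>. The trace form
  \<open>h_end\<close> is differentiated in a holomorphic frame of \<open>K\<close> and its
  \<open>h\<close>-dual frame. The derivatives of the two frames cancel in the trace, and the
  (1,0)-derivative kills the dual frame; hence only endomorphisms get differentiated and no cross
  terms remain. Vanishing in the direction of \<open>e\<close> does not follow from the inequality: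
  the curvature is evaluated on the unit field itself, which must first be shown to be holomorphic;
  then T = 0. Unit and products exist because \<open>\<zeta>\<close> is a cyclic vector: every
  endomorphism that commutes with all \<open>C p Y\<close> is itself some \<open>C p X\<close>. The
  squared norm of the commutator and the square of \<open>norm_M\<close> both have degree four under
  real scaling, so one constant found on a unit sphere serves a whole cone, and the affine case only
  rescales it by the square of the given ratio.\<close>

abbreviation fd :: "(complex^'m::finite \<Rightarrow> complex) \<Rightarrow> complex^'m \<Rightarrow> complex^'m \<Rightarrow> complex" where
  "fd f x \<equiv> frechet_derivative f (at x)"

text \<open>Only the values \<open>f' x v\<close> at points of \<open>S\<close> are known, whereas
  \<open>Ck_on (Suc k)\<close> passes on the total function \<open>\<lambda>x. fd f x v\<close>. The
  last premise therefore ranges over every \<open>g\<close> that agrees with the known derivative on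
  \<open>S\<close>. The inductions for sums, products, inverses, conjugates and compositions go
  through this rule.\<close>

lemma Ck_on_SucI:
  assumes S: "open S" and f: "\<And>x. x \<in> S \<Longrightarrow> (f has_derivative f' x) (at x)"
    and f': "\<And>v g. (\<And>x. x \<in> S \<Longrightarrow> g x = f' x v) \<Longrightarrow> Ck_on k S g"
  shows "Ck_on (Suc k) S f"
proof -
  have "fd f x v = f' x v" if "x \<in> S" for x v
    using frechet_derivative_at[OF f[OF that]] by simp
  then show ?thesis using f f' by (auto simp: differentiable_def)
qed

lemma Ck_on_cong:
  assumes "open S" "\<And>x. x \<in> S \<Longrightarrow> f x = g x" "Ck_on k S f"
  shows "Ck_on k S g"
  using assms(2,3)
proof (induction k arbitrary: f g)
  case 0
  then show ?case using continuous_on_cong[of S S f g] by simp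
next
  case (Suc k)
  have d: "(g has_derivative fd f x) (at x)" if "x \<in> S" for x
    using has_derivative_transform_within_open[OF _ \<open>open S\<close> that, of f "fd f x" UNIV g] Suc.prems that
    by (simp add: frechet_derivative_works[symmetric])
  show ?case
  proof (rule Ck_on_SucI[OF \<open>open S\<close> d])
    fix v g' assume "\<And>x. x \<in> S \<Longrightarrow> g' x = fd f x v"
    then show "Ck_on k S g'" using Suc.IH[of "\<lambda>x. fd f x v" g'] Suc.prems by auto
  qed
qed

lemma Ck_on_subset: "Ck_on k S f \<Longrightarrow> T \<subseteq> S \<Longrightarrow> Ck_on k T f"
  by (induction k arbitrary: f) (auto intro: continuous_on_subset)

lemma Ck_on_SucD:
  assumes "Ck_on (Suc k) S f"
  shows "x \<in> S \<Longrightarrow> (f has_derivative fd f x) (at x)" "Ck_on k S (\<lambda>x. fd f x v)"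
  using assms by (auto simp: frechet_derivative_works[symmetric])

lemma Ck_on_Suc_imp: "Ck_on (Suc k) S f \<Longrightarrow> Ck_on k S f"
proof (induction k arbitrary: f)
  case 0
  then show ?case
    by (auto intro!: continuous_at_imp_continuous_on differentiable_imp_continuous_within)
next
  case (Suc k)
  then show ?case by auto
qed

lemma Ck_on_local:
  assumes "\<And>x. x \<in> S \<Longrightarrow> \<exists>T. open T \<and> x \<in> T \<and> Ck_on k T f"
  shows "Ck_on k S f"
  using assms
proof (induction k arbitrary: f)
  case 0
  then show ?case
    by (auto intro!: continuous_at_imp_continuous_on) (metis continuous_on_eq_continuous_at)
next
  case (Suc k)
  then show ?case by (fastforce intro!: Suc.IH)
qed

lemma Ck_on_const: "Ck_on k S (\<lambda>_. c)"
  by (induction k arbitrary: c) auto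

lemma Ck_on_add:
  assumes "open S" "Ck_on k S f" "Ck_on k S g"
  shows "Ck_on k S (\<lambda>x. f x + g x)"
  using assms(2,3)
proof (induction k arbitrary: f g)
  case (Suc k)
  note f = Ck_on_SucD[OF Suc.prems(1)] and g = Ck_on_SucD[OF Suc.prems(2)]
  show ?case
  proof (rule Ck_on_SucI[OF \<open>open S\<close> has_derivative_add[OF f(1) g(1)]])
    fix v g' assume g': "\<And>x. x \<in> S \<Longrightarrow> g' x = fd f x v + fd g x v"
    show "Ck_on k S g'"
      by (rule Ck_on_cong[OF \<open>open S\<close> g'[symmetric] Suc.IH[OF f(2) g(2)]])
  qed
qed (auto intro: continuous_intros)

lemma Ck_on_mult:
  assumes "open S" "Ck_on k S f" "Ck_on k S g"
  shows "Ck_on k S (\<lambda>x. f x * g x)"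
  using assms(2,3)
proof (induction k arbitrary: f g)
  case (Suc k)
  note f = Ck_on_SucD[OF Suc.prems(1)] and g = Ck_on_SucD[OF Suc.prems(2)]
  show ?case
  proof (rule Ck_on_SucI[OF \<open>open S\<close> has_derivative_mult[OF f(1) g(1)]])
    fix v g' assume g': "\<And>x. x \<in> S \<Longrightarrow> g' x = f x * fd g x v + fd f x v * g x"
    have "Ck_on k S (\<lambda>x. f x * fd g x v + fd f x v * g x)"
      by (rule Ck_on_add[OF \<open>open S\<close> Suc.IH[OF Ck_on_Suc_imp[OF Suc.prems(1)] g(2)]
          Suc.IH[OF f(2) Ck_on_Suc_imp[OF Suc.prems(2)]]])
    then show "Ck_on k S g'" by (rule Ck_on_cong[OF \<open>open S\<close>, rotated]) (simp add: g')
  qed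
qed (auto intro: continuous_intros)

lemma Ck_on_inverse:
  assumes "open S" "Ck_on k S f" "\<And>x. x \<in> S \<Longrightarrow> f x \<noteq> 0"
  shows "Ck_on k S (\<lambda>x. inverse (f x))"
  using assms(2,3)
proof (induction k arbitrary: f)
  case (Suc k)
  note f = Ck_on_SucD[OF Suc.prems(1)]
  show ?case
  proof (rule Ck_on_SucI[OF \<open>open S\<close> Deriv.has_derivative_inverse[OF Suc.prems(2) f(1)]])
    fix v g' assume g': "\<And>x. x \<in> S \<Longrightarrow> g' x = - (inverse (f x) * fd f x v * inverse (f x))"
    have i: "Ck_on k S (\<lambda>x. inverse (f x))"
      by (rule Suc.IH[OF Ck_on_Suc_imp[OF Suc.prems(1)] Suc.prems(2)])
    have "Ck_on k S (\<lambda>x. (-1) * (inverse (f x) * fd f x v * inverse (f x)))"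
      by (rule Ck_on_mult[OF \<open>open S\<close> Ck_on_const Ck_on_mult[OF \<open>open S\<close> Ck_on_mult[OF \<open>open S\<close> i f(2)] i]])
    then show "Ck_on k S g'" by (rule Ck_on_cong[OF \<open>open S\<close>, rotated]) (simp add: g')
  qed
qed (auto intro: continuous_intros)

lemma Ck_on_cnj:
  assumes "open S" "Ck_on k S f"
  shows "Ck_on k S (\<lambda>x. cnj (f x))"
  using assms(2)
proof (induction k arbitrary: f)
  case (Suc k)
  note f = Ck_on_SucD[OF Suc.prems(1)]
  show ?case
  proof (rule Ck_on_SucI[OF \<open>open S\<close> has_derivative_cnj[OF f(1)]])
    fix v g' assume g': "\<And>x. x \<in> S \<Longrightarrow> g' x = cnj (fd f x v)"
    show "Ck_on k S g'"
      by (rule Ck_on_cong[OF \<open>open S\<close> g'[symmetric] Suc.IH[OF f(2)]])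
  qed
qed (auto intro: continuous_intros)

lemma Ck_on_sum:
  assumes "open S" "\<And>i. i \<in> I \<Longrightarrow> Ck_on k S (f i)"
  shows "Ck_on k S (\<lambda>x. \<Sum>i\<in>I. f i x)"
  using assms(2) by (induction I rule: infinite_finite_induct)
    (simp_all add: Ck_on_const Ck_on_add[OF \<open>open S\<close>])

text \<open>The derivative of a smooth function is only real linear, so both \<open>axis i 1\<close>
  and \<open>axis i \<i>\<close> are needed as basis directions. This turns a derivative in a moving
  direction into a finite sum of derivatives in fixed directions with function coefficients.\<close>

lemma linear_complex_vec_expand:
  fixes L :: "complex^'m::finite \<Rightarrow> complex"
  assumes "linear L"
  shows "L v = (\<Sum>i\<in>UNIV. of_real (Re (v $ i)) * L (axis i 1) + of_real (Im (v $ i)) * L (axis i \<i>))"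
proof -
  have "v = (\<Sum>i\<in>UNIV. Re (v $ i) *\<^sub>R axis i 1 + Im (v $ i) *\<^sub>R axis i \<i>)"
    by (simp add: vec_eq_iff complex_eq_iff axis_def if_distrib[of Re] if_distrib[of Im]
        if_distrib[of "(*) _"] sum.distrib cong: if_cong)
  then have "L v = L (\<Sum>i\<in>UNIV. Re (v $ i) *\<^sub>R axis i 1 + Im (v $ i) *\<^sub>R axis i \<i>)" by simp
  also have "\<dots> = (\<Sum>i\<in>UNIV. Re (v $ i) *\<^sub>R L (axis i 1) + Im (v $ i) *\<^sub>R L (axis i \<i>))"
    by (simp add: linear_sum[OF assms] linear_add[OF assms] linear_cmul[OF assms] o_def)
  finally show ?thesis by (simp add: scaleR_conv_of_real)
qed

lemma has_derivative_vec_components: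
  fixes \<phi> :: "'b::real_normed_vector \<Rightarrow> complex^'m::finite"
  assumes "\<And>i. ((\<lambda>x. \<phi> x $ i) has_derivative (\<lambda>v. \<phi>' v $ i)) (at x)"
  shows "(\<phi> has_derivative \<phi>') (at x)"
proof (subst has_derivative_componentwise_within, intro ballI)
  fix b :: "complex^'m" assume "b \<in> Basis"
  then obtain i c where b: "b = axis i c" by (auto simp: Basis_vec_def)
  show "((\<lambda>x. \<phi> x \<bullet> b) has_derivative (\<lambda>x. \<phi>' x \<bullet> b)) (at x)"
    unfolding b inner_axis by (rule has_derivative_inner_left[OF assms])
qed

lemma Ck_on_vec_differentiable:
  assumes "\<And>i. Ck_on (Suc k) S (\<lambda>x. \<phi> x $ i)" "x \<in> S"
  shows "(\<phi> has_derivative (\<lambda>v. \<chi> i. fd (\<lambda>x. \<phi> x $ i) x v)) (at x)"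
  by (rule has_derivative_vec_components) (use Ck_on_SucD(1)[OF assms] in simp)

lemma Ck_on_Re_Im:
  assumes "open S" "Ck_on k S f"
  shows "Ck_on k S (\<lambda>x. of_real (Re (f x)))" "Ck_on k S (\<lambda>x. of_real (Im (f x)))"
proof -
  have "of_real (Re z) = 1/2 * (z + cnj z)" for z
    by (simp add: complex_add_cnj)
  moreover have "Ck_on k S (\<lambda>x. 1/2 * (f x + cnj (f x)))"
    by (rule Ck_on_mult[OF assms(1) Ck_on_const Ck_on_add[OF assms Ck_on_cnj[OF assms]]])
  ultimately show "Ck_on k S (\<lambda>x. of_real (Re (f x)))" by (simp only:)
  have "of_real (Im z) = - \<i>/2 * (z + (-1) * cnj z)" for z
    by (rule complex_eqI) simp_all
  moreover have "Ck_on k S (\<lambda>x. - \<i>/2 * (f x + (-1) * cnj (f x)))"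
    by (rule Ck_on_mult[OF assms(1) Ck_on_const Ck_on_add[OF assms
        Ck_on_mult[OF assms(1) Ck_on_const Ck_on_cnj[OF assms]]]])
  ultimately show "Ck_on k S (\<lambda>x. of_real (Im (f x)))" by (simp only:)
qed

lemma Ck_on_linear_combination:
  assumes "open S" "\<And>v. Ck_on k S (\<lambda>x. L x v)" "\<And>x. x \<in> S \<Longrightarrow> linear (L x)"
    "\<And>i. Ck_on k S (\<lambda>x. w x $ i)"
  shows "Ck_on k S (\<lambda>x. L x (w x))"
proof -
  have "Ck_on k S (\<lambda>x. of_real (Re (w x $ i)) * L x (axis i 1) + of_real (Im (w x $ i)) * L x (axis i \<i>))" for i
    by (rule Ck_on_add[OF assms(1) Ck_on_mult[OF assms(1) Ck_on_Re_Im(1)[OF assms(1,4)] assms(2)]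
        Ck_on_mult[OF assms(1) Ck_on_Re_Im(2)[OF assms(1,4)] assms(2)]])
  then have 1: "Ck_on k S (\<lambda>x. \<Sum>i\<in>UNIV. of_real (Re (w x $ i)) * L x (axis i 1) + of_real (Im (w x $ i)) * L x (axis i \<i>))"
    by (rule Ck_on_sum[OF assms(1)])
  have 2: "(\<Sum>i\<in>UNIV. of_real (Re (w x $ i)) * L x (axis i 1) + of_real (Im (w x $ i)) * L x (axis i \<i>)) = L x (w x)"
    if "x \<in> S" for x
    by (rule linear_complex_vec_expand[OF assms(3)[OF that], symmetric])
  show ?thesis by (rule Ck_on_cong[OF assms(1) 2 1])
qed

lemma Ck_on_compose:
  fixes f :: "complex^'m::finite \<Rightarrow> complex" and \<phi> :: "complex^'l::finite \<Rightarrow> complex^'m"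
  assumes "open S" "open T" "\<And>i. Ck_on k S (\<lambda>x. \<phi> x $ i)" "\<phi> ` S \<subseteq> T" "Ck_on k T f"
  shows "Ck_on k S (\<lambda>x. f (\<phi> x))"
  using assms(3,5)
proof (induction k arbitrary: f)
  case 0
  then have "continuous_on S (\<lambda>x. \<chi> i. \<phi> x $ i)" by (intro continuous_on_vec_lambda) simp
  then have "continuous_on S \<phi>" by simp
  then show ?case using 0 assms(4) by (auto intro: continuous_on_compose2)
next
  case (Suc k)
  note f = Ck_on_SucD[OF Suc.prems(2)] and \<phi> = Ck_on_vec_differentiable[OF Suc.prems(1)]
  have d: "((\<lambda>x. f (\<phi> x)) has_derivative (\<lambda>v. fd f (\<phi> x) (\<chi> i. fd (\<lambda>x. \<phi> x $ i) x v))) (at x)"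
    if "x \<in> S" for x
    using has_derivative_compose[OF \<phi>[OF that] f(1)] that assms(4) by auto
  show ?case
  proof (rule Ck_on_SucI[OF \<open>open S\<close> d])
    fix v g' assume g': "\<And>x. x \<in> S \<Longrightarrow> g' x = fd f (\<phi> x) (\<chi> i. fd (\<lambda>x. \<phi> x $ i) x v)"
    \<comment> \<open>By the chain rule \<open>f\<close> is differentiated in a direction that moves
      with \<open>x\<close>. Expanding the direction leaves fixed directions, and the induction
      hypothesis applies to \<open>\<lambda>x. fd f x v\<close> composed with
      \<open>\<phi>\<close>.\<close>
    have "Ck_on k S (\<lambda>x. fd f (\<phi> x) (\<chi> i. fd (\<lambda>x. \<phi> x $ i) x v))"
    proof (rule Ck_on_linear_combination[OF \<open>open S\<close>])
      show "linear (fd f (\<phi> x))" if "x \<in> S" for x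
        using f(1)[of "\<phi> x"] assms(4) that has_derivative_linear by blast
      show "Ck_on k S (\<lambda>x. fd f (\<phi> x) v)" for v
        by (rule Suc.IH[OF Ck_on_Suc_imp[OF Suc.prems(1)] f(2)])
      show "Ck_on k S (\<lambda>x. (\<chi> i. fd (\<lambda>x. \<phi> x $ i) x v) $ i)" for i
        using Ck_on_SucD(2)[OF Suc.prems(1)] by simp
    qed
    then show "Ck_on k S g'" by (rule Ck_on_cong[OF \<open>open S\<close>, rotated]) (simp add: g')
  qed
qed

section \<open>Smooth functions\<close>

lemma smooth_onD:
  assumes "smooth_on S f"
  shows "Ck_on k S f" "x \<in> S \<Longrightarrow> (f has_derivative fd f x) (at x)"
    "x \<in> S \<Longrightarrow> linear (fd f x)" "x \<in> S \<Longrightarrow> f differentiable (at x)"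
  using assms Ck_on_SucD(1)[of 0 S f x] has_derivative_linear by (auto simp: smooth_on_def differentiable_def)

lemma smooth_on_cong: "open S \<Longrightarrow> (\<And>x. x \<in> S \<Longrightarrow> f x = g x) \<Longrightarrow> smooth_on S f \<Longrightarrow> smooth_on S g"
  unfolding smooth_on_def using Ck_on_cong by blast

lemma smooth_on_subset: "smooth_on S f \<Longrightarrow> T \<subseteq> S \<Longrightarrow> smooth_on T f"
  unfolding smooth_on_def using Ck_on_subset by blast

lemma smooth_on_local:
  assumes "\<And>x. x \<in> S \<Longrightarrow> \<exists>T. open T \<and> x \<in> T \<and> smooth_on T f"
  shows "smooth_on S f"
proof -
  have "Ck_on k S f" for k
    by (rule Ck_on_local) (meson assms smooth_onD(1))
  then show ?thesis by (simp add: smooth_on_def)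
qed

lemma smooth_on_imp_continuous_on: "smooth_on S f \<Longrightarrow> continuous_on S f"
  unfolding smooth_on_def by (metis Ck_on.simps(1))

lemma smooth_on_const: "smooth_on S (\<lambda>_. c)"
  by (simp add: smooth_on_def Ck_on_const)

lemma smooth_on_add: "open S \<Longrightarrow> smooth_on S f \<Longrightarrow> smooth_on S g \<Longrightarrow> smooth_on S (\<lambda>x. f x + g x)"
  by (simp add: smooth_on_def Ck_on_add)

lemma smooth_on_mult: "open S \<Longrightarrow> smooth_on S f \<Longrightarrow> smooth_on S g \<Longrightarrow> smooth_on S (\<lambda>x. f x * g x)"
  by (simp add: smooth_on_def Ck_on_mult)

lemma smooth_on_inverse:
  "open S \<Longrightarrow> smooth_on S f \<Longrightarrow> (\<And>x. x \<in> S \<Longrightarrow> f x \<noteq> 0) \<Longrightarrow> smooth_on S (\<lambda>x. inverse (f x))"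
  by (simp add: smooth_on_def Ck_on_inverse)

lemma smooth_on_cnj: "open S \<Longrightarrow> smooth_on S f \<Longrightarrow> smooth_on S (\<lambda>x. cnj (f x))"
  by (simp add: smooth_on_def Ck_on_cnj)

lemma smooth_on_compose:
  fixes f :: "complex^'m::finite \<Rightarrow> complex" and \<phi> :: "complex^'l::finite \<Rightarrow> complex^'m"
  assumes "open S" "open T" "\<And>i. smooth_on S (\<lambda>x. \<phi> x $ i)" "\<phi> ` S \<subseteq> T" "smooth_on T f"
  shows "smooth_on S (\<lambda>x. f (\<phi> x))"
  using Ck_on_compose[OF assms(1,2) _ assms(4)] assms(3,5) by (simp add: smooth_on_def)

lemma smooth_on_vec_differentiable:
  assumes "\<And>i. smooth_on S (\<lambda>x. \<phi> x $ i)" "x \<in> S"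
  shows "(\<phi> has_derivative (\<lambda>v. \<chi> i. fd (\<lambda>x. \<phi> x $ i) x v)) (at x)"
    "frechet_derivative \<phi> (at x) = (\<lambda>v. \<chi> i. fd (\<lambda>x. \<phi> x $ i) x v)"
proof -
  show *: "(\<phi> has_derivative (\<lambda>v. \<chi> i. fd (\<lambda>x. \<phi> x $ i) x v)) (at x)"
    by (rule Ck_on_vec_differentiable[OF smooth_onD(1)[OF assms(1)] assms(2)])
  show "frechet_derivative \<phi> (at x) = (\<lambda>v. \<chi> i. fd (\<lambda>x. \<phi> x $ i) x v)"
    using frechet_derivative_at[OF *] by simp
qed

lemma smooth_on_derivative:
  assumes "smooth_on S f" shows "smooth_on S (\<lambda>x. fd f x v)"
  unfolding smooth_on_def using Ck_on_SucD(2)[OF smooth_onD(1)[OF assms]] by blast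

lemma smooth_on_derivative_along:
  assumes "open S" "smooth_on S f" "\<And>i. smooth_on S (\<lambda>x. w x $ i)"
  shows "smooth_on S (\<lambda>x. fd f x (w x))"
proof -
  have "Ck_on k S (\<lambda>x. fd f x (w x))" for k
    by (rule Ck_on_linear_combination[OF assms(1) smooth_onD(1)[OF smooth_on_derivative[OF assms(2)]]
          smooth_onD(3)[OF assms(2)] smooth_onD(1)[OF assms(3)]])
  then show ?thesis by (simp add: smooth_on_def)
qed

text \<open>The mean value theorem is used twice: for the increment along \<open>v\<close> as a
  function of the displacement along \<open>u\<close>, then for the derivative along
  \<open>u\<close> as a function of the displacement along \<open>v\<close>.\<close>

lemma second_difference_mean_value:
  fixes f :: "'b::real_normed_vector \<Rightarrow> real"
  assumes f: "\<And>y. y \<in> ball x r \<Longrightarrow> (f has_derivative f' y) (at y)"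
    and f'': "\<And>y. y \<in> ball x r \<Longrightarrow> ((\<lambda>z. f' z u) has_derivative a y) (at y)"
    and s: "s > 0" "s * (norm u + norm v) < r"
  shows "\<exists>y. norm (y - x) \<le> s * (norm u + norm v) \<and>
    f (x + s *\<^sub>R u + s *\<^sub>R v) - f (x + s *\<^sub>R u) - f (x + s *\<^sub>R v) + f x = s\<^sup>2 * a y v"
proof -
  have nrm: "norm (\<sigma> *\<^sub>R u + \<tau> *\<^sub>R v) \<le> s * (norm u + norm v)"
    if "0 \<le> \<sigma>" "\<sigma> \<le> s" "0 \<le> \<tau>" "\<tau> \<le> s" for \<sigma> \<tau>
  proof -
    have "norm (\<sigma> *\<^sub>R u + \<tau> *\<^sub>R v) \<le> \<sigma> * norm u + \<tau> * norm v"
      using norm_triangle_ineq[of "\<sigma> *\<^sub>R u" "\<tau> *\<^sub>R v"] that by simp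
    also have "\<dots> \<le> s * norm u + s * norm v"
      using that by (intro add_mono mult_right_mono) auto
    finally show ?thesis by (simp add: algebra_simps)
  qed
  have ball: "x + \<sigma> *\<^sub>R u + \<tau> *\<^sub>R v \<in> ball x r" if "0 \<le> \<sigma>" "\<sigma> \<le> s" "0 \<le> \<tau>" "\<tau> \<le> s" for \<sigma> \<tau>
    using nrm[OF that] s norm_minus_commute[of x "x + \<sigma> *\<^sub>R u + \<tau> *\<^sub>R v"] by (simp add: dist_norm add.assoc)
  define \<alpha> where "\<alpha> \<sigma> = f (x + \<sigma> *\<^sub>R u + s *\<^sub>R v) - f (x + \<sigma> *\<^sub>R u + 0 *\<^sub>R v)" for \<sigma>
  have d1: "((\<lambda>\<sigma>. f (x + \<sigma> *\<^sub>R u + \<tau> *\<^sub>R v)) has_derivative (\<lambda>t. f' (x + \<sigma> *\<^sub>R u + \<tau> *\<^sub>R v) (t *\<^sub>R u))) (at \<sigma>)"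
    if "0 \<le> \<sigma>" "\<sigma> \<le> s" "0 \<le> \<tau>" "\<tau> \<le> s" for \<sigma> \<tau>
    by (rule has_derivative_compose[where g = f and f = "\<lambda>\<sigma>. x + \<sigma> *\<^sub>R u + \<tau> *\<^sub>R v",
          OF _ f[OF ball[OF that]]]) (auto intro!: derivative_eq_intros)
  have d\<alpha>: "(\<alpha> has_derivative (\<lambda>t. t * (f' (x + \<sigma> *\<^sub>R u + s *\<^sub>R v) u - f' (x + \<sigma> *\<^sub>R u + 0 *\<^sub>R v) u))) (at \<sigma>)"
    if "0 \<le> \<sigma>" "\<sigma> \<le> s" for \<sigma>
  proof -
    have lin: "linear (f' (x + \<sigma> *\<^sub>R u + s *\<^sub>R v))" "linear (f' (x + \<sigma> *\<^sub>R u + 0 *\<^sub>R v))"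
      using has_derivative_linear f ball that s by (metis less_eq_real_def order_refl)+
    show ?thesis
      using has_derivative_diff[OF d1[of \<sigma> s] d1[of \<sigma> 0]] that s
      unfolding \<alpha>_def linear_cmul[OF lin(1)] linear_cmul[OF lin(2)] by (simp add: right_diff_distrib)
  qed
  obtain \<sigma> where \<sigma>: "0 < \<sigma>" "\<sigma> < s"
    "\<alpha> s - \<alpha> 0 = (s - 0) * (f' (x + \<sigma> *\<^sub>R u + s *\<^sub>R v) u - f' (x + \<sigma> *\<^sub>R u + 0 *\<^sub>R v) u)"
    using mvt[of 0 s \<alpha>, OF s(1) _ d\<alpha>]
    by (metis (no_types, lifting) continuous_at_imp_continuous_on d\<alpha> has_derivative_continuous atLeastAtMost_iff less_eq_real_def)
  define \<beta> where "\<beta> \<tau> = f' (x + \<sigma> *\<^sub>R u + \<tau> *\<^sub>R v) u" for \<tau>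
  have d\<beta>: "(\<beta> has_derivative (\<lambda>t. t * a (x + \<sigma> *\<^sub>R u + \<tau> *\<^sub>R v) v)) (at \<tau>)" if "0 \<le> \<tau>" "\<tau> \<le> s" for \<tau>
  proof -
    have b: "x + \<sigma> *\<^sub>R u + \<tau> *\<^sub>R v \<in> ball x r" using ball that \<sigma> by simp
    have "(\<beta> has_derivative (\<lambda>t. a (x + \<sigma> *\<^sub>R u + \<tau> *\<^sub>R v) (t *\<^sub>R v))) (at \<tau>)"
      unfolding \<beta>_def
      by (rule has_derivative_compose[where g = "\<lambda>z. f' z u" and f = "\<lambda>\<tau>. x + \<sigma> *\<^sub>R u + \<tau> *\<^sub>R v", OF _ f''[OF b]])
        (auto intro!: derivative_eq_intros)
    then show ?thesis using linear_cmul[OF has_derivative_linear[OF f''[OF b]]] by simp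
  qed
  obtain \<tau> where \<tau>: "0 < \<tau>" "\<tau> < s" "\<beta> s - \<beta> 0 = (s - 0) * a (x + \<sigma> *\<^sub>R u + \<tau> *\<^sub>R v) v"
    using mvt[of 0 s \<beta>, OF s(1) _ d\<beta>]
    by (metis (no_types, lifting) continuous_at_imp_continuous_on d\<beta> has_derivative_continuous atLeastAtMost_iff less_eq_real_def)
  have "\<alpha> s - \<alpha> 0 = s\<^sup>2 * a (x + \<sigma> *\<^sub>R u + \<tau> *\<^sub>R v) v"
    using \<sigma>(3) \<tau>(3) by (simp add: \<beta>_def power2_eq_square)
  moreover have "\<alpha> s - \<alpha> 0 = f (x + s *\<^sub>R u + s *\<^sub>R v) - f (x + s *\<^sub>R u) - f (x + s *\<^sub>R v) + f x"
    by (simp add: \<alpha>_def)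
  moreover have "norm (x + \<sigma> *\<^sub>R u + \<tau> *\<^sub>R v - x) \<le> s * (norm u + norm v)"
    using nrm[of \<sigma> \<tau>] \<sigma> \<tau> by (simp add: add.assoc)
  ultimately show ?thesis by metis
qed

text \<open>The second difference is symmetric in \<open>u\<close> and \<open>v\<close>. Read in the
  two orders it is \<open>s\<^sup>2\<close> times either mixed derivative, each at a point near
  \<open>x\<close>; continuity at \<open>x\<close> then identifies the two values up to any
  error.\<close>

lemma symmetric_second_derivative_real:
  fixes f :: "'b::real_normed_vector \<Rightarrow> real"
  assumes S: "open S" "x \<in> S" and f: "\<And>y. y \<in> S \<Longrightarrow> (f has_derivative f' y) (at y)"
    and a: "\<And>y. y \<in> S \<Longrightarrow> ((\<lambda>z. f' z u) has_derivative a y) (at y)"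
    and b: "\<And>y. y \<in> S \<Longrightarrow> ((\<lambda>z. f' z v) has_derivative b y) (at y)"
    and ca: "continuous (at x) (\<lambda>y. a y v)" and cb: "continuous (at x) (\<lambda>y. b y u)"
  shows "a x v = b x u"
proof -
  have "\<bar>a x v - b x u\<bar> < 2 * \<epsilon>" if \<epsilon>: "\<epsilon> > 0" for \<epsilon>
  proof -
    obtain r where r: "r > 0" "ball x r \<subseteq> S" using S open_contains_ball by blast
    obtain d1 where d1: "d1 > 0" "\<And>y. norm (y - x) < d1 \<Longrightarrow> \<bar>a y v - a x v\<bar> < \<epsilon>"
      using ca[unfolded continuous_at_eps_delta, rule_format, OF \<epsilon>] by (auto simp: dist_norm)
    obtain d2 where d2: "d2 > 0" "\<And>y. norm (y - x) < d2 \<Longrightarrow> \<bar>b y u - b x u\<bar> < \<epsilon>"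
      using cb[unfolded continuous_at_eps_delta, rule_format, OF \<epsilon>] by (auto simp: dist_norm)
    define m where "m = min r (min d1 d2)"
    \<comment> \<open>With this \<open>s\<close> the parallelogram spanned by
      \<open>s *\<^sub>R u\<close> and \<open>s *\<^sub>R v\<close> stays within distance
      \<open>m\<close> of \<open>x\<close>, where \<open>f\<close> is differentiable and both mixed
      derivatives vary by less than \<epsilon>. The summand 1 avoids a division by zero for u = v =
      0.\<close>
    define s where "s = m / (norm u + norm v + 1)"
    have m: "m > 0" using r d1 d2 by (simp add: m_def)
    have "norm u + norm v + 1 > 0" by (smt (verit) norm_ge_zero)
    with m have s: "s > 0" "s * (norm u + norm v) < m"
      by (auto simp: s_def field_simps)
    have s2: "s * (norm v + norm u) < r" "s * (norm u + norm v) < r" using s by (auto simp: m_def add.commute)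
    obtain y where y: "norm (y - x) \<le> s * (norm u + norm v)"
      "f (x + s *\<^sub>R u + s *\<^sub>R v) - f (x + s *\<^sub>R u) - f (x + s *\<^sub>R v) + f x = s\<^sup>2 * a y v"
      using second_difference_mean_value[of x r f f' u a s v] f a r s s2 by blast
    obtain z where z: "norm (z - x) \<le> s * (norm v + norm u)"
      "f (x + s *\<^sub>R v + s *\<^sub>R u) - f (x + s *\<^sub>R v) - f (x + s *\<^sub>R u) + f x = s\<^sup>2 * b z u"
      using second_difference_mean_value[of x r f f' v b s u] f b r s s2 by blast
    have "s\<^sup>2 * a y v = s\<^sup>2 * b z u" unfolding y(2)[symmetric] z(2)[symmetric] by (simp add: algebra_simps)
    then have "a y v = b z u" using s by simp
    moreover have "\<bar>a y v - a x v\<bar> < \<epsilon>" using d1(2)[of y] y(1) s(2) by (simp add: m_def)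
    moreover have "\<bar>b z u - b x u\<bar> < \<epsilon>" using d2(2)[of z] z(1) s(2) by (simp add: m_def add.commute)
    ultimately show ?thesis by linarith
  qed
  from this[of "\<bar>a x v - b x u\<bar> / 2"] show ?thesis by auto
qed

text \<open>The mean value theorem concerns real functions, so real and imaginary parts are treated
  apart.\<close>

lemma symmetric_second_derivative:
  assumes S: "open S" "x \<in> S" and f: "smooth_on S f"
  shows "fd (\<lambda>y. fd f y u) x v = fd (\<lambda>y. fd f y v) x u"
proof -
  note 1 = smooth_onD(2)[OF f] and 2 = smooth_onD(2)[OF smooth_on_derivative[OF f]]
  have 3: "continuous (at x) (\<lambda>y. fd (\<lambda>y. fd f y w) y w')" for w w'
    using smooth_on_imp_continuous_on[OF smooth_on_derivative[OF smooth_on_derivative[OF f]]] S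
    by (metis continuous_on_eq_continuous_at)
  have "Re (fd (\<lambda>y. fd f y u) x v) = Re (fd (\<lambda>y. fd f y v) x u)"
    by (rule symmetric_second_derivative_real[OF S, of "\<lambda>y. Re (f y)" "\<lambda>y v. Re (fd f y v)"])
      (auto intro!: has_derivative_Re 1 2 bounded_linear.continuous[OF bounded_linear_Re] 3)
  moreover have "Im (fd (\<lambda>y. fd f y u) x v) = Im (fd (\<lambda>y. fd f y v) x u)"
    by (rule symmetric_second_derivative_real[OF S, of "\<lambda>y. Im (f y)" "\<lambda>y v. Im (fd f y v)"])
      (auto intro!: has_derivative_Im 1 2 bounded_linear.continuous[OF bounded_linear_Im] 3)
  ultimately show ?thesis by (simp add: complex_eq_iff)
qed

section \<open>Holomorphic functions of several variables\<close>

lemma hol_onI: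
  assumes "smooth_on S f" "\<And>x z v. x \<in> S \<Longrightarrow> fd f x (z *s v) = z * fd f x v"
  shows "hol_on S f"
  using assms by (simp add: hol_on_def)

lemma hol_onD:
  assumes "hol_on S f"
  shows "smooth_on S f" "x \<in> S \<Longrightarrow> fd f x (z *s v) = z * fd f x v"
  using assms by (auto simp: hol_on_def)

lemma scaleC_vec_decompose: "z *s (v :: complex^'m::finite) = Re z *\<^sub>R v + Im z *\<^sub>R (\<i> *s v)"
  by (simp add: vec_eq_iff complex_eq_iff)

text \<open>A derivative is real linear anyway, so compatibility with \<open>\<i>\<close> alone
  gives complex linearity.\<close>

lemma hol_onI_imaginary:
  assumes "smooth_on S f" "\<And>x v. x \<in> S \<Longrightarrow> fd f x (\<i> *s v) = \<i> * fd f x v"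
  shows "hol_on S f"
proof (rule hol_onI[OF assms(1)])
  fix x z v assume x: "x \<in> S"
  show "fd f x (z *s v) = z * fd f x v"
    unfolding scaleC_vec_decompose[of z v] linear_add[OF smooth_onD(3)[OF assms(1) x]]
      linear_cmul[OF smooth_onD(3)[OF assms(1) x]] assms(2)[OF x]
    by (simp add: scaleR_conv_of_real distrib_right[symmetric] complex_eq_iff)
qed

lemma fd_cong:
  assumes "open S" "x \<in> S" "\<And>x. x \<in> S \<Longrightarrow> f x = g x"
  shows "frechet_derivative f (at x) = frechet_derivative g (at x)"
proof -
  have "(f has_derivative D) (at x) \<longleftrightarrow> (g has_derivative D) (at x)" for D
    using has_derivative_transform_within_open[OF _ assms(1,2)] assms(3) by metis
  then show ?thesis by (simp add: frechet_derivative_def)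
qed

lemma hol_on_cong: "open S \<Longrightarrow> (\<And>x. x \<in> S \<Longrightarrow> f x = g x) \<Longrightarrow> hol_on S f \<Longrightarrow> hol_on S g"
  unfolding hol_on_def using smooth_on_cong[of S f g] fd_cong[of S _ f g] by auto

lemma hol_on_subset: "hol_on S f \<Longrightarrow> T \<subseteq> S \<Longrightarrow> hol_on T f"
  unfolding hol_on_def using smooth_on_subset by blast

lemma hol_on_const: "hol_on S (\<lambda>_. c)"
  by (simp add: hol_on_def smooth_on_const)

lemma hol_on_add:
  assumes "open S" "hol_on S f" "hol_on S g" shows "hol_on S (\<lambda>x. f x + g x)"
proof (rule hol_onI)
  show "fd (\<lambda>x. f x + g x) x (z *s v) = z * fd (\<lambda>x. f x + g x) x v" if "x \<in> S" for x z v
    using frechet_derivative_at[OF has_derivative_add[OF smooth_onD(2)[OF hol_onD(1)[OF assms(2)] that]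
       smooth_onD(2)[OF hol_onD(1)[OF assms(3)] that]], symmetric] hol_onD(2)[OF assms(2) that] hol_onD(2)[OF assms(3) that]
    by (simp add: algebra_simps)
qed (intro smooth_on_add hol_onD assms)

lemma hol_on_mult:
  assumes "open S" "hol_on S f" "hol_on S g" shows "hol_on S (\<lambda>x. f x * g x)"
proof (rule hol_onI)
  show "fd (\<lambda>x. f x * g x) x (z *s v) = z * fd (\<lambda>x. f x * g x) x v" if "x \<in> S" for x z v
    using frechet_derivative_at[OF has_derivative_mult[OF smooth_onD(2)[OF hol_onD(1)[OF assms(2)] that]
       smooth_onD(2)[OF hol_onD(1)[OF assms(3)] that]], symmetric] hol_onD(2)[OF assms(2) that] hol_onD(2)[OF assms(3) that]
    by (simp add: algebra_simps)
qed (intro smooth_on_mult hol_onD assms)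

lemma hol_on_compose:
  fixes f :: "complex^'m::finite \<Rightarrow> complex" and \<phi> :: "complex^'l::finite \<Rightarrow> complex^'m"
  assumes "open S" "open T" "\<And>i. hol_on S (\<lambda>x. \<phi> x $ i)" "\<phi> ` S \<subseteq> T" "hol_on T f"
  shows "hol_on S (\<lambda>x. f (\<phi> x))"
proof (rule hol_onI)
  show "smooth_on S (\<lambda>x. f (\<phi> x))"
    by (rule smooth_on_compose[OF assms(1,2) _ assms(4)]) (use hol_onD assms in blast)+
  fix x z v assume x: "x \<in> S"
  then have T: "\<phi> x \<in> T" using assms by auto
  have "((\<lambda>x. f (\<phi> x)) has_derivative (\<lambda>v. fd f (\<phi> x) (\<chi> i. fd (\<lambda>x. \<phi> x $ i) x v))) (at x)"
    using has_derivative_compose[OF smooth_on_vec_differentiable(1)[OF hol_onD(1)[OF assms(3)] x]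
        smooth_onD(2)[OF hol_onD(1)[OF assms(5)] T]] by simp
  from frechet_derivative_at[OF this]
  have *: "fd (\<lambda>x. f (\<phi> x)) x v = fd f (\<phi> x) (\<chi> i. fd (\<lambda>x. \<phi> x $ i) x v)" for v by metis
  have "(\<chi> i. fd (\<lambda>x. \<phi> x $ i) x (z *s v)) = z *s (\<chi> i. fd (\<lambda>x. \<phi> x $ i) x v)"
    using hol_onD(2)[OF assms(3) x] by (simp add: vec_eq_iff)
  then show "fd (\<lambda>x. f (\<phi> x)) x (z *s v) = z * fd (\<lambda>x. f (\<phi> x)) x v"
    unfolding * using hol_onD(2)[OF assms(5) T] by simp
qed

text \<open>Symmetry of second derivatives exchanges the two directions; complex linearity in
  \<open>w\<close> is then inherited by differentiating
  \<open>fd f x (z *s w) = z * fd f x w\<close> along the fixed \<open>v\<close>.\<close>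

lemma hol_on_derivative:
  assumes "open S" "hol_on S f" shows "hol_on S (\<lambda>x. fd f x v)"
proof (rule hol_onI)
  note f = hol_onD(1)[OF assms(2)]
  show "smooth_on S (\<lambda>x. fd f x v)" by (rule smooth_on_derivative[OF f])
  fix x z w assume x: "x \<in> S"
  have "fd (\<lambda>x. fd f x v) x (z *s w) = fd (\<lambda>x. fd f x (z *s w)) x v"
    by (rule symmetric_second_derivative[OF assms(1) x f])
  also have "\<dots> = fd (\<lambda>x. z * fd f x w) x v"
    using fd_cong[OF assms(1) x, of "\<lambda>x. fd f x (z *s w)" "\<lambda>x. z * fd f x w"] hol_onD(2)[OF assms(2)] by simp
  also have "\<dots> = z * fd (\<lambda>x. fd f x w) x v"
    using frechet_derivative_at[OF has_derivative_mult_right[OF smooth_onD(2)[OF smooth_on_derivative[OF f] x]], symmetric]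
    by simp
  also have "fd (\<lambda>x. fd f x w) x v = fd (\<lambda>x. fd f x v) x w"
    by (rule symmetric_second_derivative[OF assms(1) x f])
  finally show "fd (\<lambda>x. fd f x v) x (z *s w) = z * fd (\<lambda>x. fd f x v) x w" .
qed

text \<open>The Leibniz rule for a moving direction. It splits a second derivative along a vector
  field into a Hessian part, symmetric in the two directions, and a part that sees the derivative of
  the field.\<close>

lemma fd_derivative_along:
  assumes S: "open S" "x \<in> S" and f: "smooth_on S f" and w: "\<And>i. smooth_on S (\<lambda>x. w x $ i)"
  shows "fd (\<lambda>y. fd f y (w y)) x v = fd (\<lambda>y. fd f y v) x (w x) + fd f x (frechet_derivative w (at x) v)"
proof -
  define L where "L y = (\<Sum>i\<in>UNIV. of_real (Re (w y $ i)) * fd f y (axis i 1) + of_real (Im (w y $ i)) * fd f y (axis i \<i>))" for y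
  have "fd f y (w y) = L y" if "y \<in> S" for y
    unfolding L_def by (rule linear_complex_vec_expand[OF smooth_onD(3)[OF f that]])
  then have 1: "fd (\<lambda>y. fd f y (w y)) x = fd L x" by (rule fd_cong[OF S])
  define w' where "w' = frechet_derivative w (at x)"
  have w': "w' u $ i = fd (\<lambda>x. w x $ i) x u" for u i
    unfolding w'_def by (simp add: smooth_on_vec_differentiable(2)[OF w S(2)])
  have d1: "((\<lambda>x. w x $ i) has_derivative (\<lambda>v. w' v $ i)) (at x)" for i
    unfolding w' by (rule smooth_onD(2)[OF w S(2)])
  note d2 = smooth_onD(2)[OF smooth_on_derivative[OF f] S(2)]
  have L': "(L has_derivative (\<lambda>v. \<Sum>i\<in>UNIV.
      (of_real (Re (w x $ i)) * fd (\<lambda>y. fd f y (axis i 1)) x v + of_real (Re (w' v $ i)) * fd f x (axis i 1)) +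
      (of_real (Im (w x $ i)) * fd (\<lambda>y. fd f y (axis i \<i>)) x v + of_real (Im (w' v $ i)) * fd f x (axis i \<i>)))) (at x)"
    unfolding L_def
    by (intro has_derivative_sum has_derivative_add has_derivative_mult has_derivative_of_real
        has_derivative_Re has_derivative_Im d1 d2)
  have 2: "fd L x v = (\<Sum>i\<in>UNIV.
      (of_real (Re (w x $ i)) * fd (\<lambda>y. fd f y (axis i 1)) x v + of_real (Re (w' v $ i)) * fd f x (axis i 1)) +
      (of_real (Im (w x $ i)) * fd (\<lambda>y. fd f y (axis i \<i>)) x v + of_real (Im (w' v $ i)) * fd f x (axis i \<i>)))"
    using fun_cong[OF frechet_derivative_at[OF L'], of v] by simp
  have 3: "fd (\<lambda>y. fd f y v) x (w x) = (\<Sum>i\<in>UNIV. of_real (Re (w x $ i)) * fd (\<lambda>y. fd f y (axis i 1)) x v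
      + of_real (Im (w x $ i)) * fd (\<lambda>y. fd f y (axis i \<i>)) x v)"
    unfolding symmetric_second_derivative[OF S f, of _ v]
    by (rule linear_complex_vec_expand[OF smooth_onD(3)[OF smooth_on_derivative[OF f] S(2)]])
  have 4: "fd f x (w' v) = (\<Sum>i\<in>UNIV. of_real (Re (w' v $ i)) * fd f x (axis i 1)
      + of_real (Im (w' v $ i)) * fd f x (axis i \<i>))"
    by (rule linear_complex_vec_expand[OF smooth_onD(3)[OF f S(2)]])
  show ?thesis
    unfolding 1 2 3 w'_def[symmetric] 4 sum.distrib[symmetric] by (rule sum.cong) simp_all
qed

section \<open>Functions and vector fields on complex manifolds\<close>

locale complex_mfd =
  fixes A :: "('a::{t2_space, second_countable_topology}, 'm::finite) chart set"
  assumes cmfd: "complex_manifold A"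
begin

lemma chart_homeo:
  assumes "c \<in> A"
  shows "open (fst c)" "homeomorphism (fst c) (snd c ` fst c) (snd c) (chart_inv c)" "open (snd c ` fst c)"
  using cmfd assms unfolding complex_manifold_def by blast+

lemma chart_inv_left [simp]: "c \<in> A \<Longrightarrow> p \<in> fst c \<Longrightarrow> chart_inv c (snd c p) = p"
  using chart_homeo(2) by (simp add: homeomorphism_def)

lemma image_chart_iff:
  assumes "c \<in> A"
  shows "x \<in> snd c ` (W \<inter> fst c) \<longleftrightarrow> x \<in> snd c ` fst c \<and> chart_inv c x \<in> W"
  using assms by auto

lemma chart_inv_right:
  assumes "c \<in> A" "x \<in> snd c ` (W \<inter> fst c)"
  shows "snd c (chart_inv c x) = x" "chart_inv c x \<in> fst c" "chart_inv c x \<in> W"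
  using assms by auto

lemma open_image_chart:
  assumes "c \<in> A" "open W"
  shows "open (snd c ` (W \<inter> fst c))"
proof -
  have "openin (top_of_set (snd c ` fst c)) (snd c ` (fst c \<inter> W))"
    using homeomorphism_imp_open_map[OF chart_homeo(2)[OF assms(1)], of "fst c \<inter> W"] assms(2)
    by (simp add: openin_open_Int)
  then show ?thesis using openin_open_trans chart_homeo(3)[OF assms(1)] by (metis inf_commute)
qed

lemma transition_hol:
  assumes "c \<in> A" "d \<in> A"
  shows "hol_on (snd c ` (fst c \<inter> fst d)) (\<lambda>x. snd d (chart_inv c x) $ i)"
  using cmfd assms unfolding complex_manifold_def by blast

lemma open_mfd: "open (mfd A)"
  unfolding mfd_def using chart_homeo(1) by blast

lemma open_inI: "open W \<Longrightarrow> W \<subseteq> fst c \<Longrightarrow> c \<in> A \<Longrightarrow> open_in A W"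
  unfolding open_in_def mfd_def by auto

lemma open_inD: "open_in A W \<Longrightarrow> open W" "open_in A W \<Longrightarrow> p \<in> W \<Longrightarrow> \<exists>c\<in>A. p \<in> fst c"
  "open_in A W \<Longrightarrow> p \<in> W \<Longrightarrow> p \<in> mfd A"
  unfolding open_in_def mfd_def by auto

lemma open_in_Int: "open_in A W \<Longrightarrow> open V \<Longrightarrow> open_in A (W \<inter> V)"
  "open_in A W \<Longrightarrow> open V \<Longrightarrow> open_in A (V \<inter> W)"
  unfolding open_in_def by auto

lemma smooth_funI: "(\<And>c. c \<in> A \<Longrightarrow> smooth_on (snd c ` (W \<inter> fst c)) (\<lambda>x. f (chart_inv c x))) \<Longrightarrow> smooth_fun A W f"
  by (simp add: smooth_fun_def o_def)

lemma smooth_funD: "smooth_fun A W f \<Longrightarrow> c \<in> A \<Longrightarrow> smooth_on (snd c ` (W \<inter> fst c)) (\<lambda>x. f (chart_inv c x))"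
  by (simp add: smooth_fun_def o_def)

lemma hol_funI: "(\<And>c. c \<in> A \<Longrightarrow> hol_on (snd c ` (W \<inter> fst c)) (\<lambda>x. f (chart_inv c x))) \<Longrightarrow> hol_fun A W f"
  by (simp add: hol_fun_def o_def)

lemma hol_funD: "hol_fun A W f \<Longrightarrow> c \<in> A \<Longrightarrow> hol_on (snd c ` (W \<inter> fst c)) (\<lambda>x. f (chart_inv c x))"
  by (simp add: hol_fun_def o_def)

lemma hol_fun_imp_smooth_fun: "hol_fun A W f \<Longrightarrow> smooth_fun A W f"
  by (rule smooth_funI) (rule hol_onD(1)[OF hol_funD])

lemma smooth_fun_subset:
  assumes "smooth_fun A W f" "V \<subseteq> W" shows "smooth_fun A V f"
proof (rule smooth_funI)
  fix c assume "c \<in> A"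
  show "smooth_on (snd c ` (V \<inter> fst c)) (\<lambda>x. f (chart_inv c x))"
    by (rule smooth_on_subset[OF smooth_funD[OF assms(1) \<open>c \<in> A\<close>]]) (use assms(2) in auto)
qed

lemma hol_fun_subset:
  assumes "hol_fun A W f" "V \<subseteq> W" shows "hol_fun A V f"
proof (rule hol_funI)
  fix c assume "c \<in> A"
  show "hol_on (snd c ` (V \<inter> fst c)) (\<lambda>x. f (chart_inv c x))"
    by (rule hol_on_subset[OF hol_funD[OF assms(1) \<open>c \<in> A\<close>]]) (use assms(2) in auto)
qed

lemma smooth_fun_cong:
  assumes "open W" "\<And>p. p \<in> W \<Longrightarrow> f p = g p" "smooth_fun A W f" shows "smooth_fun A W g"
proof (rule smooth_funI)
  fix c assume c: "c \<in> A"
  show "smooth_on (snd c ` (W \<inter> fst c)) (\<lambda>x. g (chart_inv c x))"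
    by (rule smooth_on_cong[OF open_image_chart[OF c assms(1)] _ smooth_funD[OF assms(3) c]])
      (use c assms(2) in auto)
qed

lemma hol_fun_cong:
  assumes "open W" "\<And>p. p \<in> W \<Longrightarrow> f p = g p" "hol_fun A W f" shows "hol_fun A W g"
proof (rule hol_funI)
  fix c assume c: "c \<in> A"
  show "hol_on (snd c ` (W \<inter> fst c)) (\<lambda>x. g (chart_inv c x))"
    by (rule hol_on_cong[OF open_image_chart[OF c assms(1)] _ hol_funD[OF assms(3) c]])
      (use c assms(2) in auto)
qed

lemma smooth_fun_local:
  assumes "\<And>p. p \<in> W \<Longrightarrow> \<exists>V. open V \<and> p \<in> V \<and> smooth_fun A V f"
  shows "smooth_fun A W f"
proof (rule smooth_funI, rule smooth_on_local)
  fix c x assume c: "c \<in> A" and x: "x \<in> snd c ` (W \<inter> fst c)"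
  from assms[OF chart_inv_right(3)[OF c x]]
  obtain V where V: "open V" "chart_inv c x \<in> V" "smooth_fun A V f" by blast
  have "x \<in> snd c ` (V \<inter> fst c)" using x V(2) image_chart_iff[OF c] by blast
  then show "\<exists>T. open T \<and> x \<in> T \<and> smooth_on T (\<lambda>x. f (chart_inv c x))"
    using open_image_chart[OF c V(1)] smooth_funD[OF V(3) c] by blast
qed

lemma transition_image: "c \<in> A \<Longrightarrow> d \<in> A \<Longrightarrow> W \<subseteq> fst c \<Longrightarrow>
    (\<lambda>x. snd c (chart_inv d x)) ` snd d ` (W \<inter> fst d) \<subseteq> snd c ` W"
  by auto

text \<open>Transition maps are holomorphic, so composing with them carries holomorphy from the
  single chart \<open>c\<close> to all others.\<close>

lemma hol_fun_of_chart:
  assumes c: "c \<in> A" and W: "open W" "W \<subseteq> fst c"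
    and f: "hol_on (snd c ` W) (\<lambda>x. f (chart_inv c x))"
  shows "hol_fun A W f"
proof (rule hol_funI)
  fix d assume d: "d \<in> A"
  have S: "open (snd d ` (W \<inter> fst d))" by (rule open_image_chart[OF d W(1)])
  have T: "open (snd c ` W)" using open_image_chart[OF c W(1)] W(2) by (simp add: Int_absorb2)
  have "hol_on (snd d ` (W \<inter> fst d)) (\<lambda>x. f (chart_inv c (snd c (chart_inv d x))))"
    by (rule hol_on_compose[OF S T _ transition_image[OF c d W(2)] f],
        rule hol_on_subset[OF transition_hol[OF d c]]) (use W in auto)
  then show "hol_on (snd d ` (W \<inter> fst d)) (\<lambda>x. f (chart_inv d x))"
    by (rule hol_on_cong[OF S, rotated]) (use c d W in auto)
qed

lemma smooth_fun_const: "smooth_fun A W (\<lambda>_. z)"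
  by (rule smooth_funI) (rule smooth_on_const)

lemma smooth_fun_add:
  assumes "open W" "smooth_fun A W f" "smooth_fun A W g" shows "smooth_fun A W (\<lambda>p. f p + g p)"
  by (rule smooth_funI) (rule smooth_on_add[OF open_image_chart smooth_funD smooth_funD], (rule assms | assumption)+)

lemma smooth_fun_mult:
  assumes "open W" "smooth_fun A W f" "smooth_fun A W g" shows "smooth_fun A W (\<lambda>p. f p * g p)"
  by (rule smooth_funI) (rule smooth_on_mult[OF open_image_chart smooth_funD smooth_funD], (rule assms | assumption)+)

lemma smooth_fun_cnj:
  assumes "open W" "smooth_fun A W f" shows "smooth_fun A W (\<lambda>p. cnj (f p))"
  by (rule smooth_funI) (rule smooth_on_cnj[OF open_image_chart smooth_funD], (rule assms | assumption)+)

lemma smooth_fun_inverse: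
  assumes "open W" "smooth_fun A W f" "\<And>p. p \<in> W \<Longrightarrow> f p \<noteq> 0" shows "smooth_fun A W (\<lambda>p. inverse (f p))"
proof (rule smooth_funI)
  fix c assume c: "c \<in> A"
  show "smooth_on (snd c ` (W \<inter> fst c)) (\<lambda>x. inverse (f (chart_inv c x)))"
    by (rule smooth_on_inverse[OF open_image_chart[OF c assms(1)] smooth_funD[OF assms(2) c]])
      (use assms(3) c in auto)
qed

lemma smooth_fun_sum:
  assumes "open W" "\<And>i. i \<in> I \<Longrightarrow> smooth_fun A W (f i)" shows "smooth_fun A W (\<lambda>p. \<Sum>i\<in>I. f i p)"
  using assms(2) by (induction I rule: infinite_finite_induct)
    (simp_all add: smooth_fun_const smooth_fun_add[OF \<open>open W\<close>])

lemma smooth_fun_minus: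
  assumes "open W" "smooth_fun A W f" shows "smooth_fun A W (\<lambda>p. - f p)"
  using smooth_fun_mult[OF assms(1) smooth_fun_const[of W "-1"] assms(2)] by simp

lemma smooth_fun_diff:
  assumes "open W" "smooth_fun A W f" "smooth_fun A W g" shows "smooth_fun A W (\<lambda>p. f p - g p)"
  using smooth_fun_add[OF assms(1,2) smooth_fun_minus[OF assms(1,3)]] by simp

lemma hol_fun_const: "hol_fun A W (\<lambda>_. z)"
  by (rule hol_funI) (rule hol_on_const)

lemma hol_fun_add:
  assumes "open W" "hol_fun A W f" "hol_fun A W g" shows "hol_fun A W (\<lambda>p. f p + g p)"
  by (rule hol_funI) (rule hol_on_add[OF open_image_chart hol_funD hol_funD], (rule assms | assumption)+)

lemma hol_fun_mult:
  assumes "open W" "hol_fun A W f" "hol_fun A W g" shows "hol_fun A W (\<lambda>p. f p * g p)"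
  by (rule hol_funI) (rule hol_on_mult[OF open_image_chart hol_funD hol_funD], (rule assms | assumption)+)

lemma hol_fun_sum:
  assumes "open W" "\<And>i. i \<in> I \<Longrightarrow> hol_fun A W (f i)" shows "hol_fun A W (\<lambda>p. \<Sum>i\<in>I. f i p)"
  using assms(2) by (induction I rule: infinite_finite_induct)
    (simp_all add: hol_fun_const hol_fun_add[OF \<open>open W\<close>])

lemma smooth_fun_continuous:
  assumes "smooth_fun A W f" "open_in A W" shows "continuous_on W f"
proof (rule continuous_at_imp_continuous_on, rule ballI)
  fix p assume p: "p \<in> W"
  obtain c where c: "c \<in> A" "p \<in> fst c" using open_inD assms(2) p by blast
  have W: "open (W \<inter> fst c)" using open_inD(1)[OF assms(2)] chart_homeo(1)[OF c(1)] by auto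
  have "continuous_on (W \<inter> fst c) (\<lambda>q. f (chart_inv c (snd c q)))"
  proof (rule continuous_on_compose2[where f = "snd c" and g = "\<lambda>x. f (chart_inv c x)"])
    show "continuous_on (snd c ` (W \<inter> fst c)) (\<lambda>x. f (chart_inv c x))"
      by (rule smooth_on_imp_continuous_on[OF smooth_funD[OF assms(1) c(1)]])
    show "continuous_on (W \<inter> fst c) (snd c)"
      using chart_homeo(2)[OF c(1)] by (meson continuous_on_subset homeomorphism_def inf_le2)
  qed auto
  then have "continuous_on (W \<inter> fst c) f" by (rule continuous_on_eq) (use c in auto)
  then show "isCont f p" using W p c continuous_on_eq_continuous_at by blast
qed

subsection \<open>Tangent vectors\<close>

definition jac :: "('a, 'm) chart \<Rightarrow> ('a, 'm) chart \<Rightarrow> 'a \<Rightarrow> complex^'m \<Rightarrow> complex^'m" where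
  "jac c d p v = (\<chi> i. fd (\<lambda>x. snd d (chart_inv c x) $ i) (snd c p) v)"

lemma jac:
  assumes "c \<in> A" "d \<in> A" "p \<in> fst c" "p \<in> fst d"
  shows "((\<lambda>x. snd d (chart_inv c x)) has_derivative jac c d p) (at (snd c p))"
    "frechet_derivative (snd d \<circ> chart_inv c) (at (snd c p)) = jac c d p"
    "jac c d p (z *s v) = z *s jac c d p v" "linear (jac c d p)"
proof -
  have p: "snd c p \<in> snd c ` (fst c \<inter> fst d)" using assms by auto
  note h = transition_hol[OF assms(1,2)]
  have "jac c d p = (\<lambda>v. \<chi> i. fd (\<lambda>x. snd d (chart_inv c x) $ i) (snd c p) v)" by (simp add: jac_def fun_eq_iff)
  then show *: "((\<lambda>x. snd d (chart_inv c x)) has_derivative jac c d p) (at (snd c p))"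
    using smooth_on_vec_differentiable(1)[OF hol_onD(1)[OF h] p] by simp
  then show "frechet_derivative (snd d \<circ> chart_inv c) (at (snd c p)) = jac c d p" "linear (jac c d p)"
    using frechet_derivative_at[OF *] has_derivative_linear[OF *] by (simp_all add: o_def)
  show "jac c d p (z *s v) = z *s jac c d p v"
    unfolding jac_def hol_onD(2)[OF h p] by (simp add: vec_eq_iff)
qed

lemma tspace_iff:
  "X \<in> tspace A p \<longleftrightarrow> (\<forall>c. \<not> (c \<in> A \<and> p \<in> fst c) \<longrightarrow> X c = 0) \<and>
     (\<forall>c\<in>A. \<forall>d\<in>A. p \<in> fst c \<and> p \<in> fst d \<longrightarrow> X d = jac c d p (X c))"
  unfolding tspace_def using jac(2) by auto

lemma tspaceD:
  assumes "X \<in> tspace A p"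
  shows "\<not> (c \<in> A \<and> p \<in> fst c) \<Longrightarrow> X c = 0"
    "c \<in> A \<Longrightarrow> p \<in> fst c \<Longrightarrow> d \<in> A \<Longrightarrow> p \<in> fst d \<Longrightarrow> jac c d p (X c) = X d"
  using assms unfolding tspace_iff by metis+

lemma tspaceI:
  assumes "\<And>c. \<not> (c \<in> A \<and> p \<in> fst c) \<Longrightarrow> X c = 0"
    "\<And>c d. c \<in> A \<Longrightarrow> p \<in> fst c \<Longrightarrow> d \<in> A \<Longrightarrow> p \<in> fst d \<Longrightarrow> jac c d p (X c) = X d"
  shows "X \<in> tspace A p"
  using assms unfolding tspace_iff by metis

lemma jac_cocycle:
  assumes "c \<in> A" "d \<in> A" "e \<in> A" "p \<in> fst c" "p \<in> fst d" "p \<in> fst e"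
  shows "jac d e p (jac c d p v) = jac c e p v"
proof -
  define S where "S = snd c ` ((fst c \<inter> fst d) \<inter> fst c)"
  have S: "open S" "snd c p \<in> S"
    unfolding S_def using assms open_image_chart[OF assms(1)] chart_homeo(1) by blast+
  have "((\<lambda>x. snd e (chart_inv d (snd d (chart_inv c x)))) has_derivative (\<lambda>v. jac d e p (jac c d p v))) (at (snd c p))"
    by (rule has_derivative_compose[where f = "\<lambda>x. snd d (chart_inv c x)" and g = "\<lambda>y. snd e (chart_inv d y)"])
      (use assms jac(1) in auto)
  then have "((\<lambda>x. snd e (chart_inv c x)) has_derivative (\<lambda>v. jac d e p (jac c d p v))) (at (snd c p))"
    by (rule has_derivative_transform_within_open[OF _ S]) (use assms in \<open>auto simp: S_def\<close>)
  then have "(\<lambda>v. jac d e p (jac c d p v)) = jac c e p"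
    using has_derivative_unique jac(1) assms by metis
  then show ?thesis by metis
qed

lemma jac_self:
  assumes "c \<in> A" "p \<in> fst c" shows "jac c c p v = v"
proof -
  have "((\<lambda>x. x) has_derivative jac c c p) (at (snd c p))"
    by (rule has_derivative_transform_within_open[OF jac(1)[OF assms(1,1,2,2)], of "snd c ` (fst c \<inter> fst c)"])
      (use assms chart_homeo(3)[OF assms(1)] in auto)
  then have "jac c c p = (\<lambda>x. x)" using has_derivative_unique has_derivative_ident by blast
  then show ?thesis by simp
qed

text \<open>The inverse of the coordinate map \<open>\<lambda>X. X c\<close> on
  \<open>tspace A p\<close>. The value 0 at charts that do not contain \<open>p\<close> is the
  convention built into \<open>tspace\<close>.\<close>

definition tvec_of :: "('a, 'm) chart \<Rightarrow> 'a \<Rightarrow> complex^'m \<Rightarrow> ('a, 'm) tvec" where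
  "tvec_of c p v = (\<lambda>d. if d \<in> A \<and> p \<in> fst d then jac c d p v else 0)"

lemma tvec_of:
  assumes "c \<in> A" "p \<in> fst c"
  shows "tvec_of c p v \<in> tspace A p" "tvec_of c p v c = v"
    "X \<in> tspace A p \<Longrightarrow> tvec_of c p (X c) = X"
proof -
  show "tvec_of c p v \<in> tspace A p"
    unfolding tspace_iff tvec_of_def by (simp add: jac_cocycle[OF assms(1) _ _ assms(2)])
  show "tvec_of c p v c = v" using assms by (simp add: tvec_of_def jac_self)
  show "tvec_of c p (X c) = X" if X: "X \<in> tspace A p"
  proof
    fix d show "tvec_of c p (X c) d = X d"
      using tspaceD(1)[OF X, of d] tspaceD(2)[OF X assms, of d]
      by (cases "d \<in> A \<and> p \<in> fst d") (auto simp: tvec_of_def)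
  qed
qed

lemma tspace_eqI:
  assumes "c \<in> A" "p \<in> fst c" "X \<in> tspace A p" "Y \<in> tspace A p" "X c = Y c"
  shows "X = Y"
  using tvec_of(3)[OF assms(1,2)] assms by metis

lemma tspace_add: "X \<in> tspace A p \<Longrightarrow> Y \<in> tspace A p \<Longrightarrow> X + Y \<in> tspace A p"
  by (rule tspaceI) (simp_all add: tspaceD linear_add[OF jac(4)])

lemma tspace_scl: "X \<in> tspace A p \<Longrightarrow> tscl z X \<in> tspace A p"
  by (rule tspaceI) (simp_all add: tscl_def tspaceD jac(3))

lemma tspace_0: "0 \<in> tspace A p"
  by (rule tspaceI) (simp_all add: linear_0[OF jac(4)])

lemma vector_space_tscl: "vector_space (tscl :: complex \<Rightarrow> ('a, 'm) tvec \<Rightarrow> ('a, 'm) tvec)"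
  by unfold_locales (auto simp: tscl_def fun_eq_iff vec_eq_iff algebra_simps)

lemma tbundle_simps [simp]: "fib (tbundle A) = tspace A" "scl (tbundle A) = tscl"
  by (simp_all add: tbundle_def)

lemma trivs_tbundle: "trivs (tbundle A) = (\<lambda>c. (fst c, \<lambda>p X. X c)) ` A"
  unfolding tbundle_def vbundle.select_convs by (rule Setcompr_eq_image)

lemma bij_tspace:
  assumes "c \<in> A" "p \<in> fst c" shows "bij_betw (\<lambda>X. X c) (tspace A p) UNIV"
  by (rule bij_betw_byWitness[where f' = "tvec_of c p"]) (use tvec_of[OF assms] in auto)

lemma inv_into_tspace:
  assumes "c \<in> A" "p \<in> fst c" shows "inv_into (tspace A p) (\<lambda>X. X c) y = tvec_of c p y"
  using inv_into_f_f[OF bij_betw_imp_inj_on[OF bij_tspace[OF assms]] tvec_of(1)[OF assms, of y]]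
    tvec_of(2)[OF assms] by simp

text \<open>In chart \<open>d\<close>, a field that is constant in chart \<open>c\<close> has as
  coordinates directional derivatives of the transition map, and these are holomorphic by
  \<open>hol_on_derivative\<close>. This is the cocycle condition of the tangent bundle.\<close>

lemma tvec_of_hol:
  assumes c: "c \<in> A" "d \<in> A" shows "hol_fun A (fst c \<inter> fst d) (\<lambda>p. tvec_of c p y d $ i)"
proof -
  have W: "open (fst c \<inter> fst d)" by (intro open_Int chart_homeo(1) c)
  have *: "(fst c \<inter> fst d) \<inter> fst c = fst c \<inter> fst d" by auto
  show ?thesis
  proof (rule hol_fun_of_chart[OF c(1) W])
    have o: "open (snd c ` (fst c \<inter> fst d))" using open_image_chart[OF c(1) W] unfolding * .
    show "hol_on (snd c ` (fst c \<inter> fst d)) (\<lambda>x. tvec_of c (chart_inv c x) y d $ i)"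
      by (rule hol_on_cong[OF o _ hol_on_derivative[OF o transition_hol[OF c]]])
        (use c in \<open>auto simp: tvec_of_def jac_def\<close>)
  qed auto
qed

lemma holo_bundle_tbundle: "holo_bundle A (tbundle A)"
proof -
  interpret vs: vector_space "tscl :: complex \<Rightarrow> ('a, 'm) tvec \<Rightarrow> ('a, 'm) tvec" by (rule vector_space_tscl)
  have "vs.subspace (tspace A p)" for p
    using tspace_0 tspace_add tspace_scl by (auto simp: vs.subspace_def)
  moreover have "hol_fun A (fst c \<inter> fst d) (\<lambda>p. inv_into (tspace A p) (\<lambda>X. X c) y d $ i)"
    if c: "c \<in> A" "d \<in> A" for c d y i
    by (rule hol_fun_cong[OF _ _ tvec_of_hol[OF c]])
      (simp_all add: c open_Int chart_homeo(1) inv_into_tspace)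
  moreover have "open_in A (fst c)" if "c \<in> A" for c
    by (rule open_inI[OF chart_homeo(1)[OF that] order_refl that])
  ultimately show ?thesis
    unfolding holo_bundle_def trivs_tbundle tbundle_simps ball_simps case_prod_conv
    using vector_space_tscl bij_tspace by (simp add: mfd_def tscl_def)
qed

lemma smooth_vf_iff:
  "smooth_sec A (tbundle A) W X \<longleftrightarrow> (\<forall>p\<in>W. X p \<in> tspace A p) \<and> (\<forall>c\<in>A. \<forall>i. smooth_fun A (W \<inter> fst c) (\<lambda>p. X p c $ i))"
  unfolding smooth_sec_def trivs_tbundle by auto

lemma hol_vf_iff:
  "hol_sec A (tbundle A) W X \<longleftrightarrow> (\<forall>p\<in>W. X p \<in> tspace A p) \<and> (\<forall>c\<in>A. \<forall>i. hol_fun A (W \<inter> fst c) (\<lambda>p. X p c $ i))"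
  unfolding hol_sec_def trivs_tbundle by auto

subsection \<open>Derivatives along vector fields\<close>

text \<open>The real directional derivative, with the same choice of chart as in
  \<open>der10\<close> and \<open>der01\<close>. Both Wirtinger derivatives combine its values at
  \<open>X\<close> and \<open>tscl \<i> X\<close>, so their rules reduce to those of a real
  derivative.\<close>

definition rder :: "('a \<Rightarrow> complex) \<Rightarrow> 'a \<Rightarrow> ('a, 'm) tvec \<Rightarrow> complex" where
  "rder f p X = (let c = (SOME c. c \<in> A \<and> p \<in> fst c) in fd (\<lambda>x. f (chart_inv c x)) (snd c p) (X c))"

lemma der10_rder: "der10 A f p X = (rder f p X - \<i> * rder f p (tscl \<i> X)) / 2"
  by (simp add: der10_def rder_def Let_def tscl_def o_def)

lemma der01_rder: "der01 A f p X = (rder f p X + \<i> * rder f p (tscl \<i> X)) / 2"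
  by (simp add: der01_def rder_def Let_def tscl_def o_def)

lemma smooth_fun_at_chart:
  assumes "smooth_fun A W f" "open W" "p \<in> W" "c \<in> A" "p \<in> fst c"
  shows "((\<lambda>x. f (chart_inv c x)) has_derivative fd (\<lambda>x. f (chart_inv c x)) (snd c p)) (at (snd c p))"
  using smooth_onD(2)[OF smooth_funD[OF assms(1,4)], of "snd c p"] assms by auto

text \<open>This removes the chart chosen by \<open>SOME\<close>: the chain rule turns a change of
  chart into \<open>jac d c p\<close>, which maps \<open>X d\<close> to \<open>X c\<close>.\<close>

lemma rder_chart:
  assumes f: "smooth_fun A W f" "open W" and p: "p \<in> W" and c: "c \<in> A" "p \<in> fst c" and X: "X \<in> tspace A p"
  shows "rder f p X = fd (\<lambda>x. f (chart_inv c x)) (snd c p) (X c)"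
proof -
  define d where "d = (SOME c. c \<in> A \<and> p \<in> fst c)"
  have d: "d \<in> A" "p \<in> fst d" using someI[of "\<lambda>c. c \<in> A \<and> p \<in> fst c" c] c by (auto simp: d_def)
  define S where "S = snd d ` ((W \<inter> fst c) \<inter> fst d)"
  have S: "open S" "snd d p \<in> S"
    unfolding S_def using open_image_chart[OF d(1), of "W \<inter> fst c"] f(2) chart_homeo(1)[OF c(1)] p c d by auto
  have "((\<lambda>x. f (chart_inv c (snd c (chart_inv d x)))) has_derivative
      (\<lambda>v. fd (\<lambda>x. f (chart_inv c x)) (snd c p) (jac d c p v))) (at (snd d p))"
    using has_derivative_compose[where f = "\<lambda>x. snd c (chart_inv d x)" and g = "\<lambda>y. f (chart_inv c y)" and x = "snd d p",
        OF jac(1)[OF d(1) c(1) d(2) c(2)]] smooth_fun_at_chart[OF f p c] d by simp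
  then have "((\<lambda>x. f (chart_inv d x)) has_derivative
      (\<lambda>v. fd (\<lambda>x. f (chart_inv c x)) (snd c p) (jac d c p v))) (at (snd d p))"
    by (rule has_derivative_transform_within_open[OF _ S]) (use c d in \<open>auto simp: S_def\<close>)
  then have "fd (\<lambda>x. f (chart_inv d x)) (snd d p) = (\<lambda>v. fd (\<lambda>x. f (chart_inv c x)) (snd c p) (jac d c p v))"
    by (rule frechet_derivative_at[symmetric])
  moreover have "jac d c p (X d) = X c" by (rule tspaceD(2)[OF X d c])
  ultimately show ?thesis by (simp add: rder_def Let_def d_def[symmetric])
qed

lemma rder_cong:
  assumes "open W" "p \<in> W" "p \<in> mfd A" "\<And>q. q \<in> W \<Longrightarrow> f q = g q"
  shows "rder f p X = rder g p X"
proof -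
  define d where "d = (SOME c. c \<in> A \<and> p \<in> fst c)"
  have "\<exists>c. c \<in> A \<and> p \<in> fst c" using assms(3) unfolding mfd_def by blast
  from someI_ex[OF this] have d: "d \<in> A" "p \<in> fst d" unfolding d_def by blast+
  have "fd (\<lambda>x. f (chart_inv d x)) (snd d p) = fd (\<lambda>x. g (chart_inv d x)) (snd d p)"
    by (rule fd_cong[OF open_image_chart[OF d(1) assms(1)]]) (use d assms in auto)
  then show ?thesis by (simp add: rder_def Let_def d_def[symmetric])
qed

lemma der_cong:
  assumes "open W" "p \<in> W" "p \<in> mfd A" "\<And>q. q \<in> W \<Longrightarrow> f q = g q"
  shows "der10 A f p X = der10 A g p X" "der01 A f p X = der01 A g p X"
  unfolding der10_rder der01_rder using rder_cong[OF assms] by simp_all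

context
  fixes W :: "'a set" and p :: 'a
  assumes W: "open_in A W" and p: "p \<in> W"
begin

private lemma oW: "open W" using W by (rule open_inD)

private lemma chart: obtains c where "c \<in> A" "p \<in> fst c"
  using open_inD(2)[OF W p] by blast

lemma rder_add:
  assumes "smooth_fun A W f" "smooth_fun A W g" "X \<in> tspace A p"
  shows "rder (\<lambda>q. f q + g q) p X = rder f p X + rder g p X"
proof -
  obtain c where c: "c \<in> A" "p \<in> fst c" by (rule chart)
  show ?thesis
    unfolding rder_chart[OF smooth_fun_add[OF oW assms(1,2)] oW p c assms(3)] rder_chart[OF assms(1) oW p c assms(3)]
      rder_chart[OF assms(2) oW p c assms(3)]
    by (simp add: frechet_derivative_at[OF has_derivative_add[OF smooth_fun_at_chart[OF assms(1) oW p c]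
        smooth_fun_at_chart[OF assms(2) oW p c]], symmetric])
qed

lemma rder_mult:
  assumes "smooth_fun A W f" "smooth_fun A W g" "X \<in> tspace A p"
  shows "rder (\<lambda>q. f q * g q) p X = rder f p X * g p + f p * rder g p X"
proof -
  obtain c where c: "c \<in> A" "p \<in> fst c" by (rule chart)
  show ?thesis
    unfolding rder_chart[OF smooth_fun_mult[OF oW assms(1,2)] oW p c assms(3)] rder_chart[OF assms(1) oW p c assms(3)]
      rder_chart[OF assms(2) oW p c assms(3)]
    using c by (simp add: frechet_derivative_at[OF has_derivative_mult[OF smooth_fun_at_chart[OF assms(1) oW p c]
        smooth_fun_at_chart[OF assms(2) oW p c]], symmetric])
qed

lemma rder_cnj:
  assumes "smooth_fun A W f" "X \<in> tspace A p"
  shows "rder (\<lambda>q. cnj (f q)) p X = cnj (rder f p X)"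
proof -
  obtain c where c: "c \<in> A" "p \<in> fst c" by (rule chart)
  show ?thesis
    unfolding rder_chart[OF smooth_fun_cnj[OF oW assms(1)] oW p c assms(2)] rder_chart[OF assms(1) oW p c assms(2)]
    by (simp add: frechet_derivative_at[OF has_derivative_cnj[OF smooth_fun_at_chart[OF assms(1) oW p c]], symmetric])
qed

lemma rder_const: "X \<in> tspace A p \<Longrightarrow> rder (\<lambda>q. z) p X = 0"
  by (simp add: rder_def)

lemma rder_vec_add:
  assumes "smooth_fun A W f" "X \<in> tspace A p" "Y \<in> tspace A p"
  shows "rder f p (X + Y) = rder f p X + rder f p Y"
proof -
  obtain c where c: "c \<in> A" "p \<in> fst c" by (rule chart)
  show ?thesis
    unfolding rder_chart[OF assms(1) oW p c assms(2)] rder_chart[OF assms(1) oW p c assms(3)]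
      rder_chart[OF assms(1) oW p c tspace_add[OF assms(2,3)]]
    using linear_add[OF has_derivative_linear[OF smooth_fun_at_chart[OF assms(1) oW p c]]] by simp
qed

lemma rder_vec_scl:
  assumes "smooth_fun A W f" "X \<in> tspace A p"
  shows "rder f p (tscl z X) = of_real (Re z) * rder f p X + of_real (Im z) * rder f p (tscl \<i> X)"
proof -
  obtain c where c: "c \<in> A" "p \<in> fst c" by (rule chart)
  note l = has_derivative_linear[OF smooth_fun_at_chart[OF assms(1) oW p c]]
  have "tscl z X c = Re z *\<^sub>R X c + Im z *\<^sub>R tscl \<i> X c"
    unfolding tscl_def by (rule scaleC_vec_decompose)
  then show ?thesis
    unfolding rder_chart[OF assms(1) oW p c assms(2)] rder_chart[OF assms(1) oW p c tspace_scl[OF assms(2)]]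
    by (simp only: linear_add[OF l] linear_cmul[OF l]) (simp only: scaleR_conv_of_real)
qed

lemma rder_hol:
  assumes "hol_fun A W f" "X \<in> tspace A p"
  shows "rder f p (tscl z X) = z * rder f p X"
proof -
  obtain c where c: "c \<in> A" "p \<in> fst c" by (rule chart)
  note s = hol_fun_imp_smooth_fun[OF assms(1)]
  show ?thesis
    unfolding rder_chart[OF s oW p c assms(2)] rder_chart[OF s oW p c tspace_scl[OF assms(2)]]
    using hol_onD(2)[OF hol_funD[OF assms(1) c(1)], of "snd c p"] p c by (auto simp: tscl_def)
qed

lemma der_add:
  assumes "smooth_fun A W f" "smooth_fun A W g" "X \<in> tspace A p"
  shows "der10 A (\<lambda>q. f q + g q) p X = der10 A f p X + der10 A g p X"
    "der01 A (\<lambda>q. f q + g q) p X = der01 A f p X + der01 A g p X"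
  unfolding der10_rder der01_rder rder_add[OF assms] rder_add[OF assms(1,2) tspace_scl[OF assms(3)]]
  by (simp_all add: field_simps)

lemma der_mult:
  assumes "smooth_fun A W f" "smooth_fun A W g" "X \<in> tspace A p"
  shows "der10 A (\<lambda>q. f q * g q) p X = der10 A f p X * g p + f p * der10 A g p X"
    "der01 A (\<lambda>q. f q * g q) p X = der01 A f p X * g p + f p * der01 A g p X"
  unfolding der10_rder der01_rder rder_mult[OF assms] rder_mult[OF assms(1,2) tspace_scl[OF assms(3)]]
  by (simp_all add: field_simps)

lemma der_cnj:
  assumes "smooth_fun A W f" "X \<in> tspace A p"
  shows "der10 A (\<lambda>q. cnj (f q)) p X = cnj (der01 A f p X)"
    "der01 A (\<lambda>q. cnj (f q)) p X = cnj (der10 A f p X)"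
  unfolding der10_rder der01_rder rder_cnj[OF assms] rder_cnj[OF assms(1) tspace_scl[OF assms(2)]]
  by simp_all

lemma der_const: "X \<in> tspace A p \<Longrightarrow> der10 A (\<lambda>q. z) p X = 0" "X \<in> tspace A p \<Longrightarrow> der01 A (\<lambda>q. z) p X = 0"
  unfolding der10_rder der01_rder by (simp_all add: rder_const tspace_scl)

lemma der_sum:
  assumes "\<And>i. i \<in> I \<Longrightarrow> smooth_fun A W (f i)" "X \<in> tspace A p"
  shows "der10 A (\<lambda>q. \<Sum>i\<in>I. f i q) p X = (\<Sum>i\<in>I. der10 A (f i) p X)"
    "der01 A (\<lambda>q. \<Sum>i\<in>I. f i q) p X = (\<Sum>i\<in>I. der01 A (f i) p X)"
  using assms(1) by (induction I rule: infinite_finite_induct)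
    (simp_all add: der_const[OF assms(2)] der_add[OF _ _ assms(2)] smooth_fun_sum[OF oW])

lemma der_vec_add:
  assumes "smooth_fun A W f" "X \<in> tspace A p" "Y \<in> tspace A p"
  shows "der10 A f p (X + Y) = der10 A f p X + der10 A f p Y"
    "der01 A f p (X + Y) = der01 A f p X + der01 A f p Y"
proof -
  have "tscl \<i> (X + Y) = tscl \<i> X + tscl \<i> Y" by (simp add: tscl_def fun_eq_iff vec_eq_iff algebra_simps)
  then show "der10 A f p (X + Y) = der10 A f p X + der10 A f p Y"
    "der01 A f p (X + Y) = der01 A f p X + der01 A f p Y"
    unfolding der10_rder der01_rder
    by (simp_all add: rder_vec_add[OF assms] rder_vec_add[OF assms(1) tspace_scl[OF assms(2)] tspace_scl[OF assms(3)]]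
        field_simps)
qed

lemma der_vec_scl:
  assumes "smooth_fun A W f" "X \<in> tspace A p"
  shows "der10 A f p (tscl z X) = z * der10 A f p X" "der01 A f p (tscl z X) = cnj z * der01 A f p X"
proof -
  have *: "tscl \<i> (tscl z X) = tscl (\<i> * z) X" by (simp add: tscl_def fun_eq_iff vec_eq_iff)
  have z: "z = of_real (Re z) + \<i> * of_real (Im z)" "cnj z = of_real (Re z) - \<i> * of_real (Im z)"
    by (simp_all add: complex_eq_iff)
  have **: "rder f p (tscl (\<i> * z) X) = - of_real (Im z) * rder f p X + of_real (Re z) * rder f p (tscl \<i> X)"
    using rder_vec_scl[OF assms, of "\<i> * z"] by simp
  show "der10 A f p (tscl z X) = z * der10 A f p X"
    \<comment> \<open>The first four occurrences of \<open>z\<close> stand inside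
      \<open>Re z\<close> and \<open>Im z\<close>; only the factor on the right is to be split into
      real and imaginary part.\<close>
    unfolding der10_rder * ** rder_vec_scl[OF assms, of z] by (subst (5) z(1)) (simp add: field_simps)
  show "der01 A f p (tscl z X) = cnj z * der01 A f p X"
    unfolding der01_rder * ** rder_vec_scl[OF assms, of z] z(2) by (simp add: field_simps)
qed

lemma der01_hol:
  assumes "hol_fun A W f" "X \<in> tspace A p"
  shows "der01 A f p X = 0"
  unfolding der01_rder rder_hol[OF assms] by (simp add: field_simps)

end

section \<open>Derivatives along vector fields as functions of the point\<close>

lemma tscl_smooth:
  assumes "open_in A W" "smooth_sec A (tbundle A) W X" shows "smooth_sec A (tbundle A) W (\<lambda>q. tscl z (X q))"
  using assms(2) tspace_scl smooth_fun_mult[OF _ smooth_fun_const] open_inD(1)[OF assms(1)] chart_homeo(1)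
  unfolding smooth_vf_iff by (simp add: tscl_def open_Int)

lemma tscl_hol:
  assumes "open_in A W" "hol_sec A (tbundle A) W X" shows "hol_sec A (tbundle A) W (\<lambda>q. tscl z (X q))"
  using assms(2) tspace_scl hol_fun_mult[OF _ hol_fun_const] open_inD(1)[OF assms(1)] chart_homeo(1)
  unfolding hol_vf_iff by (simp add: tscl_def open_Int)

lemma hol_vf_imp_smooth: "hol_sec A (tbundle A) W X \<Longrightarrow> smooth_sec A (tbundle A) W X"
  unfolding hol_vf_iff smooth_vf_iff using hol_fun_imp_smooth_fun by blast

lemma rder_field_in_chart:
  assumes W: "open_in A W" and f: "smooth_fun A W f" and X: "smooth_sec A (tbundle A) W X" and c: "c \<in> A"
    and x: "x \<in> snd c ` (W \<inter> fst c)"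
  shows "rder f (chart_inv c x) (X (chart_inv c x)) = fd (\<lambda>x. f (chart_inv c x)) x (X (chart_inv c x) c)"
  using rder_chart[OF f open_inD(1)[OF W] _ c, of "chart_inv c x" "X (chart_inv c x)"] c x X
  unfolding smooth_vf_iff by auto

lemma smooth_vf_in_chart:
  assumes "smooth_sec A (tbundle A) W X" "c \<in> A"
  shows "smooth_on (snd c ` (W \<inter> fst c)) (\<lambda>x. X (chart_inv c x) c $ i)"
proof -
  have "smooth_fun A (W \<inter> fst c) (\<lambda>p. X p c $ i)" using assms by (auto simp: smooth_vf_iff)
  from smooth_funD[OF this assms(2)] show ?thesis by (simp add: Int_assoc)
qed

lemma rder_smooth:
  assumes W: "open_in A W" and f: "smooth_fun A W f" and X: "smooth_sec A (tbundle A) W X"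
  shows "smooth_fun A W (\<lambda>q. rder f q (X q))"
proof (rule smooth_funI)
  fix c assume c: "c \<in> A"
  have o: "open (snd c ` (W \<inter> fst c))" by (rule open_image_chart[OF c open_inD(1)[OF W]])
  show "smooth_on (snd c ` (W \<inter> fst c)) (\<lambda>x. rder f (chart_inv c x) (X (chart_inv c x)))"
    by (rule smooth_on_cong[OF o rder_field_in_chart[OF W f X c, symmetric]
        smooth_on_derivative_along[OF o smooth_funD[OF f c] smooth_vf_in_chart[OF X c]]])
qed

lemma der_smooth:
  assumes W: "open_in A W" and f: "smooth_fun A W f" and X: "smooth_sec A (tbundle A) W X"
  shows "smooth_fun A W (\<lambda>q. der10 A f q (X q))" "smooth_fun A W (\<lambda>q. der01 A f q (X q))"
proof -
  note o = open_inD(1)[OF W]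
  note 1 = rder_smooth[OF W f X] and 2 = rder_smooth[OF W f tscl_smooth[OF W X]]
  have "smooth_fun A W (\<lambda>q. (1/2) * (rder f q (X q) - \<i> * rder f q (tscl \<i> (X q))))"
    by (rule smooth_fun_mult[OF o smooth_fun_const smooth_fun_diff[OF o 1 smooth_fun_mult[OF o smooth_fun_const 2]]])
  then show "smooth_fun A W (\<lambda>q. der10 A f q (X q))" by (simp add: der10_rder)
  have "smooth_fun A W (\<lambda>q. (1/2) * (rder f q (X q) + \<i> * rder f q (tscl \<i> (X q))))"
    by (rule smooth_fun_mult[OF o smooth_fun_const smooth_fun_add[OF o 1 smooth_fun_mult[OF o smooth_fun_const 2]]])
  then show "smooth_fun A W (\<lambda>q. der01 A f q (X q))" by (simp add: der01_rder)
qed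

text \<open>The Cauchy-Riemann equations, as converse of \<open>der01_hol\<close>. They are what
  shows that the coefficients of the unit field are holomorphic.\<close>

lemma hol_funI_der01:
  assumes W: "open_in A W" and f: "smooth_fun A W f"
    and d: "\<And>p X. p \<in> W \<Longrightarrow> X \<in> tspace A p \<Longrightarrow> der01 A f p X = 0"
  shows "hol_fun A W f"
proof (rule hol_funI, rule hol_onI_imaginary)
  fix c assume c: "c \<in> A"
  show "smooth_on (snd c ` (W \<inter> fst c)) (\<lambda>x. f (chart_inv c x))" by (rule smooth_funD[OF f c])
  fix x v assume "x \<in> snd c ` (W \<inter> fst c)"
  then obtain p where p: "p \<in> W" "p \<in> fst c" "x = snd c p" by auto
  note t = tvec_of[OF c p(2), of v]
  have "rder f p (tvec_of c p v) + \<i> * rder f p (tscl \<i> (tvec_of c p v)) = 0"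
    using d[OF p(1) t(1)] by (simp add: der01_rder)
  then have "fd (\<lambda>x. f (chart_inv c x)) x v + \<i> * fd (\<lambda>x. f (chart_inv c x)) x (\<i> *s v) = 0"
    unfolding rder_chart[OF f open_inD(1)[OF W] p(1) c p(2) t(1)]
      rder_chart[OF f open_inD(1)[OF W] p(1) c p(2) tspace_scl[OF t(1)]] by (simp add: tscl_def t p(3))
  then have "\<i> * (fd (\<lambda>x. f (chart_inv c x)) x v + \<i> * fd (\<lambda>x. f (chart_inv c x)) x (\<i> *s v)) = 0" by simp
  then show "fd (\<lambda>x. f (chart_inv c x)) x (\<i> *s v) = \<i> * fd (\<lambda>x. f (chart_inv c x)) x v"
    by (simp add: algebra_simps)
qed

lemma rder_rder:
  assumes W: "open_in A W" and f: "smooth_fun A W f" and X: "smooth_sec A (tbundle A) W X"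
    and p: "p \<in> W" "c \<in> A" "p \<in> fst c" and Y: "Y \<in> tspace A p"
  shows "rder (\<lambda>q. rder f q (X q)) p Y =
    fd (\<lambda>x. fd (\<lambda>x. f (chart_inv c x)) x (Y c)) (snd c p) (X p c) +
    fd (\<lambda>x. f (chart_inv c x)) (snd c p) (frechet_derivative (\<lambda>x. X (chart_inv c x) c) (at (snd c p)) (Y c))"
proof -
  define S where "S = snd c ` (W \<inter> fst c)"
  have S: "open S" "snd c p \<in> S" using open_image_chart[OF p(2) open_inD(1)[OF W]] p by (auto simp: S_def)
  have "rder (\<lambda>q. rder f q (X q)) p Y = fd (\<lambda>x. rder f (chart_inv c x) (X (chart_inv c x))) (snd c p) (Y c)"
    by (rule rder_chart[OF rder_smooth[OF W f X] open_inD(1)[OF W] p Y])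
  also have "\<dots> = fd (\<lambda>x. fd (\<lambda>x. f (chart_inv c x)) x (X (chart_inv c x) c)) (snd c p) (Y c)"
    using fd_cong[OF S, OF rder_field_in_chart[OF W f X p(2)], folded S_def] by simp
  also have "\<dots> = fd (\<lambda>x. fd (\<lambda>x. f (chart_inv c x)) x (Y c)) (snd c p) (X (chart_inv c (snd c p)) c) +
    fd (\<lambda>x. f (chart_inv c x)) (snd c p) (frechet_derivative (\<lambda>x. X (chart_inv c x) c) (at (snd c p)) (Y c))"
    by (rule fd_derivative_along[OF S, unfolded S_def, OF smooth_funD[OF f p(2)] smooth_vf_in_chart[OF X p(2)]])
  finally show ?thesis using p by simp
qed

text \<open>This is the vanishing of the bracket of a holomorphic field with the conjugate of
  another one. In a chart the Hessian parts agree by symmetry, while the parts with derivatives of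
  the coefficients cancel, because those derivatives are complex linear.\<close>

lemma der10_der01_commute:
  assumes W: "open_in A W" and f: "smooth_fun A W f" and X: "hol_sec A (tbundle A) W X"
    and Y: "hol_sec A (tbundle A) W Y" and p: "p \<in> W"
  shows "der10 A (\<lambda>q. der01 A f q (Y q)) p (X p) = der01 A (\<lambda>q. der10 A f q (X q)) p (Y p)"
proof -
  obtain c where c: "c \<in> A" "p \<in> fst c" using open_inD(2)[OF W p] by blast
  note oW = open_inD(1)[OF W]
  have t: "X p \<in> tspace A p" "Y p \<in> tspace A p" using X Y p by (auto simp: hol_vf_iff)
  define B where "B v w = fd (\<lambda>x. fd (\<lambda>x. f (chart_inv c x)) x v) (snd c p) w" for v w
  define L where "L = fd (\<lambda>x. f (chart_inv c x)) (snd c p)"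
  define dv where "dv Z = frechet_derivative (\<lambda>x. Z (chart_inv c x) c) (at (snd c p))" for Z :: "'a \<Rightarrow> ('a, 'm) tvec"
  have S: "open (snd c ` (W \<inter> fst c))" "snd c p \<in> snd c ` (W \<inter> fst c)"
    using open_image_chart[OF c(1) oW] p c by auto
  have sym: "B v w = B w v" for v w
    unfolding B_def by (rule symmetric_second_derivative[OF S smooth_funD[OF f c(1)]])
  have Lm: "L (- v) = - L v" for v
    unfolding L_def by (rule linear_neg[OF has_derivative_linear[OF smooth_fun_at_chart[OF f oW p c]]])
  have hc: "dv Z (\<i> *s v) = \<i> *s dv Z v" "dv (\<lambda>q. tscl \<i> (Z q)) v = \<i> *s dv Z v" if Z: "hol_sec A (tbundle A) W Z" for Z v
  proof -
    have h: "hol_on (snd c ` (W \<inter> fst c)) (\<lambda>x. Z (chart_inv c x) c $ i)" for i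
      using hol_funD[of "W \<inter> fst c" "\<lambda>p. Z p c $ i", OF _ c(1)] Z c(1) by (auto simp: hol_vf_iff Int_assoc)
    have e: "dv Z = (\<lambda>v. \<chi> i. fd (\<lambda>x. Z (chart_inv c x) c $ i) (snd c p) v)"
      unfolding dv_def by (rule smooth_on_vec_differentiable(2)[OF hol_onD(1)[OF h] S(2)])
    show "dv Z (\<i> *s v) = \<i> *s dv Z v"
      unfolding e by (simp add: vec_eq_iff hol_onD(2)[OF h S(2)])
    have e2: "dv (\<lambda>q. tscl \<i> (Z q)) = (\<lambda>v. \<chi> i. fd (\<lambda>x. tscl \<i> (Z (chart_inv c x)) c $ i) (snd c p) v)"
      unfolding dv_def
      by (rule smooth_on_vec_differentiable(2)[OF smooth_vf_in_chart[OF tscl_smooth[OF W hol_vf_imp_smooth[OF Z]] c(1)] S(2)])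
    show "dv (\<lambda>q. tscl \<i> (Z q)) v = \<i> *s dv Z v"
      unfolding e e2
      by (simp add: vec_eq_iff tscl_def frechet_derivative_at[OF has_derivative_mult_right[OF smooth_onD(2)[OF hol_onD(1)[OF h] S(2)]], symmetric])
  qed
  have rr: "rder (\<lambda>q. rder f q (Z q)) p V = B (V c) (Z p c) + L (dv Z (V c))"
    if "hol_sec A (tbundle A) W Z" "V \<in> tspace A p" for Z V
    unfolding B_def L_def dv_def by (rule rder_rder[OF W f hol_vf_imp_smooth[OF that(1)] p c that(2)])
  \<comment> \<open>The free factor \<open>w\<close> lets one computation serve both Wirtinger
    derivatives: \<open>w\<close> is \<open>\<i>\<close> for \<open>der01\<close> and
    \<open>- \<i>\<close> for \<open>der10\<close>.\<close>
  have half: "rder (\<lambda>q. (rder f q (Z q) + w * rder f q (tscl \<i> (Z q))) / 2) p V =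
      (B (V c) (Z p c) + L (dv Z (V c)) + w * (B (V c) (\<i> *s Z p c) + L (\<i> *s dv Z (V c)))) / 2"
    if Z: "hol_sec A (tbundle A) W Z" and V: "V \<in> tspace A p" for Z V w
  proof -
    note s1 = rder_smooth[OF W f hol_vf_imp_smooth[OF Z]]
    note s2 = rder_smooth[OF W f tscl_smooth[OF W hol_vf_imp_smooth[OF Z], of \<i>]]
    note s3 = smooth_fun_mult[OF oW smooth_fun_const s2]
    note s4 = smooth_fun_add[OF oW s1 s3]
    have "rder (\<lambda>q. (1/2) * (rder f q (Z q) + w * rder f q (tscl \<i> (Z q)))) p V =
        (1/2) * (rder (\<lambda>q. rder f q (Z q)) p V + w * rder (\<lambda>q. rder f q (tscl \<i> (Z q))) p V)"
      by (simp only: rder_mult[OF W p smooth_fun_const s4 V] rder_add[OF W p s1 s3 V]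
          rder_mult[OF W p smooth_fun_const s2 V] rder_const[OF W p V]) simp
    then show ?thesis
      unfolding rr[OF Z V] rr[OF tscl_hol[OF W Z] V] hc(2)[OF Z] by (simp add: tscl_def)
  qed
  have i2: "\<i> *s (\<i> *s v) = - v" for v :: "complex^'m" by (simp add: vec_eq_iff)
  have 1: "der10 A (\<lambda>q. der01 A f q (Y q)) p (X p) =
      (B (X p c) (Y p c) + \<i> * B (X p c) (\<i> *s Y p c) - \<i> * B (\<i> *s X p c) (Y p c) + B (\<i> *s X p c) (\<i> *s Y p c)) / 4"
    unfolding der10_rder der01_rder half[OF Y t(1)] half[OF Y tspace_scl[OF t(1)]]
    by (simp add: tscl_def hc(1)[OF Y] i2 Lm field_simps)
  have 2: "der01 A (\<lambda>q. der10 A f q (X q)) p (Y p) =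
      (B (Y p c) (X p c) - \<i> * B (Y p c) (\<i> *s X p c) + \<i> * B (\<i> *s Y p c) (X p c) + B (\<i> *s Y p c) (\<i> *s X p c)) / 4"
    unfolding der10_rder der01_rder diff_conv_add_uminus mult_minus_left[symmetric]
      half[OF X t(2)] half[OF X tspace_scl[OF t(2)]]
    by (simp add: tscl_def hc(1)[OF X] i2 Lm field_simps)
  show ?thesis unfolding 1 2 sym[of "Y p c"] sym[of "\<i> *s Y p c"] by (simp add: algebra_simps)
qed

end

section \<open>Holomorphic bundles and local frames\<close>

locale hol_bundle = complex_mfd A
  for A :: "('a::{t2_space, second_countable_topology}, 'm::finite) chart set" +
  fixes B :: "('a, 'k::ab_group_add, 'n::finite) vbundle"
  assumes hb: "holo_bundle A B"
begin

sublocale vs: vector_space "scl B"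
  using hb by (simp add: holo_bundle_def)

lemma subspace_fib: "p \<in> mfd A \<Longrightarrow> vs.subspace (fib B p)"
  using hb by (simp add: holo_bundle_def)

lemma fib_0: "p \<in> mfd A \<Longrightarrow> 0 \<in> fib B p"
  by (rule vs.subspace_0[OF subspace_fib])
lemma fib_add: "p \<in> mfd A \<Longrightarrow> a \<in> fib B p \<Longrightarrow> b \<in> fib B p \<Longrightarrow> a + b \<in> fib B p"
  by (rule vs.subspace_add[OF subspace_fib])
lemma fib_scl: "p \<in> mfd A \<Longrightarrow> a \<in> fib B p \<Longrightarrow> scl B z a \<in> fib B p"
  by (rule vs.subspace_scale[OF subspace_fib])
lemma fib_diff: "p \<in> mfd A \<Longrightarrow> a \<in> fib B p \<Longrightarrow> b \<in> fib B p \<Longrightarrow> a - b \<in> fib B p"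
  by (rule vs.subspace_diff[OF subspace_fib])
lemma fib_neg: "p \<in> mfd A \<Longrightarrow> a \<in> fib B p \<Longrightarrow> - a \<in> fib B p"
  by (rule vs.subspace_neg[OF subspace_fib])
lemma fib_sum: "p \<in> mfd A \<Longrightarrow> (\<And>i. i \<in> I \<Longrightarrow> f i \<in> fib B p) \<Longrightarrow> (\<Sum>i\<in>I. f i) \<in> fib B p"
  by (rule vs.subspace_sum[OF subspace_fib])

lemma triv_all:
  assumes "(V, \<psi>) \<in> trivs B"
  shows "open_in A V \<and> (\<forall>p\<in>V. bij_betw (\<psi> p) (fib B p) UNIV \<and>
           (\<forall>a\<in>fib B p. \<forall>b\<in>fib B p. \<psi> p (a + b) = \<psi> p a + \<psi> p b) \<and>
           (\<forall>z. \<forall>a\<in>fib B p. \<psi> p (scl B z a) = z *s \<psi> p a))"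
proof -
  from hb have "\<forall>(V, \<psi>)\<in>trivs B. open_in A V \<and> (\<forall>p\<in>V. bij_betw (\<psi> p) (fib B p) UNIV \<and>
           (\<forall>a\<in>fib B p. \<forall>b\<in>fib B p. \<psi> p (a + b) = \<psi> p a + \<psi> p b) \<and>
           (\<forall>z. \<forall>a\<in>fib B p. \<psi> p (scl B z a) = z *s \<psi> p a))"
    unfolding holo_bundle_def by (elim conjE)
  from bspec[OF this assms] show ?thesis unfolding prod.case .
qed

lemma triv_open: "(V, \<psi>) \<in> trivs B \<Longrightarrow> open_in A V"
  by (rule conjunct1[OF triv_all])

lemma triv:
  assumes "(V, \<psi>) \<in> trivs B" "p \<in> V"
  shows "p \<in> mfd A" "bij_betw (\<psi> p) (fib B p) UNIV"
    "a \<in> fib B p \<Longrightarrow> b \<in> fib B p \<Longrightarrow> \<psi> p (a + b) = \<psi> p a + \<psi> p b"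
    "a \<in> fib B p \<Longrightarrow> \<psi> p (scl B z a) = z *s \<psi> p a"
  using open_inD(3)[OF triv_open[OF assms(1)] assms(2)] bspec[OF conjunct2[OF triv_all[OF assms(1)]] assms(2)]
  by simp_all

lemma obtain_triv:
  assumes "p \<in> mfd A"
  obtains V \<psi> where "(V, \<psi>) \<in> trivs B" "p \<in> V"
proof -
  have "mfd A = (\<Union>(V, \<psi>)\<in>trivs B. V)" using hb by (simp add: holo_bundle_def)
  then show ?thesis using assms that by blast
qed

definition frm :: "('a \<Rightarrow> 'k \<Rightarrow> complex^'n) \<Rightarrow> 'n \<Rightarrow> 'a \<Rightarrow> 'k" where
  "frm \<psi> i p = inv_into (fib B p) (\<psi> p) (axis i 1)"

lemma frm:
  assumes "(V, \<psi>) \<in> trivs B" "p \<in> V"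
  shows "frm \<psi> i p \<in> fib B p" "\<psi> p (frm \<psi> i p) = axis i 1"
proof -
  have "axis i 1 \<in> \<psi> p ` fib B p" using triv(2)[OF assms] by (simp add: bij_betw_def)
  then show "frm \<psi> i p \<in> fib B p" "\<psi> p (frm \<psi> i p) = axis i 1"
    unfolding frm_def by (rule inv_into_into, rule f_inv_into_f)
qed

lemma triv_sum:
  assumes t: "(V, \<psi>) \<in> trivs B" "p \<in> V" and a: "\<And>i. i \<in> I \<Longrightarrow> a i \<in> fib B p"
  shows "\<psi> p (\<Sum>i\<in>I. a i) = (\<Sum>i\<in>I. \<psi> p (a i))"
proof -
  note m = triv(1)[OF t]
  have 0: "\<psi> p 0 = 0" using triv(3)[OF t fib_0[OF m] fib_0[OF m]] by simp
  show ?thesis using a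
  proof (induction I rule: infinite_finite_induct)
    case (insert i I)
    then show ?case using triv(3)[OF t, of "a i" "\<Sum>i\<in>I. a i"] fib_sum[OF m, of I a] by simp
  qed (simp_all add: 0)
qed

lemma triv_comb:
  assumes t: "(V, \<psi>) \<in> trivs B" "p \<in> V"
  shows "\<psi> p (\<Sum>i\<in>UNIV. scl B (x i) (frm \<psi> i p)) $ j = x j"
proof -
  have "\<psi> p (\<Sum>i\<in>UNIV. scl B (x i) (frm \<psi> i p)) = (\<Sum>i\<in>UNIV. x i *s axis i 1)"
    using triv_sum[OF t, of UNIV "\<lambda>i. scl B (x i) (frm \<psi> i p)"] fib_scl[OF triv(1)[OF t] frm(1)[OF t]]
      triv(4)[OF t frm(1)[OF t]] frm(2)[OF t] by simp
  then show ?thesis by (simp add: axis_def if_distrib cong: if_cong)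
qed

lemma triv_inj: "(V, \<psi>) \<in> trivs B \<Longrightarrow> p \<in> V \<Longrightarrow> a \<in> fib B p \<Longrightarrow> b \<in> fib B p \<Longrightarrow> \<psi> p a = \<psi> p b \<Longrightarrow> a = b"
  using triv(2) unfolding bij_betw_def inj_on_def by blast

lemma comb_in_fib:
  assumes t: "(V, \<psi>) \<in> trivs B" "p \<in> V"
  shows "(\<Sum>i\<in>I. scl B (x i) (frm \<psi> i p)) \<in> fib B p"
  by (rule fib_sum[OF triv(1)[OF t] fib_scl[OF triv(1)[OF t] frm(1)[OF t]]])

lemma frm_expand:
  assumes t: "(V, \<psi>) \<in> trivs B" "p \<in> V" and a: "a \<in> fib B p"
  shows "(\<Sum>i\<in>UNIV. scl B (\<psi> p a $ i) (frm \<psi> i p)) = a"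
  by (rule triv_inj[OF t comb_in_fib[OF t] a]) (simp add: vec_eq_iff triv_comb[OF t])

lemma hol_secI:
  assumes "\<And>p. p \<in> W \<Longrightarrow> s p \<in> fib B p" "\<And>V \<psi> i. (V, \<psi>) \<in> trivs B \<Longrightarrow> hol_fun A (W \<inter> V) (\<lambda>p. \<psi> p (s p) $ i)"
  shows "hol_sec A B W s"
  using assms unfolding hol_sec_def by blast

lemma smooth_secI:
  assumes "\<And>p. p \<in> W \<Longrightarrow> s p \<in> fib B p" "\<And>V \<psi> i. (V, \<psi>) \<in> trivs B \<Longrightarrow> smooth_fun A (W \<inter> V) (\<lambda>p. \<psi> p (s p) $ i)"
  shows "smooth_sec A B W s"
  using assms unfolding smooth_sec_def by blast

lemma hol_secD:
  assumes "hol_sec A B W s"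
  shows "p \<in> W \<Longrightarrow> s p \<in> fib B p" "(V, \<psi>) \<in> trivs B \<Longrightarrow> hol_fun A (W \<inter> V) (\<lambda>p. \<psi> p (s p) $ i)"
  using assms unfolding hol_sec_def by blast+

lemma smooth_secD:
  assumes "smooth_sec A B W s"
  shows "p \<in> W \<Longrightarrow> s p \<in> fib B p" "(V, \<psi>) \<in> trivs B \<Longrightarrow> smooth_fun A (W \<inter> V) (\<lambda>p. \<psi> p (s p) $ i)"
  using assms unfolding smooth_sec_def by blast+

lemma hol_sec_imp_smooth: "hol_sec A B W s \<Longrightarrow> smooth_sec A B W s"
  by (rule smooth_secI[OF hol_secD(1) hol_fun_imp_smooth_fun[OF hol_secD(2)]])

lemma hol_sec_subset: "hol_sec A B W s \<Longrightarrow> V \<subseteq> W \<Longrightarrow> hol_sec A B V s"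
  by (rule hol_secI, erule hol_secD(1), blast, rule hol_fun_subset[OF hol_secD(2)]) auto

lemma smooth_sec_subset: "smooth_sec A B W s \<Longrightarrow> V \<subseteq> W \<Longrightarrow> smooth_sec A B V s"
  by (rule smooth_secI, erule smooth_secD(1), blast, rule smooth_fun_subset[OF smooth_secD(2)]) auto

lemma open_triv: "open W \<Longrightarrow> (V, \<psi>) \<in> trivs B \<Longrightarrow> open (W \<inter> V)"
  by (rule open_Int[OF _ open_inD(1)[OF triv_open]])

lemma smooth_sec_cong:
  assumes "open W" "\<And>p. p \<in> W \<Longrightarrow> s p = s' p" "smooth_sec A B W s"
  shows "smooth_sec A B W s'"
proof (rule smooth_secI)
  show "s' p \<in> fib B p" if "p \<in> W" for p
    using smooth_secD(1)[OF assms(3) that] assms(2)[OF that] by simp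
  fix V \<psi> i assume t: "(V, \<psi>) \<in> trivs B"
  show "smooth_fun A (W \<inter> V) (\<lambda>p. \<psi> p (s' p) $ i)"
    by (rule smooth_fun_cong[OF open_triv[OF assms(1) t] _ smooth_secD(2)[OF assms(3) t]]) (simp add: assms(2))
qed

lemma smooth_sec_add:
  assumes W: "open_in A W" and s: "smooth_sec A B W s" and s': "smooth_sec A B W s'"
  shows "smooth_sec A B W (\<lambda>p. s p + s' p)"
proof (rule smooth_secI)
  note o = open_inD(1)[OF W]
  fix V \<psi> i assume t: "(V, \<psi>) \<in> trivs B"
  show "smooth_fun A (W \<inter> V) (\<lambda>p. \<psi> p (s p + s' p) $ i)"
    by (rule smooth_fun_cong[OF open_triv[OF o t] _
          smooth_fun_add[OF open_triv[OF o t] smooth_secD(2)[OF s t, of i] smooth_secD(2)[OF s' t, of i]]])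
      (simp add: triv(3)[OF t] smooth_secD(1)[OF s] smooth_secD(1)[OF s'])
qed (rule fib_add[OF open_inD(3)[OF W] smooth_secD(1)[OF s] smooth_secD(1)[OF s']])

lemma smooth_sec_scl:
  assumes W: "open_in A W" and f: "smooth_fun A W f" and s: "smooth_sec A B W s"
  shows "smooth_sec A B W (\<lambda>p. scl B (f p) (s p))"
proof (rule smooth_secI)
  note o = open_inD(1)[OF W]
  fix V \<psi> i assume t: "(V, \<psi>) \<in> trivs B"
  show "smooth_fun A (W \<inter> V) (\<lambda>p. \<psi> p (scl B (f p) (s p)) $ i)"
    by (rule smooth_fun_cong[OF open_triv[OF o t] _
          smooth_fun_mult[OF open_triv[OF o t] smooth_fun_subset[OF f Int_lower1] smooth_secD(2)[OF s t, of i]]])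
      (simp add: triv(4)[OF t] smooth_secD(1)[OF s])
qed (rule fib_scl[OF open_inD(3)[OF W] smooth_secD(1)[OF s]])

lemma smooth_sec_0: "open_in A W \<Longrightarrow> smooth_sec A B W (\<lambda>p. 0)"
proof (rule smooth_secI)
  fix V \<psi> i assume W: "open_in A W" and t: "(V, \<psi>) \<in> trivs B"
  have "\<psi> p 0 = 0" if "p \<in> V" for p
    using triv_sum[OF t that, of "{}"] by simp
  then show "smooth_fun A (W \<inter> V) (\<lambda>p. \<psi> p 0 $ i)"
    by (intro smooth_fun_cong[OF open_triv[OF open_inD(1)[OF W] t] _ smooth_fun_const[of _ 0]]) simp
qed (rule fib_0[OF open_inD(3)])

lemma smooth_sec_sum:
  assumes W: "open_in A W" and s: "\<And>i. i \<in> I \<Longrightarrow> smooth_sec A B W (s i)"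
  shows "smooth_sec A B W (\<lambda>p. \<Sum>i\<in>I. s i p)"
  using s by (induction I rule: infinite_finite_induct)
    (simp_all add: smooth_sec_0[OF W] smooth_sec_add[OF W])

lemma smooth_sec_diff:
  assumes W: "open_in A W" and s: "smooth_sec A B W s" and s': "smooth_sec A B W s'"
  shows "smooth_sec A B W (\<lambda>p. s p - s' p)"
  using smooth_sec_add[OF W s smooth_sec_scl[OF W smooth_fun_const[of W "-1"] s']] by simp

lemma hol_sec_comb:
  assumes W: "open_in A W" and t: "(V, \<psi>) \<in> trivs B" "W \<subseteq> V" and f: "\<And>i. hol_fun A W (f i)"
    and s: "\<And>i. hol_sec A B W (s i)"
  shows "hol_sec A B W (\<lambda>p. \<Sum>i\<in>(UNIV :: 'i::finite set). scl B (f i p) (s i p))"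
proof (rule hol_secI)
  note o = open_inD(1)[OF W]
  fix V' \<phi> j assume t': "(V', \<phi>) \<in> trivs B"
  show "hol_fun A (W \<inter> V') (\<lambda>p. \<phi> p (\<Sum>i\<in>(UNIV :: 'i set). scl B (f i p) (s i p)) $ j)"
  proof (rule hol_fun_cong[OF open_triv[OF o t']])
    show "hol_fun A (W \<inter> V') (\<lambda>p. \<Sum>i\<in>UNIV. f i p * \<phi> p (s i p) $ j)"
      by (rule hol_fun_sum[OF open_triv[OF o t'] hol_fun_mult[OF open_triv[OF o t'] hol_fun_subset[OF f Int_lower1] hol_secD(2)[OF s t']]])
    fix p assume p: "p \<in> W \<inter> V'"
    then have p': "p \<in> W" "p \<in> V'" by auto
    show "(\<Sum>i\<in>UNIV. f i p * \<phi> p (s i p) $ j) = \<phi> p (\<Sum>i\<in>(UNIV :: 'i set). scl B (f i p) (s i p)) $ j"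
      using triv_sum[OF t' p'(2), of UNIV "\<lambda>i. scl B (f i p) (s i p)"] fib_scl[OF open_inD(3)[OF W p'(1)] hol_secD(1)[OF s p'(1)]]
        triv(4)[OF t' p'(2) hol_secD(1)[OF s p'(1)]] by simp
  qed
qed (rule fib_sum[OF open_inD(3)[OF W] fib_scl[OF open_inD(3)[OF W] hol_secD(1)[OF s]]])

text \<open>The cocycle condition in \<open>holo_bundle\<close>, taken at the constant vector
  \<open>axis i 1\<close>.\<close>

lemma frm_hol: 
  assumes t: "(V, \<psi>) \<in> trivs B" shows "hol_sec A B V (frm \<psi> i)"
proof (rule hol_secI[OF frm(1)[OF t]])
  fix V' \<phi> j assume "(V', \<phi>) \<in> trivs B"
  moreover have "\<forall>(V, \<psi>)\<in>trivs B. \<forall>(W, \<phi>)\<in>trivs B. \<forall>y i.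
        hol_fun A (V \<inter> W) (\<lambda>p. \<phi> p (inv_into (fib B p) (\<psi> p) y) $ i)"
    using hb unfolding holo_bundle_def by (elim conjE)
  ultimately have "\<forall>y i. hol_fun A (V \<inter> V') (\<lambda>p. \<phi> p (inv_into (fib B p) (\<psi> p) y) $ i)"
    using bspec[OF bspec[OF _ t, of "\<lambda>(V, \<psi>). \<forall>(W, \<phi>)\<in>trivs B. \<forall>y i.
        hol_fun A (V \<inter> W) (\<lambda>p. \<phi> p (inv_into (fib B p) (\<psi> p) y) $ i)", unfolded prod.case], of "(V', \<phi>)"]
    unfolding prod.case by blast
  then show "hol_fun A (V \<inter> V') (\<lambda>p. \<phi> p (frm \<psi> i p) $ j)"
    unfolding frm_def by blast
qed

lemma frm_smooth: "(V, \<psi>) \<in> trivs B \<Longrightarrow> smooth_sec A B V (frm \<psi> i)"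
  by (rule hol_sec_imp_smooth[OF frm_hol])

text \<open>Constant coefficients in a holomorphic frame. Holomorphic extensions have vanishing
  (0,1)-derivative, which is why fibre vectors are tested against them throughout.\<close>

lemma hol_extension:
  assumes "p \<in> mfd A" "a \<in> fib B p"
  obtains W s where "open_in A W" "p \<in> W" "hol_sec A B W s" "s p = a"
proof -
  obtain V \<psi> where t: "(V, \<psi>) \<in> trivs B" "p \<in> V" by (rule obtain_triv[OF assms(1)])
  show ?thesis
    by (rule that[OF triv_open[OF t(1)] t(2) hol_sec_comb[OF triv_open[OF t(1)] t(1) order_refl hol_fun_const frm_hol[OF t(1)]]])
      (rule frm_expand[OF t assms(2)])
qed

lemma smooth_sec_local:
  assumes "\<And>p. p \<in> W \<Longrightarrow> \<exists>V. open V \<and> p \<in> V \<and> smooth_sec A B V s"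
  shows "smooth_sec A B W s"
proof (rule smooth_secI)
  show "s p \<in> fib B p" if "p \<in> W" for p using assms[OF that] smooth_secD(1) by blast
  fix V \<psi> i assume t: "(V, \<psi>) \<in> trivs B"
  show "smooth_fun A (W \<inter> V) (\<lambda>p. \<psi> p (s p) $ i)"
  proof (rule smooth_fun_local)
    fix p assume "p \<in> W \<inter> V"
    then obtain V' where V': "open V'" "p \<in> V'" "smooth_sec A B V' s" using assms by blast
    with \<open>p \<in> W \<inter> V\<close> show "\<exists>V'. open V' \<and> p \<in> V' \<and> smooth_fun A V' (\<lambda>p. \<psi> p (s p) $ i)"
      using open_triv[OF V'(1) t] smooth_secD(2)[OF V'(3) t, of i] by blast
  qed
qed

end

section \<open>Hermitian bundles\<close>

text \<open>This is instantiated twice: with \<open>K\<close> and \<open>h\<close>, and with the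
  tangent bundle and \<open>h_M\<close>.\<close>

locale herm_bundle = hol_bundle A B
  for A :: "('a::{t2_space, second_countable_topology}, 'm::finite) chart set"
    and B :: "('a, 'k::ab_group_add, 'n::finite) vbundle" +
  fixes H :: "'a \<Rightarrow> 'k \<Rightarrow> 'k \<Rightarrow> complex"
  assumes H_pos: "p \<in> mfd A \<Longrightarrow> pos_def_form (scl B) (fib B p) (H p)"
    and H_smooth: "open_in A W \<Longrightarrow> smooth_sec A B W s \<Longrightarrow> smooth_sec A B W s' \<Longrightarrow> smooth_fun A W (\<lambda>p. H p (s p) (s' p))"
begin

section \<open>Sesquilinear algebra in one fibre\<close>

context
  fixes p assumes p: "p \<in> mfd A"
begin

lemma H_add_left: "a \<in> fib B p \<Longrightarrow> b \<in> fib B p \<Longrightarrow> c \<in> fib B p \<Longrightarrow> H p (a + b) c = H p a c + H p b c"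
  and H_scl_left: "a \<in> fib B p \<Longrightarrow> b \<in> fib B p \<Longrightarrow> H p (scl B z a) b = z * H p a b"
  and H_sym: "a \<in> fib B p \<Longrightarrow> b \<in> fib B p \<Longrightarrow> H p b a = cnj (H p a b)"
  and H_Re_pos: "a \<in> fib B p \<Longrightarrow> a \<noteq> 0 \<Longrightarrow> Re (H p a a) > 0"
  using H_pos[OF p] unfolding pos_def_form_def hermitian_form_def by blast+

lemma H_add_right: "a \<in> fib B p \<Longrightarrow> b \<in> fib B p \<Longrightarrow> c \<in> fib B p \<Longrightarrow> H p c (a + b) = H p c a + H p c b"
  using H_sym[of _ c] H_sym[of "a + b" c] H_add_left[of a b c] fib_add[OF p, of a b] by simp

lemma H_scl_right: "a \<in> fib B p \<Longrightarrow> b \<in> fib B p \<Longrightarrow> H p b (scl B z a) = cnj z * H p b a"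
  using H_sym[of _ b] H_sym[of "scl B z a" b] H_scl_left[of a b z] fib_scl[OF p, of a z] by simp

lemma H_0_left: "a \<in> fib B p \<Longrightarrow> H p 0 a = 0"
  using H_scl_left[OF fib_0[OF p], of a 0] by simp

lemma H_0_right: "a \<in> fib B p \<Longrightarrow> H p a 0 = 0"
  using H_scl_right[OF fib_0[OF p], of a 0] by simp

lemma H_neg_left: "a \<in> fib B p \<Longrightarrow> b \<in> fib B p \<Longrightarrow> H p (- a) b = - H p a b"
  using H_scl_left[of a b "-1"] by simp

lemma H_neg_right: "a \<in> fib B p \<Longrightarrow> b \<in> fib B p \<Longrightarrow> H p b (- a) = - H p b a"
  using H_scl_right[of a b "-1"] by simp

lemma H_diff_left: "a \<in> fib B p \<Longrightarrow> b \<in> fib B p \<Longrightarrow> c \<in> fib B p \<Longrightarrow> H p (a - b) c = H p a c - H p b c"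
  using H_add_left[of a "- b" c] H_neg_left[of b c] fib_neg[OF p] by simp

lemma H_sum_left: "(\<And>i. i \<in> I \<Longrightarrow> f i \<in> fib B p) \<Longrightarrow> c \<in> fib B p \<Longrightarrow> H p (\<Sum>i\<in>I. f i) c = (\<Sum>i\<in>I. H p (f i) c)"
  by (induction I rule: infinite_finite_induct) (simp_all add: H_0_left H_add_left fib_sum[OF p])

lemma H_sum_right: "(\<And>i. i \<in> I \<Longrightarrow> f i \<in> fib B p) \<Longrightarrow> c \<in> fib B p \<Longrightarrow> H p c (\<Sum>i\<in>I. f i) = (\<Sum>i\<in>I. H p c (f i))"
  by (induction I rule: infinite_finite_induct) (simp_all add: H_0_right H_add_right fib_sum[OF p])

lemma H_comb_left:
  assumes "\<And>i. i \<in> I \<Longrightarrow> f i \<in> fib B p" "c \<in> fib B p"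
  shows "H p (\<Sum>i\<in>I. scl B (x i) (f i)) c = (\<Sum>i\<in>I. x i * H p (f i) c)"
  using H_sum_left[of I "\<lambda>i. scl B (x i) (f i)" c] fib_scl[OF p assms(1)] H_scl_left[OF assms] assms(2) by simp

lemma H_comb_right:
  assumes "\<And>i. i \<in> I \<Longrightarrow> f i \<in> fib B p" "c \<in> fib B p"
  shows "H p c (\<Sum>i\<in>I. scl B (x i) (f i)) = (\<Sum>i\<in>I. cnj (x i) * H p c (f i))"
  using H_sum_right[of I "\<lambda>i. scl B (x i) (f i)" c] fib_scl[OF p assms(1)] H_scl_right[OF assms] assms(2) by simp

lemma H_nondeg: "a \<in> fib B p \<Longrightarrow> (\<And>b. b \<in> fib B p \<Longrightarrow> H p a b = 0) \<Longrightarrow> a = 0"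
  using H_Re_pos[of a] by force

lemma H_self_real: "a \<in> fib B p \<Longrightarrow> Im (H p a a) = 0"
  using H_sym[of a a] by (metis Reals_cnj_iff complex_is_Real_iff)

lemma H_self_nonneg: "a \<in> fib B p \<Longrightarrow> Re (H p a a) \<ge> 0"
  using H_Re_pos[of a] H_0_left[of 0] fib_0[OF p] by (cases "a = 0") auto

text \<open>The expansion of every vector of the fibre is made part of the notion, so no dimension
  count is needed to know that \<open>b\<close> spans.\<close>

definition dual_bases :: "('i::finite \<Rightarrow> 'k) \<Rightarrow> ('i \<Rightarrow> 'k) \<Rightarrow> bool" where
  "dual_bases b b' \<longleftrightarrow> (\<forall>i. b i \<in> fib B p \<and> b' i \<in> fib B p) \<and> (\<forall>i j. H p (b i) (b' j) = (if i = j then 1 else 0)) \<and>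
    (\<forall>a\<in>fib B p. a = (\<Sum>i\<in>UNIV. scl B (H p a (b' i)) (b i)))"

end

lemma dual_basesD:
  assumes "p \<in> mfd A" "dual_bases p b b'"
  shows "b i \<in> fib B p" "b' i \<in> fib B p" "H p (b i) (b' j) = (if i = j then 1 else 0)"
    "a \<in> fib B p \<Longrightarrow> a = (\<Sum>i\<in>UNIV. scl B (H p a (b' i)) (b i))"
  using assms unfolding dual_bases_def[OF assms(1)] by blast+

text \<open>The difference of a vector and its expansion in \<open>b'\<close> is orthogonal to every
  \<open>b j\<close>. As the \<open>b j\<close> span the fibre, it is zero by
  non-degeneracy.\<close>

lemma dual_bases_sym:
  assumes p: "p \<in> mfd A" and b: "dual_bases p b b'" shows "dual_bases p b' b"
proof -
  note d = dual_basesD[OF p b]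
  have *: "H p (b' i) (b j) = (if i = j then 1 else 0)" for i j
    using H_sym[OF p d(1)[of j] d(2)[of i]] d(3)[of j i] by simp
  have "a = (\<Sum>i\<in>UNIV. scl B (H p a (b i)) (b' i))" if a: "a \<in> fib B p" for a
  proof -
    let ?c = "\<Sum>i\<in>UNIV. scl B (H p a (b i)) (b' i)"
    have c: "?c \<in> fib B p" by (rule fib_sum[OF p fib_scl[OF p d(2)]])
    have e: "H p ?c (b j) = H p a (b j)" for j
      unfolding H_comb_left[OF p d(2) d(1)] * by (simp add: if_distrib cong: if_cong)
    have "a - ?c = 0"
    proof (rule H_nondeg[OF p fib_diff[OF p a c]])
      fix v assume v: "v \<in> fib B p"
      have "H p (a - ?c) v = H p (a - ?c) (\<Sum>i\<in>UNIV. scl B (H p v (b' i)) (b i))" using d(4)[OF v] by simp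
      also have "\<dots> = 0" unfolding H_comb_right[OF p d(1) fib_diff[OF p a c]] H_diff_left[OF p a c d(1)] e by simp
      finally show "H p (a - ?c) v = 0" .
    qed
    then show ?thesis by simp
  qed
  then show ?thesis unfolding dual_bases_def[OF p] using d(1,2) * by blast
qed

section \<open>Gram matrix and dual frame\<close>

definition gram :: "('a \<Rightarrow> 'k \<Rightarrow> complex^'n) \<Rightarrow> 'a \<Rightarrow> complex^'n^'n" where
  "gram \<psi> p = (\<chi> i k. H p (frm \<psi> i p) (frm \<psi> k p))"

definition dfrm :: "('a \<Rightarrow> 'k \<Rightarrow> complex^'n) \<Rightarrow> 'n \<Rightarrow> 'a \<Rightarrow> 'k" where
  \<comment> \<open>the dual frame, by Cramer's rule\<close>
  "dfrm \<psi> j p = (\<Sum>k\<in>UNIV. scl B (cnj (det (\<chi> i l. if l = k then axis j 1 $ i else gram \<psi> p $ i $ l) / det (gram \<psi> p))) (frm \<psi> k p))"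

text \<open>A kernel vector of the Gram matrix yields a combination of the frame that is orthogonal
  to the frame, hence to itself, hence zero. Its coefficients are conjugated because
  \<open>H\<close> is conjugate linear in the second argument.\<close>

lemma gram_det:
  assumes t: "(V, \<psi>) \<in> trivs B" "p \<in> V"
  shows "det (gram \<psi> p) \<noteq> 0"
proof -
  note m = triv(1)[OF t]
  have "x = 0" if x: "gram \<psi> p *v x = 0" for x
  proof -
    let ?a = "\<Sum>k\<in>UNIV. scl B (cnj (x $ k)) (frm \<psi> k p)"
    note a = comb_in_fib[OF t, where I = UNIV and x = "\<lambda>k. cnj (x $ k)"]
    have *: "H p (frm \<psi> i p) ?a = 0" for i
      unfolding H_comb_right[OF m frm(1)[OF t] frm(1)[OF t]]
      using x by (simp add: vec_eq_iff matrix_vector_mult_def gram_def mult.commute)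
    have "H p ?a ?a = 0" by (subst H_comb_left[OF m frm(1)[OF t] a]) (simp add: *)
    then have "?a = 0" using H_Re_pos[OF m a] by force
    then have "\<psi> p ?a = 0" using triv_sum[OF t, of "{}"] by simp
    then have "cnj (x $ k) = 0" for k using triv_comb[OF t, of "\<lambda>k. cnj (x $ k)" k] by simp
    then show "x = 0" by (simp add: vec_eq_iff)
  qed
  then show ?thesis using invertible_det_nz matrix_left_invertible_ker invertible_left_inverse by blast
qed

lemma dfrm_dual:
  assumes t: "(V, \<psi>) \<in> trivs B" "p \<in> V"
  shows "dual_bases p (\<lambda>i. frm \<psi> i p) (\<lambda>i. dfrm \<psi> i p)"
proof -
  note m = triv(1)[OF t]
  have in': "dfrm \<psi> i p \<in> fib B p" for i unfolding dfrm_def by (rule comb_in_fib[OF t])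
  have d: "H p (frm \<psi> i p) (dfrm \<psi> j p) = (if i = j then 1 else 0)" for i j
  proof -
    define y where "y = (\<chi> k. det (\<chi> i l. if l = k then axis j 1 $ i else gram \<psi> p $ i $ l) / det (gram \<psi> p))"
    have "gram \<psi> p *v y = axis j 1" unfolding y_def cramer[OF gram_det[OF t]] ..
    then have "(\<Sum>k\<in>UNIV. H p (frm \<psi> i p) (frm \<psi> k p) * y $ k) = axis j 1 $ i"
      by (metis (no_types, lifting) gram_def matrix_vector_mult_def sum.cong vec_lambda_beta)
    moreover have "dfrm \<psi> j p = (\<Sum>k\<in>UNIV. scl B (cnj (y $ k)) (frm \<psi> k p))"
      by (simp add: dfrm_def y_def)
    moreover have "H p (frm \<psi> i p) (\<Sum>k\<in>UNIV. scl B (cnj (y $ k)) (frm \<psi> k p)) =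
        (\<Sum>k\<in>UNIV. cnj (cnj (y $ k)) * H p (frm \<psi> i p) (frm \<psi> k p))"
      by (rule H_comb_right[OF m frm(1)[OF t] frm(1)[OF t]])
    ultimately show ?thesis by (simp add: axis_def mult.commute)
  qed
  have "a = (\<Sum>i\<in>UNIV. scl B (H p a (dfrm \<psi> i p)) (frm \<psi> i p))" if a: "a \<in> fib B p" for a
  proof -
    have "H p a (dfrm \<psi> j p) = \<psi> p a $ j" for j
      by (subst frm_expand[OF t a, symmetric], subst H_comb_left[OF m frm(1)[OF t] in'])
        (simp add: d if_distrib cong: if_cong)
    then show ?thesis using frm_expand[OF t a] by simp
  qed
  then show ?thesis unfolding dual_bases_def[OF m] using frm(1)[OF t] in' d by blast
qed

lemma smooth_fun_prod:
  assumes "open W" "\<And>i. i \<in> I \<Longrightarrow> smooth_fun A W (f i)" shows "smooth_fun A W (\<lambda>p. \<Prod>i\<in>I. f i p)"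
  using assms(2) by (induction I rule: infinite_finite_induct)
    (simp_all add: smooth_fun_const smooth_fun_mult[OF \<open>open W\<close>])

lemma smooth_fun_det:
  fixes G :: "'a \<Rightarrow> complex^'l^'l::finite"
  assumes "open W" "\<And>i j. smooth_fun A W (\<lambda>p. G p $ i $ j)" shows "smooth_fun A W (\<lambda>p. det (G p))"
  unfolding det_def
  by (rule smooth_fun_sum[OF assms(1) smooth_fun_mult[OF assms(1) smooth_fun_const smooth_fun_prod[OF assms]]])

text \<open>Here Cramer's rule pays off: the coefficients are quotients of determinants in smooth
  functions, so smoothness follows from sums, products and inverses alone.\<close>

lemma dfrm_smooth:
  assumes t: "(V, \<psi>) \<in> trivs B" shows "smooth_sec A B V (dfrm \<psi> j)"
proof -
  note V = triv_open[OF t]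
  note o = open_inD(1)[OF V]
  have g: "smooth_fun A V (\<lambda>p. gram \<psi> p $ i $ l)" for i l
    using H_smooth[OF V frm_smooth[OF t] frm_smooth[OF t]] by (simp add: gram_def)
  have "smooth_fun A V (\<lambda>p. (\<chi> i l. if l = k then axis j 1 $ i else gram \<psi> p $ i $ l) $ i $ l)" for k i l
    by (cases "l = k") (simp_all add: smooth_fun_const g)
  then have "smooth_fun A V (\<lambda>p. cnj (det (\<chi> i l. if l = k then axis j 1 $ i else gram \<psi> p $ i $ l) / det (gram \<psi> p)))" for k
    unfolding divide_inverse
    by (intro smooth_fun_cnj[OF o] smooth_fun_mult[OF o] smooth_fun_inverse[OF o] smooth_fun_det[OF o] g gram_det[OF t])
  then show ?thesis unfolding dfrm_def
    by (intro smooth_sec_sum[OF V] smooth_sec_scl[OF V] frm_smooth[OF t])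
qed

subsection \<open>Existence of the Chern connection\<close>

text \<open>For holomorphic \<open>w\<close> the term of the metric equation with the
  (0,1)-derivative of \<open>w\<close> vanishes. What is left prescribes the pairing of the
  derivative of \<open>s\<close> with every vector of the fibre, and so determines it.\<close>

definition chern10 :: "('a \<Rightarrow> 'k) \<Rightarrow> 'a \<Rightarrow> ('a, 'm) tvec \<Rightarrow> 'k" where
  "chern10 s p X = (THE z. z \<in> fib B p \<and> (\<forall>W w. open_in A W \<and> p \<in> W \<and> hol_sec A B W w \<longrightarrow>
     H p z (w p) = der10 A (\<lambda>q. H q (s q) (w q)) p X))"

lemma chern10_formula:
  assumes W: "open_in A W" "p \<in> W" and s: "smooth_sec A B W s" and X: "X \<in> tspace A p"
    and t: "(V, \<psi>) \<in> trivs B" "p \<in> V"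
  shows "chern10 s p X = (\<Sum>i\<in>UNIV. scl B (der10 A (\<lambda>q. H q (s q) (frm \<psi> i q)) p X) (dfrm \<psi> i p))" (is "_ = ?Z")
    and "open_in A W' \<Longrightarrow> p \<in> W' \<Longrightarrow> hol_sec A B W' w \<Longrightarrow> H p (chern10 s p X) (w p) = der10 A (\<lambda>q. H q (s q) (w q)) p X"
    and "chern10 s p X \<in> fib B p"
proof -
  note m = triv(1)[OF t]
  note d = dual_basesD[OF m dual_bases_sym[OF m dfrm_dual[OF t]]]
  have Z: "?Z \<in> fib B p" by (rule fib_sum[OF m fib_scl[OF m d(1)]])
  have char: "H p ?Z (w p) = der10 A (\<lambda>q. H q (s q) (w q)) p X"
    if W': "open_in A W'" "p \<in> W'" and w: "hol_sec A B W' w" for W' w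
  proof -
    define S where "S = W \<inter> W' \<inter> V"
    have S: "open_in A S" "p \<in> S" "S \<subseteq> W" "S \<subseteq> W'" "S \<subseteq> V"
      using open_in_Int(1)[OF open_in_Int(1)[OF W(1) open_inD(1)[OF W'(1)]] open_inD(1)[OF triv_open[OF t(1)]]] W' W t
      by (auto simp: S_def)
    note oS = open_inD(1)[OF S(1)]
    have hw: "hol_fun A S (\<lambda>q. \<psi> q (w q) $ i)" for i
      by (rule hol_fun_subset[OF hol_secD(2)[OF w t(1)]]) (auto simp: S_def)
    have sH: "smooth_fun A S (\<lambda>q. H q (s q) (frm \<psi> i q))" for i
      by (rule H_smooth[OF S(1) smooth_sec_subset[OF s S(3)] smooth_sec_subset[OF frm_smooth[OF t(1)] S(5)]])
    note sc = smooth_fun_cnj[OF oS hol_fun_imp_smooth_fun[OF hw]]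
    have e: "H q (s q) (w q) = (\<Sum>i\<in>UNIV. cnj (\<psi> q (w q) $ i) * H q (s q) (frm \<psi> i q))" if q: "q \<in> S" for q
    proof -
      have t': "(V, \<psi>) \<in> trivs B" "q \<in> V" using t q S by auto
      have "H q (s q) (w q) = H q (s q) (\<Sum>i\<in>UNIV. scl B (\<psi> q (w q) $ i) (frm \<psi> i q))"
        using frm_expand[OF t' hol_secD(1)[OF w]] q S by auto
      also have "\<dots> = (\<Sum>i\<in>UNIV. cnj (\<psi> q (w q) $ i) * H q (s q) (frm \<psi> i q))"
        by (rule H_comb_right[OF triv(1)[OF t'] frm(1)[OF t'] smooth_secD(1)[OF s]]) (use q S in auto)
      finally show ?thesis .
    qed
    have "der10 A (\<lambda>q. H q (s q) (w q)) p X = der10 A (\<lambda>q. \<Sum>i\<in>UNIV. cnj (\<psi> q (w q) $ i) * H q (s q) (frm \<psi> i q)) p X"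
      by (rule der_cong(1)[OF oS S(2) m e])
    \<comment> \<open>The coefficients of \<open>w\<close> are holomorphic, so their conjugates are
      constant for the (1,0)-derivative and come out of it.\<close>
    also have "\<dots> = (\<Sum>i\<in>UNIV. cnj (\<psi> p (w p) $ i) * der10 A (\<lambda>q. H q (s q) (frm \<psi> i q)) p X)"
      unfolding der_sum(1)[OF S(1,2) smooth_fun_mult[OF oS sc sH] X]
        der_mult(1)[OF S(1,2) sc sH X] der_cnj(1)[OF S(1,2) hol_fun_imp_smooth_fun[OF hw] X] der01_hol[OF S(1,2) hw X]
      by simp
    also have "\<dots> = H p ?Z (w p)"
    proof -
      have "H p (dfrm \<psi> i p) (w p) = cnj (\<psi> p (w p) $ i)" for i
      proof -
        have "H p (dfrm \<psi> i p) (w p) = H p (dfrm \<psi> i p) (\<Sum>i\<in>UNIV. scl B (\<psi> p (w p) $ i) (frm \<psi> i p))"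
          using frm_expand[OF t hol_secD(1)[OF w W'(2)]] by simp
        also have "\<dots> = cnj (\<psi> p (w p) $ i)"
          unfolding H_comb_right[OF m d(2) d(1)] d(3) by (simp add: if_distrib cong: if_cong)
        finally show ?thesis .
      qed
      then show ?thesis unfolding H_comb_left[OF m d(1) hol_secD(1)[OF w W'(2)]] by (simp add: mult.commute)
    qed
    finally show ?thesis ..
  qed
  have u: "z = ?Z" if z: "z \<in> fib B p" "\<forall>W w. open_in A W \<and> p \<in> W \<and> hol_sec A B W w \<longrightarrow>
     H p z (w p) = der10 A (\<lambda>q. H q (s q) (w q)) p X" for z
  proof -
    have "z - ?Z = 0"
    proof (rule H_nondeg[OF m fib_diff[OF m z(1) Z]])
      fix b assume "b \<in> fib B p"
      then obtain W' w where w: "open_in A W'" "p \<in> W'" "hol_sec A B W' w" "w p = b" by (rule hol_extension[OF m])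
      have "H p z (w p) = H p ?Z (w p)" using z(2)[rule_format, of W' w] w char[OF w(1-3)] by simp
      then show "H p (z - ?Z) b = 0" using H_diff_left[OF m z(1) Z \<open>b \<in> fib B p\<close>] w(4) by simp
    qed
    then show ?thesis by simp
  qed
  show eq: "chern10 s p X = ?Z"
    unfolding chern10_def
  proof (rule the_equality)
    show "?Z \<in> fib B p \<and> (\<forall>W w. open_in A W \<and> p \<in> W \<and> hol_sec A B W w \<longrightarrow>
        H p ?Z (w p) = der10 A (\<lambda>q. H q (s q) (w q)) p X)"
      by (intro conjI allI impI Z, elim conjE, rule char)
  next
    fix z assume z: "z \<in> fib B p \<and> (\<forall>W w. open_in A W \<and> p \<in> W \<and> hol_sec A B W w \<longrightarrow>
        H p z (w p) = der10 A (\<lambda>q. H q (s q) (w q)) p X)"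
    show "z = ?Z" by (rule u[OF conjunct1[OF z] conjunct2[OF z]])
  qed
  show "open_in A W' \<Longrightarrow> p \<in> W' \<Longrightarrow> hol_sec A B W' w \<Longrightarrow> H p (chern10 s p X) (w p) = der10 A (\<lambda>q. H q (s q) (w q)) p X"
    unfolding eq by (rule char)
  show "chern10 s p X \<in> fib B p" unfolding eq by (rule Z)
qed

text \<open>The Cauchy-Riemann operator of the bundle, in a trivialisation picked by
  \<open>SOME\<close>; \<open>chern01_formula\<close> shows that the choice is immaterial.\<close>

definition chern01 :: "('a \<Rightarrow> 'k) \<Rightarrow> 'a \<Rightarrow> ('a, 'm) tvec \<Rightarrow> 'k" where
  "chern01 s p X = (let (V, \<psi>) = (SOME (V, \<psi>). (V, \<psi>) \<in> trivs B \<and> p \<in> V) in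
     \<Sum>i\<in>UNIV. scl B (der01 A (\<lambda>q. \<psi> q (s q) $ i) p X) (frm \<psi> i p))"

text \<open>Two trivialisations differ by holomorphic functions, which \<open>der01\<close>
  annihilates; it therefore acts on the coefficients of the section only.\<close>

lemma chern01_formula:
  assumes W: "open_in A W" "p \<in> W" and s: "smooth_sec A B W s" and X: "X \<in> tspace A p"
    and t: "(V, \<psi>) \<in> trivs B" "p \<in> V"
  shows "chern01 s p X = (\<Sum>i\<in>UNIV. scl B (der01 A (\<lambda>q. \<psi> q (s q) $ i) p X) (frm \<psi> i p))"
proof -
  define c where "c = (SOME (V, \<psi>). (V, \<psi>) \<in> trivs B \<and> p \<in> V)"
  obtain V' \<phi> where c: "c = (V', \<phi>)" by (cases c) auto
  have t': "(V', \<phi>) \<in> trivs B" "p \<in> V'"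
    using someI[of "\<lambda>(V, \<psi>). (V, \<psi>) \<in> trivs B \<and> p \<in> V" "(V, \<psi>)"] t c unfolding c_def[symmetric] by auto
  note m = triv(1)[OF t]
  define S where "S = W \<inter> V \<inter> V'"
  have S: "open_in A S" "p \<in> S" "S \<subseteq> W" "S \<subseteq> V" "S \<subseteq> V'"
    using open_in_Int(1)[OF open_in_Int(1)[OF W(1) open_inD(1)[OF triv_open[OF t(1)]]] open_inD(1)[OF triv_open[OF t'(1)]]] W t t'
    by (auto simp: S_def)
  note oS = open_inD(1)[OF S(1)]
  have h: "hol_fun A S (\<lambda>q. \<phi> q (frm \<psi> i q) $ k)" for i k
    by (rule hol_fun_subset[OF hol_secD(2)[OF frm_hol[OF t(1)] t'(1)]]) (auto simp: S_def)
  have sm: "smooth_fun A S (\<lambda>q. \<psi> q (s q) $ i)" for i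
    by (rule smooth_fun_subset[OF smooth_secD(2)[OF s t(1)]]) (auto simp: S_def)
  have e: "\<phi> q (s q) $ k = (\<Sum>i\<in>UNIV. \<psi> q (s q) $ i * \<phi> q (frm \<psi> i q) $ k)" if q: "q \<in> S" for q k
  proof -
    have tq: "q \<in> V" "q \<in> V'" "q \<in> W" using q S by auto
    have "\<phi> q (s q) = \<phi> q (\<Sum>i\<in>UNIV. scl B (\<psi> q (s q) $ i) (frm \<psi> i q))"
      using frm_expand[OF t(1) tq(1) smooth_secD(1)[OF s tq(3)]] by simp
    also have "\<dots> = (\<Sum>i\<in>UNIV. \<psi> q (s q) $ i *s \<phi> q (frm \<psi> i q))"
      using triv_sum[OF t'(1) tq(2), of UNIV "\<lambda>i. scl B (\<psi> q (s q) $ i) (frm \<psi> i q)"]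
        fib_scl[OF triv(1)[OF t(1) tq(1)] frm(1)[OF t(1) tq(1)]] triv(4)[OF t'(1) tq(2) frm(1)[OF t(1) tq(1)]] by simp
    finally show ?thesis by simp
  qed
  have d1: "der01 A (\<lambda>q. \<phi> q (s q) $ k) p X = der01 A (\<lambda>q. \<Sum>i\<in>UNIV. \<psi> q (s q) $ i * \<phi> q (frm \<psi> i q) $ k) p X" for k
    by (rule der_cong(2)[OF oS S(2) m e])
  have "der01 A (\<lambda>q. \<phi> q (s q) $ k) p X = (\<Sum>i\<in>UNIV. der01 A (\<lambda>q. \<psi> q (s q) $ i) p X * \<phi> p (frm \<psi> i p) $ k)" for k
    unfolding d1
      der_sum(2)[OF S(1,2) smooth_fun_mult[OF oS sm hol_fun_imp_smooth_fun[OF h]] X]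
      der_mult(2)[OF S(1,2) sm hol_fun_imp_smooth_fun[OF h] X] der01_hol[OF S(1,2) h X]
    by simp
  then have "chern01 s p X = (\<Sum>k\<in>UNIV. \<Sum>i\<in>UNIV. scl B (der01 A (\<lambda>q. \<psi> q (s q) $ i) p X * \<phi> p (frm \<psi> i p) $ k) (frm \<phi> k p))"
    unfolding chern01_def c_def[symmetric] c by (simp add: vs.scale_sum_left)
  also have "\<dots> = (\<Sum>i\<in>UNIV. scl B (der01 A (\<lambda>q. \<psi> q (s q) $ i) p X) (\<Sum>k\<in>UNIV. scl B (\<phi> p (frm \<psi> i p) $ k) (frm \<phi> k p)))"
    by (subst sum.swap) (simp add: vs.scale_sum_right)
  finally show ?thesis by (simp add: frm_expand[OF t' frm(1)[OF t]])
qed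

lemma chern01_in: 
  assumes "p \<in> mfd A" shows "chern01 s p X \<in> fib B p"
proof -
  obtain V \<psi> where t: "(V, \<psi>) \<in> trivs B" "p \<in> V" by (rule obtain_triv[OF assms])
  define c where "c = (SOME (V, \<psi>). (V, \<psi>) \<in> trivs B \<and> p \<in> V)"
  obtain V' \<phi> where c: "c = (V', \<phi>)" by (cases c) auto
  have t': "(V', \<phi>) \<in> trivs B" "p \<in> V'"
    using someI[of "\<lambda>(V, \<psi>). (V, \<psi>) \<in> trivs B \<and> p \<in> V" "(V, \<psi>)"] t c unfolding c_def[symmetric] by auto
  show ?thesis unfolding chern01_def c_def[symmetric] c by (simp add: comb_in_fib[OF t'])
qed

definition chern :: "('a, ('a, 'm) tvec, 'k) conn" where
  "chern = \<lparr>d10 = chern10, d01 = chern01\<rparr>"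

lemma chern10_smooth:
  assumes W: "open_in A W" and s: "smooth_sec A B W s" and X: "smooth_sec A (tbundle A) W X"
  shows "smooth_sec A B W (\<lambda>p. chern10 s p (X p))" "smooth_sec A B W (\<lambda>p. chern01 s p (X p))"
proof -
  have X': "X p \<in> tspace A p" if "p \<in> W" for p using X that by (auto simp: smooth_vf_iff)
  have "\<exists>S. open S \<and> p \<in> S \<and> smooth_sec A B S (\<lambda>p. chern10 s p (X p)) \<and> smooth_sec A B S (\<lambda>p. chern01 s p (X p))"
    if p: "p \<in> W" for p
  proof -
    obtain V \<psi> where t: "(V, \<psi>) \<in> trivs B" "p \<in> V" by (rule obtain_triv[OF open_inD(3)[OF W p]])
    define S where "S = W \<inter> V"
    have S: "open_in A S" "p \<in> S" "S \<subseteq> W" "S \<subseteq> V"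
      using open_in_Int(1)[OF W open_inD(1)[OF triv_open[OF t(1)]]] p t by (auto simp: S_def)
    note oS = open_inD(1)[OF S(1)]
    have XS: "smooth_sec A (tbundle A) S X"
      using X S(3) smooth_fun_subset[of "W \<inter> fst _" _ "S \<inter> fst _"] unfolding smooth_vf_iff by blast
    note f = frm_smooth[OF t(1)] dfrm_smooth[OF t(1)]
    note sS = smooth_sec_subset[OF s S(3)]
    have "smooth_sec A B S (\<lambda>p. \<Sum>i\<in>UNIV. scl B (der10 A (\<lambda>q. H q (s q) (frm \<psi> i q)) p (X p)) (dfrm \<psi> i p))"
      by (intro smooth_sec_sum[OF S(1)] smooth_sec_scl[OF S(1)] der_smooth(1)[OF S(1) _ XS]
          H_smooth[OF S(1)] sS smooth_sec_subset[OF f(1) S(4)] smooth_sec_subset[OF f(2) S(4)])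
    then have 1: "smooth_sec A B S (\<lambda>p. chern10 s p (X p))"
      by (rule smooth_sec_cong[OF oS chern10_formula(1)[OF W _ s X' t(1), symmetric], rotated -1]) (use S in auto)
    have "smooth_fun A S (\<lambda>p. \<psi> p (s p) $ i)" for i
      using smooth_secD(2)[OF s t(1)] by (simp add: S_def)
    then have "smooth_sec A B S (\<lambda>p. \<Sum>i\<in>UNIV. scl B (der01 A (\<lambda>q. \<psi> q (s q) $ i) p (X p)) (frm \<psi> i p))"
      by (intro smooth_sec_sum[OF S(1)] smooth_sec_scl[OF S(1)] der_smooth(2)[OF S(1) _ XS]
          smooth_sec_subset[OF f(1) S(4)])
    then have 2: "smooth_sec A B S (\<lambda>p. chern01 s p (X p))"
      by (rule smooth_sec_cong[OF oS chern01_formula[OF W _ s X' t(1), symmetric], rotated -1]) (use S in auto)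
    show ?thesis using 1 2 oS S(2) by blast
  qed
  then show "smooth_sec A B W (\<lambda>p. chern10 s p (X p))" "smooth_sec A B W (\<lambda>p. chern01 s p (X p))"
    by (intro smooth_sec_local; blast)+
qed

lemma chern_metric:
  assumes W: "open_in A W" "p \<in> W" and s: "smooth_sec A B W s" and s': "smooth_sec A B W s'" and X: "X \<in> tspace A p"
  shows "der10 A (\<lambda>q. H q (s q) (s' q)) p X = H p (chern10 s p X) (s' p) + H p (s p) (chern01 s' p X)"
proof -
  obtain V \<psi> where t: "(V, \<psi>) \<in> trivs B" "p \<in> V" by (rule obtain_triv[OF open_inD(3)[OF W]])
  note m = triv(1)[OF t]
  define S where "S = W \<inter> V"
  have S: "open_in A S" "p \<in> S" "S \<subseteq> W" "S \<subseteq> V"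
    using open_in_Int(1)[OF W(1) open_inD(1)[OF triv_open[OF t(1)]]] W t by (auto simp: S_def)
  note oS = open_inD(1)[OF S(1)]
  have c: "smooth_fun A S (\<lambda>q. \<psi> q (s' q) $ i)" for i
    using smooth_secD(2)[OF s' t(1)] by (simp add: S_def)
  have sH: "smooth_fun A S (\<lambda>q. H q (s q) (frm \<psi> i q))" for i
    by (rule H_smooth[OF S(1) smooth_sec_subset[OF s S(3)] smooth_sec_subset[OF frm_smooth[OF t(1)] S(4)]])
  have e: "H q (s q) (s' q) = (\<Sum>i\<in>UNIV. cnj (\<psi> q (s' q) $ i) * H q (s q) (frm \<psi> i q))" if q: "q \<in> S" for q
  proof -
    have t': "(V, \<psi>) \<in> trivs B" "q \<in> V" "q \<in> W" using t q S by auto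
    have "H q (s q) (s' q) = H q (s q) (\<Sum>i\<in>UNIV. scl B (\<psi> q (s' q) $ i) (frm \<psi> i q))"
      using frm_expand[OF t'(1,2) smooth_secD(1)[OF s' t'(3)]] by simp
    also have "\<dots> = (\<Sum>i\<in>UNIV. cnj (\<psi> q (s' q) $ i) * H q (s q) (frm \<psi> i q))"
      by (rule H_comb_right[OF triv(1)[OF t'(1,2)] frm(1)[OF t'(1,2)] smooth_secD(1)[OF s t'(3)]])
    finally show ?thesis .
  qed
  have "der10 A (\<lambda>q. H q (s q) (s' q)) p X = der10 A (\<lambda>q. \<Sum>i\<in>UNIV. cnj (\<psi> q (s' q) $ i) * H q (s q) (frm \<psi> i q)) p X"
    by (rule der_cong(1)[OF oS S(2) m e])
  also have "\<dots> = (\<Sum>i\<in>UNIV. cnj (der01 A (\<lambda>q. \<psi> q (s' q) $ i) p X) * H p (s p) (frm \<psi> i p)) +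
      (\<Sum>i\<in>UNIV. cnj (\<psi> p (s' p) $ i) * der10 A (\<lambda>q. H q (s q) (frm \<psi> i q)) p X)"
    unfolding der_sum(1)[OF S(1,2) smooth_fun_mult[OF oS smooth_fun_cnj[OF oS c] sH] X]
      der_mult(1)[OF S(1,2) smooth_fun_cnj[OF oS c] sH X] der_cnj(1)[OF S(1,2) c X]
    by (simp add: sum.distrib)
  also have "(\<Sum>i\<in>UNIV. cnj (der01 A (\<lambda>q. \<psi> q (s' q) $ i) p X) * H p (s p) (frm \<psi> i p)) = H p (s p) (chern01 s' p X)"
    unfolding chern01_formula[OF W s' X t] by (rule H_comb_right[OF m frm(1)[OF t] smooth_secD(1)[OF s W(2)], symmetric])
  also have "(\<Sum>i\<in>UNIV. cnj (\<psi> p (s' p) $ i) * der10 A (\<lambda>q. H q (s q) (frm \<psi> i q)) p X) = H p (chern10 s p X) (s' p)"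
  proof -
    have "H p (chern10 s p X) (s' p) = H p (chern10 s p X) (\<Sum>i\<in>UNIV. scl B (\<psi> p (s' p) $ i) (frm \<psi> i p))"
      using frm_expand[OF t smooth_secD(1)[OF s' W(2)]] by simp
    also have "\<dots> = (\<Sum>i\<in>UNIV. cnj (\<psi> p (s' p) $ i) * H p (chern10 s p X) (frm \<psi> i p))"
      by (rule H_comb_right[OF m frm(1)[OF t] chern10_formula(3)[OF W s X t]])
    also have "\<dots> = (\<Sum>i\<in>UNIV. cnj (\<psi> p (s' p) $ i) * der10 A (\<lambda>q. H q (s q) (frm \<psi> i q)) p X)"
      using chern10_formula(2)[OF W s X t triv_open[OF t(1)] t(2) frm_hol[OF t(1)]] by simp
    finally show ?thesis ..
  qed
  finally show ?thesis by (simp add: add.commute)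
qed

text \<open>\<open>R_M\<close> takes some Chern connection of \<open>h_M\<close>. Only this
  existence result gives that choice its defining properties.\<close>

lemma chern_connection_chern: "chern_connection A B H chern"
  unfolding chern_connection_def connection_def chern_def conn.select_convs
proof (intro conjI allI impI ballI; elim conjE)
  fix W s X assume W: "open_in A W" and s: "smooth_sec A B W s" and X: "smooth_sec A (tbundle A) W X"
  show "smooth_sec A B W (\<lambda>p. chern10 s p (X p))" "smooth_sec A B W (\<lambda>p. chern01 s p (X p))"
    by (rule chern10_smooth[OF W s X])+
next
  fix W s p X Y assume W: "open_in A W" and s: "smooth_sec A B W s" and p: "p \<in> W" and X: "X \<in> tspace A p" and Y: "Y \<in> tspace A p"
  obtain V \<psi> where t: "(V, \<psi>) \<in> trivs B" "p \<in> V" by (rule obtain_triv[OF open_inD(3)[OF W p]])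
  have S: "open_in A (W \<inter> V)" "p \<in> W \<inter> V" using open_in_Int(1)[OF W open_inD(1)[OF triv_open[OF t(1)]]] p t by auto
  have f: "smooth_fun A (W \<inter> V) (\<lambda>q. H q (s q) (frm \<psi> i q))" "smooth_fun A (W \<inter> V) (\<lambda>q. \<psi> q (s q) $ i)" for i
    by (rule H_smooth[OF S(1) smooth_sec_subset[OF s Int_lower1] smooth_sec_subset[OF frm_smooth[OF t(1)] Int_lower2]])
      (rule smooth_secD(2)[OF s t(1)])
  show "chern10 s p (X + Y) = chern10 s p X + chern10 s p Y"
    unfolding chern10_formula(1)[OF W p s X t] chern10_formula(1)[OF W p s Y t] chern10_formula(1)[OF W p s tspace_add[OF X Y] t]
      der_vec_add(1)[OF S f(1) X Y] vs.scale_left_distrib by (rule sum.distrib)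
  show "chern01 s p (X + Y) = chern01 s p X + chern01 s p Y"
    unfolding chern01_formula[OF W p s X t] chern01_formula[OF W p s Y t] chern01_formula[OF W p s tspace_add[OF X Y] t]
      der_vec_add(2)[OF S f(2) X Y] vs.scale_left_distrib by (rule sum.distrib)
next
  fix W s p X z assume W: "open_in A W" and s: "smooth_sec A B W s" and p: "p \<in> W" and X: "X \<in> tspace A p"
  obtain V \<psi> where t: "(V, \<psi>) \<in> trivs B" "p \<in> V" by (rule obtain_triv[OF open_inD(3)[OF W p]])
  have S: "open_in A (W \<inter> V)" "p \<in> W \<inter> V" using open_in_Int(1)[OF W open_inD(1)[OF triv_open[OF t(1)]]] p t by auto
  have f: "smooth_fun A (W \<inter> V) (\<lambda>q. H q (s q) (frm \<psi> i q))" "smooth_fun A (W \<inter> V) (\<lambda>q. \<psi> q (s q) $ i)" for i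
    by (rule H_smooth[OF S(1) smooth_sec_subset[OF s Int_lower1] smooth_sec_subset[OF frm_smooth[OF t(1)] Int_lower2]])
      (rule smooth_secD(2)[OF s t(1)])
  show "chern10 s p (tscl z X) = scl B z (chern10 s p X)"
    unfolding chern10_formula(1)[OF W p s X t] chern10_formula(1)[OF W p s tspace_scl[OF X] t]
      der_vec_scl(1)[OF S f(1) X] by (simp add: vs.scale_sum_right)
  show "chern01 s p (tscl z X) = scl B (cnj z) (chern01 s p X)"
    unfolding chern01_formula[OF W p s X t] chern01_formula[OF W p s tspace_scl[OF X] t]
      der_vec_scl(2)[OF S f(2) X] by (simp add: vs.scale_sum_right)
next
  fix W s s' p X assume W: "open_in A W" and s: "smooth_sec A B W s" and s': "smooth_sec A B W s'" and p: "p \<in> W" and X: "X \<in> tspace A p"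
  obtain V \<psi> where t: "(V, \<psi>) \<in> trivs B" "p \<in> V" by (rule obtain_triv[OF open_inD(3)[OF W p]])
  have S: "open_in A (W \<inter> V)" "p \<in> W \<inter> V" using open_in_Int(1)[OF W open_inD(1)[OF triv_open[OF t(1)]]] p t by auto
  note f = H_smooth[OF S(1) smooth_sec_subset[OF _ Int_lower1] smooth_sec_subset[OF frm_smooth[OF t(1)] Int_lower2]]
  have *: "der10 A (\<lambda>q. H q (s q + s' q) (frm \<psi> i q)) p X = der10 A (\<lambda>q. H q (s q) (frm \<psi> i q) + H q (s' q) (frm \<psi> i q)) p X" for i
    by (rule der_cong(1)[OF open_inD(1)[OF S(1)] S(2) open_inD(3)[OF W p]])
      (simp add: H_add_left triv(1)[OF t(1)] smooth_secD(1)[OF s] smooth_secD(1)[OF s'] frm(1)[OF t(1)])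
  show "chern10 (\<lambda>q. s q + s' q) p X = chern10 s p X + chern10 s' p X"
    unfolding chern10_formula(1)[OF W p s X t] chern10_formula(1)[OF W p s' X t] chern10_formula(1)[OF W p smooth_sec_add[OF W s s'] X t]
      * der_add(1)[OF S f[OF s] f[OF s'] X] vs.scale_left_distrib by (rule sum.distrib)
  have *: "der01 A (\<lambda>q. \<psi> q (s q + s' q) $ i) p X = der01 A (\<lambda>q. \<psi> q (s q) $ i + \<psi> q (s' q) $ i) p X" for i
    by (rule der_cong(2)[OF open_inD(1)[OF S(1)] S(2) open_inD(3)[OF W p]])
      (simp add: triv(3)[OF t(1)] smooth_secD(1)[OF s] smooth_secD(1)[OF s'])
  show "chern01 (\<lambda>q. s q + s' q) p X = chern01 s p X + chern01 s' p X"
    unfolding chern01_formula[OF W p s X t] chern01_formula[OF W p s' X t] chern01_formula[OF W p smooth_sec_add[OF W s s'] X t]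
      * der_add(2)[OF S smooth_secD(2)[OF s t(1)] smooth_secD(2)[OF s' t(1)] X] vs.scale_left_distrib by (rule sum.distrib)
next
  fix W s s' p X assume W: "open_in A W" and s: "smooth_sec A B W s" and e: "\<forall>q\<in>W. s' q = s q" and p: "p \<in> W" and X: "X \<in> tspace A p"
  have s': "smooth_sec A B W s'" by (rule smooth_sec_cong[OF open_inD(1)[OF W] _ s]) (simp add: e)
  obtain V \<psi> where t: "(V, \<psi>) \<in> trivs B" "p \<in> V" by (rule obtain_triv[OF open_inD(3)[OF W p]])
  have c: "der10 A (\<lambda>q. H q (s' q) (frm \<psi> i q)) p X = der10 A (\<lambda>q. H q (s q) (frm \<psi> i q)) p X"
    "der01 A (\<lambda>q. \<psi> q (s' q) $ i) p X = der01 A (\<lambda>q. \<psi> q (s q) $ i) p X" for i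
    by (rule der_cong[OF open_inD(1)[OF W] p open_inD(3)[OF W p]], simp add: e)+
  show "chern10 s' p X = chern10 s p X"
    unfolding chern10_formula(1)[OF W p s X t] chern10_formula(1)[OF W p s' X t] c ..
  show "chern01 s' p X = chern01 s p X"
    unfolding chern01_formula[OF W p s X t] chern01_formula[OF W p s' X t] c ..
next
  fix W s f p X assume W: "open_in A W" and s: "smooth_sec A B W s" and f: "smooth_fun A W f" and p: "p \<in> W" and X: "X \<in> tspace A p"
  obtain V \<psi> where t: "(V, \<psi>) \<in> trivs B" "p \<in> V" by (rule obtain_triv[OF open_inD(3)[OF W p]])
  note m = triv(1)[OF t]
  note d = dual_basesD[OF m dual_bases_sym[OF m dfrm_dual[OF t]]]
  have S: "open_in A (W \<inter> V)" "p \<in> W \<inter> V" using open_in_Int(1)[OF W open_inD(1)[OF triv_open[OF t(1)]]] p t by auto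
  note sH = H_smooth[OF S(1) smooth_sec_subset[OF s Int_lower1] smooth_sec_subset[OF frm_smooth[OF t(1)] Int_lower2]]
  note fS = smooth_fun_subset[OF f Int_lower1]
  have *: "der10 A (\<lambda>q. H q (scl B (f q) (s q)) (frm \<psi> i q)) p X = der10 A (\<lambda>q. f q * H q (s q) (frm \<psi> i q)) p X" for i
    by (rule der_cong(1)[OF open_inD(1)[OF S(1)] S(2) open_inD(3)[OF W p]])
      (simp add: H_scl_left triv(1)[OF t(1)] smooth_secD(1)[OF s] frm(1)[OF t(1)])
  have "chern10 (\<lambda>q. scl B (f q) (s q)) p X = scl B (der10 A f p X) (\<Sum>i\<in>UNIV. scl B (H p (s p) (frm \<psi> i p)) (dfrm \<psi> i p)) + scl B (f p) (chern10 s p X)"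
    unfolding chern10_formula(1)[OF W p s X t] chern10_formula(1)[OF W p smooth_sec_scl[OF W f s] X t]
      * der_mult(1)[OF S fS sH X] vs.scale_left_distrib by (simp add: sum.distrib vs.scale_sum_right)
  then show "chern10 (\<lambda>q. scl B (f q) (s q)) p X = scl B (der10 A f p X) (s p) + scl B (f p) (chern10 s p X)"
    using d(4)[OF smooth_secD(1)[OF s p]] by simp
  have *: "der01 A (\<lambda>q. \<psi> q (scl B (f q) (s q)) $ i) p X = der01 A (\<lambda>q. f q * \<psi> q (s q) $ i) p X" for i
    by (rule der_cong(2)[OF open_inD(1)[OF S(1)] S(2) open_inD(3)[OF W p]])
      (simp add: triv(4)[OF t(1)] smooth_secD(1)[OF s])
  have "chern01 (\<lambda>q. scl B (f q) (s q)) p X = scl B (der01 A f p X) (\<Sum>i\<in>UNIV. scl B (\<psi> p (s p) $ i) (frm \<psi> i p)) + scl B (f p) (chern01 s p X)"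
    unfolding chern01_formula[OF W p s X t] chern01_formula[OF W p smooth_sec_scl[OF W f s] X t]
      * der_mult(2)[OF S fS smooth_secD(2)[OF s t(1)] X] vs.scale_left_distrib by (simp add: sum.distrib vs.scale_sum_right)
  then show "chern01 (\<lambda>q. scl B (f q) (s q)) p X = scl B (der01 A f p X) (s p) + scl B (f p) (chern01 s p X)"
    unfolding frm_expand[OF t smooth_secD(1)[OF s p]] .
next
  fix W s s' p X assume W: "open_in A W" and s: "smooth_sec A B W s" and s': "smooth_sec A B W s'" and p: "p \<in> W" and X: "X \<in> tspace A p"
  show "der10 A (\<lambda>q. H q (s q) (s' q)) p X = H p (chern10 s p X) (s' p) + H p (s p) (chern01 s' p X)"
    by (rule chern_metric[OF W p s s' X])
  obtain V \<psi> where t: "(V, \<psi>) \<in> trivs B" "p \<in> V" by (rule obtain_triv[OF open_inD(3)[OF W p]])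
  note m = triv(1)[OF t]
  \<comment> \<open>The second metric equation is the conjugate of the first with the two sections
    exchanged.\<close>
  have "der01 A (\<lambda>q. H q (s q) (s' q)) p X = der01 A (\<lambda>q. cnj (H q (s' q) (s q))) p X"
    by (rule der_cong(2)[OF open_inD(1)[OF W] p m])
      (rule H_sym[OF open_inD(3)[OF W] smooth_secD(1)[OF s'] smooth_secD(1)[OF s]])
  also have "\<dots> = cnj (H p (chern10 s' p X) (s p)) + cnj (H p (s' p) (chern01 s p X))"
    unfolding der_cnj(2)[OF W p H_smooth[OF W s' s] X] chern_metric[OF W p s' s X] by simp
  also have "\<dots> = H p (s p) (chern10 s' p X) + H p (chern01 s p X) (s' p)"
    using H_sym[OF m chern10_formula(3)[OF W p s' X t] smooth_secD(1)[OF s p]]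
      H_sym[OF m smooth_secD(1)[OF s' p] chern01_in[OF m]] by simp
  finally show "der01 A (\<lambda>q. H q (s q) (s' q)) p X = H p (chern01 s p X) (s' p) + H p (s p) (chern10 s' p X)"
    by simp
next
  fix W s p X assume W: "open_in A W" and s: "hol_sec A B W s" and p: "p \<in> W" and X: "X \<in> tspace A p"
  obtain V \<psi> where t: "(V, \<psi>) \<in> trivs B" "p \<in> V" by (rule obtain_triv[OF open_inD(3)[OF W p]])
  have S: "open_in A (W \<inter> V)" "p \<in> W \<inter> V" using open_in_Int(1)[OF W open_inD(1)[OF triv_open[OF t(1)]]] p t by auto
  show "chern01 s p X = 0"
    unfolding chern01_formula[OF W p hol_sec_imp_smooth[OF s] X t] der01_hol[OF S hol_secD(2)[OF s t(1)] X] by simp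
qed

end

section \<open>Curvature of Chern connections\<close>

locale chern_bundle = herm_bundle A B H
  for A :: "('a::{t2_space, second_countable_topology}, 'm::finite) chart set"
    and B :: "('a, 'k::ab_group_add, 'n::finite) vbundle"
    and H :: "'a \<Rightarrow> 'k \<Rightarrow> 'k \<Rightarrow> complex" +
  fixes D :: "('a, ('a, 'm) tvec, 'k) conn"
  assumes chern_D: "chern_connection A B H D"
begin

lemma conn_D: "connection A B D"
  using chern_D by (simp add: chern_connection_def)

lemma conn_all:
  assumes "open_in A W" "smooth_sec A B W s"
  shows "(\<forall>X. smooth_sec A (tbundle A) W X \<longrightarrow>
        smooth_sec A B W (\<lambda>p. d10 D s p (X p)) \<and> smooth_sec A B W (\<lambda>p. d01 D s p (X p)))"
    "(\<forall>p\<in>W. \<forall>X\<in>tspace A p. \<forall>Y\<in>tspace A p.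
        d10 D s p (X + Y) = d10 D s p X + d10 D s p Y \<and>
        d01 D s p (X + Y) = d01 D s p X + d01 D s p Y)"
    "(\<forall>p\<in>W. \<forall>X\<in>tspace A p. \<forall>z.
        d10 D s p (tscl z X) = scl B z (d10 D s p X) \<and>
        d01 D s p (tscl z X) = scl B (cnj z) (d01 D s p X))"
    "(\<forall>s'. smooth_sec A B W s' \<longrightarrow> (\<forall>p\<in>W. \<forall>X\<in>tspace A p.
        d10 D (\<lambda>q. s q + s' q) p X = d10 D s p X + d10 D s' p X \<and>
        d01 D (\<lambda>q. s q + s' q) p X = d01 D s p X + d01 D s' p X))"
    "(\<forall>s'. (\<forall>q\<in>W. s' q = s q) \<longrightarrow> (\<forall>p\<in>W. \<forall>X\<in>tspace A p.
        d10 D s' p X = d10 D s p X \<and> d01 D s' p X = d01 D s p X))"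
    "(\<forall>f. smooth_fun A W f \<longrightarrow> (\<forall>p\<in>W. \<forall>X\<in>tspace A p.
        d10 D (\<lambda>q. scl B (f q) (s q)) p X = scl B (der10 A f p X) (s p) + scl B (f p) (d10 D s p X) \<and>
        d01 D (\<lambda>q. scl B (f q) (s q)) p X = scl B (der01 A f p X) (s p) + scl B (f p) (d01 D s p X)))"
  by (rule conn_D[unfolded connection_def, THEN spec, THEN spec, THEN mp, OF conjI[OF assms], THEN conjunct1]
    conn_D[unfolded connection_def, THEN spec, THEN spec, THEN mp, OF conjI[OF assms], THEN conjunct2, THEN conjunct1]
    conn_D[unfolded connection_def, THEN spec, THEN spec, THEN mp, OF conjI[OF assms], THEN conjunct2, THEN conjunct2,
      THEN conjunct1]
    conn_D[unfolded connection_def, THEN spec, THEN spec, THEN mp, OF conjI[OF assms], THEN conjunct2, THEN conjunct2,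
      THEN conjunct2, THEN conjunct1]
    conn_D[unfolded connection_def, THEN spec, THEN spec, THEN mp, OF conjI[OF assms], THEN conjunct2, THEN conjunct2,
      THEN conjunct2, THEN conjunct2, THEN conjunct1]
    conn_D[unfolded connection_def, THEN spec, THEN spec, THEN mp, OF conjI[OF assms], THEN conjunct2, THEN conjunct2,
      THEN conjunct2, THEN conjunct2, THEN conjunct2])+

context
  fixes W s assumes W: "open_in A W" and s: "smooth_sec A B W s"
begin

lemma D_smooth:
  assumes "smooth_sec A (tbundle A) W X"
  shows "smooth_sec A B W (\<lambda>p. d10 D s p (X p))" "smooth_sec A B W (\<lambda>p. d01 D s p (X p))"
  using conn_all(1)[OF W s] assms by blast+

lemma D_add:
  assumes "smooth_sec A B W s'" "p \<in> W" "X \<in> tspace A p"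
  shows "d10 D (\<lambda>q. s q + s' q) p X = d10 D s p X + d10 D s' p X"
    "d01 D (\<lambda>q. s q + s' q) p X = d01 D s p X + d01 D s' p X"
  using conn_all(4)[OF W s] assms by blast+

lemma D_cong:
  assumes "\<And>q. q \<in> W \<Longrightarrow> s' q = s q" "p \<in> W" "X \<in> tspace A p"
  shows "d10 D s' p X = d10 D s p X" "d01 D s' p X = d01 D s p X"
  using conn_all(5)[OF W s] assms by blast+

lemma D_leibniz:
  assumes "smooth_fun A W f" "p \<in> W" "X \<in> tspace A p"
  shows "d10 D (\<lambda>q. scl B (f q) (s q)) p X = scl B (der10 A f p X) (s p) + scl B (f p) (d10 D s p X)"
    "d01 D (\<lambda>q. scl B (f q) (s q)) p X = scl B (der01 A f p X) (s p) + scl B (f p) (d01 D s p X)"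
  using conn_all(6)[OF W s, rule_format, OF assms] by blast+

lemma D_metric:
  assumes "smooth_sec A B W s'" "p \<in> W" "X \<in> tspace A p"
  shows "der10 A (\<lambda>q. H q (s q) (s' q)) p X = H p (d10 D s p X) (s' p) + H p (s p) (d01 D s' p X)"
    "der01 A (\<lambda>q. H q (s q) (s' q)) p X = H p (d01 D s p X) (s' p) + H p (s p) (d10 D s' p X)"
proof -
  have "\<forall>W s s'. open_in A W \<and> smooth_sec A B W s \<and> smooth_sec A B W s' \<longrightarrow>
        (\<forall>p\<in>W. \<forall>X\<in>tspace A p.
           der10 A (\<lambda>q. H q (s q) (s' q)) p X = H p (d10 D s p X) (s' p) + H p (s p) (d01 D s' p X) \<and>
           der01 A (\<lambda>q. H q (s q) (s' q)) p X = H p (d01 D s p X) (s' p) + H p (s p) (d10 D s' p X))"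
    using chern_D unfolding chern_connection_def by (elim conjE)
  from this[rule_format, OF conjI[OF W conjI[OF s assms(1)]] assms(2,3)]
  show "der10 A (\<lambda>q. H q (s q) (s' q)) p X = H p (d10 D s p X) (s' p) + H p (s p) (d01 D s' p X)"
    "der01 A (\<lambda>q. H q (s q) (s' q)) p X = H p (d01 D s p X) (s' p) + H p (s p) (d10 D s' p X)" by blast+
qed

lemma D_0: "p \<in> W \<Longrightarrow> X \<in> tspace A p \<Longrightarrow> d10 D (\<lambda>q. 0) p X = 0" "p \<in> W \<Longrightarrow> X \<in> tspace A p \<Longrightarrow> d01 D (\<lambda>q. 0) p X = 0"
  using D_leibniz[of "\<lambda>_. 0", OF smooth_fun_const] der_const[OF W] by simp_all

end

lemma D_hol: "open_in A W \<Longrightarrow> hol_sec A B W s \<Longrightarrow> p \<in> W \<Longrightarrow> X \<in> tspace A p \<Longrightarrow> d01 D s p X = 0"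
proof -
  assume "open_in A W" "hol_sec A B W s" "p \<in> W" "X \<in> tspace A p"
  moreover have "\<forall>W s. open_in A W \<and> hol_sec A B W s \<longrightarrow> (\<forall>p\<in>W. \<forall>X\<in>tspace A p. d01 D s p X = 0)"
    using chern_D unfolding chern_connection_def by (elim conjE)
  ultimately show ?thesis by blast
qed

text \<open>The definition of a connection places derivatives in the fibre only along smooth fields,
  so \<open>X\<close> is first extended to a local holomorphic field.\<close>

lemma D_in:
  assumes W: "open_in A W" and s: "smooth_sec A B W s" and p: "p \<in> W" and X: "X \<in> tspace A p"
  shows "d10 D s p X \<in> fib B p" "d01 D s p X \<in> fib B p"
proof -
  interpret T: hol_bundle A "tbundle A" by unfold_locales (rule holo_bundle_tbundle)
  obtain W' X' where X': "open_in A W'" "p \<in> W'" "hol_sec A (tbundle A) W' X'" "X' p = X"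
    using T.hol_extension[OF open_inD(3)[OF W p], of X] X by auto
  have S: "open_in A (W \<inter> W')" by (rule open_in_Int(1)[OF W open_inD(1)[OF X'(1)]])
  note c = D_smooth[OF S smooth_sec_subset[OF s Int_lower1] T.smooth_sec_subset[OF T.hol_sec_imp_smooth[OF X'(3)] Int_lower2]]
  show "d10 D s p X \<in> fib B p" "d01 D s p X \<in> fib B p"
    using smooth_secD(1)[OF c(1), of p] smooth_secD(1)[OF c(2), of p] p X' by auto
qed

lemma D_sum:
  assumes W: "open_in A W" and s: "\<And>i. i \<in> I \<Longrightarrow> smooth_sec A B W (s i)" and p: "p \<in> W" and X: "X \<in> tspace A p"
  shows "d10 D (\<lambda>q. \<Sum>i\<in>I. s i q) p X = (\<Sum>i\<in>I. d10 D (s i) p X)"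
    "d01 D (\<lambda>q. \<Sum>i\<in>I. s i q) p X = (\<Sum>i\<in>I. d01 D (s i) p X)"
  using s by (induction I rule: infinite_finite_induct)
    (simp_all add: D_0[OF W smooth_sec_0[OF W] p X] D_add[OF W _ _ p X] smooth_sec_sum[OF W])

lemma D_diff:
  assumes W: "open_in A W" and s: "smooth_sec A B W s" and s': "smooth_sec A B W s'" and p: "p \<in> W" and X: "X \<in> tspace A p"
  shows "d10 D (\<lambda>q. s q - s' q) p X = d10 D s p X - d10 D s' p X"
    "d01 D (\<lambda>q. s q - s' q) p X = d01 D s p X - d01 D s' p X"
proof -
  have e: "(\<lambda>q. s q - s' q) = (\<lambda>q. s q + scl B (-1) (s' q))" by (simp add: fun_eq_iff)
  note n = smooth_sec_scl[OF W smooth_fun_const s', of "-1"]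
  show "d10 D (\<lambda>q. s q - s' q) p X = d10 D s p X - d10 D s' p X"
    unfolding e D_add(1)[OF W s n p X] D_leibniz(1)[OF W s' smooth_fun_const p X] der_const[OF W p X] by simp
  show "d01 D (\<lambda>q. s q - s' q) p X = d01 D s p X - d01 D s' p X"
    unfolding e D_add(2)[OF W s n p X] D_leibniz(2)[OF W s' smooth_fun_const p X] der_const[OF W p X] by simp
qed

section \<open>Curvature computed on local sections, and its tensoriality\<close>

lemma vf_tspace: "hol_sec A (tbundle A) W X \<Longrightarrow> p \<in> W \<Longrightarrow> X p \<in> tspace A p"
  by (simp add: hol_vf_iff)

lemma curv_sec_hol:
  assumes W: "open_in A W" and X: "hol_sec A (tbundle A) W X" and Y: "hol_sec A (tbundle A) W Y"
    and w: "hol_sec A B W w" and p: "p \<in> W"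
  shows "curv_sec D X Y w p = - d01 D (\<lambda>q. d10 D w q (X q)) p (Y p)"
proof -
  have "d10 D (\<lambda>q. d01 D w q (Y q)) p (X p) = d10 D (\<lambda>q. 0) p (X p)"
    by (rule D_cong(1)[OF W smooth_sec_0[OF W] _ p vf_tspace[OF X p]]) (rule D_hol[OF W w _ vf_tspace[OF Y]])
  then show ?thesis
    unfolding curv_sec_def D_0(1)[OF W smooth_sec_0[OF W] p vf_tspace[OF X p]] by simp
qed

text \<open>Since \<open>s\<close> is holomorphic, only one second derivative of it survives, and
  the metric equation moves the outer one onto a function. For s = w = X = Y on the tangent bundle
  this is the squared norm of Z minus the derivative of a function known from
  \<open>K\<close>.\<close>

lemma curv_sec_metric:
  assumes W: "open_in A W" and X: "hol_sec A (tbundle A) W X" and Y: "hol_sec A (tbundle A) W Y"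
    and s: "hol_sec A B W s" and w: "smooth_sec A B W w" and p: "p \<in> W"
  shows "H p (curv_sec D X Y s p) (w p) =
    H p (d10 D s p (X p)) (d10 D w p (Y p)) - der01 A (\<lambda>q. H q (d10 D s q (X q)) (w q)) p (Y p)"
proof -
  note m = open_inD(3)[OF W p] and t = vf_tspace[OF Y p]
  note ds = D_smooth(1)[OF W hol_sec_imp_smooth[OF s] hol_vf_imp_smooth[OF X]]
  show ?thesis
    unfolding curv_sec_hol[OF W X Y s p] D_metric(2)[OF W ds w p t]
      H_neg_left[OF m D_in(2)[OF W ds p t] smooth_secD(1)[OF w p]] by simp
qed

text \<open>The mixed second derivatives of \<open>H q (s q) (w q)\<close> commute, and expanding
  both by the metric equations leaves this identity. Its right side depends on \<open>s\<close> only
  through \<open>s p\<close>, so the curvature is tensorial in the section.\<close>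

lemma curv_sec_adjoint:
  assumes W: "open_in A W" and X: "hol_sec A (tbundle A) W X" and Y: "hol_sec A (tbundle A) W Y"
    and s: "smooth_sec A B W s" and w: "hol_sec A B W w" and p: "p \<in> W"
  shows "H p (curv_sec D X Y s p) (w p) = H p (s p) (curv_sec D Y X w p)"
proof -
  note m = open_inD(3)[OF W p]
  note tX = vf_tspace[OF X p] and tY = vf_tspace[OF Y p]
  note Xs = hol_vf_imp_smooth[OF X] and Ys = hol_vf_imp_smooth[OF Y] and ws = hol_sec_imp_smooth[OF w]
  note s1 = D_smooth(2)[OF W s Ys] and s2 = D_smooth(1)[OF W s Xs] and wY = D_smooth(1)[OF W ws Ys]
  note sm = H_smooth[OF W s ws] and sm2 = H_smooth[OF W s wY] and o = open_inD(1)[OF W]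
  have 1: "der10 A (\<lambda>q. H q (d01 D s q (Y q)) (w q)) p (X p) = H p (d10 D (\<lambda>q. d01 D s q (Y q)) p (X p)) (w p)"
    unfolding D_metric(1)[OF W s1 ws p tX] D_hol[OF W w p tX] H_0_right[OF m smooth_secD(1)[OF s1 p]] by simp
  have 2: "der01 A (\<lambda>q. H q (d10 D s q (X q)) (w q)) p (Y p) =
      H p (d01 D (\<lambda>q. d10 D s q (X q)) p (Y p)) (w p) + H p (d10 D s p (X p)) (d10 D w p (Y p))"
    by (rule D_metric(2)[OF W s2 ws p tY])
  have e1: "H q (d01 D s q (Y q)) (w q) = der01 A (\<lambda>q. H q (s q) (w q)) q (Y q) - H q (s q) (d10 D w q (Y q))" if "q \<in> W" for q
    unfolding D_metric(2)[OF W s ws that vf_tspace[OF Y that]] by simp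
  have e2: "H q (d10 D s q (X q)) (w q) = der10 A (\<lambda>q. H q (s q) (w q)) q (X q)" if "q \<in> W" for q
    unfolding D_metric(1)[OF W s ws that vf_tspace[OF X that]] D_hol[OF W w that vf_tspace[OF X that]]
      H_0_right[OF open_inD(3)[OF W that] smooth_secD(1)[OF s that]] by simp
  have "der10 A (\<lambda>q. H q (d01 D s q (Y q)) (w q)) p (X p) =
      der10 A (\<lambda>q. der01 A (\<lambda>q. H q (s q) (w q)) q (Y q) + (-1) * H q (s q) (d10 D w q (Y q))) p (X p)"
    by (rule der_cong(1)[OF o p m]) (simp add: e1)
  also have "\<dots> = der10 A (\<lambda>q. der01 A (\<lambda>q. H q (s q) (w q)) q (Y q)) p (X p) - der10 A (\<lambda>q. H q (s q) (d10 D w q (Y q))) p (X p)"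
    unfolding der_add(1)[OF W p der_smooth(2)[OF W sm Ys] smooth_fun_mult[OF o smooth_fun_const sm2] tX]
      der_mult(1)[OF W p smooth_fun_const sm2 tX] der_const[OF W p tX] by simp
  also have "der10 A (\<lambda>q. der01 A (\<lambda>q. H q (s q) (w q)) q (Y q)) p (X p) =
      der01 A (\<lambda>q. der10 A (\<lambda>q. H q (s q) (w q)) q (X q)) p (Y p)"
    by (rule der10_der01_commute[OF W sm X Y p])
  also have "\<dots> = der01 A (\<lambda>q. H q (d10 D s q (X q)) (w q)) p (Y p)"
    by (rule der_cong(2)[OF o p m]) (simp add: e2)
  also have "der10 A (\<lambda>q. H q (s q) (d10 D w q (Y q))) p (X p) =
      H p (d10 D s p (X p)) (d10 D w p (Y p)) + H p (s p) (d01 D (\<lambda>q. d10 D w q (Y q)) p (X p))"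
    by (rule D_metric(1)[OF W s wY p tX])
  finally have "H p (d10 D (\<lambda>q. d01 D s q (Y q)) p (X p)) (w p) - H p (d01 D (\<lambda>q. d10 D s q (X q)) p (Y p)) (w p)
      = - H p (s p) (d01 D (\<lambda>q. d10 D w q (Y q)) p (X p))"
    unfolding 1 2 by simp
  then show ?thesis
    unfolding curv_sec_hol[OF W Y X w p] H_neg_right[OF m D_in(2)[OF W wY p tX] smooth_secD(1)[OF s p]]
    unfolding curv_sec_def H_diff_left[OF m D_in(1)[OF W s1 p tX] D_in(2)[OF W s2 p tY] smooth_secD(1)[OF ws p]] .
qed

lemma curv_sec_in:
  assumes W: "open_in A W" and X: "hol_sec A (tbundle A) W X" and Y: "hol_sec A (tbundle A) W Y"
    and s: "smooth_sec A B W s" and p: "p \<in> W"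
  shows "curv_sec D X Y s p \<in> fib B p"
  unfolding curv_sec_def
  by (rule fib_diff[OF open_inD(3)[OF W p] D_in(1)[OF W D_smooth(2)[OF W s hol_vf_imp_smooth[OF Y]] p vf_tspace[OF X p]]
        D_in(2)[OF W D_smooth(1)[OF W s hol_vf_imp_smooth[OF X]] p vf_tspace[OF Y p]]])

text \<open>By the adjoint formula \<open>s\<close> may be replaced by a holomorphic section with
  the same value at \<open>p\<close>. For such a section \<open>curv_sec_hol\<close> shows that
  \<open>Y\<close> enters only through \<open>Y p\<close>. Taking the adjoint once more exchanges
  the roles of \<open>X\<close> and \<open>Y\<close>, which settles \<open>X\<close>.\<close>

lemma curv_sec_unique:
  assumes W: "open_in A W" and p: "p \<in> W"
    and 1: "hol_sec A (tbundle A) W X" "hol_sec A (tbundle A) W Y" "smooth_sec A B W s"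
    and 2: "hol_sec A (tbundle A) W X'" "hol_sec A (tbundle A) W Y'" "smooth_sec A B W s'"
    and e: "X p = X' p" "Y p = Y' p" "s p = s' p"
  shows "curv_sec D X Y s p = curv_sec D X' Y' s' p"
proof -
  note m = open_inD(3)[OF W p]
  have "curv_sec D X Y s p - curv_sec D X' Y' s' p = 0"
  proof (rule H_nondeg[OF m fib_diff[OF m curv_sec_in[OF W 1 p] curv_sec_in[OF W 2 p]]])
    fix b assume b: "b \<in> fib B p"
    obtain W1 w where w: "open_in A W1" "p \<in> W1" "hol_sec A B W1 w" "w p = b" by (rule hol_extension[OF m b])
    obtain W2 v where v: "open_in A W2" "p \<in> W2" "hol_sec A B W2 v" "v p = s p"
      by (rule hol_extension[OF m smooth_secD(1)[OF 1(3) p]])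
    define S where "S = W \<inter> W1 \<inter> W2"
    have S: "open_in A S" "p \<in> S" "S \<subseteq> W" "S \<subseteq> W1" "S \<subseteq> W2"
      using open_in_Int(1)[OF open_in_Int(1)[OF W open_inD(1)[OF w(1)]] open_inD(1)[OF v(1)]] w v p by (auto simp: S_def)
    interpret T: hol_bundle A "tbundle A" by unfold_locales (rule holo_bundle_tbundle)
    note X = T.hol_sec_subset[OF 1(1) S(3)] and Y = T.hol_sec_subset[OF 1(2) S(3)] and s = smooth_sec_subset[OF 1(3) S(3)]
    note X' = T.hol_sec_subset[OF 2(1) S(3)] and Y' = T.hol_sec_subset[OF 2(2) S(3)] and s' = smooth_sec_subset[OF 2(3) S(3)]
    note wS = hol_sec_subset[OF w(3) S(4)] and vS = hol_sec_subset[OF v(3) S(5)]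
    note v' = hol_sec_imp_smooth[OF vS]
    have "H p (curv_sec D X Y s p) (w p) = H p (v p) (curv_sec D Y X w p)"
      unfolding curv_sec_adjoint[OF S(1) X Y s wS S(2)] v(4) ..
    also have "\<dots> = H p (curv_sec D X Y v p) (w p)" by (rule curv_sec_adjoint[OF S(1) X Y v' wS S(2), symmetric])
    also have "curv_sec D X Y v p = curv_sec D X Y' v p"
      unfolding curv_sec_hol[OF S(1) X Y vS S(2)] curv_sec_hol[OF S(1) X Y' vS S(2)] e(2) ..
    also have "H p (curv_sec D X Y' v p) (w p) = H p (v p) (curv_sec D Y' X w p)"
      by (rule curv_sec_adjoint[OF S(1) X Y' v' wS S(2)])
    also have "curv_sec D Y' X w p = curv_sec D Y' X' w p"
      unfolding curv_sec_hol[OF S(1) Y' X wS S(2)] curv_sec_hol[OF S(1) Y' X' wS S(2)] e(1) ..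
    also have "H p (v p) (curv_sec D Y' X' w p) = H p (curv_sec D X' Y' s' p) (w p)"
      unfolding curv_sec_adjoint[OF S(1) X' Y' s' wS S(2)] v(4) e(3) ..
    finally show "H p (curv_sec D X Y s p - curv_sec D X' Y' s' p) b = 0"
      using H_diff_left[OF m curv_sec_in[OF W 1 p] curv_sec_in[OF W 2 p] b] w(4) by simp
  qed
  then show ?thesis by simp
qed

lemma curv_eq_curv_sec:
  assumes W: "open_in A W" and p: "p \<in> W"
    and X: "hol_sec A (tbundle A) W X" and Y: "hol_sec A (tbundle A) W Y" and s: "smooth_sec A B W s"
  shows "curv A B D p (X p) (Y p) (s p) = curv_sec D X Y s p"
  unfolding curv_def
proof (rule the_equality)
  show "\<exists>W X' Y' s'. open_in A W \<and> p \<in> W \<and> hol_sec A (tbundle A) W X' \<and> hol_sec A (tbundle A) W Y' \<and>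
      smooth_sec A B W s' \<and> X' p = X p \<and> Y' p = Y p \<and> s' p = s p \<and> curv_sec D X Y s p = curv_sec D X' Y' s' p"
    using assms by blast
next
  fix r assume "\<exists>W X' Y' s'. open_in A W \<and> p \<in> W \<and> hol_sec A (tbundle A) W X' \<and> hol_sec A (tbundle A) W Y' \<and>
      smooth_sec A B W s' \<and> X' p = X p \<and> Y' p = Y p \<and> s' p = s p \<and> r = curv_sec D X' Y' s' p"
  then obtain W' X' Y' s' where W': "open_in A W'" "p \<in> W'" "hol_sec A (tbundle A) W' X'" "hol_sec A (tbundle A) W' Y'"
      "smooth_sec A B W' s'" and e: "X' p = X p" "Y' p = Y p" "s' p = s p" and r: "r = curv_sec D X' Y' s' p" by blast
  interpret T: hol_bundle A "tbundle A" by unfold_locales (rule holo_bundle_tbundle)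
  have S: "open_in A (W \<inter> W')" "p \<in> W \<inter> W'" using open_in_Int(1)[OF W open_inD(1)[OF W'(1)]] p W'(2) by auto
  show "r = curv_sec D X Y s p"
    unfolding r
    by (rule curv_sec_unique[OF S T.hol_sec_subset[OF W'(3) Int_lower2] T.hol_sec_subset[OF W'(4) Int_lower2]
          smooth_sec_subset[OF W'(5) Int_lower2] T.hol_sec_subset[OF X Int_lower1] T.hol_sec_subset[OF Y Int_lower1]
          smooth_sec_subset[OF s Int_lower1] e])
qed

end

section \<open>The hermitian form on endomorphisms\<close>

context hol_bundle
begin

context
  fixes p and \<Phi> assumes p: "p \<in> mfd A" and \<Phi>: "\<Phi> \<in> fib_end B p"
begin

lemma end_in: "a \<in> fib B p \<Longrightarrow> \<Phi> a \<in> fib B p"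
  and end_add: "a \<in> fib B p \<Longrightarrow> b \<in> fib B p \<Longrightarrow> \<Phi> (a + b) = \<Phi> a + \<Phi> b"
  and end_scl: "a \<in> fib B p \<Longrightarrow> \<Phi> (scl B z a) = scl B z (\<Phi> a)"
  and end_outside: "a \<notin> fib B p \<Longrightarrow> \<Phi> a = 0"
  using \<Phi> unfolding fib_end_def by blast+

lemma end_0: "\<Phi> 0 = 0"
  using end_add[OF fib_0[OF p] fib_0[OF p]] by simp

lemma end_sum: "(\<And>i. i \<in> I \<Longrightarrow> f i \<in> fib B p) \<Longrightarrow> \<Phi> (\<Sum>i\<in>I. f i) = (\<Sum>i\<in>I. \<Phi> (f i))"
  by (induction I rule: infinite_finite_induct) (simp_all add: end_0 end_add fib_sum[OF p])

lemma end_comb: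
  assumes "\<And>i. i \<in> I \<Longrightarrow> f i \<in> fib B p"
  shows "\<Phi> (\<Sum>i\<in>I. scl B (x i) (f i)) = (\<Sum>i\<in>I. scl B (x i) (\<Phi> (f i)))"
  using end_sum[of I "\<lambda>i. scl B (x i) (f i)"] fib_scl[OF p assms] end_scl[OF assms] by simp

lemma end_neg: "a \<in> fib B p \<Longrightarrow> \<Phi> (- a) = - \<Phi> a"
  using end_scl[of a "-1"] by simp

lemma end_diff: "a \<in> fib B p \<Longrightarrow> b \<in> fib B p \<Longrightarrow> \<Phi> (a - b) = \<Phi> a - \<Phi> b"
  using end_add[of a "- b"] end_neg[of b] fib_neg[OF p, of b] by simp

end

lemma fib_endI:
  assumes "\<And>a. a \<in> fib B p \<Longrightarrow> \<Phi> a \<in> fib B p" "\<And>a b. a \<in> fib B p \<Longrightarrow> b \<in> fib B p \<Longrightarrow> \<Phi> (a + b) = \<Phi> a + \<Phi> b"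
    "\<And>a z. a \<in> fib B p \<Longrightarrow> \<Phi> (scl B z a) = scl B z (\<Phi> a)" "\<And>a. a \<notin> fib B p \<Longrightarrow> \<Phi> a = 0"
  shows "\<Phi> \<in> fib_end B p"
  using assms unfolding fib_end_def by blast

lemma fib_end_add:
  assumes p: "p \<in> mfd A" and "\<Phi> \<in> fib_end B p" "\<Psi> \<in> fib_end B p" shows "\<Phi> + \<Psi> \<in> fib_end B p"
  using end_in[OF p assms(2)] end_in[OF p assms(3)] end_add[OF p assms(2)] end_add[OF p assms(3)]
    end_scl[OF p assms(2)] end_scl[OF p assms(3)] end_outside[OF p assms(2)] end_outside[OF p assms(3)]
  by (intro fib_endI) (auto simp: fib_add[OF p] vs.scale_right_distrib)

lemma fib_end_scl:
  assumes p: "p \<in> mfd A" and "\<Phi> \<in> fib_end B p" shows "end_scl B z \<Phi> \<in> fib_end B p"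
  using end_in[OF assms] end_add[OF assms] end_scl[OF assms] end_outside[OF assms]
  by (intro fib_endI) (auto simp: end_scl_def fib_scl[OF p] vs.scale_right_distrib mult.commute)

lemma fib_end_diff:
  assumes p: "p \<in> mfd A" and "\<Phi> \<in> fib_end B p" "\<Psi> \<in> fib_end B p" shows "\<Phi> - \<Psi> \<in> fib_end B p"
proof -
  have "\<Phi> - \<Psi> = \<Phi> + end_scl B (-1) \<Psi>" by (simp add: fun_eq_iff end_scl_def)
  then show ?thesis by (simp only: fib_end_add[OF p assms(2) fib_end_scl[OF p assms(3)]])
qed

lemma fib_end_comp:
  assumes p: "p \<in> mfd A" and "\<Phi> \<in> fib_end B p" "\<Psi> \<in> fib_end B p" shows "(\<lambda>a. \<Phi> (\<Psi> a)) \<in> fib_end B p"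
  using end_in[OF p assms(2)] end_in[OF p assms(3)] end_add[OF p assms(2)] end_add[OF p assms(3)]
    end_scl[OF p assms(2)] end_scl[OF p assms(3)] end_outside[OF p assms(3)] end_0[OF p assms(2)]
  by (intro fib_endI) auto

lemma fib_end_eqI:
  assumes p: "p \<in> mfd A" and "\<Phi> \<in> fib_end B p" "\<Psi> \<in> fib_end B p" "\<And>a. a \<in> fib B p \<Longrightarrow> \<Phi> a = \<Psi> a"
  shows "\<Phi> = \<Psi>"
  using assms(4) end_outside[OF p assms(2)] end_outside[OF p assms(3)] by (metis ext)

end

context herm_bundle
begin

section \<open>Independence of the trace form from the chosen dual bases\<close>

lemma dual_bases_of_fib_basis:
  assumes p: "p \<in> mfd A" and b: "fib_basis B p b" "fib_basis B p b'"
    and d: "\<And>i j. H p (b i) (b' j) = (if i = j then 1 else 0)"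
  shows "dual_bases p b b'"
proof -
  have in': "c i \<in> fib B p" if "fib_basis B p c" for c i
    using that vs.span_superset[of "range c"] unfolding fib_basis_def by blast
  have "a = (\<Sum>i\<in>UNIV. scl B (H p a (b' i)) (b i))" if a: "a \<in> fib B p" for a
  proof -
    have "a \<in> vs.span (range b)" using a b(1) by (simp add: fib_basis_def)
    then obtain u where "a = (\<Sum>v\<in>range b. scl B (u v) v)"
      using vs.span_finite[of "range b"] by auto
    also have "\<dots> = (\<Sum>i\<in>UNIV. scl B (u (b i)) (b i))"
      using sum.reindex[of b UNIV "\<lambda>v. scl B (u v) v"] b(1) by (simp add: fib_basis_def)
    finally have a': "a = (\<Sum>i\<in>UNIV. scl B (u (b i)) (b i))" .
    have "H p a (b' j) = u (b j)" for j
      by (subst a', subst H_comb_left[OF p in'[OF b(1)] in'[OF b(2)]]) (simp add: d if_distrib cong: if_cong)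
    then show ?thesis using a' by simp
  qed
  then show ?thesis unfolding dual_bases_def[OF p] using in'[OF b(1)] in'[OF b(2)] d by blast
qed

lemma fib_basis_of_dual_bases:
  fixes b b' :: "'n \<Rightarrow> 'k"
  assumes p: "p \<in> mfd A" and b: "dual_bases p b b'" shows "fib_basis B p b"
proof -
  note d = dual_basesD[OF p b]
  have inj: "inj b"
  proof (rule injI)
    fix i j assume "b i = b j"
    then show "i = j" using d(3)[of i i] d(3)[of j i] by (metis one_neq_zero)
  qed
  have "\<not> vs.dependent (range b)"
  proof
    assume "vs.dependent (range b)"
    then obtain u v where u: "v \<in> range b" "u v \<noteq> 0" "(\<Sum>v\<in>range b. scl B (u v) v) = 0"
      using vs.dependent_finite[of "range b"] by auto
    obtain j where j: "v = b j" using u(1) by blast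
    have "(\<Sum>i\<in>UNIV. scl B (u (b i)) (b i)) = 0"
      using u(3) sum.reindex[OF inj, of "\<lambda>v. scl B (u v) v"] by simp
    then have "H p (\<Sum>i\<in>UNIV. scl B (u (b i)) (b i)) (b' j) = 0" using H_0_left[OF p d(2)] by simp
    then have "u (b j) = 0" unfolding H_comb_left[OF p d(1) d(2)] d(3) by (simp add: if_distrib cong: if_cong)
    then show False using u(2) j by simp
  qed
  moreover have "vs.span (range b) = fib B p"
  proof
    show "vs.span (range b) \<subseteq> fib B p" by (rule vs.span_minimal[OF _ subspace_fib[OF p]]) (use d(1) in blast)
    show "fib B p \<subseteq> vs.span (range b)"
    proof
      fix a assume "a \<in> fib B p"
      then show "a \<in> vs.span (range b)"
        by (subst d(4)) (auto intro: vs.span_sum vs.span_scale vs.span_base)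
    qed
  qed
  ultimately show ?thesis using inj by (simp add: fib_basis_def)
qed

lemma obtain_dual_bases:
  assumes p: "p \<in> mfd A"
  obtains b b' :: "'n \<Rightarrow> 'k" where "dual_bases p b b'"
proof -
  obtain V \<psi> where t: "(V, \<psi>) \<in> trivs B" "p \<in> V" by (rule obtain_triv[OF p])
  show ?thesis by (rule that[OF dfrm_dual[OF t]])
qed

lemma dual_sum_right:
  assumes p: "p \<in> mfd A" and \<Phi>: "\<Phi> \<in> fib_end B p" and b: "dual_bases p b b'"
    and x: "x \<in> fib B p" and y: "y \<in> fib B p"
  shows "H p x (\<Phi> y) = (\<Sum>i\<in>UNIV. H p (b i) y * H p x (\<Phi> (b' i)))"
proof -
  note d = dual_basesD[OF p b] and d' = dual_basesD[OF p dual_bases_sym[OF p b]]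
  have "H p x (\<Phi> y) = H p x (\<Phi> (\<Sum>i\<in>UNIV. scl B (H p y (b i)) (b' i)))" using d'(4)[OF y] by simp
  also have "\<dots> = (\<Sum>i\<in>UNIV. cnj (H p y (b i)) * H p x (\<Phi> (b' i)))"
    unfolding end_comb[OF p \<Phi> d(2)] by (rule H_comb_right[OF p end_in[OF p \<Phi> d(2)] x])
  finally show ?thesis using H_sym[OF p y d(1)] by simp
qed

lemma dual_sum_left:
  assumes p: "p \<in> mfd A" and \<Phi>: "\<Phi> \<in> fib_end B p" and b: "dual_bases p b b'"
    and x: "x \<in> fib B p" and y: "y \<in> fib B p"
  shows "H p (\<Phi> y) x = (\<Sum>i\<in>UNIV. H p y (b' i) * H p (\<Phi> (b i)) x)"
proof -
  note d = dual_basesD[OF p b]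
  have "H p (\<Phi> y) x = H p (\<Phi> (\<Sum>i\<in>UNIV. scl B (H p y (b' i)) (b i))) x" using d(4)[OF y] by simp
  also have "\<dots> = (\<Sum>i\<in>UNIV. H p y (b' i) * H p (\<Phi> (b i)) x)"
    unfolding end_comb[OF p \<Phi> d(1)] by (rule H_comb_left[OF p end_in[OF p \<Phi> d(1)] x])
  finally show ?thesis .
qed

text \<open>Expanding \<open>b i\<close> in the basis \<open>c\<close> gives a double sum; summing
  over \<open>i\<close> first collects the \<open>b' i\<close> into \<open>c' j\<close>. Without
  this the description by \<open>THE\<close> in \<open>h_end\<close> would have no known
  value.\<close>

lemma end_trace_independent:
  assumes p: "p \<in> mfd A" and \<Phi>: "\<Phi> \<in> fib_end B p" and \<Psi>: "\<Psi> \<in> fib_end B p"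
    and b: "dual_bases p b b'" and c: "dual_bases p c c'"
  shows "(\<Sum>i\<in>UNIV. H p (\<Phi> (b i)) (\<Psi> (b' i))) = (\<Sum>i\<in>UNIV. H p (\<Phi> (c i)) (\<Psi> (c' i)))"
proof -
  note d = dual_basesD[OF p b] and dc = dual_basesD[OF p c]
  have "(\<Sum>i\<in>UNIV. H p (\<Phi> (b i)) (\<Psi> (b' i))) = (\<Sum>i\<in>UNIV. \<Sum>j\<in>UNIV. H p (b i) (c' j) * H p (\<Phi> (c j)) (\<Psi> (b' i)))"
    using dual_sum_left[OF p \<Phi> c end_in[OF p \<Psi> d(2)] d(1)] by simp
  also have "\<dots> = (\<Sum>j\<in>UNIV. H p (\<Phi> (c j)) (\<Psi> (c' j)))"
    using dual_sum_right[OF p \<Psi> b end_in[OF p \<Phi> dc(1)] dc(2)] by (subst sum.swap) simp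
  finally show ?thesis .
qed

lemma h_end_eq:
  fixes b b' :: "'n \<Rightarrow> 'k"
  assumes p: "p \<in> mfd A" and \<Phi>: "\<Phi> \<in> fib_end B p" and \<Psi>: "\<Psi> \<in> fib_end B p" and b: "dual_bases p b b'"
  shows "h_end B H p \<Phi> \<Psi> = (\<Sum>i\<in>UNIV. H p (\<Phi> (b i)) (\<Psi> (b' i)))"
  unfolding h_end_def
proof (rule the_equality)
  show "\<exists>c c'. fib_basis B p c \<and> fib_basis B p c' \<and> (\<forall>i j. H p (c i) (c' j) = (if i = j then 1 else 0)) \<and>
      (\<Sum>i\<in>UNIV. H p (\<Phi> (b i)) (\<Psi> (b' i))) = (\<Sum>i\<in>UNIV. H p (\<Phi> (c i)) (\<Psi> (c' i)))"
    using fib_basis_of_dual_bases[OF p b] fib_basis_of_dual_bases[OF p dual_bases_sym[OF p b]] dual_basesD(3)[OF p b]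
    by blast
  fix r assume "\<exists>c c'. fib_basis B p c \<and> fib_basis B p c' \<and> (\<forall>i j. H p (c i) (c' j) = (if i = j then 1 else 0)) \<and>
      r = (\<Sum>i\<in>UNIV. H p (\<Phi> (c i)) (\<Psi> (c' i)))"
  then obtain c c' where c: "fib_basis B p c" "fib_basis B p c'" "\<forall>i j. H p (c i) (c' j) = (if i = j then 1 else 0)"
    and r: "r = (\<Sum>i\<in>UNIV. H p (\<Phi> (c i)) (\<Psi> (c' i)))" by blast
  have "dual_bases p c c'" by (rule dual_bases_of_fib_basis[OF p c(1,2)]) (use c(3) in blast)
  from end_trace_independent[OF p \<Phi> \<Psi> this b] show "r = (\<Sum>i\<in>UNIV. H p (\<Phi> (b i)) (\<Psi> (b' i)))"
    unfolding r .
qed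

text \<open>Over general dual bases the terms of \<open>h_end\<close> for equal arguments are not
  visibly non-negative. Over an orthonormal basis they are squared norms, which is how positivity is
  obtained.\<close>

lemma orthonormal_basis:
  assumes p: "p \<in> mfd A"
  obtains e :: "'n \<Rightarrow> 'k" where "dual_bases p e e"
proof -
  obtain b b' :: "'n \<Rightarrow> 'k" where b: "dual_bases p b b'" by (rule obtain_dual_bases[OF p])
  note d = dual_basesD[OF p b] and fb = fib_basis_of_dual_bases[OF p b]
  \<comment> \<open>Gram-Schmidt over finite sets of indices. The span clause, with the independence
    of \<open>b\<close>, shows that the next vector does not vanish after projection; the expansion
    clause makes the final system complete.\<close>
  have "\<exists>e. (\<forall>j\<in>I. e j \<in> fib B p \<and> e j \<in> vs.span (b ` I)) \<and> (\<forall>i\<in>I. \<forall>j\<in>I. H p (e i) (e j) = (if i = j then 1 else 0)) \<and>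
      (\<forall>i\<in>I. b i = (\<Sum>j\<in>I. scl B (H p (b i) (e j)) (e j)))" for I :: "'n set"
  proof (induction I rule: finite_induct[OF finite])
    case (2 i I)
    then obtain e where e: "\<And>j. j \<in> I \<Longrightarrow> e j \<in> fib B p" "\<And>j. j \<in> I \<Longrightarrow> e j \<in> vs.span (b ` I)"
      and on: "\<And>i j. i \<in> I \<Longrightarrow> j \<in> I \<Longrightarrow> H p (e i) (e j) = (if i = j then 1 else 0)"
      and ex: "\<And>i. i \<in> I \<Longrightarrow> b i = (\<Sum>j\<in>I. scl B (H p (b i) (e j)) (e j))" by blast
    define u where "u = (\<Sum>j\<in>I. scl B (H p (b i) (e j)) (e j))"
    define v where "v = b i - u"
    have u: "u \<in> fib B p" unfolding u_def by (rule fib_sum[OF p fib_scl[OF p e(1)]])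
    have v: "v \<in> fib B p" unfolding v_def by (rule fib_diff[OF p d(1) u])
    have us: "u \<in> vs.span (b ` I)" unfolding u_def by (rule vs.span_sum[OF vs.span_scale[OF e(2)]])
    have ue: "H p u (e k) = H p (b i) (e k)" if "k \<in> I" for k
    proof -
      have "H p u (e k) = (\<Sum>j\<in>I. H p (b i) (e j) * H p (e j) (e k))"
        unfolding u_def by (rule H_comb_left[OF p]) (use e(1) that in auto)
      also have "\<dots> = (\<Sum>j\<in>I. if j = k then H p (b i) (e j) else 0)"
        by (rule sum.cong) (use on[OF _ that] in auto)
      finally show ?thesis using that 2(1) by simp
    qed
    then have ve: "H p v (e k) = 0" if "k \<in> I" for k
      unfolding v_def using H_diff_left[OF p d(1) u e(1)[OF that]] that by simp
    then have ev: "H p (e k) v = 0" if "k \<in> I" for k using H_sym[OF p v e(1)[OF that]] that by simp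
    have "v \<noteq> 0"
    proof
      assume "v = 0"
      then have "b i \<in> vs.span (b ` I)" using us by (simp add: v_def)
      moreover have "b ` I \<subseteq> range b - {b i}" using fb 2(2) by (auto simp: fib_basis_def dest: injD)
      ultimately have "b i \<in> vs.span (range b - {b i})" using vs.span_mono by blast
      then show False using fb unfolding fib_basis_def vs.dependent_def by blast
    qed
    define r where "r = Re (H p v v)"
    have r: "r > 0" "H p v v = of_real r"
      using H_Re_pos[OF p v \<open>v \<noteq> 0\<close>] H_self_real[OF p v] by (simp_all add: r_def complex_eq_iff)
    define w where "w = scl B (of_real (1 / sqrt r)) v"
    have w: "w \<in> fib B p" unfolding w_def by (rule fib_scl[OF p v])
    have we: "H p w (e k) = 0" "H p (e k) w = 0" if "k \<in> I" for k
      unfolding w_def H_scl_left[OF p v e(1)[OF that]] H_scl_right[OF p v e(1)[OF that]] ve[OF that] ev[OF that] by simp_all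
    have "of_real (1 / sqrt r) * of_real (1 / sqrt r) * of_real r = (1 :: complex)"
      using r(1) by (simp flip: of_real_mult)
    then have ww: "H p w w = 1"
      unfolding w_def H_scl_left[OF p v fib_scl[OF p v]] H_scl_right[OF p v v] r(2) by (simp add: mult.assoc)
    have vw: "scl B (H p (b i) w) w = v"
    proof -
      have "H p u w = (\<Sum>j\<in>I. H p (b i) (e j) * H p (e j) w)"
        unfolding u_def by (rule H_comb_left[OF p]) (use e(1) w in auto)
      then have "H p u w = 0" using we(2) by simp
      then have "H p (b i) w = H p v w" unfolding v_def H_diff_left[OF p d(1) u w] by simp
      also have "\<dots> = of_real (1 / sqrt r) * of_real r" unfolding w_def H_scl_right[OF p v v] r(2) by simp
      finally have "H p (b i) w * of_real (1 / sqrt r) = 1"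
        using r(1) by (simp flip: of_real_mult)
      then show ?thesis unfolding w_def[symmetric] by (metis vs.scale_one vs.scale_scale w_def)
    qed
    have bi: "b i = scl B (H p (b i) w) w + u" unfolding vw v_def by simp
    have bk: "H p (b k) w = 0" if "k \<in> I" for k
    proof -
      have "H p (b k) w = H p (\<Sum>j\<in>I. scl B (H p (b k) (e j)) (e j)) w" using ex[OF that] by simp
      also have "\<dots> = (\<Sum>j\<in>I. H p (b k) (e j) * H p (e j) w)"
        by (rule H_comb_left[OF p]) (use e(1) w in auto)
      finally show ?thesis using we(2) by simp
    qed
    have ws: "w \<in> vs.span (b ` insert i I)"
    proof -
      have "b i \<in> vs.span (b ` insert i I)" by (rule vs.span_base) simp
      moreover have "u \<in> vs.span (b ` insert i I)" using us vs.span_mono[of "b ` I" "b ` insert i I"] by blast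
      ultimately show ?thesis unfolding w_def v_def by (intro vs.span_scale vs.span_diff)
    qed
    have es: "e j \<in> vs.span (b ` insert i I)" if "j \<in> I" for j
      using e(2)[OF that] vs.span_mono[of "b ` I" "b ` insert i I"] by blast
    define e' where "e' = e(i := w)"
    have e': "e' i = w" "\<And>j. j \<in> I \<Longrightarrow> e' j = e j" using 2(2) by (auto simp: e'_def)
    have sum': "(\<Sum>j\<in>insert i I. scl B (H p (b k) (e' j)) (e' j)) =
        scl B (H p (b k) w) w + (\<Sum>j\<in>I. scl B (H p (b k) (e j)) (e j))" for k
      using 2(1,2) e' by simp
    have f1: "b k = (\<Sum>j\<in>insert i I. scl B (H p (b k) (e' j)) (e' j))" if "k \<in> insert i I" for k
      unfolding sum' using that bi[unfolded u_def] bk[of k] ex[of k] by auto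
    have f2: "e' j \<in> fib B p \<and> e' j \<in> vs.span (b ` insert i I)" if "j \<in> insert i I" for j
      using that e' w ws e(1) es by auto
    have f3: "H p (e' k) (e' j) = (if k = j then 1 else 0)" if "k \<in> insert i I" "j \<in> insert i I" for k j
      using that e' on we ww 2(2) by auto
    show ?case
      by (rule exI[of _ e'], intro conjI ballI)
        ((rule f1 f2[THEN conjunct1] f2[THEN conjunct2] f3; assumption)+)
  qed simp
  from this[of UNIV] obtain e :: "'n \<Rightarrow> 'k" where e0: "\<forall>j\<in>UNIV. e j \<in> fib B p \<and> e j \<in> vs.span (range b)"
    "\<forall>i\<in>UNIV. \<forall>j\<in>UNIV. H p (e i) (e j) = (if i = j then 1 else 0)"
    "\<forall>i\<in>UNIV. b i = (\<Sum>j\<in>UNIV. scl B (H p (b i) (e j)) (e j))" by blast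
  have e: "e j \<in> fib B p" "H p (e i) (e j) = (if i = j then 1 else 0)" for i j
    using e0(1,2) by blast+
  have ex: "b i = (\<Sum>j\<in>UNIV. scl B (H p (b i) (e j)) (e j))" for i
    using e0(3) by blast
  have "a = (\<Sum>j\<in>UNIV. scl B (H p a (e j)) (e j))" if a: "a \<in> fib B p" for a
  proof -
    have "H p a (e j) = (\<Sum>i\<in>UNIV. H p a (b' i) * H p (b i) (e j))" for j
      by (subst d(4)[OF a]) (rule H_comb_left[OF p d(1) e(1)])
    then have "(\<Sum>j\<in>UNIV. scl B (H p a (e j)) (e j)) =
        (\<Sum>i\<in>UNIV. scl B (H p a (b' i)) (\<Sum>j\<in>UNIV. scl B (H p (b i) (e j)) (e j)))"
      by (simp add: vs.scale_sum_left vs.scale_sum_right) (rule sum.swap)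
    then show ?thesis unfolding ex[symmetric] using d(4)[OF a] by simp
  qed
  then have "dual_bases p e e" unfolding dual_bases_def[OF p] using e by blast
  then show ?thesis by (rule that)
qed

section \<open>The trace form as a positive definite hermitian form\<close>

context
  fixes p assumes p: "p \<in> mfd A"
begin

lemma h_end_add_left:
  assumes "\<Phi> \<in> fib_end B p" "\<Phi>' \<in> fib_end B p" "\<Psi> \<in> fib_end B p"
  shows "h_end B H p (\<Phi> + \<Phi>') \<Psi> = h_end B H p \<Phi> \<Psi> + h_end B H p \<Phi>' \<Psi>"
proof -
  obtain b b' :: "'n \<Rightarrow> 'k" where b: "dual_bases p b b'" by (rule obtain_dual_bases[OF p])
  note d = dual_basesD[OF p b]
  show ?thesis
    unfolding h_end_eq[OF p assms(1,3) b] h_end_eq[OF p assms(2,3) b] h_end_eq[OF p fib_end_add[OF p assms(1,2)] assms(3) b]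
    by (simp add: H_add_left[OF p end_in[OF p assms(1) d(1)] end_in[OF p assms(2) d(1)] end_in[OF p assms(3) d(2)]] sum.distrib)
qed

lemma h_end_scl_left:
  assumes "\<Phi> \<in> fib_end B p" "\<Psi> \<in> fib_end B p"
  shows "h_end B H p (end_scl B z \<Phi>) \<Psi> = z * h_end B H p \<Phi> \<Psi>"
proof -
  obtain b b' :: "'n \<Rightarrow> 'k" where b: "dual_bases p b b'" by (rule obtain_dual_bases[OF p])
  note d = dual_basesD[OF p b]
  show ?thesis
    unfolding h_end_eq[OF p assms b] h_end_eq[OF p fib_end_scl[OF p assms(1)] assms(2) b]
    by (simp add: end_scl_def H_scl_left[OF p end_in[OF p assms(1) d(1)] end_in[OF p assms(2) d(2)]] sum_distrib_left)
qed

lemma h_end_sym: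
  assumes "\<Phi> \<in> fib_end B p" "\<Psi> \<in> fib_end B p"
  shows "h_end B H p \<Psi> \<Phi> = cnj (h_end B H p \<Phi> \<Psi>)"
proof -
  obtain b b' :: "'n \<Rightarrow> 'k" where b: "dual_bases p b b'" by (rule obtain_dual_bases[OF p])
  note d = dual_basesD[OF p b]
  show ?thesis
    unfolding h_end_eq[OF p assms b] h_end_eq[OF p assms(2,1) dual_bases_sym[OF p b]]
    by (simp add: H_sym[OF p end_in[OF p assms(1) d(1)] end_in[OF p assms(2) d(2)]])
qed

lemma h_end_pos:
  assumes \<Phi>: "\<Phi> \<in> fib_end B p" "\<Phi> \<noteq> 0"
  shows "Re (h_end B H p \<Phi> \<Phi>) > 0"
proof -
  obtain e :: "'n \<Rightarrow> 'k" where e: "dual_bases p e e" by (rule orthonormal_basis[OF p])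
  note d = dual_basesD[OF p e]
  have "\<exists>i. \<Phi> (e i) \<noteq> 0"
  proof (rule ccontr)
    assume "\<not> (\<exists>i. \<Phi> (e i) \<noteq> 0)"
    then have z: "\<Phi> (e i) = 0" for i by blast
    have "\<Phi> a = 0" for a
    proof (cases "a \<in> fib B p")
      case True
      have "\<Phi> a = \<Phi> (\<Sum>i\<in>UNIV. scl B (H p a (e i)) (e i))" using d(4)[OF True] by simp
      also have "\<dots> = (\<Sum>i\<in>UNIV. scl B (H p a (e i)) (\<Phi> (e i)))" by (rule end_comb[OF p \<Phi>(1) d(1)])
      finally show ?thesis by (simp add: z)
    qed (rule end_outside[OF p \<Phi>(1)])
    then show False using \<Phi>(2) by (simp add: fun_eq_iff)
  qed
  then obtain j where j: "\<Phi> (e j) \<noteq> 0" by blast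
  have "0 < (\<Sum>i\<in>UNIV. Re (H p (\<Phi> (e i)) (\<Phi> (e i))))"
    by (rule sum_pos2[where i = j]) (use j H_Re_pos[OF p end_in[OF p \<Phi>(1) d(1)]] H_self_nonneg[OF p end_in[OF p \<Phi>(1) d(1)]] in auto)
  then show ?thesis unfolding h_end_eq[OF p \<Phi>(1) \<Phi>(1) e] by simp
qed

lemma pos_def_h_end: "pos_def_form (end_scl B) (fib_end B p) (h_end B H p)"
  unfolding pos_def_form_def hermitian_form_def
  using h_end_add_left h_end_scl_left h_end_sym h_end_pos by blast

end

end

context chern_bundle
begin

lemma D01_comb:
  assumes W: "open_in A W" and f: "\<And>i. smooth_fun A W (f i)" and c: "\<And>i. hol_sec A B W (c i)"
    and p: "p \<in> W" and X: "X \<in> tspace A p"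
  shows "d01 D (\<lambda>q. \<Sum>i\<in>(UNIV :: 'i::finite set). scl B (f i q) (c i q)) p X = (\<Sum>i\<in>UNIV. scl B (der01 A (f i) p X) (c i p))"
  unfolding D_sum(2)[OF W smooth_sec_scl[OF W f hol_sec_imp_smooth[OF c]] p X]
    D_leibniz(2)[OF W hol_sec_imp_smooth[OF c] f p X] D_hol[OF W c p X] by simp

end

section \<open>\<open>CV\<oplus>\<close>-structures with the unfolding condition\<close>

locale cv_unfolding = CV_plus_structure A K C \<U> g \<kappa> h D \<Q>
  for A :: "('a::{t2_space, second_countable_topology}, 'm::finite) chart set"
    and K :: "('a, 'k::ab_group_add, 'n::finite) vbundle"
    and C \<U> g \<kappa> h D \<Q> +
  assumes unf: "unfolding_condition A K C"
begin

sublocale complex_mfd A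
  by unfold_locales (rule M)

sublocale KB: hol_bundle A K
  by unfold_locales (rule K)

sublocale TB: hol_bundle A "tbundle A"
  by unfold_locales (rule holo_bundle_tbundle)

section \<open>\<open>C\<close>, \<open>g\<close> and \<open>h\<close> on smooth sections\<close>

lemma C_0:
  assumes p: "p \<in> mfd A" shows "C p 0 = 0"
proof -
  have e: "tscl 0 0 = (0 :: ('a, 'm) tvec)" by (simp add: tscl_def fun_eq_iff)
  show ?thesis using C_scl[OF p tspace_0[of p], of 0] unfolding e by (simp add: end_scl_def fun_eq_iff)
qed

lemma C_add_apply: "p \<in> mfd A \<Longrightarrow> X \<in> tspace A p \<Longrightarrow> Y \<in> tspace A p \<Longrightarrow> C p (X + Y) a = C p X a + C p Y a"
  by (simp add: C_add)

lemma C_sum: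
  assumes p: "p \<in> mfd A" and X: "\<And>i. i \<in> I \<Longrightarrow> X i \<in> tspace A p"
  shows "C p (\<Sum>i\<in>I. X i) a = (\<Sum>i\<in>I. C p (X i) a)"
  using X
proof (induction I rule: infinite_finite_induct)
  case (insert i I)
  have "(\<Sum>i\<in>I. X i) \<in> tspace A p" using TB.fib_sum[OF p, of I X] insert.prems by simp
  then have "C p (X i + (\<Sum>i\<in>I. X i)) a = C p (X i) a + C p (\<Sum>i\<in>I. X i) a"
    by (intro C_add_apply[OF p]) (simp_all add: insert.prems)
  moreover have "C p (\<Sum>i\<in>I. X i) a = (\<Sum>i\<in>I. C p (X i) a)" by (rule insert.IH) (simp add: insert.prems)
  ultimately show ?case unfolding sum.insert[OF insert.hyps] by (simp only:)
qed (simp_all add: C_0[OF p])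

lemma C_comb:
  assumes p: "p \<in> mfd A" and X: "\<And>i. i \<in> I \<Longrightarrow> X i \<in> tspace A p"
  shows "C p (\<Sum>i\<in>I. tscl (x i) (X i)) a = (\<Sum>i\<in>I. scl K (x i) (C p (X i) a))"
  using C_sum[OF p, of I "\<lambda>i. tscl (x i) (X i)" a] tspace_scl[OF X] C_scl[OF p X]
  by (simp add: end_scl_def)

lemma C_in: "p \<in> mfd A \<Longrightarrow> X \<in> tspace A p \<Longrightarrow> a \<in> fib K p \<Longrightarrow> C p X a \<in> fib K p"
  by (rule KB.end_in[OF _ C_end])

lemma C_scl_apply: "p \<in> mfd A \<Longrightarrow> X \<in> tspace A p \<Longrightarrow> C p (tscl z X) a = scl K z (C p X a)"
  by (simp add: C_scl end_scl_def)

lemma C_commute: "p \<in> mfd A \<Longrightarrow> X \<in> tspace A p \<Longrightarrow> Y \<in> tspace A p \<Longrightarrow> C p X (C p Y a) = C p Y (C p X a)"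
  using C_comm[of p X Y] by (metis comp_apply)

lemma local_frames:
  assumes W: "open_in A W" "p \<in> W"
  obtains S V \<psi> V' \<phi> where "open_in A S" "p \<in> S" "S \<subseteq> W" "S \<subseteq> V" "S \<subseteq> V'"
    "(V, \<psi>) \<in> trivs K" "(V', \<phi>) \<in> trivs (tbundle A)"
proof -
  obtain V \<psi> where t: "(V, \<psi>) \<in> trivs K" "p \<in> V" by (rule KB.obtain_triv[OF open_inD(3)[OF W]])
  obtain V' \<phi> where t': "(V', \<phi>) \<in> trivs (tbundle A)" "p \<in> V'" by (rule TB.obtain_triv[OF open_inD(3)[OF W]])
  show ?thesis
    by (rule that[of "W \<inter> V \<inter> V'", OF open_in_Int(1)[OF open_in_Int(1)[OF W(1) open_inD(1)[OF KB.triv_open[OF t(1)]]]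
            open_inD(1)[OF TB.triv_open[OF t'(1)]]] _ _ _ _ t(1) t'(1)]) (use W t t' in auto)
qed

lemma g_comb_left:
  assumes p: "p \<in> mfd A" and f: "\<And>i. i \<in> I \<Longrightarrow> f i \<in> fib K p" and c: "c \<in> fib K p"
  shows "g p (\<Sum>i\<in>I. scl K (x i) (f i)) c = (\<Sum>i\<in>I. x i * g p (f i) c)"
  using f
proof (induction I rule: infinite_finite_induct)
  case (insert i I)
  have "g p (scl K (x i) (f i) + (\<Sum>i\<in>I. scl K (x i) (f i))) c = g p (scl K (x i) (f i)) c + g p (\<Sum>i\<in>I. scl K (x i) (f i)) c"
    by (rule g_add[OF p KB.fib_scl[OF p] KB.fib_sum[OF p KB.fib_scl[OF p]] c]) (use insert.prems in auto)
  then show ?case using insert g_scl[OF p _ c] by simp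
qed (use g_scl[OF p KB.fib_0[OF p] c, of 0] in simp_all)

text \<open>Regularity of \<open>g\<close> is given for holomorphic sections only; smooth sections
  are reduced to these by expansion in a holomorphic frame. The same device gives
  \<open>C_smooth\<close>.\<close>

lemma g_smooth:
  assumes W: "open_in A W" and s: "smooth_sec A K W s" and s': "smooth_sec A K W s'"
  shows "smooth_fun A W (\<lambda>p. g p (s p) (s' p))"
proof (rule smooth_fun_local)
  fix p assume p: "p \<in> W"
  obtain S V \<psi> V' \<phi> where S: "open_in A S" "p \<in> S" "S \<subseteq> W" "S \<subseteq> V" and t: "(V, \<psi>) \<in> trivs K"
    by (rule local_frames[OF W p])
  note o = open_inD(1)[OF S(1)] and b = KB.hol_sec_subset[OF KB.frm_hol[OF t] S(4)]
  note c = smooth_fun_subset[OF KB.smooth_secD(2)[OF KB.smooth_sec_subset[OF s S(3)] t], of S]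
    smooth_fun_subset[OF KB.smooth_secD(2)[OF KB.smooth_sec_subset[OF s' S(3)] t], of S]
  have e: "(\<Sum>i\<in>UNIV. \<psi> q (s q) $ i * (\<Sum>j\<in>UNIV. \<psi> q (s' q) $ j * g q (KB.frm \<psi> j q) (KB.frm \<psi> i q))) = g q (s q) (s' q)"
    if q: "q \<in> S" for q
  proof -
    have t': "(V, \<psi>) \<in> trivs K" "q \<in> V" "q \<in> W" using t q S by auto
    note m = KB.triv(1)[OF t'(1,2)] and fr = KB.frm(1)[OF t'(1,2)]
    note sq = KB.smooth_secD(1)[OF s t'(3)] KB.smooth_secD(1)[OF s' t'(3)]
    have "g q (s q) (s' q) = g q (\<Sum>i\<in>UNIV. scl K (\<psi> q (s q) $ i) (KB.frm \<psi> i q)) (s' q)"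
      unfolding KB.frm_expand[OF t'(1,2) sq(1)] ..
    also have "\<dots> = (\<Sum>i\<in>UNIV. \<psi> q (s q) $ i * g q (KB.frm \<psi> i q) (s' q))"
      by (rule g_comb_left[OF m fr sq(2)])
    also have "\<dots> = (\<Sum>i\<in>UNIV. \<psi> q (s q) $ i * (\<Sum>j\<in>UNIV. \<psi> q (s' q) $ j * g q (KB.frm \<psi> j q) (KB.frm \<psi> i q)))"
    proof (rule sum.cong[OF refl], rule arg_cong[where f = "(*) _"])
      fix i
      have "g q (KB.frm \<psi> i q) (s' q) = g q (\<Sum>i\<in>UNIV. scl K (\<psi> q (s' q) $ i) (KB.frm \<psi> i q)) (KB.frm \<psi> i q)"
        unfolding KB.frm_expand[OF t'(1,2) sq(2)] by (rule g_sym[OF m fr sq(2)])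
      also have "\<dots> = (\<Sum>j\<in>UNIV. \<psi> q (s' q) $ j * g q (KB.frm \<psi> j q) (KB.frm \<psi> i q))"
        by (rule g_comb_left[OF m fr fr])
      finally show "g q (KB.frm \<psi> i q) (s' q) = (\<Sum>j\<in>UNIV. \<psi> q (s' q) $ j * g q (KB.frm \<psi> j q) (KB.frm \<psi> i q))" .
    qed
    finally show ?thesis ..
  qed
  have SV: "S \<subseteq> S \<inter> V" using S(4) by auto
  have "smooth_fun A S (\<lambda>q. \<Sum>i\<in>UNIV. \<psi> q (s q) $ i * (\<Sum>j\<in>UNIV. \<psi> q (s' q) $ j * g q (KB.frm \<psi> j q) (KB.frm \<psi> i q)))"
    by (rule smooth_fun_sum[OF o smooth_fun_mult[OF o c(1)[OF SV] smooth_fun_sum[OF o smooth_fun_mult[OF o c(2)[OF SV]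
        hol_fun_imp_smooth_fun[OF g_hol[OF S(1) b b]]]]]])
  then have "smooth_fun A S (\<lambda>q. g q (s q) (s' q))" by (rule smooth_fun_cong[OF o, rotated]) (rule e)
  then show "\<exists>V. open V \<and> p \<in> V \<and> smooth_fun A V (\<lambda>p. g p (s p) (s' p))" using o S(2) by blast
qed

lemma h_smooth:
  assumes W: "open_in A W" and s: "smooth_sec A K W s" and s': "smooth_sec A K W s'"
  shows "smooth_fun A W (\<lambda>p. h p (s p) (s' p))"
  by (rule smooth_fun_cong[OF open_inD(1)[OF W] _ g_smooth[OF W s kappa_smooth[OF W s']]])
    (rule h_def[OF open_inD(3)[OF W] KB.smooth_secD(1)[OF s] KB.smooth_secD(1)[OF s'], symmetric])

sublocale KB: chern_bundle A K h D
  by unfold_locales (fact h_pos, fact h_smooth, fact D_chern)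

lemma C_smooth:
  assumes W: "open_in A W" and \<xi>: "smooth_sec A (tbundle A) W \<xi>" and s: "smooth_sec A K W s"
  shows "smooth_sec A K W (\<lambda>p. C p (\<xi> p) (s p))"
proof (rule KB.smooth_sec_local)
  fix p assume p: "p \<in> W"
  obtain S V \<psi> V' \<phi> where S: "open_in A S" "p \<in> S" "S \<subseteq> W" "S \<subseteq> V" "S \<subseteq> V'"
    and t: "(V, \<psi>) \<in> trivs K" "(V', \<phi>) \<in> trivs (tbundle A)"
    by (rule local_frames[OF W p])
  note o = open_inD(1)[OF S(1)] and b = KB.hol_sec_subset[OF KB.frm_hol[OF t(1)] S(4)]
    and b' = TB.hol_sec_subset[OF TB.frm_hol[OF t(2)] S(5)]
  have SV: "S \<subseteq> S \<inter> V" "S \<subseteq> S \<inter> V'" using S by auto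
  note c = smooth_fun_subset[OF KB.smooth_secD(2)[OF KB.smooth_sec_subset[OF s S(3)] t(1)] SV(1)]
    smooth_fun_subset[OF TB.smooth_secD(2)[OF TB.smooth_sec_subset[OF \<xi> S(3)] t(2)] SV(2)]
  have e: "(\<Sum>i\<in>UNIV. scl K (\<phi> q (\<xi> q) $ i) (\<Sum>j\<in>UNIV. scl K (\<psi> q (s q) $ j) (C q (TB.frm \<phi> i q) (KB.frm \<psi> j q)))) = C q (\<xi> q) (s q)"
    if q: "q \<in> S" for q
  proof -
    have t': "q \<in> V" "q \<in> V'" "q \<in> W" using q S by auto
    note m = KB.triv(1)[OF t(1) t'(1)] and fr = KB.frm(1)[OF t(1) t'(1)] and fr' = TB.frm(1)[OF t(2) t'(2), simplified]
    note sq = KB.smooth_secD(1)[OF s t'(3)] and xq = TB.smooth_secD(1)[OF \<xi> t'(3)]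
    have "C q (\<xi> q) (s q) = C q (\<Sum>i\<in>UNIV. tscl (\<phi> q (\<xi> q) $ i) (TB.frm \<phi> i q)) (s q)"
      using TB.frm_expand[OF t(2) t'(2) xq] by simp
    also have "\<dots> = (\<Sum>i\<in>UNIV. scl K (\<phi> q (\<xi> q) $ i) (C q (TB.frm \<phi> i q) (s q)))" by (rule C_comb[OF m fr'])
    also have "\<dots> = (\<Sum>i\<in>UNIV. scl K (\<phi> q (\<xi> q) $ i) (\<Sum>j\<in>UNIV. scl K (\<psi> q (s q) $ j) (C q (TB.frm \<phi> i q) (KB.frm \<psi> j q))))"
    proof (rule sum.cong[OF refl], rule arg_cong[where f = "scl K _"])
      fix i
      have "C q (TB.frm \<phi> i q) (s q) = C q (TB.frm \<phi> i q) (\<Sum>j\<in>UNIV. scl K (\<psi> q (s q) $ j) (KB.frm \<psi> j q))"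
        unfolding KB.frm_expand[OF t(1) t'(1) sq] ..
      also have "\<dots> = (\<Sum>j\<in>UNIV. scl K (\<psi> q (s q) $ j) (C q (TB.frm \<phi> i q) (KB.frm \<psi> j q)))"
        by (rule KB.end_comb[OF m C_end[OF m fr'] fr])
      finally show "C q (TB.frm \<phi> i q) (s q) = (\<Sum>j\<in>UNIV. scl K (\<psi> q (s q) $ j) (C q (TB.frm \<phi> i q) (KB.frm \<psi> j q)))" .
    qed
    finally show ?thesis ..
  qed
  have "smooth_sec A K S (\<lambda>q. \<Sum>i\<in>UNIV. scl K (\<phi> q (\<xi> q) $ i) (\<Sum>j\<in>UNIV. scl K (\<psi> q (s q) $ j) (C q (TB.frm \<phi> i q) (KB.frm \<psi> j q))))"
    by (rule KB.smooth_sec_sum[OF S(1) KB.smooth_sec_scl[OF S(1) c(2) KB.smooth_sec_sum[OF S(1) KB.smooth_sec_scl[OF S(1) c(1)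
        KB.hol_sec_imp_smooth[OF C_hol[OF S(1) b' b]]]]]])
  then have "smooth_sec A K S (\<lambda>q. C q (\<xi> q) (s q))" by (rule KB.smooth_sec_cong[OF o, rotated]) (rule e)
  then show "\<exists>V. open V \<and> p \<in> V \<and> smooth_sec A K V (\<lambda>p. C p (\<xi> p) (s p))" using o S(2) by blast
qed

text \<open>In a holomorphic frame the (0,1)-derivative acts on coefficients only, and a holomorphic
  endomorphism maps the frame to holomorphic sections. So the two operations commute.\<close>

lemma D01_C:
  assumes W: "open_in A W" and \<xi>: "hol_sec A (tbundle A) W \<xi>" and s: "smooth_sec A K W s"
    and p: "p \<in> W" and X: "X \<in> tspace A p"
  shows "d01 D (\<lambda>q. C q (\<xi> q) (s q)) p X = C p (\<xi> p) (d01 D s p X)"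
proof -
  obtain S V \<psi> V' \<phi> where S: "open_in A S" "p \<in> S" "S \<subseteq> W" "S \<subseteq> V" and t: "(V, \<psi>) \<in> trivs K"
    by (rule local_frames[OF W p])
  have SV: "S \<subseteq> S \<inter> V" using S by auto
  note b = KB.hol_sec_subset[OF KB.frm_hol[OF t] S(4)] and \<xi>S = TB.hol_sec_subset[OF \<xi> S(3)] and sS = KB.smooth_sec_subset[OF s S(3)]
  note c = smooth_fun_subset[OF KB.smooth_secD(2)[OF sS t] SV]
  note Cs = C_smooth[OF S(1) TB.hol_sec_imp_smooth[OF \<xi>S] sS] and Cb = C_hol[OF S(1) \<xi>S b]
  have e: "(\<Sum>i\<in>UNIV. scl K (\<psi> q (s q) $ i) (KB.frm \<psi> i q)) = s q"
    "(\<Sum>i\<in>UNIV. scl K (\<psi> q (s q) $ i) (C q (\<xi> q) (KB.frm \<psi> i q))) = C q (\<xi> q) (s q)" if q: "q \<in> S" for q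
  proof -
    have t': "(V, \<psi>) \<in> trivs K" "q \<in> V" using t q S by auto
    show 1: "(\<Sum>i\<in>UNIV. scl K (\<psi> q (s q) $ i) (KB.frm \<psi> i q)) = s q"
      by (rule KB.frm_expand[OF t' KB.smooth_secD(1)[OF sS q]])
    have "C q (\<xi> q) (\<Sum>i\<in>UNIV. scl K (\<psi> q (s q) $ i) (KB.frm \<psi> i q)) = (\<Sum>i\<in>UNIV. scl K (\<psi> q (s q) $ i) (C q (\<xi> q) (KB.frm \<psi> i q)))"
      by (rule KB.end_comb[OF open_inD(3)[OF S(1) q] C_end[OF open_inD(3)[OF S(1) q] KB.vf_tspace[OF \<xi>S q]] KB.frm(1)[OF t']])
    then show "(\<Sum>i\<in>UNIV. scl K (\<psi> q (s q) $ i) (C q (\<xi> q) (KB.frm \<psi> i q))) = C q (\<xi> q) (s q)" unfolding 1 ..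
  qed
  have "d01 D (\<lambda>q. C q (\<xi> q) (s q)) p X = d01 D (\<lambda>q. \<Sum>i\<in>UNIV. scl K (\<psi> q (s q) $ i) (C q (\<xi> q) (KB.frm \<psi> i q))) p X"
    by (rule KB.D_cong(2)[OF S(1) Cs e(2) S(2) X, symmetric])
  also have "\<dots> = (\<Sum>i\<in>UNIV. scl K (der01 A (\<lambda>q. \<psi> q (s q) $ i) p X) (C p (\<xi> p) (KB.frm \<psi> i p)))"
    by (rule KB.D01_comb[OF S(1) c Cb S(2) X])
  also have "\<dots> = C p (\<xi> p) (\<Sum>i\<in>UNIV. scl K (der01 A (\<lambda>q. \<psi> q (s q) $ i) p X) (KB.frm \<psi> i p))"
    by (rule KB.end_comb[OF open_inD(3)[OF W p] C_end[OF open_inD(3)[OF W p] KB.vf_tspace[OF \<xi> p]], symmetric])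
      (rule KB.hol_secD(1)[OF b S(2)])
  also have "(\<Sum>i\<in>UNIV. scl K (der01 A (\<lambda>q. \<psi> q (s q) $ i) p X) (KB.frm \<psi> i p)) = d01 D s p X"
    unfolding KB.D01_comb[OF S(1) c b S(2) X, symmetric] by (rule KB.D_cong(2)[OF S(1) sS e(1) S(2) X])
  finally show ?thesis .
qed

section \<open>The unfolding section, unit and multiplication\<close>

lemma obtain_zeta:
  obtains \<zeta> where "hol_sec A K (mfd A) \<zeta>" "\<And>p. p \<in> mfd A \<Longrightarrow> bij_betw (\<lambda>X. - C p X (\<zeta> p)) (tspace A p) (fib K p)"
  using unf unfolding unfolding_condition_def by blast

lemma open_in_mfd: "open_in A (mfd A)"
  by (simp add: open_in_def open_mfd)

lemma C_inj_zeta: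
  assumes "p \<in> mfd A" "bij_betw (\<lambda>X. - C p X a) (tspace A p) (fib K p)"
    "X \<in> tspace A p" "Y \<in> tspace A p" "C p X a = C p Y a"
  shows "X = Y"
  using assms unfolding bij_betw_def inj_on_def by auto

lemma C_inj:
  assumes "p \<in> mfd A" "X \<in> tspace A p" "Y \<in> tspace A p" "C p X = C p Y"
  shows "X = Y"
proof -
  obtain \<zeta> where "hol_sec A K (mfd A) \<zeta>" and z: "bij_betw (\<lambda>X. - C p X (\<zeta> p)) (tspace A p) (fib K p)"
    using obtain_zeta assms(1) by metis
  show ?thesis by (rule C_inj_zeta[OF assms(1) z assms(2,3)]) (simp add: assms(4))
qed

text \<open>Every vector of the fibre has the form \<open>C p Y (\<zeta> p)\<close>, so an
  endomorphism commuting with all \<open>C p Y\<close> is determined by its value at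
  \<open>\<zeta> p\<close>. The \<open>X\<close> with the same value at \<open>\<zeta> p\<close> is
  therefore the one sought.\<close>

lemma C_ex:
  assumes p: "p \<in> mfd A" and \<Phi>: "\<Phi> \<in> fib_end K p"
    and comm: "\<And>Y a. Y \<in> tspace A p \<Longrightarrow> a \<in> fib K p \<Longrightarrow> \<Phi> (C p Y a) = C p Y (\<Phi> a)"
  shows "\<exists>X\<in>tspace A p. C p X = \<Phi>"
proof -
  obtain \<zeta> where \<zeta>: "hol_sec A K (mfd A) \<zeta>" and z: "bij_betw (\<lambda>X. - C p X (\<zeta> p)) (tspace A p) (fib K p)"
    using obtain_zeta p by metis
  have zp: "\<zeta> p \<in> fib K p" by (rule KB.hol_secD(1)[OF \<zeta> p])
  have im: "(\<lambda>X. - C p X (\<zeta> p)) ` tspace A p = fib K p" using z by (simp add: bij_betw_def)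
  have "- \<Phi> (\<zeta> p) \<in> (\<lambda>X. - C p X (\<zeta> p)) ` tspace A p"
    unfolding im by (rule KB.fib_neg[OF p KB.end_in[OF p \<Phi> zp]])
  then obtain X where X: "X \<in> tspace A p" "C p X (\<zeta> p) = \<Phi> (\<zeta> p)" by auto
  have "C p X a = \<Phi> a" if "a \<in> fib K p" for a
  proof -
    have "- a \<in> (\<lambda>X. - C p X (\<zeta> p)) ` tspace A p" unfolding im by (rule KB.fib_neg[OF p that])
    then obtain Y where Y: "Y \<in> tspace A p" "a = C p Y (\<zeta> p)" by auto
    show ?thesis unfolding Y(2) C_commute[OF p X(1) Y(1)] X(2) comm[OF Y(1) zp] ..
  qed
  then show ?thesis using KB.fib_end_eqI[OF p C_end[OF p X(1)] \<Phi>] X(1) by blast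
qed

definition neg_id :: "'a \<Rightarrow> 'k \<Rightarrow> 'k" where
  "neg_id p a = (if a \<in> fib K p then - a else 0)"

lemma neg_id_end: "p \<in> mfd A \<Longrightarrow> neg_id p \<in> fib_end K p"
  by (intro KB.fib_endI) (simp_all add: neg_id_def KB.fib_neg KB.fib_add KB.fib_scl)

lemma cv_unit:
  assumes p: "p \<in> mfd A"
  shows "cv_unit A K C p \<in> tspace A p" "C p (cv_unit A K C p) = neg_id p"
proof -
  have "neg_id p (C p Y a) = C p Y (neg_id p a)" if "Y \<in> tspace A p" "a \<in> fib K p" for Y a
    using KB.end_neg[OF p C_end[OF p that(1)] that(2)] C_in[OF p that] that(2) by (simp add: neg_id_def)
  then obtain X where X: "X \<in> tspace A p" "C p X = neg_id p"
    using C_ex[OF p neg_id_end[OF p]] by blast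
  have "cv_unit A K C p = X"
    unfolding cv_unit_def
  proof (rule the_equality)
    show "X \<in> tspace A p \<and> (\<forall>a\<in>fib K p. C p X a = - a)" using X by (simp add: neg_id_def)
    fix Y assume Y: "Y \<in> tspace A p \<and> (\<forall>a\<in>fib K p. C p Y a = - a)"
    have "C p Y = neg_id p"
      by (rule KB.fib_end_eqI[OF p C_end[OF p] neg_id_end[OF p]]) (use Y in \<open>simp_all add: neg_id_def\<close>)
    then show "Y = X" using C_inj[OF p] X Y by metis
  qed
  then show "cv_unit A K C p \<in> tspace A p" "C p (cv_unit A K C p) = neg_id p" using X by simp_all
qed

lemma cv_mult:
  assumes p: "p \<in> mfd A" and X: "X \<in> tspace A p" and Y: "Y \<in> tspace A p"
  shows "cv_mult A K C p X Y \<in> tspace A p" "C p (cv_mult A K C p X Y) a = - C p X (C p Y a)"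
proof -
  define \<Phi> where "\<Phi> a = - C p X (C p Y a)" for a
  have "\<Phi> = end_scl K (-1) (\<lambda>a. C p X (C p Y a))" by (simp add: \<Phi>_def end_scl_def fun_eq_iff)
  then have \<Phi>: "\<Phi> \<in> fib_end K p" using KB.fib_end_scl[OF p KB.fib_end_comp[OF p C_end[OF p X] C_end[OF p Y]]] by simp
  have "\<Phi> (C p Z a) = C p Z (\<Phi> a)" if "Z \<in> tspace A p" "a \<in> fib K p" for Z a
    unfolding \<Phi>_def KB.end_neg[OF p C_end[OF p that(1)] C_in[OF p X C_in[OF p Y that(2)]]]
      C_commute[OF p that(1) X] C_commute[OF p that(1) Y] ..
  then obtain Z where Z: "Z \<in> tspace A p" "C p Z = \<Phi>" using C_ex[OF p \<Phi>] by blast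
  have "cv_mult A K C p X Y = Z"
    unfolding cv_mult_def
  proof (rule the_equality)
    show "Z \<in> tspace A p \<and> (\<forall>a\<in>fib K p. C p Z a = - C p X (C p Y a))" using Z by (simp add: \<Phi>_def)
    fix Z' assume Z': "Z' \<in> tspace A p \<and> (\<forall>a\<in>fib K p. C p Z' a = - C p X (C p Y a))"
    have "C p Z' = \<Phi>"
      by (rule KB.fib_end_eqI[OF p C_end[OF p] \<Phi>]) (use Z' in \<open>simp_all add: \<Phi>_def\<close>)
    then show "Z' = Z" using C_inj[OF p] Z Z' by metis
  qed
  then show "cv_mult A K C p X Y \<in> tspace A p" "C p (cv_mult A K C p X Y) a = - C p X (C p Y a)"
    using Z by (simp_all add: \<Phi>_def)
qed

subsection \<open>The metric on the tangent bundle\<close>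

lemma pos_def_h_M:
  assumes p: "p \<in> mfd A" shows "pos_def_form tscl (tspace A p) (h_M K C h p)"
  unfolding pos_def_form_def hermitian_form_def h_M_def
proof (intro conjI ballI allI)
  fix X assume X: "X \<in> tspace A p - {0}"
  then have "C p X \<noteq> C p 0" using C_inj[OF p _ tspace_0] by blast
  then show "Re (h_end K h p (C p X) (C p X)) > 0"
    using KB.h_end_pos[OF p C_end[OF p]] X by (simp add: C_0[OF p])
next
  fix X Y Z assume "X \<in> tspace A p" "Y \<in> tspace A p" "Z \<in> tspace A p"
  then show "h_end K h p (C p (X + Y)) (C p Z) = h_end K h p (C p X) (C p Z) + h_end K h p (C p Y) (C p Z)"
    using KB.h_end_add_left[OF p C_end[OF p] C_end[OF p] C_end[OF p], of X Y Z] C_add[OF p, of X Y] by simp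
next
  fix z X Y assume "X \<in> tspace A p" "Y \<in> tspace A p"
  then show "h_end K h p (C p (tscl z X)) (C p Y) = z * h_end K h p (C p X) (C p Y)"
    using KB.h_end_scl_left[OF p C_end[OF p] C_end[OF p], of X Y z] C_scl[OF p, of X z] by simp
next
  fix X Y assume "X \<in> tspace A p" "Y \<in> tspace A p"
  then show "h_end K h p (C p Y) (C p X) = cnj (h_end K h p (C p X) (C p Y))"
    by (intro KB.h_end_sym[OF p] C_end[OF p])
qed

lemma h_M_eq:
  assumes t: "(V, \<psi>) \<in> trivs K" "p \<in> V" and X: "X \<in> tspace A p" "Y \<in> tspace A p"
  shows "h_M K C h p X Y = (\<Sum>i\<in>UNIV. h p (C p X (KB.frm \<psi> i p)) (C p Y (KB.dfrm \<psi> i p)))"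
  unfolding h_M_def
  by (rule KB.h_end_eq[OF KB.triv(1)[OF t] C_end[OF KB.triv(1)[OF t] X(1)] C_end[OF KB.triv(1)[OF t] X(2)] KB.dfrm_dual[OF t]])

lemma h_M_smooth:
  assumes W: "open_in A W" and X: "smooth_sec A (tbundle A) W X" and Y: "smooth_sec A (tbundle A) W Y"
  shows "smooth_fun A W (\<lambda>p. h_M K C h p (X p) (Y p))"
proof (rule smooth_fun_local)
  fix p assume p: "p \<in> W"
  obtain S V \<psi> V' \<phi> where S: "open_in A S" "p \<in> S" "S \<subseteq> W" "S \<subseteq> V" and t: "(V, \<psi>) \<in> trivs K"
    by (rule local_frames[OF W p])
  note o = open_inD(1)[OF S(1)]
  have 1: "smooth_fun A S (\<lambda>q. \<Sum>i\<in>UNIV. h q (C q (X q) (KB.frm \<psi> i q)) (C q (Y q) (KB.dfrm \<psi> i q)))"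
    by (rule smooth_fun_sum[OF o h_smooth[OF S(1) C_smooth[OF S(1) TB.smooth_sec_subset[OF X S(3)] KB.smooth_sec_subset[OF KB.frm_smooth[OF t] S(4)]]
        C_smooth[OF S(1) TB.smooth_sec_subset[OF Y S(3)] KB.smooth_sec_subset[OF KB.dfrm_smooth[OF t] S(4)]]]])
  have 2: "(\<Sum>i\<in>UNIV. h q (C q (X q) (KB.frm \<psi> i q)) (C q (Y q) (KB.dfrm \<psi> i q))) = h_M K C h q (X q) (Y q)" if "q \<in> S" for q
  proof -
    have q: "q \<in> V" "q \<in> W" using S that by auto
    show ?thesis
      by (rule h_M_eq[OF t q(1) TB.smooth_secD(1)[OF X q(2), simplified] TB.smooth_secD(1)[OF Y q(2), simplified], symmetric])
  qed
  have "smooth_fun A S (\<lambda>p. h_M K C h p (X p) (Y p))"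
    by (rule smooth_fun_cong[OF o _ 1]) (rule 2)
  then show "\<exists>V. open V \<and> p \<in> V \<and> smooth_fun A V (\<lambda>p. h_M K C h p (X p) (Y p))" using o S(2) by blast
qed

sublocale TB: herm_bundle A "tbundle A" "h_M K C h"
  by unfold_locales (simp_all add: pos_def_h_M h_M_smooth)

text \<open>The unit is given pointwise by \<open>THE\<close>, but as it acts by minus the identity
  its pairings under \<open>h_M\<close> with frame fields are explicit smooth functions; these are
  its coefficients in the dual frame.\<close>

lemma unit_smooth: "smooth_sec A (tbundle A) (mfd A) (cv_unit A K C)"
proof (rule TB.smooth_sec_local)
  fix p assume p: "p \<in> mfd A"
  obtain S V \<psi> V' \<phi> where S: "open_in A S" "p \<in> S" "S \<subseteq> V" "S \<subseteq> V'"
    and t: "(V, \<psi>) \<in> trivs K" "(V', \<phi>) \<in> trivs (tbundle A)"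
    by (rule local_frames[OF open_in_mfd p])
  note o = open_inD(1)[OF S(1)]
  note b = KB.smooth_sec_subset[OF KB.frm_smooth[OF t(1)] S(3)] KB.smooth_sec_subset[OF KB.dfrm_smooth[OF t(1)] S(3)]
    and \<delta> = TB.smooth_sec_subset[OF TB.frm_smooth[OF t(2)] S(4)] TB.smooth_sec_subset[OF TB.dfrm_smooth[OF t(2)] S(4)]
  have 1: "smooth_sec A (tbundle A) S (\<lambda>q. \<Sum>i\<in>UNIV. scl (tbundle A) (\<Sum>j\<in>UNIV. h q (scl K (-1) (KB.frm \<psi> j q)) (C q (TB.frm \<phi> i q) (KB.dfrm \<psi> j q))) (TB.dfrm \<phi> i q))"
    by (rule TB.smooth_sec_sum[OF S(1) TB.smooth_sec_scl[OF S(1) smooth_fun_sum[OF o h_smooth[OF S(1) KB.smooth_sec_scl[OF S(1) smooth_fun_const b(1)]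
        C_smooth[OF S(1) \<delta>(1) b(2)]]] \<delta>(2)]])
  have 2: "(\<Sum>i\<in>UNIV. scl (tbundle A) (\<Sum>j\<in>UNIV. h q (scl K (-1) (KB.frm \<psi> j q)) (C q (TB.frm \<phi> i q) (KB.dfrm \<psi> j q))) (TB.dfrm \<phi> i q)) = cv_unit A K C q"
    if q: "q \<in> S" for q
  proof -
    have q': "q \<in> V" "q \<in> V'" using q S by auto
    note m = KB.triv(1)[OF t(1) q'(1)] and f = TB.frm(1)[OF t(2) q'(2), simplified]
    have "h_M K C h q (cv_unit A K C q) (TB.frm \<phi> i q) = (\<Sum>j\<in>UNIV. h q (scl K (-1) (KB.frm \<psi> j q)) (C q (TB.frm \<phi> i q) (KB.dfrm \<psi> j q)))" for i
      unfolding h_M_eq[OF t(1) q'(1) cv_unit(1)[OF m] f] cv_unit(2)[OF m] neg_id_def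
      using KB.frm(1)[OF t(1) q'(1)] by simp
    then show ?thesis
      using TB.dual_basesD(4)[OF m TB.dual_bases_sym[OF m TB.dfrm_dual[OF t(2) q'(2)]], of "cv_unit A K C q"] cv_unit(1)[OF m]
      by simp
  qed
  have "smooth_sec A (tbundle A) S (cv_unit A K C)" by (rule TB.smooth_sec_cong[OF o _ 1]) (rule 2)
  then show "\<exists>V. open V \<and> p \<in> V \<and> smooth_sec A (tbundle A) V (cv_unit A K C)" using o S(2) by blast
qed

text \<open>The (0,1)-derivative is applied to the identity that the unit maps \<zeta> to its
  negative. As \<open>C\<close> and \<zeta> are holomorphic, only the coefficients of the unit are
  differentiated, and injectivity of \<open>C\<close> at \<zeta> makes their derivatives vanish.
  Smoothness is needed beforehand to differentiate at all.\<close>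

lemma unit_hol:
  assumes p: "p \<in> mfd A"
  obtains W where "open_in A W" "p \<in> W" "hol_sec A (tbundle A) W (cv_unit A K C)"
proof -
  let ?e = "cv_unit A K C"
  obtain S V \<psi> V' \<phi> where S: "open_in A S" "p \<in> S" "S \<subseteq> V" "S \<subseteq> V'"
    and t: "(V, \<psi>) \<in> trivs K" "(V', \<phi>) \<in> trivs (tbundle A)"
    by (rule local_frames[OF open_in_mfd p])
  note o = open_inD(1)[OF S(1)]
  have SM: "S \<subseteq> mfd A" using open_inD(3)[OF S(1)] by blast
  then have SV: "S \<subseteq> mfd A \<inter> V'" using S by auto
  note x = smooth_fun_subset[OF TB.smooth_secD(2)[OF unit_smooth t(2)] SV]
  note b = TB.hol_sec_subset[OF TB.frm_hol[OF t(2)] S(4)]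
  obtain \<zeta> where \<zeta>: "hol_sec A K (mfd A) \<zeta>" and z: "\<And>p. p \<in> mfd A \<Longrightarrow> bij_betw (\<lambda>X. - C p X (\<zeta> p)) (tspace A p) (fib K p)"
    using obtain_zeta by blast
  note \<zeta>S = KB.hol_sec_subset[OF \<zeta> SM]
  note Cb = C_hol[OF S(1) b \<zeta>S]
  have fr: "TB.frm \<phi> i r \<in> tspace A r" if "r \<in> S" for i r using TB.frm(1)[OF t(2), of r i] that S by auto
  have ex: "(\<Sum>i\<in>UNIV. tscl (\<phi> q (?e q) $ i) (TB.frm \<phi> i q)) = ?e q" if q: "q \<in> S" for q
    using TB.frm_expand[OF t(2), of q "?e q"] cv_unit(1)[OF open_inD(3)[OF S(1) q]] q S by auto
  have e: "(\<Sum>i\<in>UNIV. scl K (\<phi> r (?e r) $ i) (C r (TB.frm \<phi> i r) (\<zeta> r))) = scl K (-1) (\<zeta> r)" if r: "r \<in> S" for r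
  proof -
    note mr = open_inD(3)[OF S(1) r]
    have "scl K (-1) (\<zeta> r) = C r (?e r) (\<zeta> r)"
      unfolding cv_unit(2)[OF mr] using KB.hol_secD(1)[OF \<zeta> mr] by (simp add: neg_id_def)
    also have "\<dots> = C r (\<Sum>i\<in>UNIV. tscl (\<phi> r (?e r) $ i) (TB.frm \<phi> i r)) (\<zeta> r)" unfolding ex[OF r] ..
    also have "\<dots> = (\<Sum>i\<in>UNIV. scl K (\<phi> r (?e r) $ i) (C r (TB.frm \<phi> i r) (\<zeta> r)))"
      by (rule C_comb[OF mr fr[OF r]])
    finally show ?thesis ..
  qed
  have hx: "hol_fun A S (\<lambda>q. \<phi> q (?e q) $ i)" for i
  proof (rule hol_funI_der01[OF S(1) x])
    fix q X assume q: "q \<in> S" and X: "X \<in> tspace A q"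
    note m = open_inD(3)[OF S(1) q]
    \<comment> \<open>\<open>?Z\<close> is the (0,1)-derivative of the unit field; the goal is that
      it is zero.\<close>
    let ?Z = "\<Sum>i\<in>UNIV. tscl (der01 A (\<lambda>q. \<phi> q (?e q) $ i) q X) (TB.frm \<phi> i q)"
    note z1 = KB.smooth_sec_scl[OF S(1) smooth_fun_const KB.hol_sec_imp_smooth[OF \<zeta>S], of "-1"]
    have "C q ?Z (\<zeta> q) = (\<Sum>i\<in>UNIV. scl K (der01 A (\<lambda>q. \<phi> q (?e q) $ i) q X) (C q (TB.frm \<phi> i q) (\<zeta> q)))"
      by (rule C_comb[OF m fr[OF q]])
    also have "\<dots> = d01 D (\<lambda>q. \<Sum>i\<in>UNIV. scl K (\<phi> q (?e q) $ i) (C q (TB.frm \<phi> i q) (\<zeta> q))) q X"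
      by (rule KB.D01_comb[OF S(1) x Cb q X, symmetric])
    also have "\<dots> = d01 D (\<lambda>q. scl K (-1) (\<zeta> q)) q X"
      by (rule KB.D_cong(2)[OF S(1) z1 _ q X]) (rule e)
    also have "\<dots> = 0"
      unfolding KB.D_leibniz(2)[OF S(1) KB.hol_sec_imp_smooth[OF \<zeta>S] smooth_fun_const q X] der_const(2)[OF S(1) q X]
        KB.D_hol[OF S(1) \<zeta>S q X] by simp
    finally have Z: "C q ?Z (\<zeta> q) = C q 0 (\<zeta> q)" by (simp add: C_0[OF m])
    have qV: "q \<in> V'" using q S by auto
    have Zt: "?Z \<in> tspace A q" using TB.comb_in_fib[OF t(2) qV, where I = UNIV and x = "\<lambda>i. der01 A (\<lambda>q. \<phi> q (?e q) $ i) q X"] by simp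
    have Z0: "?Z = 0" by (rule C_inj_zeta[OF m z[OF m] Zt tspace_0 Z])
    have "der01 A (\<lambda>q. \<phi> q (?e q) $ i) q X = \<phi> q ?Z $ i"
      using TB.triv_comb[OF t(2) qV, of "\<lambda>i. der01 A (\<lambda>q. \<phi> q (?e q) $ i) q X" i] by simp
    also have "\<dots> = 0" unfolding Z0 using TB.triv_sum[OF t(2) qV, of "{}"] by simp
    finally show "der01 A (\<lambda>q. \<phi> q (?e q) $ i) q X = 0" .
  qed
  have h: "hol_sec A (tbundle A) S (\<lambda>q. \<Sum>i\<in>UNIV. scl (tbundle A) (\<phi> q (?e q) $ i) (TB.frm \<phi> i q))"
    by (rule TB.hol_sec_comb[OF S(1) t(2) S(4) hx b])
  have "hol_sec A (tbundle A) S ?e"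
  proof (rule TB.hol_secI)
    show "?e q \<in> fib (tbundle A) q" if "q \<in> S" for q using cv_unit(1)[OF open_inD(3)[OF S(1) that]] by simp
    fix U \<theta> i assume u: "(U, \<theta>) \<in> trivs (tbundle A)"
    show "hol_fun A (S \<inter> U) (\<lambda>q. \<theta> q (?e q) $ i)"
      by (rule hol_fun_cong[OF TB.open_triv[OF o u] _ TB.hol_secD(2)[OF h u]]) (simp add: ex)
  qed
  then show ?thesis using that S(1,2) by blast
qed

subsection \<open>The curvature of the induced metric\<close>

definition adj_C :: "'a \<Rightarrow> ('a, 'm) tvec \<Rightarrow> 'k \<Rightarrow> 'k" where
  "adj_C p X a = (if a \<in> fib K p then \<kappa> p (C p X (\<kappa> p a)) else 0)"

lemma adj_C_end:
  assumes p: "p \<in> mfd A" and X: "X \<in> tspace A p" shows "adj_C p X \<in> fib_end K p"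
proof (rule KB.fib_endI)
  fix a assume a: "a \<in> fib K p"
  note k = kappa_fib[OF p]
  show "adj_C p X a \<in> fib K p" unfolding adj_C_def using a C_in[OF p X] k by simp
  show "adj_C p X (scl K z a) = scl K z (adj_C p X a)" for z
    unfolding adj_C_def using a KB.fib_scl[OF p a] KB.end_scl[OF p C_end[OF p X] k[OF a]] C_in[OF p X] k kappa_scl[OF p] by simp
  fix b assume b: "b \<in> fib K p"
  show "adj_C p X (a + b) = adj_C p X a + adj_C p X b"
    unfolding adj_C_def
    using a b KB.fib_add[OF p a b] KB.end_add[OF p C_end[OF p X] k[OF a] k[OF b]] C_in[OF p X] k kappa_add[OF p] by simp
qed (simp add: adj_C_def)

lemma adj_C:
  assumes p: "p \<in> mfd A" and X: "X \<in> tspace A p" and a: "a \<in> fib K p" and b: "b \<in> fib K p"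
  shows "h p (C p X a) b = h p a (adj_C p X b)"
proof -
  note k = kappa_fib[OF p b]
  have "h p (C p X a) b = g p (C p X a) (\<kappa> p b)" by (rule h_def[OF p C_in[OF p X a] b])
  also have "\<dots> = g p a (C p X (\<kappa> p b))" by (rule C_g[OF p X a k])
  also have "\<dots> = g p a (\<kappa> p (\<kappa> p (C p X (\<kappa> p b))))" unfolding kappa_invol[OF p C_in[OF p X k]] ..
  also have "\<dots> = h p a (adj_C p X b)"
    unfolding adj_C_def using b h_def[OF p a kappa_fib[OF p C_in[OF p X k]]] by simp
  finally show ?thesis .
qed

definition comm_C :: "'a \<Rightarrow> ('a, 'm) tvec \<Rightarrow> 'k \<Rightarrow> 'k" where
  "comm_C p X = (\<lambda>a. C p X (adj_C p X a)) - (\<lambda>a. adj_C p X (C p X a))"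

lemma comm_C_end:
  assumes p: "p \<in> mfd A" and X: "X \<in> tspace A p" shows "comm_C p X \<in> fib_end K p"
  unfolding comm_C_def
  by (rule KB.fib_end_diff[OF p KB.fib_end_comp[OF p C_end[OF p X] adj_C_end[OF p X]]
        KB.fib_end_comp[OF p adj_C_end[OF p X] C_end[OF p X]]])

text \<open>For the trace form, multiplication by \<open>C p X\<close> on the left or on the right
  has as adjoint the multiplication by \<open>adj_C p X\<close> on the same side. On the right this
  is the cyclic invariance of the trace, carried out in dual bases.\<close>

lemma h_end_C_cyclic:
  assumes p: "p \<in> mfd A" and \<Phi>: "\<Phi> \<in> fib_end K p" and \<Psi>: "\<Psi> \<in> fib_end K p" and X: "X \<in> tspace A p"
  shows "h_end K h p (\<lambda>a. C p X (\<Phi> a)) \<Psi> = h_end K h p \<Phi> (\<lambda>a. adj_C p X (\<Psi> a))"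
    "h_end K h p (\<lambda>a. \<Phi> (C p X a)) \<Psi> = h_end K h p \<Phi> (\<lambda>a. \<Psi> (adj_C p X a))"
proof -
  obtain b b' :: "'n \<Rightarrow> 'k" where b: "KB.dual_bases p b b'" by (rule KB.obtain_dual_bases[OF p])
  note d = KB.dual_basesD[OF p b] and Ce = C_end[OF p X] and Ae = adj_C_end[OF p X]
  show "h_end K h p (\<lambda>a. C p X (\<Phi> a)) \<Psi> = h_end K h p \<Phi> (\<lambda>a. adj_C p X (\<Psi> a))"
    unfolding KB.h_end_eq[OF p KB.fib_end_comp[OF p Ce \<Phi>] \<Psi> b] KB.h_end_eq[OF p \<Phi> KB.fib_end_comp[OF p Ae \<Psi>] b]
    by (simp add: adj_C[OF p X KB.end_in[OF p \<Phi> d(1)] KB.end_in[OF p \<Psi> d(2)]])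
  have "(\<Sum>i\<in>UNIV. h p (\<Phi> (C p X (b i))) (\<Psi> (b' i))) =
      (\<Sum>i\<in>UNIV. \<Sum>j\<in>UNIV. h p (C p X (b i)) (b' j) * h p (\<Phi> (b j)) (\<Psi> (b' i)))"
    using KB.dual_sum_left[OF p \<Phi> b KB.end_in[OF p \<Psi> d(2)] C_in[OF p X d(1)]] by simp
  also have "\<dots> = (\<Sum>j\<in>UNIV. \<Sum>i\<in>UNIV. h p (b i) (adj_C p X (b' j)) * h p (\<Phi> (b j)) (\<Psi> (b' i)))"
    unfolding adj_C[OF p X d(1) d(2)] by (rule sum.swap)
  also have "\<dots> = (\<Sum>j\<in>UNIV. h p (\<Phi> (b j)) (\<Psi> (adj_C p X (b' j))))"
    using KB.dual_sum_right[OF p \<Psi> b KB.end_in[OF p \<Phi> d(1)] KB.end_in[OF p Ae d(2)]] by simp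
  finally show "h_end K h p (\<lambda>a. \<Phi> (C p X a)) \<Psi> = h_end K h p \<Phi> (\<lambda>a. \<Psi> (adj_C p X a))"
    unfolding KB.h_end_eq[OF p KB.fib_end_comp[OF p \<Phi> Ce] \<Psi> b] KB.h_end_eq[OF p \<Phi> KB.fib_end_comp[OF p \<Psi> Ae] b] .
qed

lemma h_end_diff_left:
  assumes p: "p \<in> mfd A" and "\<Phi> \<in> fib_end K p" "\<Phi>' \<in> fib_end K p" "\<Psi> \<in> fib_end K p"
  shows "h_end K h p (\<Phi> - \<Phi>') \<Psi> = h_end K h p \<Phi> \<Psi> - h_end K h p \<Phi>' \<Psi>"
  using KB.h_end_add_left[OF p KB.fib_end_diff[OF p assms(2,3)] assms(3,4)] by simp

lemma h_end_diff_right: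
  assumes p: "p \<in> mfd A" and "\<Phi> \<in> fib_end K p" "\<Phi>' \<in> fib_end K p" "\<Psi> \<in> fib_end K p"
  shows "h_end K h p \<Psi> (\<Phi> - \<Phi>') = h_end K h p \<Psi> \<Phi> - h_end K h p \<Psi> \<Phi>'"
  using h_end_diff_left[OF assms] KB.h_end_sym[OF p assms(4) KB.fib_end_diff[OF p assms(2,3)]]
    KB.h_end_sym[OF p assms(4,2)] KB.h_end_sym[OF p assms(4,3)] by (metis complex_cnj_cnj complex_cnj_diff)

text \<open>Moving the outer factor \<open>C p X\<close> to the other argument, once from the right
  and once from the left, turns that argument from \<open>C p X\<close> into the commutator itself.
  The curvature term thus becomes a squared norm.\<close>

lemma h_end_double_commutator:
  assumes p: "p \<in> mfd A" and X: "X \<in> tspace A p"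
  shows "h_end K h p ((\<lambda>a. comm_C p X (C p X a)) - (\<lambda>a. C p X (comm_C p X a))) (C p X) = h_end K h p (comm_C p X) (comm_C p X)"
proof -
  note Ce = C_end[OF p X] and Ae = adj_C_end[OF p X] and Ge = comm_C_end[OF p X]
  show ?thesis
    unfolding h_end_diff_left[OF p KB.fib_end_comp[OF p Ge Ce] KB.fib_end_comp[OF p Ce Ge] Ce]
      h_end_C_cyclic[OF p Ge Ce X] h_end_diff_right[OF p KB.fib_end_comp[OF p Ce Ae] KB.fib_end_comp[OF p Ae Ce] Ge, symmetric]
      comm_C_def[symmetric] ..
qed

text \<open>The covariant derivative of the endomorphism field
  \<open>\<lambda>q. C q (\<xi> q)\<close> in the direction of \<open>\<xi>\<close>, applied to a
  section; on a single fibre it becomes \<open>T_end\<close>.\<close>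

definition C_deriv :: "('a \<Rightarrow> ('a, 'm) tvec) \<Rightarrow> ('a \<Rightarrow> 'k) \<Rightarrow> 'a \<Rightarrow> 'k" where
  "C_deriv \<xi> s p = end_der D (\<lambda>q. C q (\<xi> q)) s p (\<xi> p)"

lemma C_deriv_eq: "d10 D (\<lambda>q. C q (\<xi> q) (s q)) p (\<xi> p) = C_deriv \<xi> s p + C p (\<xi> p) (d10 D s p (\<xi> p))"
  by (simp add: C_deriv_def end_der_def)

lemma C_deriv_smooth:
  assumes W: "open_in A W" and \<xi>: "hol_sec A (tbundle A) W \<xi>" and s: "smooth_sec A K W s"
  shows "smooth_sec A K W (C_deriv \<xi> s)"
proof -
  note x = TB.hol_sec_imp_smooth[OF \<xi>]
  show ?thesis
    unfolding C_deriv_def end_der_def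
    by (rule KB.smooth_sec_diff[OF W KB.D_smooth(1)[OF W C_smooth[OF W x s] x] C_smooth[OF W x KB.D_smooth(1)[OF W s x]]])
qed

text \<open>The derivatives of the coefficients occur in both terms of \<open>end_der\<close> and
  cancel. Hence the expression is linear over functions and comes from an endomorphism of the
  fibre.\<close>

lemma C_deriv_comb:
  assumes W: "open_in A W" and \<xi>: "hol_sec A (tbundle A) W \<xi>" and f: "\<And>i. smooth_fun A W (f i)"
    and b: "\<And>i. smooth_sec A K W (b i)" and p: "p \<in> W"
    and s: "\<And>q. q \<in> W \<Longrightarrow> s q = (\<Sum>i\<in>(UNIV :: 'i::finite set). scl K (f i q) (b i q))"
  shows "C_deriv \<xi> s p = (\<Sum>i\<in>UNIV. scl K (f i p) (C_deriv \<xi> (b i) p))"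
proof -
  note x = TB.hol_sec_imp_smooth[OF \<xi>] and t = KB.vf_tspace[OF \<xi>] and m = open_inD(3)[OF W]
  note fb = KB.smooth_sec_scl[OF W f b] and fC = KB.smooth_sec_scl[OF W f C_smooth[OF W x b]]
  have 1: "C q (\<xi> q) (s q) = (\<Sum>i\<in>UNIV. scl K (f i q) (C q (\<xi> q) (b i q)))" if q: "q \<in> W" for q
    unfolding s[OF q] by (rule KB.end_comb[OF m[OF q] C_end[OF m[OF q] t[OF q]] KB.smooth_secD(1)[OF b q]])
  have 2: "d10 D (\<lambda>q. C q (\<xi> q) (s q)) p (\<xi> p) = d10 D (\<lambda>q. \<Sum>i\<in>UNIV. scl K (f i q) (C q (\<xi> q) (b i q))) p (\<xi> p)"
    by (rule KB.D_cong(1)[OF W KB.smooth_sec_sum[OF W fC] _ p t[OF p]]) (rule 1)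
  have 3: "d10 D s p (\<xi> p) = d10 D (\<lambda>q. \<Sum>i\<in>UNIV. scl K (f i q) (b i q)) p (\<xi> p)"
    by (rule KB.D_cong(1)[OF W KB.smooth_sec_sum[OF W fb] _ p t[OF p]]) (rule s)
  have db: "scl K (der10 A (f i) p (\<xi> p)) (b i p) + scl K (f i p) (d10 D (b i) p (\<xi> p)) \<in> fib K p" for i
    by (rule KB.fib_add[OF m[OF p] KB.fib_scl[OF m[OF p] KB.smooth_secD(1)[OF b p]] KB.fib_scl[OF m[OF p] KB.D_in(1)[OF W b p t[OF p]]]])
  note Ce = C_end[OF m[OF p] t[OF p]]
  have 4: "C p (\<xi> p) (\<Sum>i\<in>UNIV. scl K (der10 A (f i) p (\<xi> p)) (b i p) + scl K (f i p) (d10 D (b i) p (\<xi> p))) =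
      (\<Sum>i\<in>UNIV. scl K (der10 A (f i) p (\<xi> p)) (C p (\<xi> p) (b i p)) + scl K (f i p) (C p (\<xi> p) (d10 D (b i) p (\<xi> p))))"
    unfolding KB.end_sum[OF m[OF p] Ce db]
      KB.end_add[OF m[OF p] Ce KB.fib_scl[OF m[OF p] KB.smooth_secD(1)[OF b p]] KB.fib_scl[OF m[OF p] KB.D_in(1)[OF W b p t[OF p]]]]
      KB.end_scl[OF m[OF p] Ce KB.smooth_secD(1)[OF b p]] KB.end_scl[OF m[OF p] Ce KB.D_in(1)[OF W b p t[OF p]]] ..
  have "d10 D (\<lambda>q. C q (\<xi> q) (s q)) p (\<xi> p) - C p (\<xi> p) (d10 D s p (\<xi> p)) =
      (\<Sum>i\<in>UNIV. scl K (f i p) (d10 D (\<lambda>q. C q (\<xi> q) (b i q)) p (\<xi> p) - C p (\<xi> p) (d10 D (b i) p (\<xi> p))))"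
    unfolding 2 3 KB.D_sum(1)[OF W fC p t[OF p]] KB.D_sum(1)[OF W fb p t[OF p]] KB.D_leibniz(1)[OF W b f p t[OF p]]
      KB.D_leibniz(1)[OF W C_smooth[OF W x b] f p t[OF p]] 4
    by (simp add: sum_subtractf[symmetric] KB.vs.scale_right_diff_distrib)
  then show ?thesis by (simp add: C_deriv_def end_der_def)
qed

section \<open>Derivatives of the trace form in a holomorphic frame and its dual frame\<close>

context
  fixes V \<psi> W \<xi>
  assumes t: "(V, \<psi>) \<in> trivs K" and W: "open_in A W" "W \<subseteq> V" and \<xi>: "hol_sec A (tbundle A) W \<xi>"
begin

abbreviation fr where "fr \<equiv> KB.frm \<psi>"
abbreviation fr' where "fr' \<equiv> KB.dfrm \<psi>"

lemma frame_at:
  assumes "p \<in> W"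
  shows "p \<in> mfd A" "p \<in> V" "\<xi> p \<in> tspace A p" "KB.dual_bases p (\<lambda>i. fr i p) (\<lambda>i. fr' i p)"
  using open_inD(3)[OF W(1) assms] W(2) assms KB.vf_tspace[OF \<xi> assms] KB.dfrm_dual[OF t, of p] by auto

lemma frame_hol: "hol_sec A K W (fr i)"
  by (rule KB.hol_sec_subset[OF KB.frm_hol[OF t] W(2)])

lemma frame_smooth: "smooth_sec A K W (fr i)"
  by (rule KB.hol_sec_imp_smooth[OF frame_hol])

lemma dframe_smooth: "smooth_sec A K W (fr' i)"
  by (rule KB.smooth_sec_subset[OF KB.dfrm_smooth[OF t] W(2)])

lemma \<xi>_smooth: "smooth_sec A (tbundle A) W \<xi>"
  by (rule TB.hol_sec_imp_smooth[OF \<xi>])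

text \<open>Both parts differentiate the constants \<open>h q (fr i q) (fr' j q)\<close>. As the
  frame is holomorphic, the (0,1)-derivative of the constants leaves only the (1,0)-derivative of
  the dual frame, which must vanish.\<close>

lemma der_frame:
  assumes p: "p \<in> W" and X: "X \<in> tspace A p"
  shows "h p (d10 D (fr i) p X) (fr' j p) + h p (fr i p) (d01 D (fr' j) p X) = 0"
    and "d10 D (fr' j) p X = 0"
proof -
  note d = KB.dual_basesD[OF frame_at(1)[OF p] frame_at(4)[OF p]]
  have c: "der10 A (\<lambda>q. h q (fr i q) (fr' j q)) p X = der10 A (\<lambda>q. if i = j then 1 else 0) p X"
    "der01 A (\<lambda>q. h q (fr i q) (fr' j q)) p X = der01 A (\<lambda>q. if i = j then 1 else 0) p X" for i
    by (rule der_cong[OF open_inD(1)[OF W(1)] p frame_at(1)[OF p]],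
        rule KB.dual_basesD(3)[OF frame_at(1) frame_at(4)]; assumption)+
  show "h p (d10 D (fr i) p X) (fr' j p) + h p (fr i p) (d01 D (fr' j) p X) = 0"
    unfolding KB.D_metric(1)[OF W(1) frame_smooth dframe_smooth p X, symmetric] c(1) by (rule der_const(1)[OF W(1) p X])
  have z: "h p (fr i p) (d10 D (fr' j) p X) = 0" for i
    using KB.D_metric(2)[OF W(1) frame_smooth[of i] dframe_smooth[of j] p X] der_const(2)[OF W(1) p X]
      KB.D_hol[OF W(1) frame_hol[of i] p X] KB.H_0_left[OF frame_at(1)[OF p] d(2)] unfolding c(2) by simp
  note in' = KB.D_in(1)[OF W(1) dframe_smooth[of j] p X]
  have "h p (d10 D (fr' j) p X) (fr i p) = 0" for i
    using KB.H_sym[OF frame_at(1)[OF p] d(1)[of i] in'] z[of i] by simp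
  then show "d10 D (fr' j) p X = 0"
    using KB.dual_basesD(4)[OF frame_at(1)[OF p] KB.dual_bases_sym[OF frame_at(1)[OF p] frame_at(4)[OF p]] in'] by simp
qed

text \<open>By \<open>der_frame\<close> the connection coefficients of the frame and of its dual are
  opposite. So the frame vectors contribute nothing when a trace is differentiated.\<close>

lemma frame_cancel:
  assumes p: "p \<in> W" and X: "X \<in> tspace A p" and \<Phi>: "\<Phi> \<in> fib_end K p" and \<Psi>: "\<Psi> \<in> fib_end K p"
  shows "(\<Sum>i\<in>UNIV. h p (\<Phi> (d10 D (fr i) p X)) (\<Psi> (fr' i p)) + h p (\<Phi> (fr i p)) (\<Psi> (d01 D (fr' i) p X))) = 0"
proof -
  note m = frame_at(1)[OF p] and db = frame_at(4)[OF p]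
  note d = KB.dual_basesD[OF m db]
  have "(\<Sum>i\<in>UNIV. h p (\<Phi> (d10 D (fr i) p X)) (\<Psi> (fr' i p))) =
      (\<Sum>i\<in>UNIV. \<Sum>j\<in>UNIV. h p (d10 D (fr i) p X) (fr' j p) * h p (\<Phi> (fr j p)) (\<Psi> (fr' i p)))"
    using KB.dual_sum_left[OF m \<Phi> db KB.end_in[OF m \<Psi> d(2)] KB.D_in(1)[OF W(1) frame_smooth p X]] by simp
  moreover have "(\<Sum>i\<in>UNIV. h p (\<Phi> (fr i p)) (\<Psi> (d01 D (fr' i) p X))) =
      (\<Sum>i\<in>UNIV. \<Sum>j\<in>UNIV. h p (fr j p) (d01 D (fr' i) p X) * h p (\<Phi> (fr i p)) (\<Psi> (fr' j p)))"
    using KB.dual_sum_right[OF m \<Psi> db KB.end_in[OF m \<Phi> d(1)] KB.D_in(2)[OF W(1) dframe_smooth p X]] by simp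
  moreover have "\<dots> = (\<Sum>i\<in>UNIV. \<Sum>j\<in>UNIV. h p (fr i p) (d01 D (fr' j) p X) * h p (\<Phi> (fr j p)) (\<Psi> (fr' i p)))"
    by (rule sum.swap)
  ultimately show ?thesis
    by (simp add: sum.distrib sum.distrib[symmetric] distrib_right[symmetric] der_frame(1)[OF p X])
qed

text \<open>\<open>C_deriv\<close> expects sections; this is the endomorphism of the single fibre
  with the same values on the frame and on the dual frame. It is the T of the overview.\<close>

definition T_end :: "'a \<Rightarrow> 'k \<Rightarrow> 'k" where
  "T_end p a = (if a \<in> fib K p then \<Sum>i\<in>UNIV. scl K (h p a (fr' i p)) (C_deriv \<xi> (fr i) p) else 0)"

lemma T_end:
  assumes p: "p \<in> W"
  shows "T_end p \<in> fib_end K p" "T_end p (fr i p) = C_deriv \<xi> (fr i) p" "T_end p (fr' i p) = C_deriv \<xi> (fr' i) p"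
proof -
  note m = frame_at(1)[OF p] and db = frame_at(4)[OF p]
  note d = KB.dual_basesD[OF m db] and c = KB.smooth_secD(1)[OF C_deriv_smooth[OF W(1) \<xi> frame_smooth] p]
  show "T_end p \<in> fib_end K p"
  proof (rule KB.fib_endI)
    fix a assume a: "a \<in> fib K p"
    show "T_end p a \<in> fib K p" using a KB.fib_sum[OF m KB.fib_scl[OF m c]] by (simp add: T_end_def)
    show "T_end p (scl K z a) = scl K z (T_end p a)" for z
      using a KB.fib_scl[OF m a] by (simp add: T_end_def KB.H_scl_left[OF m a d(2)] KB.vs.scale_sum_right)
    fix a' assume a': "a' \<in> fib K p"
    show "T_end p (a + a') = T_end p a + T_end p a'"
      using a a' KB.fib_add[OF m a a'] by (simp add: T_end_def KB.H_add_left[OF m a a' d(2)] KB.vs.scale_left_distrib sum.distrib)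
  qed (simp add: T_end_def)
  have "T_end p (fr i p) = (\<Sum>j\<in>UNIV. scl K (if i = j then 1 else 0) (C_deriv \<xi> (fr j) p))"
    unfolding T_end_def d(3) using d(1) by simp
  also have "\<dots> = (\<Sum>j\<in>UNIV. if j = i then C_deriv \<xi> (fr j) p else 0)" by (rule sum.cong) auto
  finally show "T_end p (fr i p) = C_deriv \<xi> (fr i) p" by simp
  have "C_deriv \<xi> (fr' i) p = (\<Sum>j\<in>UNIV. scl K (h p (fr' i p) (fr' j p)) (C_deriv \<xi> (fr j) p))"
    by (rule C_deriv_comb[OF W(1) \<xi> h_smooth[OF W(1) dframe_smooth dframe_smooth] frame_smooth p])
      (rule KB.dual_basesD(4)[OF frame_at(1) frame_at(4) KB.smooth_secD(1)[OF dframe_smooth]]; assumption)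
  then show "T_end p (fr' i p) = C_deriv \<xi> (fr' i) p" using d(2) by (simp add: T_end_def)
qed

text \<open>The derivatives of the frames cancel and \<open>w\<close> is holomorphic, so only
  \<open>C\<close> along \<open>\<xi>\<close> is differentiated. The right side is the pairing of T
  with \<open>C p (w p)\<close>, which identifies Z with the projection of T.\<close>

lemma der10_h_M:
  assumes w: "hol_sec A (tbundle A) W w" and p: "p \<in> W"
  shows "der10 A (\<lambda>q. h_M K C h q (\<xi> q) (w q)) p (\<xi> p) = (\<Sum>i\<in>UNIV. h p (C_deriv \<xi> (fr i) p) (C p (w p) (fr' i p)))"
proof -
  note m = frame_at(1)[OF p] and x = frame_at(3)[OF p] and wt = KB.vf_tspace[OF w p] and ws = TB.hol_sec_imp_smooth[OF w]
  note d = KB.dual_basesD[OF m frame_at(4)[OF p]]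
  note s1 = C_smooth[OF W(1) \<xi>_smooth frame_smooth] and s2 = C_smooth[OF W(1) ws dframe_smooth]
  note o = open_inD(1)[OF W(1)]
  have "der10 A (\<lambda>q. h_M K C h q (\<xi> q) (w q)) p (\<xi> p) =
      der10 A (\<lambda>q. \<Sum>i\<in>UNIV. h q (C q (\<xi> q) (fr i q)) (C q (w q) (fr' i q))) p (\<xi> p)"
    by (rule der_cong(1)[OF o p m], rule h_M_eq[OF t frame_at(2) frame_at(3) KB.vf_tspace[OF w]]; assumption)
  also have "\<dots> = (\<Sum>i\<in>UNIV. h p (C_deriv \<xi> (fr i) p + C p (\<xi> p) (d10 D (fr i) p (\<xi> p))) (C p (w p) (fr' i p)) +
      h p (C p (\<xi> p) (fr i p)) (C p (w p) (d01 D (fr' i) p (\<xi> p))))"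
    unfolding der_sum(1)[OF W(1) p h_smooth[OF W(1) s1 s2] x] KB.D_metric(1)[OF W(1) s1 s2 p x] C_deriv_eq
      D01_C[OF W(1) w dframe_smooth p x] ..
  also have "\<dots> = (\<Sum>i\<in>UNIV. h p (C_deriv \<xi> (fr i) p) (C p (w p) (fr' i p))) +
      (\<Sum>i\<in>UNIV. h p (C p (\<xi> p) (d10 D (fr i) p (\<xi> p))) (C p (w p) (fr' i p)) + h p (C p (\<xi> p) (fr i p)) (C p (w p) (d01 D (fr' i) p (\<xi> p))))"
    by (simp add: sum.distrib KB.H_add_left[OF m KB.smooth_secD(1)[OF C_deriv_smooth[OF W(1) \<xi> frame_smooth] p]
        C_in[OF m x KB.D_in(1)[OF W(1) frame_smooth p x]] C_in[OF m wt d(2)]])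
  also have "\<dots> = (\<Sum>i\<in>UNIV. h p (C_deriv \<xi> (fr i) p) (C p (w p) (fr' i p)))"
    unfolding frame_cancel[OF p x C_end[OF m x] C_end[OF m wt]] by simp
  finally show ?thesis .
qed

lemma curv_sec_comm_C:
  assumes s: "smooth_sec A K W s" and p: "p \<in> W"
  shows "curv_sec D \<xi> \<xi> s p = - comm_C p (\<xi> p) (s p)"
proof -
  note m = frame_at(1)[OF p] and x = frame_at(3)[OF p] and sp = KB.smooth_secD(1)[OF s p]
  have "comm_C p (\<xi> p) (s p) = C p (\<xi> p) (\<kappa> p (C p (\<xi> p) (\<kappa> p (s p)))) - \<kappa> p (C p (\<xi> p) (\<kappa> p (C p (\<xi> p) (s p))))"
    unfolding comm_C_def adj_C_def using sp C_in[OF m x sp] by simp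
  then show ?thesis using D_curv[OF W(1) \<xi> \<xi> s p] by (simp only: eq_neg_iff_add_eq_0)
qed

text \<open>\<open>C\<close> along \<open>\<xi>\<close> is holomorphic, so the (0,1)-derivative of
  its covariant derivative is, up to sign, its commutator with the curvature; and the curvature is
  \<open>- comm_C\<close>.\<close>

lemma d01_C_deriv:
  assumes p: "p \<in> W"
  shows "d01 D (C_deriv \<xi> (fr i)) p (\<xi> p) = comm_C p (\<xi> p) (C p (\<xi> p) (fr i p)) - C p (\<xi> p) (comm_C p (\<xi> p) (fr i p))"
proof -
  note m = frame_at(1)[OF p] and x = frame_at(3)[OF p]
  note d = KB.dual_basesD[OF m frame_at(4)[OF p]]
  note Cb = C_hol[OF W(1) \<xi> frame_hol] and s1 = C_smooth[OF W(1) \<xi>_smooth frame_smooth]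
  note s2 = KB.D_smooth(1)[OF W(1) s1 \<xi>_smooth] and s3 = KB.D_smooth(1)[OF W(1) frame_smooth \<xi>_smooth]
  note s4 = C_smooth[OF W(1) \<xi>_smooth s3]
  have "d01 D (\<lambda>q. d10 D (\<lambda>q. C q (\<xi> q) (fr i q)) q (\<xi> q)) p (\<xi> p) = - curv_sec D \<xi> \<xi> (\<lambda>q. C q (\<xi> q) (fr i q)) p"
    using KB.curv_sec_hol[OF W(1) \<xi> \<xi> Cb p] by simp
  also have "\<dots> = comm_C p (\<xi> p) (C p (\<xi> p) (fr i p))" unfolding curv_sec_comm_C[OF s1 p] by simp
  finally have 1: "d01 D (\<lambda>q. d10 D (\<lambda>q. C q (\<xi> q) (fr i q)) q (\<xi> q)) p (\<xi> p) = comm_C p (\<xi> p) (C p (\<xi> p) (fr i p))" .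
  have "d01 D (\<lambda>q. d10 D (fr i) q (\<xi> q)) p (\<xi> p) = - curv_sec D \<xi> \<xi> (fr i) p"
    using KB.curv_sec_hol[OF W(1) \<xi> \<xi> frame_hol p] by simp
  also have "\<dots> = comm_C p (\<xi> p) (fr i p)" unfolding curv_sec_comm_C[OF frame_smooth p] by simp
  finally have 2: "d01 D (\<lambda>q. d10 D (fr i) q (\<xi> q)) p (\<xi> p) = comm_C p (\<xi> p) (fr i p)" .
  show ?thesis
    unfolding C_deriv_def end_der_def KB.D_diff(2)[OF W(1) s2 s4 p x] 1 D01_C[OF W(1) \<xi> s3 p x] 2 ..
qed

lemma der01_der10_h_M:
  assumes p: "p \<in> W"
  shows "der01 A (\<lambda>q. \<Sum>i\<in>UNIV. h q (C_deriv \<xi> (fr i) q) (C q (\<xi> q) (fr' i q))) p (\<xi> p) =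
    h_end K h p (comm_C p (\<xi> p)) (comm_C p (\<xi> p)) + h_end K h p (T_end p) (T_end p)"
proof -
  note m = frame_at(1)[OF p] and x = frame_at(3)[OF p] and db = frame_at(4)[OF p]
  note Ce = C_end[OF m x] and Ge = comm_C_end[OF m x]
  note dC = KB.fib_end_diff[OF m KB.fib_end_comp[OF m Ge Ce] KB.fib_end_comp[OF m Ce Ge]]
  note s1 = C_deriv_smooth[OF W(1) \<xi> frame_smooth] and s2 = C_smooth[OF W(1) \<xi>_smooth dframe_smooth]
  \<comment> \<open>Since the (1,0)-derivative kills the dual frame, the second argument contributes
    exactly T, and the pairing becomes the squared norm of T without cross terms.\<close>
  have e: "d10 D (\<lambda>q. C q (\<xi> q) (fr' i q)) p (\<xi> p) = C_deriv \<xi> (fr' i) p" for i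
    unfolding C_deriv_eq der_frame(2)[OF p x] KB.end_0[OF m Ce] by simp
  have "der01 A (\<lambda>q. \<Sum>i\<in>UNIV. h q (C_deriv \<xi> (fr i) q) (C q (\<xi> q) (fr' i q))) p (\<xi> p) =
      (\<Sum>i\<in>UNIV. h p (d01 D (C_deriv \<xi> (fr i)) p (\<xi> p)) (C p (\<xi> p) (fr' i p))) +
      (\<Sum>i\<in>UNIV. h p (C_deriv \<xi> (fr i) p) (C_deriv \<xi> (fr' i) p))"
    unfolding der_sum(2)[OF W(1) p h_smooth[OF W(1) s1 s2] x] KB.D_metric(2)[OF W(1) s1 s2 p x] e by (rule sum.distrib)
  also have "(\<Sum>i\<in>UNIV. h p (d01 D (C_deriv \<xi> (fr i)) p (\<xi> p)) (C p (\<xi> p) (fr' i p))) =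
      h_end K h p ((\<lambda>a. comm_C p (\<xi> p) (C p (\<xi> p) a)) - (\<lambda>a. C p (\<xi> p) (comm_C p (\<xi> p) a))) (C p (\<xi> p))"
    unfolding KB.h_end_eq[OF m dC Ce db] d01_C_deriv[OF p] by simp
  also have "\<dots> = h_end K h p (comm_C p (\<xi> p)) (comm_C p (\<xi> p))" by (rule h_end_double_commutator[OF m x])
  also have "(\<Sum>i\<in>UNIV. h p (C_deriv \<xi> (fr i) p) (C_deriv \<xi> (fr' i) p)) = h_end K h p (T_end p) (T_end p)"
    unfolding KB.h_end_eq[OF m T_end(1)[OF p] T_end(1)[OF p] db] T_end(2,3)[OF p] ..
  finally show ?thesis .
qed

end

abbreviation DM :: "('a, ('a, 'm) tvec, ('a, 'm) tvec) conn" where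
  "DM \<equiv> SOME D. chern_connection A (tbundle A) (h_M K C h) D"

lemma chern_DM: "chern_connection A (tbundle A) (h_M K C h) DM"
  by (rule someI[of "chern_connection A (tbundle A) (h_M K C h)", OF TB.chern_connection_chern])

text \<open>Z is the (1,0)-derivative of \<open>\<xi>\<close> along itself for the Chern connection
  of \<open>h_M\<close>. That it corresponds to the projection of T is recorded in one equation, the
  pairing of T with \<open>C p Z\<close>, which is all that comparing the norms of Z and T
  requires.\<close>

lemma curvature_h_M:
  assumes t: "(V, \<psi>) \<in> trivs K" and W: "open_in A W" "W \<subseteq> V" and \<xi>: "hol_sec A (tbundle A) W \<xi>" and p: "p \<in> W"
  obtains Z where "Z \<in> tspace A p" "h_end K h p (T_end \<psi> \<xi> p) (C p Z) = h_M K C h p Z Z"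
    "h_M K C h p (R_M A K C h p (\<xi> p) (\<xi> p) (\<xi> p)) (\<xi> p) =
      h_M K C h p Z Z - h_end K h p (T_end \<psi> \<xi> p) (T_end \<psi> \<xi> p) - h_end K h p (comm_C p (\<xi> p)) (comm_C p (\<xi> p))"
proof -
  interpret TC: chern_bundle A "tbundle A" "h_M K C h" DM
    by unfold_locales (rule chern_DM)
  note m = open_inD(3)[OF W(1) p] and xs = TB.hol_sec_imp_smooth[OF \<xi>] and xt = TC.vf_tspace[OF \<xi>] and o = open_inD(1)[OF W(1)]
  define Z where "Z = d10 DM \<xi> p (\<xi> p)"
  have Z: "Z \<in> tspace A p" unfolding Z_def using TC.D_in(1)[OF W(1) xs p xt[OF p]] by simp
  have 1: "h_M K C h q (d10 DM \<xi> q (\<xi> q)) (w q) = (\<Sum>i\<in>UNIV. h q (C_deriv \<xi> (KB.frm \<psi> i) q) (C q (w q) (KB.dfrm \<psi> i q)))"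
    if w: "open_in A W'" "W' \<subseteq> W" "hol_sec A (tbundle A) W' w" and q: "q \<in> W'" for W' w q
  proof -
    note \<xi>' = TB.hol_sec_subset[OF \<xi> w(2)] and V = subset_trans[OF w(2) W(2)]
    have qt: "\<xi> q \<in> tspace A q" using xt q w(2) by auto
    have "der10 A (\<lambda>r. h_M K C h r (\<xi> r) (w r)) q (\<xi> q) = h_M K C h q (d10 DM \<xi> q (\<xi> q)) (w q) + h_M K C h q (\<xi> q) (d01 DM w q (\<xi> q))"
      by (rule TC.D_metric(1)[OF w(1) TB.hol_sec_imp_smooth[OF \<xi>'] TB.hol_sec_imp_smooth[OF w(3)] q qt])
    also have "h_M K C h q (\<xi> q) (d01 DM w q (\<xi> q)) = 0"
      unfolding TC.D_hol[OF w(1) w(3) q qt] using TB.H_0_right[OF open_inD(3)[OF w(1) q]] qt by simp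
    finally show ?thesis using der10_h_M[OF t w(1) V \<xi>' w(3) q] by simp
  qed
  have 2: "h_end K h p (T_end \<psi> \<xi> p) (C p Z) = h_M K C h p Z Z"
  proof -
    obtain W' w where w: "open_in A W'" "p \<in> W'" "hol_sec A (tbundle A) W' w" "w p = Z"
      by (rule TB.hol_extension[OF m, of Z]) (use Z in auto)
    have S: "open_in A (W \<inter> W')" "p \<in> W \<inter> W'" using open_in_Int(1)[OF W(1) open_inD(1)[OF w(1)]] p w(2) by auto
    have "h_M K C h p (d10 DM \<xi> p (\<xi> p)) (w p) = (\<Sum>i\<in>UNIV. h p (C_deriv \<xi> (KB.frm \<psi> i) p) (C p (w p) (KB.dfrm \<psi> i p)))"
      by (rule 1[OF S(1) Int_lower1 TB.hol_sec_subset[OF w(3) Int_lower2] S(2)])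
    also have "\<dots> = h_end K h p (T_end \<psi> \<xi> p) (C p Z)"
      unfolding KB.h_end_eq[OF m T_end(1)[OF t W \<xi> p] C_end[OF m Z] frame_at(4)[OF t W \<xi> p]] T_end(2)[OF t W \<xi> p] w(4) ..
    finally show ?thesis by (simp add: w(4) Z_def)
  qed
  have "h_M K C h p (R_M A K C h p (\<xi> p) (\<xi> p) (\<xi> p)) (\<xi> p) = h_M K C h p (curv_sec DM \<xi> \<xi> \<xi> p) (\<xi> p)"
    unfolding R_M_def TC.curv_eq_curv_sec[OF W(1) p \<xi> \<xi> xs] ..
  also have "\<dots> = h_M K C h p Z Z - der01 A (\<lambda>q. h_M K C h q (d10 DM \<xi> q (\<xi> q)) (\<xi> q)) p (\<xi> p)"
    unfolding Z_def by (rule TC.curv_sec_metric[OF W(1) \<xi> \<xi> \<xi> xs p])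
  also have "der01 A (\<lambda>q. h_M K C h q (d10 DM \<xi> q (\<xi> q)) (\<xi> q)) p (\<xi> p) =
      der01 A (\<lambda>q. \<Sum>i\<in>UNIV. h q (C_deriv \<xi> (KB.frm \<psi> i) q) (C q (\<xi> q) (KB.dfrm \<psi> i q))) p (\<xi> p)"
    by (rule der_cong(2)[OF o p m 1[OF W(1) order_refl \<xi>]])
  also have "\<dots> = h_end K h p (comm_C p (\<xi> p)) (comm_C p (\<xi> p)) + h_end K h p (T_end \<psi> \<xi> p) (T_end \<psi> \<xi> p)"
    by (rule der01_der10_h_M[OF t W \<xi> p])
  finally show ?thesis using that[OF Z 2] by simp
qed

section \<open>The bound for the sectional curvature, and the direction of the unit\<close>

lemma h_end_self:
  assumes p: "p \<in> mfd A" and \<Phi>: "\<Phi> \<in> fib_end K p"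
  shows "h_end K h p \<Phi> \<Phi> = of_real (Re (h_end K h p \<Phi> \<Phi>))" "Re (h_end K h p \<Phi> \<Phi>) \<ge> 0"
proof -
  show "h_end K h p \<Phi> \<Phi> = of_real (Re (h_end K h p \<Phi> \<Phi>))"
    using KB.h_end_sym[OF p \<Phi> \<Phi>] by (metis Reals_cnj_iff of_real_Re)
  show "Re (h_end K h p \<Phi> \<Phi>) \<ge> 0"
  proof (cases "\<Phi> = 0")
    case True
    have "h_end K h p (\<Phi> - \<Phi>) \<Phi> = 0" unfolding h_end_diff_left[OF p \<Phi> \<Phi> \<Phi>] by simp
    then show ?thesis using True by simp
  qed (use KB.h_end_pos[OF p \<Phi>] in force)
qed

text \<open>Despite the names, \<open>comm_norm\<close> and \<open>norm_M\<close> are squared norms;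
  their degrees in \<open>X\<close> under real scaling are four and two.\<close>

definition comm_norm :: "'a \<Rightarrow> ('a, 'm) tvec \<Rightarrow> real" where
  "comm_norm p X = Re (h_end K h p (comm_C p X) (comm_C p X))"

definition norm_M :: "'a \<Rightarrow> ('a, 'm) tvec \<Rightarrow> real" where
  "norm_M p X = Re (h_M K C h p X X)"

lemma h_M_self: "p \<in> mfd A \<Longrightarrow> X \<in> tspace A p \<Longrightarrow> h_M K C h p X X = of_real (norm_M p X)"
  unfolding norm_M_def h_M_def by (rule h_end_self(1)[OF _ C_end])

lemma R_sect_bound:
  assumes p: "p \<in> mfd A" and X: "X \<in> tspace A p"
  shows "Im (R_sect A K C h p X) = 0" "Re (R_sect A K C h p X) \<le> - comm_norm p X / (norm_M p X)\<^sup>2"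
proof -
  obtain W' \<xi> where \<xi>: "open_in A W'" "p \<in> W'" "hol_sec A (tbundle A) W' \<xi>" "\<xi> p = X"
    by (rule TB.hol_extension[OF p, of X]) (use X in auto)
  obtain V \<psi> where t: "(V, \<psi>) \<in> trivs K" "p \<in> V" by (rule KB.obtain_triv[OF p])
  have W: "open_in A (W' \<inter> V)" "W' \<inter> V \<subseteq> V" "p \<in> W' \<inter> V"
    using open_in_Int(1)[OF \<xi>(1) open_inD(1)[OF KB.triv_open[OF t(1)]]] \<xi>(2) t(2) by auto
  note \<xi>' = TB.hol_sec_subset[OF \<xi>(3) Int_lower1[of W' V]]
  obtain Z where Z: "Z \<in> tspace A p" "h_end K h p (T_end \<psi> \<xi> p) (C p Z) = h_M K C h p Z Z"
    "h_M K C h p (R_M A K C h p (\<xi> p) (\<xi> p) (\<xi> p)) (\<xi> p) =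
      h_M K C h p Z Z - h_end K h p (T_end \<psi> \<xi> p) (T_end \<psi> \<xi> p) - h_end K h p (comm_C p (\<xi> p)) (comm_C p (\<xi> p))"
    by (rule curvature_h_M[OF t(1) W(1,2) \<xi>' W(3)])
  let ?T = "T_end \<psi> \<xi> p"
  define \<tau> where "\<tau> = Re (h_end K h p ?T ?T)"
  note T = T_end(1)[OF t(1) W(1,2) \<xi>' W(3)] and Ze = C_end[OF p Z(1)]
  have "h_end K h p (C p Z) ?T = h_M K C h p Z Z"
    using KB.h_end_sym[OF p T Ze] unfolding Z(2) h_M_self[OF p Z(1)] by simp
  \<comment> \<open>Pythagoras: the pairing of T with \<open>C p Z\<close> equals the squared norm
    of Z, so this difference of squared norms is itself a squared norm and cannot be
    negative.\<close>
  then have "h_end K h p (?T - C p Z) (?T - C p Z) = h_end K h p ?T ?T - h_M K C h p Z Z"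
    unfolding h_end_diff_left[OF p T Ze KB.fib_end_diff[OF p T Ze]] h_end_diff_right[OF p T Ze T] h_end_diff_right[OF p T Ze Ze] Z(2)
    by (simp add: h_M_def)
  then have le: "norm_M p Z \<le> \<tau>"
    using h_end_self(2)[OF p KB.fib_end_diff[OF p T Ze]] by (simp add: \<tau>_def norm_M_def)
  have eq: "h_M K C h p (R_M A K C h p X X X) X = of_real (norm_M p Z - \<tau> - comm_norm p X)"
    using Z(3) h_end_self(1)[OF p T, folded \<tau>_def] h_end_self(1)[OF p comm_C_end[OF p X], folded comm_norm_def]
    unfolding \<xi>(4) h_M_self[OF p Z(1)] by simp
  have R: "R_sect A K C h p X = of_real ((norm_M p Z - \<tau> - comm_norm p X) / (norm_M p X)\<^sup>2)"
    unfolding R_sect_def eq h_M_self[OF p X] by simp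
  show "Im (R_sect A K C h p X) = 0" unfolding R by simp
  show "Re (R_sect A K C h p X) \<le> - comm_norm p X / (norm_M p X)\<^sup>2"
    unfolding R Re_complex_of_real by (rule divide_right_mono) (use le in simp_all)
qed

lemma comm_norm_nonneg: "p \<in> mfd A \<Longrightarrow> X \<in> tspace A p \<Longrightarrow> comm_norm p X \<ge> 0"
  unfolding comm_norm_def by (rule h_end_self(2)[OF _ comm_C_end])

lemma comm_C_unit: 
  assumes p: "p \<in> mfd A" shows "comm_C p (cv_unit A K C p) = 0"
proof
  fix a
  note u = cv_unit[OF p]
  have k: "a \<in> fib K p \<Longrightarrow> \<kappa> p (- \<kappa> p a) = - a" for a
    using kappa_scl[OF p kappa_fib[OF p], of a "-1"] kappa_invol[OF p, of a] by simp
  show "comm_C p (cv_unit A K C p) a = 0 a"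
    unfolding comm_C_def adj_C_def u(2) neg_id_def
    using k[of a] k[of "- a"] k[of 0] KB.fib_0[OF p] kappa_fib[OF p] KB.fib_neg[OF p] by auto
qed

text \<open>Here the extension of the vector has to be the unit field itself: as it acts everywhere
  by minus the identity, its covariant derivative T vanishes. Then the squared norm of Z is a
  pairing with T, hence zero, and the commutator of a scalar vanishes too.\<close>

lemma R_sect_unit:
  assumes p: "p \<in> mfd A" shows "R_sect A K C h p (cv_unit A K C p) = 0"
proof -
  let ?e = "cv_unit A K C"
  obtain W' where e: "open_in A W'" "p \<in> W'" "hol_sec A (tbundle A) W' ?e" by (rule unit_hol[OF p])
  obtain V \<psi> where t: "(V, \<psi>) \<in> trivs K" "p \<in> V" by (rule KB.obtain_triv[OF p])
  have W: "open_in A (W' \<inter> V)" "W' \<inter> V \<subseteq> V" "p \<in> W' \<inter> V"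
    using open_in_Int(1)[OF e(1) open_inD(1)[OF KB.triv_open[OF t(1)]]] e(2) t(2) by auto
  note e' = TB.hol_sec_subset[OF e(3) Int_lower1[of W' V]]
  note x = KB.vf_tspace[OF e' W(3)] and fs = frame_smooth[OF t(1) W(1,2) e']
  have "C_deriv ?e (KB.frm \<psi> i) p = 0" for i
  proof -
    note n = KB.smooth_sec_scl[OF W(1) smooth_fun_const[of _ "-1"] fs]
    have "d10 D (\<lambda>q. C q (?e q) (KB.frm \<psi> i q)) p (?e p) = d10 D (\<lambda>q. scl K (-1) (KB.frm \<psi> i q)) p (?e p)"
    proof (rule KB.D_cong(1)[OF W(1) n _ W(3) x])
      fix q assume q: "q \<in> W' \<inter> V"
      show "C q (?e q) (KB.frm \<psi> i q) = scl K (-1) (KB.frm \<psi> i q)"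
        unfolding cv_unit(2)[OF open_inD(3)[OF W(1) q]] using KB.smooth_secD(1)[OF fs q] by (simp add: neg_id_def)
    qed
    also have "\<dots> = - d10 D (KB.frm \<psi> i) p (?e p)"
      unfolding KB.D_leibniz(1)[OF W(1) fs smooth_fun_const W(3) x] der_const(1)[OF W(1,3) x] by simp
    also have "\<dots> = C p (?e p) (d10 D (KB.frm \<psi> i) p (?e p))"
      unfolding cv_unit(2)[OF p] using KB.D_in(1)[OF W(1) fs W(3) x] by (simp add: neg_id_def)
    finally show ?thesis by (simp add: C_deriv_def end_der_def)
  qed
  then have T0: "T_end \<psi> ?e p = 0" by (simp add: T_end_def[OF t(1) W(1,2) e'] fun_eq_iff)
  obtain Z where Z: "Z \<in> tspace A p" "h_end K h p (T_end \<psi> ?e p) (C p Z) = h_M K C h p Z Z"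
    "h_M K C h p (R_M A K C h p (?e p) (?e p) (?e p)) (?e p) =
      h_M K C h p Z Z - h_end K h p (T_end \<psi> ?e p) (T_end \<psi> ?e p) - h_end K h p (comm_C p (?e p)) (comm_C p (?e p))"
    by (rule curvature_h_M[OF t(1) W(1,2) e' W(3)])
  have "h_end K h p 0 \<Phi> = 0" if "\<Phi> \<in> fib_end K p" for \<Phi>
    using h_end_diff_left[OF p that that that] by simp
  then have "h_M K C h p (R_M A K C h p (?e p) (?e p) (?e p)) (?e p) = 0"
    using Z(2) C_end[OF p Z(1)] T_end(1)[OF t(1) W(1,2) e' W(3)] comm_C_end[OF p cv_unit(1)[OF p]]
    unfolding Z(3) T0 comm_C_unit[OF p] by simp
  then show ?thesis by (simp add: R_sect_def)
qed

end

section \<open>Irreducible commutative algebras\<close>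

locale comm_alg = vector_space sc for sc :: "complex \<Rightarrow> 'v::ab_group_add \<Rightarrow> 'v" +
  fixes V :: "'v set" and m :: "'v \<Rightarrow> 'v \<Rightarrow> 'v" and e :: 'v
  assumes V: "subspace V"
    and m_in: "x \<in> V \<Longrightarrow> y \<in> V \<Longrightarrow> m x y \<in> V"
    and m_add: "x \<in> V \<Longrightarrow> y \<in> V \<Longrightarrow> z \<in> V \<Longrightarrow> m x (y + z) = m x y + m x z"
    and m_sc: "x \<in> V \<Longrightarrow> y \<in> V \<Longrightarrow> m x (sc c y) = sc c (m x y)"
    and m_comm: "x \<in> V \<Longrightarrow> y \<in> V \<Longrightarrow> m x y = m y x"
    and m_assoc: "x \<in> V \<Longrightarrow> y \<in> V \<Longrightarrow> z \<in> V \<Longrightarrow> m (m x y) z = m x (m y z)"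
    and e_in: "e \<in> V" and e_unit: "x \<in> V \<Longrightarrow> m e x = x" and e_nz: "e \<noteq> 0"
begin

lemma V_add: "x \<in> V \<Longrightarrow> y \<in> V \<Longrightarrow> x + y \<in> V"
  and V_sc: "x \<in> V \<Longrightarrow> sc c x \<in> V"
  and V_diff: "x \<in> V \<Longrightarrow> y \<in> V \<Longrightarrow> x - y \<in> V"
  and V_0: "0 \<in> V"
  using subspace_add[OF V] subspace_scale[OF V] subspace_diff[OF V] subspace_0[OF V] by blast+

lemma m_0: "x \<in> V \<Longrightarrow> m x 0 = 0"
  using m_sc[of x 0 0] V_0 by simp

lemma m_diff: "x \<in> V \<Longrightarrow> y \<in> V \<Longrightarrow> z \<in> V \<Longrightarrow> m x (y - z) = m x y - m x z"
  using m_add[of x y "sc (-1) z"] m_sc[of x z "-1"] V_sc[of z "-1"] by simp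

lemma m_left_comm: "x \<in> V \<Longrightarrow> y \<in> V \<Longrightarrow> z \<in> V \<Longrightarrow> m x (m y z) = m y (m x z)"
  using m_assoc[of x y z] m_assoc[of y x z] m_comm[of x y] by simp

lemma e_unit_right: "x \<in> V \<Longrightarrow> m x e = x"
  using m_comm[of x e] e_unit e_in by simp

definition pw :: "'v \<Rightarrow> nat \<Rightarrow> 'v" where
  "pw x k = (m x ^^ k) e"

lemma pw_0 [simp]: "pw x 0 = e"
  and pw_Suc [simp]: "pw x (Suc k) = m x (pw x k)"
  by (simp_all add: pw_def)

lemma pw_in: "x \<in> V \<Longrightarrow> pw x k \<in> V"
  by (induction k) (simp_all add: e_in m_in)

lemma pw_add: "x \<in> V \<Longrightarrow> pw x (j + k) = m (pw x j) (pw x k)"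
  by (induction j) (simp_all add: e_unit pw_in m_assoc)

lemma pw_mult: "x \<in> V \<Longrightarrow> y \<in> V \<Longrightarrow> pw (m x y) k = m (pw x k) (pw y k)"
proof (induction k)
  case (Suc k)
  then show ?case
    using m_left_comm[OF Suc.prems(2) pw_in[OF Suc.prems(1), of k] pw_in[OF Suc.prems(2), of k]]
    by (simp add: m_assoc m_in pw_in)
qed (simp add: e_unit e_in)

definition nilp :: "'v \<Rightarrow> bool" where
  "nilp x \<longleftrightarrow> (\<exists>k. pw x k = 0)"

definition peval :: "'v \<Rightarrow> complex poly \<Rightarrow> 'v" where
  "peval x p = fold_coeffs (\<lambda>a y. sc a e + m x y) p 0"

lemma peval_0 [simp]: "peval x 0 = 0"
  by (simp add: peval_def)

context
  fixes x assumes x: "x \<in> V"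
begin

lemma peval_pCons: "peval x (pCons a p) = sc a e + m x (peval x p)"
  using x by (cases "a = 0 \<and> p = 0") (auto simp: peval_def m_0)

lemma peval_in: "peval x p \<in> V"
  by (induction p rule: pCons_induct) (simp_all add: V_0 peval_pCons V_add V_sc e_in m_in x)

lemma peval_add: "peval x (p + q) = peval x p + peval x q"
  by (induction p q rule: poly_induct2)
    (simp_all add: peval_pCons scale_left_distrib m_add[OF x peval_in peval_in])

lemma peval_smult: "peval x (smult c p) = sc c (peval x p)"
  by (induction p rule: pCons_induct)
    (simp_all add: peval_pCons scale_right_distrib m_sc[OF x peval_in])

lemma peval_linear: "peval x ([:- c, 1:] * p) = m (x - sc c e) (peval x p)"
proof -
  have "[:- c, 1:] * p = smult (- c) p + pCons 0 p" by (simp add: algebra_simps)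
  then have "peval x ([:- c, 1:] * p) = sc (- c) (peval x p) + m x (peval x p)"
    by (simp only: peval_add peval_smult peval_pCons) simp
  also have "\<dots> = m (peval x p) (x - sc c e)"
    using m_diff[OF peval_in x V_sc[OF e_in], of p c] m_sc[OF peval_in e_in] e_unit_right[OF peval_in] m_comm[OF peval_in x]
    by simp
  finally show ?thesis using m_comm[OF peval_in V_diff[OF x V_sc[OF e_in]]] by simp
qed

lemma peval_monom: "peval x (monom c k) = sc c (pw x k)"
  by (induction k) (simp_all add: monom_0 monom_Suc peval_pCons m_0[OF x] m_sc[OF x pw_in[OF x]])

lemma peval_sum_monom: "peval x (\<Sum>i\<in>I. monom (u i) i) = (\<Sum>i\<in>I. sc (u i) (pw x i))"
  by (induction I rule: infinite_finite_induct) (simp_all add: peval_add peval_monom)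

text \<open>The factor is written in the shape \<open>[:- 0, 1:]\<close> that
  \<open>order_decomp\<close> produces for the root 0.\<close>

lemma peval_X_power: "peval x ([:- 0, 1:] ^ k * p) = m (pw x k) (peval x p)"
proof (induction k)
  case (Suc k)
  have "peval x ([:- 0, 1:] ^ Suc k * p) = m (x - sc 0 e) (peval x ([:- 0, 1:] ^ k * p))"
    unfolding power_Suc mult.assoc by (rule peval_linear)
  then show ?case using Suc by (simp add: m_assoc[OF x pw_in[OF x] peval_in])
qed (simp add: e_unit peval_in)

end

end

text \<open>\<open>algebraic\<close> is the only form in which the finite dimension of the algebra
  enters.\<close>

locale irreducible_comm_alg = comm_alg sc V m e
  for sc :: "complex \<Rightarrow> 'v::ab_group_add \<Rightarrow> 'v" and V m e +
  assumes algebraic: "x \<in> V \<Longrightarrow> \<exists>p. p \<noteq> 0 \<and> peval x p = 0"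
    and irr: "irreducible_algebra sc V m"
begin

text \<open>A polynomial relation for \<open>y\<close> gives \<open>y\<^sup>k = y\<^sup>k\<^sup>+\<^sup>1 s\<close>, so \<open>y\<^sup>k s\<^sup>k\<close> is idempotent.\<close>

lemma nilp_or_invertible:
  assumes y: "y \<in> V"
  shows "nilp y \<or> (\<exists>w\<in>V. m y w = e)"
proof -
  obtain p where p: "p \<noteq> 0" "peval y p = 0" using algebraic[OF y] by blast
  obtain q where q: "p = [:- 0, 1:] ^ order 0 p * q" "\<not> [:- 0, 1:] dvd q"
    using order_decomp[OF p(1), of 0] by blast
  define k where "k = order 0 p"
  obtain a r where r: "q = pCons a r" by (cases q)
  \<comment> \<open>\<open>a\<close> is the constant term of what is left of \<open>p\<close> once
    the root 0 has been divided out completely.\<close>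
  have a: "a \<noteq> 0"
  proof
    assume "a = 0"
    then have "q = [:- 0, 1:] * r" using r by simp
    then show False using q(2) by (metis dvd_triv_left)
  qed
  have rV: "peval y r \<in> V" by (rule peval_in[OF y])
  \<comment> \<open>The relation reads \<open>y\<^sup>k (a + y r(y)) = 0\<close>; solving it for
    \<open>y\<^sup>k\<close> gives this \<open>s\<close>.\<close>
  define s where "s = sc (- 1 / a) (peval y r)"
  have s: "s \<in> V" unfolding s_def by (rule V_sc[OF rV])
  note yk = pw_in[OF y, of k] and sk = pw_in[OF s, of k]
  have rel: "pw y k = m (pw y (Suc k)) s"
  proof -
    have "0 = m (pw y k) (sc a e + m y (peval y r))"
      using p(2) q(1) peval_X_power[OF y, of k q] unfolding k_def[symmetric] r peval_pCons[OF y] by simp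
    also have "\<dots> = sc a (pw y k) + m (pw y k) (m y (peval y r))"
      using m_add[OF yk V_sc[OF e_in] m_in[OF y rV]] m_sc[OF yk e_in] e_unit_right[OF yk] by simp
    finally have "sc a (pw y k) = - m (pw y k) (m y (peval y r))" by (simp add: eq_neg_iff_add_eq_0)
    then have "sc (1 / a) (sc a (pw y k)) = sc (- 1 / a) (m (pw y k) (m y (peval y r)))" by simp
    then have "pw y k = sc (- 1 / a) (m (pw y k) (m y (peval y r)))" using a by simp
    also have "\<dots> = m (pw y (Suc k)) s"
      unfolding s_def pw_Suc m_sc[OF m_in[OF y yk] rV] m_left_comm[OF yk y rV] m_assoc[OF y yk rV] ..
    finally show ?thesis .
  qed
  \<comment> \<open>Iterating the relation and taking j = k shows that \<epsilon> below acts as a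
    unit on \<open>pw y k\<close>, from which idempotence follows.\<close>
  have relj: "pw y k = m (pw y (j + k)) (pw s j)" for j
  proof (induction j)
    case (Suc j)
    have "m (pw y (j + k)) (pw s j) = m (m (pw y j) (m (pw y (Suc k)) s)) (pw s j)"
      unfolding pw_add[OF y] rel[symmetric] ..
    also have "\<dots> = m (pw y (Suc j + k)) (pw s (Suc j))"
      using pw_add[OF y, of j "Suc k"] pw_in[OF y] pw_in[OF s] s
      by (simp add: m_assoc m_in y del: pw_Suc) (simp add: m_assoc m_in y)
    finally show ?case using Suc by simp
  qed (simp add: e_unit_right yk)
  define \<epsilon> where "\<epsilon> = m (pw y k) (pw s k)"
  have \<epsilon>: "\<epsilon> \<in> V" unfolding \<epsilon>_def by (rule m_in[OF yk sk])
  have yke: "m (pw y k) \<epsilon> = pw y k"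
    unfolding \<epsilon>_def using relj[of k] pw_add[OF y, of k k] m_assoc[OF yk yk sk] by simp
  have idem: "m \<epsilon> \<epsilon> = \<epsilon>"
    using m_assoc[OF yk sk \<epsilon>] m_left_comm[OF yk sk \<epsilon>] m_comm[OF yk sk] yke unfolding \<epsilon>_def by simp
  \<comment> \<open>The Peirce decomposition for the idempotent \<epsilon>; irreducibility forces
    one of the two summands to be zero.\<close>
  define I where "I = (\<lambda>v. m \<epsilon> v) ` V"
  define J where "J = (\<lambda>v. v - m \<epsilon> v) ` V"
  have I_iff: "x \<in> I \<longleftrightarrow> x \<in> V \<and> m \<epsilon> x = x" for x
    unfolding I_def using m_in[OF \<epsilon>] m_assoc[OF \<epsilon> \<epsilon>] idem by (metis (no_types, lifting) image_iff)
  have J_iff: "x \<in> J \<longleftrightarrow> x \<in> V \<and> m \<epsilon> x = 0" for x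
  proof
    assume "x \<in> J"
    then obtain v where v: "v \<in> V" "x = v - m \<epsilon> v" by (auto simp: J_def)
    have "m \<epsilon> (m \<epsilon> v) = m \<epsilon> v" using m_assoc[OF \<epsilon> \<epsilon> v(1)] idem by simp
    then show "x \<in> V \<and> m \<epsilon> x = 0" using v V_diff[OF v(1) m_in[OF \<epsilon> v(1)]] m_diff[OF \<epsilon> v(1) m_in[OF \<epsilon> v(1)]] by simp
  qed (force simp: J_def)
  have split: "I = {0} \<or> J = {0}"
  proof (rule ccontr)
    assume nz: "\<not> (I = {0} \<or> J = {0})"
    have "subspace I" using V_add V_sc V_0 m_add[OF \<epsilon>] m_sc[OF \<epsilon>] m_0[OF \<epsilon>] by (auto simp: subspace_def I_iff)
    moreover have "subspace J" using V_add V_sc V_0 m_add[OF \<epsilon>] m_sc[OF \<epsilon>] m_0[OF \<epsilon>] by (auto simp: subspace_def J_iff)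
    moreover have "V = {x + y | x y. x \<in> I \<and> y \<in> J}"
    proof (intro set_eqI iffI)
      fix v assume v: "v \<in> V"
      have "v = m \<epsilon> v + (v - m \<epsilon> v)" by simp
      moreover have "m \<epsilon> v \<in> I" "v - m \<epsilon> v \<in> J" using v by (auto simp: I_def J_def)
      ultimately show "v \<in> {x + y | x y. x \<in> I \<and> y \<in> J}" by blast
    qed (auto simp: I_iff J_iff V_add)
    moreover have "I \<inter> J = {0}" using V_0 m_0[OF \<epsilon>] by (auto simp: I_iff J_iff)
    moreover have "\<forall>x\<in>I. \<forall>x'\<in>I. m x x' \<in> I" using m_in m_left_comm[OF \<epsilon>] by (auto simp: I_iff)
    moreover have "\<forall>x\<in>J. \<forall>x'\<in>J. m x x' \<in> J" using m_in m_left_comm[OF \<epsilon>] m_0 by (auto simp: J_iff)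
    moreover have "m x y = 0 \<and> m y x = 0" if "x \<in> I" "y \<in> J" for x y
    proof -
      have xy: "x \<in> V" "m \<epsilon> x = x" "y \<in> V" "m \<epsilon> y = 0" using that by (auto simp: I_iff J_iff)
      have "m x y = m x (m \<epsilon> y)" using m_assoc[OF \<epsilon> xy(1,3)] m_left_comm[OF \<epsilon> xy(1,3)] xy(2) by simp
      then show ?thesis using xy m_0 m_comm by simp
    qed
    ultimately have "\<exists>I J. subspace I \<and> subspace J \<and> I \<noteq> {0} \<and> J \<noteq> {0} \<and>
          V = {x + y | x y. x \<in> I \<and> y \<in> J} \<and> I \<inter> J = {0} \<and>
          (\<forall>x\<in>I. \<forall>x'\<in>I. m x x' \<in> I) \<and> (\<forall>y\<in>J. \<forall>y'\<in>J. m y y' \<in> J) \<and>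
          (\<forall>x\<in>I. \<forall>y\<in>J. m x y = 0 \<and> m y x = 0)"
      using nz by (intro exI[of _ I] exI[of _ J] conjI ballI) simp_all
    then show False using irr unfolding irreducible_algebra_def by contradiction
  qed
  show ?thesis
  \<comment> \<open>If \<open>J\<close> is zero then \<epsilon> is the unit, and \<epsilon> is a
    multiple of \<open>y\<close> by \<open>rel\<close>, so \<open>y\<close> is invertible. Otherwise
    \<open>I\<close> is zero, hence \<epsilon> too, and \<open>pw y k\<close> vanishes.\<close>
  proof (cases "J = {0}")
    case True
    have "e - m \<epsilon> e \<in> J" using e_in by (auto simp: J_def)
    then have "e = \<epsilon>" using True e_unit_right[OF \<epsilon>] by simp
    also have "\<dots> = m (m (m y (pw y k)) s) (pw s k)" unfolding \<epsilon>_def by (subst rel) simp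
    also have "\<dots> = m y (m (pw y k) (m s (pw s k)))"
      using m_assoc[OF y yk s] m_assoc[OF y m_in[OF yk s] sk] m_assoc[OF yk s sk] by simp
    finally show ?thesis using m_in[OF yk m_in[OF s sk]] by metis
  next
    case False
    then have "I = {0}" using split by blast
    moreover have "\<epsilon> \<in> I" using \<epsilon> idem by (simp add: I_iff)
    ultimately have "pw y k = 0" using yke m_0[OF yk] by simp
    then show ?thesis by (auto simp: nilp_def)
  qed
qed

text \<open>Multiplying \<open>a + b = e\<close> by the last non-zero power of \<open>a\<close>
  shows that this power is unchanged under multiplication by \<open>b\<close>, hence by all powers
  of \<open>b\<close>, one of which is zero. A last non-zero power exists since the power with
  exponent 0 is \<open>e\<close>.\<close>

lemma e_minus_nilp:
  assumes a: "a \<in> V" "nilp a" and b: "b \<in> V" "nilp b" shows "a + b \<noteq> e"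
proof
  assume ab: "a + b = e"
  define k where "k = (LEAST k. pw a k = 0)"
  have k: "pw a k = 0" unfolding k_def by (rule LeastI_ex[OF a(2)[unfolded nilp_def]])
  then have "k \<noteq> 0" using e_nz by (metis pw_0)
  then obtain l where l: "k = Suc l" by (cases k) auto
  have nz: "pw a l \<noteq> 0" using not_less_Least[of l "\<lambda>k. pw a k = 0"] l unfolding k_def by simp
  have al: "pw a l \<in> V" by (rule pw_in[OF a(1)])
  have "pw a l = m (pw a l) (a + b)" unfolding ab using e_unit_right[OF al] by simp
  also have "\<dots> = m (pw a l) b" using m_add[OF al a(1) b(1)] m_comm[OF al a(1)] k l by simp
  finally have step: "pw a l = m (pw a l) b" .
  have "pw a l = m (pw a l) (pw b j)" for j
  proof (induction j)
    case (Suc j)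
    have "m (pw a l) (m b (pw b j)) = m (m (pw a l) b) (pw b j)" using m_assoc[OF al b(1) pw_in[OF b(1)]] by simp
    then show ?case using Suc step by simp
  qed (simp add: e_unit_right al)
  moreover obtain j where "pw b j = 0" using b(2) by (auto simp: nilp_def)
  ultimately show False using nz m_0[OF al] by metis
qed

lemma nilp_mult: "x \<in> V \<Longrightarrow> y \<in> V \<Longrightarrow> nilp y \<Longrightarrow> nilp (m x y)"
  unfolding nilp_def using pw_mult m_0 pw_in by metis

lemma nilp_0: "nilp 0"
  unfolding nilp_def using m_comm[OF V_0 e_in] m_0[OF e_in] by (intro exI[of _ 1]) simp

lemma not_nilp_e: "\<not> nilp e"
  using e_minus_nilp[OF e_in _ V_0 nilp_0] by auto

text \<open>A non-nilpotent sum would be invertible, and multiplying by its inverse would write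
  \<open>e\<close> as a sum of two nilpotents.\<close>

lemma nilp_add:
  assumes x: "x \<in> V" "nilp x" and y: "y \<in> V" "nilp y" shows "nilp (x + y)"
proof (rule ccontr)
  assume "\<not> nilp (x + y)"
  then obtain w where w: "w \<in> V" "m (x + y) w = e" using nilp_or_invertible[OF V_add[OF x(1) y(1)]] by blast
  have "m w x + m w y = e" using w m_comm[OF V_add[OF x(1) y(1)] w(1)] m_add[OF w(1) x(1) y(1)] by simp
  then show False
    using e_minus_nilp[OF m_in[OF w(1) x(1)] nilp_mult[OF w(1) x] m_in[OF w(1) y(1)] nilp_mult[OF w(1) y]] by blast
qed

lemma nilp_sc: "x \<in> V \<Longrightarrow> nilp x \<Longrightarrow> nilp (sc c x)"
  using nilp_mult[of "sc c e" x] V_sc[OF e_in] m_comm[of "sc c e" x] m_sc[of x e c] e_in e_unit_right by simp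

text \<open>Otherwise \<open>x - sc c e\<close> would be invertible for every \<open>c\<close>. The
  linear factors of a polynomial that annihilates \<open>x\<close>, which exist over the complex
  numbers, could then be cancelled one by one until a non-zero constant annihilated
  \<open>e\<close>.\<close>

lemma scalar_plus_nilp:
  assumes x: "x \<in> V" shows "\<exists>c. nilp (x - sc c e)"
proof (rule ccontr)
  assume n: "\<not> (\<exists>c. nilp (x - sc c e))"
  have "p = 0" if "peval x p = 0" for p
    using that
  proof (induction "degree p" arbitrary: p rule: less_induct)
    case less
    show ?case
    proof (cases "degree p = 0")
      case True
      then obtain a where "p = [:a:]" by (rule degree_eq_zeroE)
      then show ?thesis using less.prems e_nz by (simp add: peval_pCons[OF x] m_0[OF x])
    next
      case False
      then obtain c where "poly p c = 0"
        using fundamental_theorem_of_algebra[of p] constant_degree[of p] by auto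
      then obtain q where q: "p = [:- c, 1:] * q" using poly_eq_0_iff_dvd[of p c] by (auto simp: dvd_def)
      obtain w where w: "w \<in> V" "m (x - sc c e) w = e"
        using nilp_or_invertible[OF V_diff[OF x V_sc[OF e_in]], of c] n by blast
      note d = V_diff[OF x V_sc[OF e_in], of c] and qV = peval_in[OF x, of q]
      have "m (x - sc c e) (peval x q) = 0" using less.prems unfolding q peval_linear[OF x] .
      then have "m w (m (x - sc c e) (peval x q)) = 0" using m_0[OF w(1)] by simp
      then have "peval x q = 0" using m_assoc[OF w(1) d qV] m_comm[OF w(1) d] w(2) e_unit[OF qV] by simp
      moreover have "degree q < degree p"
      proof -
        have "q \<noteq> 0" using q False by auto
        then have "degree p = Suc (degree q)" unfolding q by (subst degree_mult_eq) auto
        then show ?thesis by simp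
      qed
      ultimately have "q = 0" by (intro less.hyps)
      then show ?thesis using q by simp
    qed
  qed
  then show False using algebraic[OF x] by blast
qed

lemma ideal_nilp: "alg_ideal sc V m {x \<in> V. nilp x}"
  unfolding alg_ideal_def subspace_def
  using nilp_mult m_in V_0 nilp_0 V_add nilp_add V_sc nilp_sc by auto

lemma proper_ideal_nilp:
  assumes I: "alg_ideal sc V m I" "I \<noteq> V" shows "I \<subseteq> {x \<in> V. nilp x}"
proof
  fix x assume x: "x \<in> I"
  have sub: "I \<subseteq> V" and mi: "\<And>x y. x \<in> V \<Longrightarrow> y \<in> I \<Longrightarrow> m x y \<in> I" using I(1) by (auto simp: alg_ideal_def)
  have xV: "x \<in> V" using x sub by blast
  have "nilp x"
  proof (rule ccontr)
    assume "\<not> nilp x"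
    then obtain w where w: "w \<in> V" "m x w = e" using nilp_or_invertible[OF xV] by blast
    have "e \<in> I" using mi[OF w(1) x] w(2) m_comm[OF xV w(1)] by simp
    then have "V \<subseteq> I" using mi e_unit_right by (metis subsetI)
    then show False using I(2) sub by blast
  qed
  then show "x \<in> {x \<in> V. nilp x}" using xV by simp
qed

lemma max_ideal_eq: "max_ideal sc V m = {x \<in> V. nilp x}"
  unfolding max_ideal_def
proof (rule the_equality)
  have ne: "{x \<in> V. nilp x} \<noteq> V" using e_in not_nilp_e by blast
  show "alg_ideal sc V m {x \<in> V. nilp x} \<and> {x \<in> V. nilp x} \<noteq> V \<and>
     (\<forall>J. alg_ideal sc V m J \<and> {x \<in> V. nilp x} \<subseteq> J \<and> J \<noteq> V \<longrightarrow> J = {x \<in> V. nilp x})"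
    using ideal_nilp ne proper_ideal_nilp by blast
  fix I assume "alg_ideal sc V m I \<and> I \<noteq> V \<and> (\<forall>J. alg_ideal sc V m J \<and> I \<subseteq> J \<and> J \<noteq> V \<longrightarrow> J = I)"
  then show "I = {x \<in> V. nilp x}" using proper_ideal_nilp ideal_nilp ne by blast
qed

lemma max_ideal_decomposition:
  "V = {sc z e + u | z u. u \<in> max_ideal sc V m}" "range (\<lambda>z. sc z e) \<inter> max_ideal sc V m = {0}"
proof -
  show "V = {sc z e + u | z u. u \<in> max_ideal sc V m}"
  proof (intro set_eqI iffI)
    fix x assume x: "x \<in> V"
    then obtain c where "nilp (x - sc c e)" using scalar_plus_nilp by blast
    moreover have "x = sc c e + (x - sc c e)" by simp
    ultimately show "x \<in> {sc z e + u | z u. u \<in> max_ideal sc V m}"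
      unfolding max_ideal_eq using V_diff[OF x V_sc[OF e_in]] by blast
  qed (auto simp: max_ideal_eq V_add V_sc e_in)
  have "z = 0" if "nilp (sc z e)" for z
  proof (rule ccontr)
    assume "z \<noteq> 0"
    then have "sc (1 / z) (sc z e) = e" by simp
    then show False using nilp_sc[OF V_sc[OF e_in] that, of "1 / z"] not_nilp_e by simp
  qed
  then show "range (\<lambda>z. sc z e) \<inter> max_ideal sc V m = {0}"
    using V_0 nilp_0 by (auto simp: max_ideal_eq intro: rev_image_eqI[of 0])
qed

end

context cv_unfolding
begin

section \<open>The algebra structure on a tangent space\<close>

lemma unit_nonzero: assumes p: "p \<in> mfd A" shows "cv_unit A K C p \<noteq> 0"
proof
  assume "cv_unit A K C p = 0"
  then have n: "neg_id p = 0" using cv_unit(2)[OF p] C_0[OF p] by simp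
  obtain V \<psi> where t: "(V, \<psi>) \<in> trivs K" "p \<in> V" by (rule KB.obtain_triv[OF p])
  have "KB.frm \<psi> i p = 0" for i
    using fun_cong[OF n, of "KB.frm \<psi> i p"] KB.frm(1)[OF t] by (simp add: neg_id_def)
  then have "axis i (1::complex) = 0" for i :: 'n
    using KB.frm(2)[OF t, of i] KB.triv_sum[OF t, of "{}"] by simp
  then show False by simp
qed

lemma comm_alg_cv:
  assumes p: "p \<in> mfd A"
  shows "comm_alg tscl (tspace A p) (cv_mult A K C p) (cv_unit A K C p)"
proof -
  interpret vs: vector_space "tscl :: complex \<Rightarrow> ('a, 'm) tvec \<Rightarrow> ('a, 'm) tvec" by (rule vector_space_tscl)
  note mi = cv_mult(1)[OF p] and mC = cv_mult(2)[OF p]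
  have eqI: "X = Y" if "X \<in> tspace A p" "Y \<in> tspace A p" "\<And>a. a \<in> fib K p \<Longrightarrow> C p X a = C p Y a" for X Y
    by (rule C_inj[OF p that(1,2) KB.fib_end_eqI[OF p C_end[OF p that(1)] C_end[OF p that(2)] that(3)]])
  show ?thesis
  proof
    show "vs.subspace (tspace A p)" using TB.subspace_fib[OF p] by simp
    fix X Y assume X: "X \<in> tspace A p" and Y: "Y \<in> tspace A p"
    show "cv_mult A K C p X Y \<in> tspace A p" by (rule mi[OF X Y])
    show "cv_mult A K C p X Y = cv_mult A K C p Y X"
      by (rule eqI[OF mi[OF X Y] mi[OF Y X]]) (simp add: mC[OF X Y] mC[OF Y X] C_commute[OF p X Y])
    show "cv_mult A K C p X (tscl z Y) = tscl z (cv_mult A K C p X Y)" for z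
      by (rule eqI[OF mi[OF X tspace_scl[OF Y]] tspace_scl[OF mi[OF X Y]]])
        (simp add: mC[OF X tspace_scl[OF Y]] C_scl_apply[OF p mi[OF X Y]] C_scl_apply[OF p Y] mC[OF X Y]
          KB.end_scl[OF p C_end[OF p X] C_in[OF p Y]])
    fix Z assume Z: "Z \<in> tspace A p"
    show "cv_mult A K C p X (Y + Z) = cv_mult A K C p X Y + cv_mult A K C p X Z"
      by (rule eqI[OF mi[OF X tspace_add[OF Y Z]] tspace_add[OF mi[OF X Y] mi[OF X Z]]])
        (simp only: mC[OF X tspace_add[OF Y Z]] C_add_apply[OF p mi[OF X Y] mi[OF X Z]] C_add_apply[OF p Y Z] mC[OF X Y] mC[OF X Z]
          KB.end_add[OF p C_end[OF p X] C_in[OF p Y] C_in[OF p Z]], simp)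
    show "cv_mult A K C p (cv_mult A K C p X Y) Z = cv_mult A K C p X (cv_mult A K C p Y Z)"
      by (rule eqI[OF mi[OF mi[OF X Y] Z] mi[OF X mi[OF Y Z]]])
        (simp add: mC[OF mi[OF X Y] Z] mC[OF X mi[OF Y Z]] mC[OF X Y] mC[OF Y Z]
          KB.end_neg[OF p C_end[OF p X] C_in[OF p Y C_in[OF p Z]]])
  next
    show "cv_unit A K C p \<in> tspace A p" by (rule cv_unit(1)[OF p])
    show "cv_unit A K C p \<noteq> 0" by (rule unit_nonzero[OF p])
    fix X assume X: "X \<in> tspace A p"
    show "cv_mult A K C p (cv_unit A K C p) X = X"
      by (rule eqI[OF mi[OF cv_unit(1)[OF p] X] X])
        (simp add: mC[OF cv_unit(1)[OF p] X] cv_unit(2)[OF p] neg_id_def C_in[OF p X])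
  qed
qed

text \<open>The polynomial relation for \<open>X\<close> comes from a linear dependence among the
  coordinate vectors, in one chart, of its powers with exponents 0 to \<open>CARD('m)\<close>, one
  more than the dimension.\<close>

lemma irreducible_comm_alg_cv:
  assumes p: "p \<in> mfd A" and irr: "irreducible_algebra tscl (tspace A p) (cv_mult A K C p)"
  shows "irreducible_comm_alg tscl (tspace A p) (cv_mult A K C p) (cv_unit A K C p)"
proof -
  interpret T: comm_alg tscl "tspace A p" "cv_mult A K C p" "cv_unit A K C p" by (rule comm_alg_cv[OF p])
  obtain c where c: "c \<in> A" "p \<in> fst c" using p unfolding mfd_def by blast
  have "\<exists>q. q \<noteq> 0 \<and> T.peval X q = 0" if X: "X \<in> tspace A p" for X
  proof -
    define f where "f i = T.pw X i c" for i
    define N where "N = CARD('m)"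
    have "\<exists>u :: nat \<Rightarrow> complex. (\<exists>i\<le>N. u i \<noteq> 0) \<and> (\<Sum>i\<le>N. u i *s f i) = 0"
    \<comment> \<open>The notion of dependence concerns the set of powers and does not see
      repetitions. If two powers coincide, their difference is taken as the relation
      instead.\<close>
    proof (cases "inj_on f {..N}")
      case True
      have "vec.dim (f ` {..N}) \<le> N"
        using vec.dim_subset[of "f ` {..N}" UNIV] unfolding N_def vec_dim_card by simp
      then have "vec.dependent (f ` {..N})"
        by (intro vec.dependent_biggerset_general) (simp add: card_image[OF True])
      then obtain u v where u: "v \<in> f ` {..N}" "u v \<noteq> 0" "(\<Sum>v\<in>f ` {..N}. u v *s v) = 0"
        using vec.dependent_finite[of "f ` {..N}"] by auto
      then show ?thesis
        by (intro exI[of _ "\<lambda>i. u (f i)"]) (auto simp: sum.reindex[OF True])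
    next
      case False
      then obtain i j where ij: "i \<le> N" "j \<le> N" "i \<noteq> j" "f i = f j" by (auto simp: inj_on_def)
      have "(\<Sum>k\<le>N. ((if k = i then 1 else 0) - (if k = j then 1 else 0)) *s f k) =
          (\<Sum>k\<le>N. (if k = i then f k else 0) - (if k = j then f k else 0))"
        by (rule sum.cong) (auto simp: vector_sub_rdistrib)
      also have "\<dots> = 0" using ij by (simp add: sum_subtractf)
      finally show ?thesis
        using ij by (intro exI[of _ "\<lambda>k. (if k = i then 1 else 0) - (if k = j then 1 else 0)"]) auto
    qed
    then obtain u where u: "\<exists>i\<le>N. u i \<noteq> 0" "(\<Sum>i\<le>N. u i *s f i) = 0" by blast
    let ?q = "\<Sum>i\<le>N. monom (u i) i"
    have "?q \<noteq> 0"
    proof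
      assume "?q = 0"
      moreover obtain i where i: "i \<le> N" "u i \<noteq> 0" using u(1) by blast
      moreover have "coeff ?q i = u i" using i(1) by (simp add: coeff_sum)
      ultimately show False by simp
    qed
    moreover have "T.peval X ?q = 0"
    proof (rule tspace_eqI[OF c T.peval_in[OF X] tspace_0])
      have "(\<Sum>i\<in>I. tscl (u i) (T.pw X i)) c = (\<Sum>i\<in>I. u i *s f i)" for I
        by (induction I rule: infinite_finite_induct) (simp_all add: f_def tscl_def)
      then show "T.peval X ?q c = 0 c" unfolding T.peval_sum_monom[OF X] u(2) by (simp add: u(2))
    qed
    ultimately show ?thesis by blast
  qed
  then show ?thesis by unfold_locales (use irr in auto)
qed

text \<open>For a normal operator \<open>sq\<close> holds: if the square kills a vector, so does the
  operator, because the adjoint applied to the image has norm zero. Descending along the powers,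
  nilpotency then forces the operator to be zero.\<close>

lemma nilpotent_normal_zero:
  assumes p: "p \<in> mfd A" and X: "X \<in> tspace A p" and n: "comm_C p X = 0"
    and nil: "\<And>a. a \<in> fib K p \<Longrightarrow> (C p X ^^ k) a = 0"
  shows "C p X = 0"
proof -
  note Ce = C_end[OF p X] and Ae = adj_C_end[OF p X]
  have norm: "C p X (adj_C p X a) = adj_C p X (C p X a)" for a
    using fun_cong[OF n, of a] by (simp add: comm_C_def)
  have sq: "C p X a = 0" if a: "a \<in> fib K p" and z: "C p X (C p X a) = 0" for a
  proof -
    note Ca = KB.end_in[OF p Ce a]
    note ACa = KB.end_in[OF p Ae Ca]
    have h0: "v = 0" if "v \<in> fib K p" "h p v v = 0" for v
      using KB.H_Re_pos[OF p that(1)] that(2) by force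
    have "h p (adj_C p X (C p X a)) (adj_C p X (C p X a)) = h p (C p X (adj_C p X (C p X a))) (C p X a)"
      by (rule adj_C[OF p X ACa Ca, symmetric])
    also have "\<dots> = 0" unfolding norm z KB.end_0[OF p Ae] by (rule KB.H_0_left[OF p Ca])
    finally have "adj_C p X (C p X a) = 0" by (rule h0[OF ACa])
    then have "h p (C p X a) (C p X a) = 0" using adj_C[OF p X a Ca] KB.H_0_right[OF p a] by simp
    then show ?thesis by (rule h0[OF Ca])
  qed
  have "a \<in> fib K p \<Longrightarrow> (C p X ^^ Suc j) a = 0 \<Longrightarrow> C p X a = 0" for j a
  proof (induction j arbitrary: a)
    case (Suc j)
    have "(C p X ^^ Suc j) (C p X a) = 0" using Suc.prems(2) by (simp add: funpow_swap1)
    then have "C p X (C p X a) = 0" by (rule Suc.IH[OF KB.end_in[OF p Ce Suc.prems(1)]])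
    then show ?case by (rule sq[OF Suc.prems(1)])
  qed simp
  moreover have "(C p X ^^ Suc k) a = 0" if "a \<in> fib K p" for a
    using nil[OF that] KB.end_0[OF p Ce] by simp
  ultimately have "C p X a = 0" if "a \<in> fib K p" for a using that by blast
  then show ?thesis using KB.end_outside[OF p Ce] by (metis ext zero_fun_def)
qed

lemma comm_norm_max_ideal:
  assumes p: "p \<in> mfd A" and irr: "irreducible_algebra tscl (tspace A p) (cv_mult A K C p)"
    and X: "X \<in> max_ideal tscl (tspace A p) (cv_mult A K C p)" "X \<noteq> 0"
  shows "X \<in> tspace A p" "comm_norm p X > 0"
proof -
  interpret T: irreducible_comm_alg tscl "tspace A p" "cv_mult A K C p" "cv_unit A K C p"
    by (rule irreducible_comm_alg_cv[OF p irr])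
  have nX: "T.nilp X" and XV: "X \<in> tspace A p" using X(1) unfolding T.max_ideal_eq by auto
  then obtain k where k: "T.pw X k = 0" by (auto simp: T.nilp_def)
  \<comment> \<open>The sign starts at -1 because the unit acts by minus the identity, and changes
    at each step because the product acts by minus the composition.\<close>
  have "(C p X ^^ j) a = scl K ((-1) ^ (j + 1)) (C p (T.pw X j) a)" if a: "a \<in> fib K p" for j a
  proof (induction j)
    case 0
    then show ?case using a by (simp add: cv_unit(2)[OF p] neg_id_def)
  next
    case (Suc j)
    have "(C p X ^^ Suc j) a = C p X ((C p X ^^ j) a)" by simp
    also have "\<dots> = scl K ((-1) ^ (j + 1)) (C p X (C p (T.pw X j) a))"
      unfolding Suc.IH by (rule KB.end_scl[OF p C_end[OF p XV] C_in[OF p T.pw_in[OF XV] a]])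
    also have "\<dots> = scl K ((-1) ^ (Suc j + 1)) (C p (T.pw X (Suc j)) a)"
      unfolding T.pw_Suc cv_mult(2)[OF p XV T.pw_in[OF XV]] by simp
    finally show ?case .
  qed
  then have "(C p X ^^ k) a = 0" if "a \<in> fib K p" for a
    using that k by (simp add: C_0[OF p])
  moreover have "C p X \<noteq> 0" using C_inj[OF p XV tspace_0] X(2) C_0[OF p] by metis
  ultimately have "comm_C p X \<noteq> 0" using nilpotent_normal_zero[OF p XV] by blast
  then show "X \<in> tspace A p" "comm_norm p X > 0"
    using XV KB.h_end_pos[OF p comm_C_end[OF p XV]] by (auto simp: comm_norm_def)
qed

section \<open>Negative curvature near an irreducible point\<close>

text \<open>The polarisation of \<open>comm_C\<close>, linear in \<open>X\<close> and conjugate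
  linear in \<open>Y\<close>. It is needed to expand the commutator in coordinate fields.\<close>

definition comm_pair :: "'a \<Rightarrow> ('a, 'm) tvec \<Rightarrow> ('a, 'm) tvec \<Rightarrow> 'k \<Rightarrow> 'k" where
  "comm_pair p X Y a = C p X (adj_C p Y a) - adj_C p Y (C p X a)"

lemma comm_C_pair: "comm_C p X a = comm_pair p X X a"
  by (simp add: comm_C_def comm_pair_def)

lemma kappa_0: "p \<in> mfd A \<Longrightarrow> \<kappa> p 0 = 0"
  using kappa_add[of p 0 0] KB.fib_0 by simp

lemma kappa_sum:
  assumes p: "p \<in> mfd A" and f: "\<And>i. i \<in> I \<Longrightarrow> f i \<in> fib K p"
  shows "\<kappa> p (\<Sum>i\<in>I. f i) = (\<Sum>i\<in>I. \<kappa> p (f i))"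
  using f
proof (induction I rule: infinite_finite_induct)
  case (insert i I)
  then show ?case using kappa_add[OF p, of "f i" "sum f I"] KB.fib_sum[OF p, of I f] by simp
qed (simp_all add: kappa_0[OF p])

lemma adj_C_comb:
  assumes p: "p \<in> mfd A" and X: "\<And>i. i \<in> I \<Longrightarrow> X i \<in> tspace A p" and a: "a \<in> fib K p"
  shows "adj_C p (\<Sum>i\<in>I. tscl (x i) (X i)) a = (\<Sum>i\<in>I. scl K (cnj (x i)) (adj_C p (X i) a))"
proof -
  note k = kappa_fib[OF p a]
  have "C p (\<Sum>i\<in>I. tscl (x i) (X i)) (\<kappa> p a) = (\<Sum>i\<in>I. scl K (x i) (C p (X i) (\<kappa> p a)))"
    by (rule C_comb[OF p X])
  then have "\<kappa> p (C p (\<Sum>i\<in>I. tscl (x i) (X i)) (\<kappa> p a)) = \<kappa> p (\<Sum>i\<in>I. scl K (x i) (C p (X i) (\<kappa> p a)))"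
    by simp
  also have "\<dots> = (\<Sum>i\<in>I. \<kappa> p (scl K (x i) (C p (X i) (\<kappa> p a))))"
    by (rule kappa_sum[OF p KB.fib_scl[OF p C_in[OF p X k]]])
  also have "\<dots> = (\<Sum>i\<in>I. scl K (cnj (x i)) (\<kappa> p (C p (X i) (\<kappa> p a))))"
    by (rule sum.cong[OF refl kappa_scl[OF p C_in[OF p X k]]])
  finally show ?thesis using a by (simp add: adj_C_def)
qed

lemma comm_C_comb:
  assumes p: "p \<in> mfd A" and X: "\<And>i. X i \<in> tspace A p" and a: "a \<in> fib K p"
  shows "comm_C p (\<Sum>i\<in>UNIV. tscl (x i) (X i)) a =
    (\<Sum>\<pi>\<in>(UNIV :: ('i::finite \<times> 'i) set). scl K (x (fst \<pi>) * cnj (x (snd \<pi>))) (comm_pair p (X (fst \<pi>)) (X (snd \<pi>)) a))"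
proof -
  note ad = KB.end_in[OF p adj_C_end[OF p X] a] and ca = C_in[OF p X a]
  have Cs: "C p (\<Sum>i\<in>UNIV. tscl (x i) (X i)) b = (\<Sum>i\<in>UNIV. scl K (x i) (C p (X i) b))" for b
    by (rule C_comb[OF p X])
  have As: "adj_C p (\<Sum>i\<in>UNIV. tscl (x i) (X i)) b = (\<Sum>i\<in>UNIV. scl K (cnj (x i)) (adj_C p (X i) b))"
    if "b \<in> fib K p" for b
    by (rule adj_C_comb[OF p X that])
  have "C p (\<Sum>i\<in>UNIV. tscl (x i) (X i)) (adj_C p (\<Sum>i\<in>UNIV. tscl (x i) (X i)) a) =
      (\<Sum>i\<in>UNIV. scl K (x i) (C p (X i) (\<Sum>j\<in>UNIV. scl K (cnj (x j)) (adj_C p (X j) a))))"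
    unfolding As[OF a] by (rule Cs)
  also have "\<dots> = (\<Sum>i\<in>UNIV. \<Sum>j\<in>UNIV. scl K (x i * cnj (x j)) (C p (X i) (adj_C p (X j) a)))"
  proof (rule sum.cong[OF refl])
    fix i
    have "C p (X i) (\<Sum>j\<in>UNIV. scl K (cnj (x j)) (adj_C p (X j) a)) = (\<Sum>j\<in>UNIV. scl K (cnj (x j)) (C p (X i) (adj_C p (X j) a)))"
      by (rule KB.end_comb[OF p C_end[OF p X] ad])
    then show "scl K (x i) (C p (X i) (\<Sum>j\<in>UNIV. scl K (cnj (x j)) (adj_C p (X j) a))) =
        (\<Sum>j\<in>UNIV. scl K (x i * cnj (x j)) (C p (X i) (adj_C p (X j) a)))"
      by (simp add: KB.vs.scale_sum_right)
  qed
  finally have 1: "C p (\<Sum>i\<in>UNIV. tscl (x i) (X i)) (adj_C p (\<Sum>i\<in>UNIV. tscl (x i) (X i)) a) =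
      (\<Sum>i\<in>UNIV. \<Sum>j\<in>UNIV. scl K (x i * cnj (x j)) (C p (X i) (adj_C p (X j) a)))" .
  have Ca: "C p (\<Sum>i\<in>UNIV. tscl (x i) (X i)) a \<in> fib K p"
    unfolding Cs by (rule KB.fib_sum[OF p KB.fib_scl[OF p ca]])
  have "adj_C p (\<Sum>i\<in>UNIV. tscl (x i) (X i)) (C p (\<Sum>i\<in>UNIV. tscl (x i) (X i)) a) =
      (\<Sum>j\<in>UNIV. scl K (cnj (x j)) (adj_C p (X j) (\<Sum>i\<in>UNIV. scl K (x i) (C p (X i) a))))"
    by (subst As[OF Ca]) (simp only: Cs)
  also have "\<dots> = (\<Sum>j\<in>UNIV. \<Sum>i\<in>UNIV. scl K (x i * cnj (x j)) (adj_C p (X j) (C p (X i) a)))"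
  proof (rule sum.cong[OF refl])
    fix j
    have "adj_C p (X j) (\<Sum>i\<in>UNIV. scl K (x i) (C p (X i) a)) = (\<Sum>i\<in>UNIV. scl K (x i) (adj_C p (X j) (C p (X i) a)))"
      by (rule KB.end_comb[OF p adj_C_end[OF p X] ca])
    then show "scl K (cnj (x j)) (adj_C p (X j) (\<Sum>i\<in>UNIV. scl K (x i) (C p (X i) a))) =
        (\<Sum>i\<in>UNIV. scl K (x i * cnj (x j)) (adj_C p (X j) (C p (X i) a)))"
      by (simp add: KB.vs.scale_sum_right mult.commute)
  qed
  also have "\<dots> = (\<Sum>i\<in>UNIV. \<Sum>j\<in>UNIV. scl K (x i * cnj (x j)) (adj_C p (X j) (C p (X i) a)))" by (rule sum.swap)
  finally have 2: "adj_C p (\<Sum>i\<in>UNIV. tscl (x i) (X i)) (C p (\<Sum>i\<in>UNIV. tscl (x i) (X i)) a) =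
      (\<Sum>i\<in>UNIV. \<Sum>j\<in>UNIV. scl K (x i * cnj (x j)) (adj_C p (X j) (C p (X i) a)))" .
  have "comm_C p (\<Sum>i\<in>UNIV. tscl (x i) (X i)) a = (\<Sum>i\<in>UNIV. \<Sum>j\<in>UNIV. scl K (x i * cnj (x j)) (comm_pair p (X i) (X j) a))"
    unfolding comm_C_pair comm_pair_def[of p "\<Sum>i\<in>UNIV. tscl (x i) (X i)"] 1 2
    by (simp add: comm_pair_def KB.vs.scale_right_diff_distrib sum_subtractf)
  then show ?thesis by (simp add: sum.cartesian_product case_prod_beta)
qed

section \<open>Joint continuity of both squared norms in the point and the vector\<close>

lemma adj_C_smooth:
  assumes W: "open_in A W" and X: "smooth_sec A (tbundle A) W X" and s: "smooth_sec A K W s"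
  shows "smooth_sec A K W (\<lambda>p. adj_C p (X p) (s p))"
  by (rule KB.smooth_sec_cong[OF open_inD(1)[OF W] _ kappa_smooth[OF W C_smooth[OF W X kappa_smooth[OF W s]]]])
    (simp add: adj_C_def KB.smooth_secD(1)[OF s])

lemma comm_pair_smooth:
  assumes W: "open_in A W" and X: "smooth_sec A (tbundle A) W X" and Y: "smooth_sec A (tbundle A) W Y" and s: "smooth_sec A K W s"
  shows "smooth_sec A K W (\<lambda>p. comm_pair p (X p) (Y p) (s p))"
  unfolding comm_pair_def
  by (rule KB.smooth_sec_diff[OF W C_smooth[OF W X adj_C_smooth[OF W Y s]] adj_C_smooth[OF W Y C_smooth[OF W X s]]])

abbreviation coord_field :: "('a, 'm) chart \<Rightarrow> 'm \<Rightarrow> 'a \<Rightarrow> ('a, 'm) tvec" where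
  "coord_field c \<equiv> TB.frm (\<lambda>p X. X c)"

lemma chart_triv: "c \<in> A \<Longrightarrow> (fst c, \<lambda>p X. X c) \<in> trivs (tbundle A)"
  unfolding trivs_tbundle by blast

lemma tvec_of_expand:
  assumes "c \<in> A" "p \<in> fst c"
  shows "tvec_of c p x = (\<Sum>j\<in>UNIV. tscl (x $ j) (coord_field c j p))" "coord_field c j p \<in> tspace A p"
  using TB.frm_expand[OF chart_triv[OF assms(1)] assms(2), of "tvec_of c p x"] tvec_of[OF assms]
    TB.frm(1)[OF chart_triv[OF assms(1)] assms(2)] by simp_all

lemma coord_field_smooth: "c \<in> A \<Longrightarrow> W \<subseteq> fst c \<Longrightarrow> smooth_sec A (tbundle A) W (coord_field c j)"
  by (rule TB.smooth_sec_subset[OF TB.frm_smooth[OF chart_triv]])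

text \<open>In coordinates of the vector this is a hermitian polynomial whose coefficients are
  continuous in the point. Continuity is needed jointly in both variables, as the tube lemma is to
  be applied.\<close>

lemma norm_M_continuous:
  assumes c: "c \<in> A" and S: "open_in A S" "S \<subseteq> fst c"
  shows "continuous_on (S \<times> UNIV) (\<lambda>z. norm_M (fst z) (tvec_of c (fst z) (snd z)))"
proof -
  note H = smooth_fun_continuous[OF h_M_smooth[OF S(1) coord_field_smooth[OF c S(2)] coord_field_smooth[OF c S(2)]] S(1)]
  define f where "f z = Re (\<Sum>i\<in>UNIV. snd z $ i * (\<Sum>j\<in>UNIV. cnj (snd z $ j) * h_M K C h (fst z) (coord_field c i (fst z)) (coord_field c j (fst z))))"
    for z :: "'a \<times> (complex^'m)"
  have "continuous_on (S \<times> UNIV) f"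
    unfolding f_def
    by (intro continuous_intros continuous_on_compose2[OF H]) auto
  moreover have "f z = norm_M (fst z) (tvec_of c (fst z) (snd z))" if "z \<in> S \<times> UNIV" for z
  proof -
    have q: "fst z \<in> fst c" "fst z \<in> mfd A" using that S open_inD(3)[OF S(1)] by auto
    note b = tvec_of_expand(2)[OF c q(1)]
    have b': "coord_field c j (fst z) \<in> fib (tbundle A) (fst z)" for j using b by simp
    have tz: "tvec_of c (fst z) (snd z) \<in> fib (tbundle A) (fst z)" using tvec_of(1)[OF c q(1)] by simp
    have "h_M K C h (fst z) (tvec_of c (fst z) (snd z)) (tvec_of c (fst z) (snd z)) =
        h_M K C h (fst z) (\<Sum>j\<in>UNIV. scl (tbundle A) (snd z $ j) (coord_field c j (fst z))) (tvec_of c (fst z) (snd z))"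
      by (subst tvec_of_expand(1)[OF c q(1), of "snd z"]) simp
    also have "\<dots> = (\<Sum>i\<in>UNIV. snd z $ i * h_M K C h (fst z) (coord_field c i (fst z)) (tvec_of c (fst z) (snd z)))"
      by (rule TB.H_comb_left[OF q(2) b' tz])
    also have "\<dots> = (\<Sum>i\<in>UNIV. snd z $ i * (\<Sum>j\<in>UNIV. cnj (snd z $ j) * h_M K C h (fst z) (coord_field c i (fst z)) (coord_field c j (fst z))))"
    proof (rule sum.cong[OF refl], rule arg_cong[where f = "(*) _"])
      fix i
      have "h_M K C h (fst z) (coord_field c i (fst z)) (tvec_of c (fst z) (snd z)) =
          h_M K C h (fst z) (coord_field c i (fst z)) (\<Sum>j\<in>UNIV. scl (tbundle A) (snd z $ j) (coord_field c j (fst z)))"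
        by (subst tvec_of_expand(1)[OF c q(1), of "snd z"]) simp
      also have "\<dots> = (\<Sum>j\<in>UNIV. cnj (snd z $ j) * h_M K C h (fst z) (coord_field c i (fst z)) (coord_field c j (fst z)))"
        by (rule TB.H_comb_right[OF q(2) b' b'])
      finally show "h_M K C h (fst z) (coord_field c i (fst z)) (tvec_of c (fst z) (snd z)) =
        (\<Sum>j\<in>UNIV. cnj (snd z $ j) * h_M K C h (fst z) (coord_field c i (fst z)) (coord_field c j (fst z)))" .
    qed
    finally show ?thesis by (simp add: norm_M_def f_def)
  qed
  ultimately show ?thesis by (rule continuous_on_eq)
qed

text \<open>As for \<open>norm_M\<close>, but of degree two in the coordinates and two in their
  conjugates: each of the two commutators contributes products \<open>x $ i * cnj (x $ j)\<close>,
  indexed by pairs.\<close>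

lemma comm_norm_continuous:
  assumes c: "c \<in> A" and t: "(V, \<psi>) \<in> trivs K" and S: "open_in A S" "S \<subseteq> fst c" "S \<subseteq> V"
  shows "continuous_on (S \<times> UNIV) (\<lambda>z. comm_norm (fst z) (tvec_of c (fst z) (snd z)))"
proof -
  define P where "P x \<pi> = x $ (fst \<pi>) * cnj (x $ (snd \<pi>))" for x :: "complex^'m" and \<pi>
  define s where "s i \<pi> q = comm_pair q (coord_field c (fst \<pi>) q) (coord_field c (snd \<pi>) q) (KB.frm \<psi> i q)" for i \<pi> q
  define s' where "s' i \<pi> q = comm_pair q (coord_field c (fst \<pi>) q) (coord_field c (snd \<pi>) q) (KB.dfrm \<psi> i q)" for i \<pi> q
  note f = coord_field_smooth[OF c S(2)]
  have s: "smooth_sec A K S (s i \<pi>)" "smooth_sec A K S (s' i \<pi>)" for i \<pi>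
    unfolding s_def s'_def
    by (rule comm_pair_smooth[OF S(1) f f KB.smooth_sec_subset[OF KB.frm_smooth[OF t] S(3)]],
        rule comm_pair_smooth[OF S(1) f f KB.smooth_sec_subset[OF KB.dfrm_smooth[OF t] S(3)]])
  note H = smooth_fun_continuous[OF h_smooth[OF S(1) s(1) s(2)] S(1)]
  define F where "F z = Re (\<Sum>i\<in>UNIV. \<Sum>\<pi>\<in>UNIV. P (snd z) \<pi> * (\<Sum>\<rho>\<in>UNIV. cnj (P (snd z) \<rho>) * h (fst z) (s i \<pi> (fst z)) (s' i \<rho> (fst z))))" for z
  have "continuous_on (S \<times> UNIV) F"
    unfolding F_def P_def
    by (intro continuous_intros continuous_on_compose2[OF H]) auto
  moreover have "F z = comm_norm (fst z) (tvec_of c (fst z) (snd z))" if z: "z \<in> S \<times> UNIV" for z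
  proof -
    obtain q x where zq: "z = (q, x)" by (cases z)
    have q: "q \<in> S" "q \<in> fst c" "q \<in> V" "q \<in> mfd A" using z S open_inD(3)[OF S(1)] zq by auto
    note X = tvec_of_expand(2)[OF c q(2)] and Xq = tvec_of(1)[OF c q(2)]
    note d = KB.dual_basesD[OF q(4) KB.dfrm_dual[OF t q(3)]]
    note ss = KB.smooth_secD(1)[OF s(1) q(1)] KB.smooth_secD(1)[OF s(2) q(1)]
    have G: "comm_C q (tvec_of c q x) (KB.frm \<psi> i q) = (\<Sum>\<pi>\<in>UNIV. scl K (P x \<pi>) (s i \<pi> q))"
      "comm_C q (tvec_of c q x) (KB.dfrm \<psi> i q) = (\<Sum>\<pi>\<in>UNIV. scl K (P x \<pi>) (s' i \<pi> q))" for i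
      unfolding tvec_of_expand(1)[OF c q(2)] P_def s_def s'_def
      by (rule comm_C_comb[OF q(4) X d(1)], rule comm_C_comb[OF q(4) X d(2)])
    have e: "h q (\<Sum>\<pi>\<in>UNIV. scl K (P x \<pi>) (s i \<pi> q)) (\<Sum>\<pi>\<in>UNIV. scl K (P x \<pi>) (s' i \<pi> q)) =
        (\<Sum>\<pi>\<in>UNIV. P x \<pi> * (\<Sum>\<rho>\<in>UNIV. cnj (P x \<rho>) * h q (s i \<pi> q) (s' i \<rho> q)))" for i
    proof -
      have "h q (\<Sum>\<pi>\<in>UNIV. scl K (P x \<pi>) (s i \<pi> q)) (\<Sum>\<pi>\<in>UNIV. scl K (P x \<pi>) (s' i \<pi> q)) =
          (\<Sum>\<pi>\<in>UNIV. P x \<pi> * h q (s i \<pi> q) (\<Sum>\<pi>\<in>UNIV. scl K (P x \<pi>) (s' i \<pi> q)))"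
        by (rule KB.H_comb_left[OF q(4) ss(1) KB.fib_sum[OF q(4) KB.fib_scl[OF q(4) ss(2)]]])
      also have "\<dots> = (\<Sum>\<pi>\<in>UNIV. P x \<pi> * (\<Sum>\<rho>\<in>UNIV. cnj (P x \<rho>) * h q (s i \<pi> q) (s' i \<rho> q)))"
        by (rule sum.cong[OF refl], rule arg_cong[where f = "(*) _"], rule KB.H_comb_right[OF q(4) ss(2) ss(1)])
      finally show ?thesis .
    qed
    show ?thesis
      unfolding comm_norm_def zq fst_conv snd_conv F_def
        KB.h_end_eq[OF q(4) comm_C_end[OF q(4) Xq] comm_C_end[OF q(4) Xq] KB.dfrm_dual[OF t q(3)]] G e ..
  qed
  ultimately show ?thesis by (rule continuous_on_eq)
qed

section \<open>Positivity, homogeneity and translation by the unit\<close>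

lemma norm_M_pos: "p \<in> mfd A \<Longrightarrow> X \<in> tspace A p \<Longrightarrow> X \<noteq> 0 \<Longrightarrow> norm_M p X > 0"
  unfolding norm_M_def using TB.H_Re_pos by simp

lemma norm_M_nonneg: "p \<in> mfd A \<Longrightarrow> X \<in> tspace A p \<Longrightarrow> norm_M p X \<ge> 0"
  unfolding norm_M_def using TB.H_self_nonneg by simp

lemma norm_M_scl:
  assumes p: "p \<in> mfd A" and X: "X \<in> tspace A p" shows "norm_M p (tscl (of_real r) X) = r\<^sup>2 * norm_M p X"
proof -
  have X': "X \<in> fib (tbundle A) p" using X by simp
  note X'' = TB.fib_scl[OF p X', of "of_real r"]
  have "h_M K C h p (scl (tbundle A) (of_real r) X) (scl (tbundle A) (of_real r) X) = of_real r * (of_real r * h_M K C h p X X)"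
    unfolding TB.H_scl_left[OF p X' X''] TB.H_scl_right[OF p X' X'] by simp
  then show ?thesis by (simp add: norm_M_def power2_eq_square)
qed

lemma comm_C_scl:
  assumes p: "p \<in> mfd A" and X: "X \<in> tspace A p"
  shows "comm_C p (tscl (of_real r) X) = end_scl K (of_real (r\<^sup>2)) (comm_C p X)"
proof (rule KB.fib_end_eqI[OF p comm_C_end[OF p tspace_scl[OF X]] KB.fib_end_scl[OF p comm_C_end[OF p X]]])
  fix a assume a: "a \<in> fib K p"
  have ad: "adj_C p (tscl (of_real r) X) b = scl K (of_real r) (adj_C p X b)" if "b \<in> fib K p" for b
    using adj_C_comb[OF p, of "{()}" "\<lambda>_. X" b "\<lambda>_. of_real r"] X that by simp
  show "comm_C p (tscl (of_real r) X) a = end_scl K (of_real (r\<^sup>2)) (comm_C p X) a"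
    using KB.end_scl[OF p C_end[OF p X] KB.end_in[OF p adj_C_end[OF p X] a]] KB.end_scl[OF p adj_C_end[OF p X] C_in[OF p X a]]
      ad[OF a] ad[OF KB.fib_scl[OF p C_in[OF p X a]]]
    by (simp add: comm_C_pair comm_pair_def end_scl_def C_scl_apply[OF p X] KB.vs.scale_right_diff_distrib power2_eq_square)
qed

text \<open>Degree four, as for the square of \<open>norm_M\<close>. Comparing these two quantities
  is therefore invariant under positive scaling and need only be done on coordinate vectors of
  length one.\<close>

lemma comm_norm_scl:
  assumes p: "p \<in> mfd A" and X: "X \<in> tspace A p" shows "comm_norm p (tscl (of_real r) X) = (r\<^sup>2)\<^sup>2 * comm_norm p X"
proof -
  note G = comm_C_end[OF p X] and G' = KB.fib_end_scl[OF p comm_C_end[OF p X], of "of_real (r\<^sup>2)"]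
  have "h_end K h p (end_scl K (of_real (r\<^sup>2)) (comm_C p X)) (end_scl K (of_real (r\<^sup>2)) (comm_C p X)) =
      of_real (r\<^sup>2) * cnj (of_real (r\<^sup>2) * h_end K h p (comm_C p X) (comm_C p X))"
    unfolding KB.h_end_scl_left[OF p G G'] KB.h_end_sym[OF p G' G] KB.h_end_scl_left[OF p G G] ..
  then show ?thesis unfolding comm_norm_def comm_C_scl[OF p X] by (simp add: power2_eq_square)
qed

lemma comm_C_unit_add:
  assumes p: "p \<in> mfd A" and u: "u \<in> tspace A p"
  shows "comm_C p (cv_unit A K C p + u) = comm_C p u"
proof (rule KB.fib_end_eqI[OF p comm_C_end[OF p tspace_add[OF cv_unit(1)[OF p] u]] comm_C_end[OF p u]])
  fix a assume a: "a \<in> fib K p"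
  note e = cv_unit[OF p]
  have Ce: "C p (cv_unit A K C p + u) b = C p u b - b" if "b \<in> fib K p" for b
    unfolding C_add_apply[OF p e(1) u] e(2) using that by (simp add: neg_id_def)
  have Ae: "adj_C p (cv_unit A K C p + u) b = adj_C p u b - b" if b: "b \<in> fib K p" for b
  proof -
    note k = kappa_fib[OF p b]
    have "\<kappa> p (C p u (\<kappa> p b) + scl K (-1) (\<kappa> p b)) = \<kappa> p (C p u (\<kappa> p b)) + scl K (cnj (-1)) (\<kappa> p (\<kappa> p b))"
      unfolding kappa_add[OF p C_in[OF p u k] KB.fib_scl[OF p k]] kappa_scl[OF p k] ..
    then show ?thesis unfolding adj_C_def using b Ce[OF k] kappa_invol[OF p b] by simp
  qed
  have Ca: "C p u a \<in> fib K p" and Aa: "adj_C p u a \<in> fib K p"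
    using C_in[OF p u a] KB.end_in[OF p adj_C_end[OF p u] a] by auto
  have *: "C p u (adj_C p u a - a) = C p u (adj_C p u a) - C p u a" "adj_C p u (C p u a - a) = adj_C p u (C p u a) - adj_C p u a"
    by (rule KB.end_diff[OF p C_end[OF p u] Aa a], rule KB.end_diff[OF p adj_C_end[OF p u] Ca a])
  show "comm_C p (cv_unit A K C p + u) a = comm_C p u a"
    unfolding comm_C_pair comm_pair_def Ae[OF a] Ce[OF a] Ce[OF KB.fib_diff[OF p Aa a]] Ae[OF KB.fib_diff[OF p Ca a]] * by simp
qed

lemma comm_norm_unit_add:
  "p \<in> mfd A \<Longrightarrow> u \<in> tspace A p \<Longrightarrow> comm_norm p (cv_unit A K C p + u) = comm_norm p u"
  by (simp add: comm_norm_def comm_C_unit_add)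

lemma tvec_of_linear:
  assumes c: "c \<in> A" "p \<in> fst c"
  shows "tvec_of c p (x + y) = tvec_of c p x + tvec_of c p y" "tvec_of c p (z *s x) = tscl z (tvec_of c p x)"
proof -
  note t = tvec_of(1,2)[OF c]
  show "tvec_of c p (x + y) = tvec_of c p x + tvec_of c p y"
    by (rule tspace_eqI[OF c t(1) tspace_add[OF t(1) t(1)]]) (simp add: t(2))
  show "tvec_of c p (z *s x) = tscl z (tvec_of c p x)"
    by (rule tspace_eqI[OF c t(1) tspace_scl[OF t(1)]]) (simp add: t(2) tscl_def)
qed

lemma unit_continuous:
  assumes c: "c \<in> A" shows "continuous_on (fst c) (\<lambda>q. cv_unit A K C q c)"
proof -
  have sub: "fst c \<subseteq> mfd A" using c unfolding mfd_def by blast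
  have o: "open_in A (fst c)" by (rule open_inI[OF chart_homeo(1)[OF c] order_refl c])
  have "smooth_fun A (fst c) (\<lambda>q. cv_unit A K C q c $ i)" for i
    using TB.smooth_secD(2)[OF unit_smooth chart_triv[OF c], of i] sub by (simp add: Int_absorb1)
  then have "continuous_on (fst c) (\<lambda>q. \<chi> i. cv_unit A K C q c $ i)"
    by (intro continuous_on_vec_lambda smooth_fun_continuous[OF _ o])
  then show ?thesis by simp
qed

section \<open>Cones around an irreducible point\<close>

context
  fixes t c
  assumes t: "t \<in> mfd A" and irr: "irreducible_algebra tscl (tspace A t) (cv_mult A K C t)"
    and c: "c \<in> A" "t \<in> fst c"
begin

abbreviation I\<^sub>t :: "('a, 'm) tvec set" where
  "I\<^sub>t \<equiv> max_ideal tscl (tspace A t) (cv_mult A K C t)"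

definition I_coord :: "(complex^'m) set" where
  "I_coord = {x. tvec_of c t x \<in> I\<^sub>t}"

interpretation T: irreducible_comm_alg tscl "tspace A t" "cv_mult A K C t" "cv_unit A K C t"
  by (rule irreducible_comm_alg_cv[OF t irr])

lemma I_coord_add: "x \<in> I_coord \<Longrightarrow> y \<in> I_coord \<Longrightarrow> x + y \<in> I_coord"
  unfolding I_coord_def T.max_ideal_eq tvec_of_linear[OF c] mem_Collect_eq using T.V_add T.nilp_add by blast

lemma I_coord_scl: "x \<in> I_coord \<Longrightarrow> z *s x \<in> I_coord"
  unfolding I_coord_def T.max_ideal_eq tvec_of_linear[OF c] mem_Collect_eq using T.V_sc T.nilp_sc by blast

lemma I_coord_scaleR:
  assumes "x \<in> I_coord" shows "r *\<^sub>R x \<in> I_coord"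
proof -
  have "r *\<^sub>R x = of_real r *s x" unfolding vec_eq_iff by (simp add: scaleR_conv_of_real[where 'a = complex])
  then show ?thesis using I_coord_scl[OF assms] by simp
qed

lemma I_coord_0: "0 \<in> I_coord"
proof -
  have "tvec_of c t 0 = 0" by (rule tspace_eqI[OF c tvec_of(1)[OF c] tspace_0]) (simp add: tvec_of(2)[OF c])
  then show ?thesis unfolding I_coord_def T.max_ideal_eq using T.V_0 T.nilp_0 by simp
qed

lemma closed_I_coord: "closed I_coord"
  by (rule closed_subspace) (simp add: subspace_def I_coord_0 I_coord_add I_coord_scaleR)

lemma I_t_coord: "X \<in> I\<^sub>t \<Longrightarrow> X \<in> tspace A t \<and> X c \<in> I_coord"
  unfolding I_coord_def T.max_ideal_eq using tvec_of(3)[OF c] by auto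

lemma unit_not_I_coord: "cv_unit A K C t c \<notin> I_coord"
  unfolding I_coord_def T.max_ideal_eq using tvec_of(3)[OF c T.e_in] T.not_nilp_e by simp

text \<open>The cones are linear: in the chart \<open>c\<close> all of them are the coordinate space of the maximal ideal at \<open>t\<close>.\<close>

definition neg_cone :: "'a \<Rightarrow> ('a, 'm) tvec set" where
  "neg_cone q = {X \<in> tspace A q. X c \<in> I_coord}"

lemma neg_cone_scl: "X \<in> neg_cone q \<Longrightarrow> tscl z X \<in> neg_cone q"
  unfolding neg_cone_def using tspace_scl I_coord_scl by (auto simp: tscl_def)

text \<open>\<open>I_coord\<close> is a complement of one line, so any line not contained in it is a
  complement as well. The only condition at \<open>q\<close> is that the coordinates of the unit lie
  outside.\<close>

lemma neg_cone_decomposition: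
  assumes q: "q \<in> fst c" and e: "cv_unit A K C q c \<notin> I_coord"
  shows "tspace A q = {tscl z (cv_unit A K C q) + u | z u. u \<in> neg_cone q}"
    "range (\<lambda>z. tscl z (cv_unit A K C q)) \<inter> neg_cone q = {0}"
proof -
  have m: "q \<in> mfd A" using q c(1) unfolding mfd_def by blast
  note eq = cv_unit(1)[OF m]
  \<comment> \<open>The splitting of the algebra at \<open>t\<close>, read as a splitting of the
    coordinate space that is used at all nearby points.\<close>
  have dec: "\<exists>z u. x = z *s cv_unit A K C t c + u \<and> u \<in> I_coord" for x
  proof -
    have "tvec_of c t x \<in> {tscl z (cv_unit A K C t) + u | z u. u \<in> I\<^sub>t}"
      using T.max_ideal_decomposition(1) tvec_of(1)[OF c] by blast
    then obtain z u where zu: "tvec_of c t x = tscl z (cv_unit A K C t) + u" "u \<in> I\<^sub>t" by blast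
    have "x = z *s cv_unit A K C t c + u c"
      using fun_cong[OF zu(1), of c] tvec_of(2)[OF c] by (simp add: tscl_def)
    then show ?thesis using I_t_coord[OF zu(2)] by blast
  qed
  obtain z0 u0 where 0: "cv_unit A K C q c = z0 *s cv_unit A K C t c + u0" "u0 \<in> I_coord" using dec by blast
  \<comment> \<open>\<open>z0\<close> is the component of the unit at \<open>q\<close> along the
    unit at \<open>t\<close>; dividing by it removes that component from an arbitrary
    vector.\<close>
  have z0: "z0 \<noteq> 0" using e 0 by auto
  show "tspace A q = {tscl z (cv_unit A K C q) + u | z u. u \<in> neg_cone q}"
  proof (intro set_eqI iffI)
    fix X assume X: "X \<in> tspace A q"
    obtain z u where zu: "X c = z *s cv_unit A K C t c + u" "u \<in> I_coord" using dec by blast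
    define Y where "Y = X + tscl (- (z / z0)) (cv_unit A K C q)"
    have Yc: "Y c = u + (- (z / z0)) *s u0"
      using z0 by (simp add: Y_def tscl_def zu(1) 0(1) vec_eq_iff field_simps)
    have Yt: "Y \<in> tspace A q" unfolding Y_def by (rule tspace_add[OF X tspace_scl[OF eq]])
    have "Y c \<in> I_coord" unfolding Yc by (rule I_coord_add[OF zu(2) I_coord_scl[OF 0(2)]])
    with Yt have "Y \<in> neg_cone q" by (simp add: neg_cone_def)
    moreover have "X = tscl (z / z0) (cv_unit A K C q) + Y"
      by (simp add: Y_def tscl_def fun_eq_iff vec_eq_iff)
    ultimately show "X \<in> {tscl z (cv_unit A K C q) + u | z u. u \<in> neg_cone q}" by blast
  next
    fix X assume "X \<in> {tscl z (cv_unit A K C q) + u | z u. u \<in> neg_cone q}"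
    then show "X \<in> tspace A q" using tspace_add[OF tspace_scl[OF eq]] by (auto simp: neg_cone_def)
  qed
  have zero: "tscl z (cv_unit A K C q) = 0" if "tscl z (cv_unit A K C q) \<in> neg_cone q" for z
  proof (cases "z = 0")
    case False
    have "(1 / z) *s (z *s cv_unit A K C q c) \<in> I_coord"
      by (rule I_coord_scl) (use that in \<open>simp add: neg_cone_def tscl_def\<close>)
    then show ?thesis using e False by (simp add: vector_smult_assoc)
  qed (simp add: tscl_def fun_eq_iff)
  show "range (\<lambda>z. tscl z (cv_unit A K C q)) \<inter> neg_cone q = {0}"
  proof (intro equalityI subsetI)
    fix X assume "X \<in> range (\<lambda>z. tscl z (cv_unit A K C q)) \<inter> neg_cone q"
    then obtain z where "X = tscl z (cv_unit A K C q)" "X \<in> neg_cone q" by blast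
    then show "X \<in> {0}" using zero by simp
  next
    fix X :: "('a, 'm) tvec" assume "X \<in> {0}"
    moreover have "0 \<in> neg_cone q" using tspace_0 I_coord_0 by (simp add: neg_cone_def)
    moreover have "0 = tscl 0 (cv_unit A K C q)" by (simp add: tscl_def fun_eq_iff)
    ultimately show "X \<in> range (\<lambda>z. tscl z (cv_unit A K C q)) \<inter> neg_cone q" by blast
  qed
qed

text \<open>The neighbourhood has to meet two demands: the inequality between the two squared norms
  persists on all of the cone, and the unit stays outside \<open>I_coord\<close>, so that the cone
  remains a complement. Both are open conditions that hold at \<open>t\<close>.\<close>

lemma neg_cone_bound:
  "\<exists>N k. open_in A N \<and> t \<in> N \<and> N \<subseteq> fst c \<and> k > 0 \<and>
    (\<forall>q\<in>N. cv_unit A K C q c \<notin> I_coord \<and> (\<forall>u\<in>neg_cone q - {0}. comm_norm q u > k * (norm_M q u)\<^sup>2))"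
proof -
  obtain V \<psi> where tr: "(V, \<psi>) \<in> trivs K" "t \<in> V" by (rule KB.obtain_triv[OF t])
  define S where "S = fst c \<inter> V"
  have S: "open_in A S" "t \<in> S" "S \<subseteq> fst c" "S \<subseteq> V"
    using open_in_Int(1)[OF open_inI[OF chart_homeo(1)[OF c(1)] order_refl c(1)] open_inD(1)[OF KB.triv_open[OF tr(1)]]] c tr
    by (auto simp: S_def)
  note oS = open_inD(1)[OF S(1)]
  define f where "f z = comm_norm (fst z) (tvec_of c (fst z) (snd z))" for z :: "'a \<times> (complex^'m)"
  define n where "n z = norm_M (fst z) (tvec_of c (fst z) (snd z))" for z :: "'a \<times> (complex^'m)"
  have cf: "continuous_on (S \<times> UNIV) f" "continuous_on (S \<times> UNIV) n"
    unfolding f_def n_def by (rule comm_norm_continuous[OF c(1) tr(1) S(1,3,4)], rule norm_M_continuous[OF c(1) S(1,3)])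
  define S0 where "S0 = I_coord \<inter> sphere 0 1"
  have cS0: "compact S0" unfolding S0_def by (rule closed_Int_compact[OF closed_I_coord compact_sphere])
  have pos: "f (t, x) > 0" "n (t, x) > 0" if x: "x \<in> S0" for x
  proof -
    have X: "tvec_of c t x \<in> I\<^sub>t" using x by (simp add: S0_def I_coord_def)
    have nz: "tvec_of c t x \<noteq> 0" using tvec_of(2)[OF c, of x] x by (auto simp: S0_def)
    show "f (t, x) > 0" using comm_norm_max_ideal(2)[OF t irr X nz] by (simp add: f_def)
    show "n (t, x) > 0" using norm_M_pos[OF t tvec_of(1)[OF c] nz] by (simp add: n_def)
  qed
  have "\<exists>k>0. \<forall>x\<in>S0. f (t, x) > k * (n (t, x))\<^sup>2"
  \<comment> \<open>The sphere is empty when the maximal ideal is zero; then nothing is claimed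
    about vectors and any positive constant will do.\<close>
  proof (cases "S0 = {}")
    case False
    have ct: "continuous_on S0 (\<lambda>x. f (t, x))" "continuous_on S0 (\<lambda>x. n (t, x))"
      by (rule continuous_on_compose2[OF cf(1)], (intro continuous_intros), use S(2) in blast)
        (rule continuous_on_compose2[OF cf(2)], (intro continuous_intros), use S(2) in blast)
    have "continuous_on S0 (\<lambda>x. f (t, x) / (n (t, x))\<^sup>2)"
      by (intro continuous_intros ct) (use pos(2) in force)
    then obtain x0 where x0: "x0 \<in> S0" "\<And>x. x \<in> S0 \<Longrightarrow> f (t, x0) / (n (t, x0))\<^sup>2 \<le> f (t, x) / (n (t, x))\<^sup>2"
      using continuous_attains_inf[OF cS0 False] by blast
    \<comment> \<open>The minimum of the ratio at \<open>t\<close>. Half of it is used below, so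
      that the inequality is strict and survives a small change of the point.\<close>
    define m0 where "m0 = f (t, x0) / (n (t, x0))\<^sup>2"
    have m0: "m0 > 0" using pos[OF x0(1)] by (simp add: m0_def)
    have "f (t, x) > (m0 / 2) * (n (t, x))\<^sup>2" if "x \<in> S0" for x
    proof -
      have "(m0 / 2) * (n (t, x))\<^sup>2 < m0 * (n (t, x))\<^sup>2" using m0 pos(2)[OF that] by simp
      also have "\<dots> \<le> f (t, x)" using x0(2)[OF that, folded m0_def] pos(2)[OF that] by (simp add: pos_le_divide_eq)
      finally show ?thesis .
    qed
    then show ?thesis using m0 by (intro exI[of _ "m0 / 2"]) simp
  qed (auto intro: exI[of _ 1])
  then obtain k where k: "k > 0" "\<And>x. x \<in> S0 \<Longrightarrow> f (t, x) > k * (n (t, x))\<^sup>2" by blast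
  \<comment> \<open>The set where the strict inequality holds is open in both variables and contains
    the sphere over \<open>t\<close>. By compactness the tube lemma yields a neighbourhood of
    \<open>t\<close> that works for all directions at once.\<close>
  define Z where "Z = (S \<times> UNIV) \<inter> (\<lambda>z. f z - k * (n z)\<^sup>2) -` {0<..}"
  have "open Z" unfolding Z_def
    by (rule continuous_open_preimage[OF continuous_on_diff[OF cf(1)
          continuous_on_mult[OF continuous_on_const continuous_on_power[OF cf(2)]]] open_Times[OF oS open_UNIV] open_greaterThan])
  moreover have "{t} \<times> S0 \<subseteq> Z" using k(2) S(2) by (auto simp: Z_def)
  ultimately have "\<exists>X0. t \<in> X0 \<and> open X0 \<and> X0 \<times> S0 \<subseteq> Z"
    by (rule Elementary_Topology.tube_lemma[OF cS0])
  then obtain N0 where N0: "t \<in> N0" "open N0" "N0 \<times> S0 \<subseteq> Z" by blast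
  \<comment> \<open>This secures the second demand: \<open>I_coord\<close> is closed and the unit is
    continuous in the chart.\<close>
  define N1 where "N1 = fst c \<inter> (\<lambda>q. cv_unit A K C q c) -` (- I_coord)"
  have N1: "open N1" unfolding N1_def
    by (rule continuous_open_preimage[OF unit_continuous[OF c(1)] chart_homeo(1)[OF c(1)]]) (use closed_I_coord in auto)
  define N where "N = S \<inter> N0 \<inter> N1"
  have N: "open_in A N" unfolding N_def by (rule open_in_Int(1)[OF open_in_Int(1)[OF S(1) N0(2)] N1])
  have key: "comm_norm q u > k * (norm_M q u)\<^sup>2" if q: "q \<in> N" and u: "u \<in> neg_cone q" "u \<noteq> 0" for q u
  proof -
    have q': "q \<in> S" "q \<in> N0" "q \<in> fst c" "q \<in> mfd A" using q S open_inD(3)[OF N q] by (auto simp: N_def)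
    note cq = c(1) q'(3)
    have ut: "u \<in> tspace A q" "u c \<in> I_coord" using u(1) by (auto simp: neg_cone_def)
    have unz: "u c \<noteq> 0" using tspace_eqI[OF cq ut(1) tspace_0] u(2) by auto
    \<comment> \<open>This is the euclidean length of the coordinates, not \<open>norm_M\<close>;
      dividing by it moves \<open>u\<close> to the sphere on which the bound was
      established.\<close>
    define r where "r = norm (u c)"
    have r: "r > 0" using unz by (simp add: r_def)
    define x where "x = (1 / r) *\<^sub>R u c"
    have x: "x \<in> S0" using I_coord_scaleR[OF ut(2)] r by (simp add: S0_def x_def r_def)
    have "u c = of_real r *s x" using r by (simp add: x_def vec_eq_iff scaleR_conv_of_real[where 'a = complex])
    then have ux: "u = tscl (of_real r) (tvec_of c q x)"
      using tvec_of(3)[OF cq ut(1)] tvec_of_linear(2)[OF cq] by metis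
    have "(q, x) \<in> Z" using N0(3) q'(2) x by blast
    then have "comm_norm q (tvec_of c q x) > k * (norm_M q (tvec_of c q x))\<^sup>2" by (simp add: Z_def f_def n_def)
    then have "(r\<^sup>2)\<^sup>2 * comm_norm q (tvec_of c q x) > (r\<^sup>2)\<^sup>2 * (k * (norm_M q (tvec_of c q x))\<^sup>2)" using r by simp
    then show ?thesis
      unfolding ux comm_norm_scl[OF q'(4) tvec_of(1)[OF cq]] norm_M_scl[OF q'(4) tvec_of(1)[OF cq]]
      by (simp add: power_mult_distrib mult.left_commute)
  qed
  have n1: "t \<in> N" using S(2) N0(1) c(2) unit_not_I_coord by (simp add: N_def N1_def)
  have n2: "N \<subseteq> fst c" using S(3) by (auto simp: N_def)
  have n3: "cv_unit A K C q c \<notin> I_coord" if "q \<in> N" for q using that by (simp add: N_def N1_def)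
  show ?thesis
    by (rule exI[of _ N], rule exI[of _ k], intro conjI ballI N n1 n2 k(1)) (rule n3, assumption, rule key, auto)
qed

end

lemma R_sect_less:
  assumes q: "q \<in> mfd A" and X: "X \<in> tspace A q" "X \<noteq> 0" and k: "comm_norm q X > k * (norm_M q X)\<^sup>2"
  shows "Re (R_sect A K C h q X) < - k"
proof -
  have "k < comm_norm q X / (norm_M q X)\<^sup>2" using k norm_M_pos[OF q X] by (simp add: pos_less_divide_eq)
  then show ?thesis using R_sect_bound(2)[OF q X(1)] by simp
qed

lemma irreducible_point:
  assumes t: "t \<in> mfd A" and irr: "irreducible_algebra tscl (tspace A t) (cv_mult A K C t)"
  shows "\<exists>V U. open_in A V \<and> t \<in> V \<and>
           (\<forall>q\<in>V. U q \<subseteq> tspace A q \<and>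
              tspace A q = {tscl z (cv_unit A K C q) + u | z u. u \<in> U q} \<and>
              range (\<lambda>z. tscl z (cv_unit A K C q)) \<inter> U q = {0}) \<and>
           (\<forall>q\<in>V. \<forall>r\<ge>0. \<forall>u\<in>U q. tscl (complex_of_real r) u \<in> U q) \<and>
           max_ideal tscl (tspace A t) (cv_mult A K C t) \<subseteq> U t \<and>
           (\<exists>k0>0. \<forall>q\<in>V. \<forall>X\<in>U q - {0}. Re (R_sect A K C h q X) < - k0) \<and>
           (\<forall>l0>0. \<exists>k1>0. \<forall>q\<in>V. \<forall>X\<in>tspace A q.
              X - cv_unit A K C q \<in> U q - {0} \<and>
              Re (h_M K C h q (X - cv_unit A K C q) (X - cv_unit A K C q)) > l0 * Re (h_M K C h q X X)
              \<longrightarrow> Re (R_sect A K C h q X) < - k1)"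
proof -
  obtain c where c: "c \<in> A" "t \<in> fst c" using t unfolding mfd_def by blast
  obtain N k where N: "open_in A N" "t \<in> N" "N \<subseteq> fst c" and k: "k > 0"
    and ek: "\<forall>q\<in>N. cv_unit A K C q c \<notin> I_coord t c \<and> (\<forall>u\<in>neg_cone t c q - {0}. comm_norm q u > k * (norm_M q u)\<^sup>2)"
    using neg_cone_bound[OF t irr c] by (elim exE conjE) (rule that)
  have e: "cv_unit A K C q c \<notin> I_coord t c" if "q \<in> N" for q using ek that by blast
  have key: "comm_norm q u > k * (norm_M q u)\<^sup>2" if "q \<in> N" "u \<in> neg_cone t c q" "u \<noteq> 0" for q u
    using ek that by blast
  let ?U = "neg_cone t c"
  have Ut: "?U q \<subseteq> tspace A q" for q by (auto simp: neg_cone_def[OF t irr c])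
  have dec: "tspace A q = {tscl z (cv_unit A K C q) + u | z u. u \<in> ?U q}"
    "range (\<lambda>z. tscl z (cv_unit A K C q)) \<inter> ?U q = {0}" if "q \<in> N" for q
    by (rule neg_cone_decomposition[OF t irr c subsetD[OF N(3) that] e[OF that]])+
  have 1: "max_ideal tscl (tspace A t) (cv_mult A K C t) \<subseteq> ?U t"
    using I_t_coord[OF t irr c] by (auto simp: neg_cone_def[OF t irr c])
  have 2: "Re (R_sect A K C h q X) < - k" if "q \<in> N" "X \<in> ?U q - {0}" for q X
  proof -
    have X: "X \<in> ?U q" "X \<noteq> 0" using that(2) by auto
    show ?thesis by (rule R_sect_less[OF open_inD(3)[OF N(1) that(1)] subsetD[OF Ut X(1)] X(2) key[OF that(1) X]])
  qed
  \<comment> \<open>With \<open>u\<close> the difference of \<open>X\<close> and the unit, the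
    commutators of \<open>X\<close> and \<open>u\<close> agree, so \<open>comm_norm\<close> of
    \<open>X\<close> exceeds \<open>k\<close> times the square of \<open>norm_M\<close> of
    \<open>u\<close>. The hypothesis bounds \<open>norm_M\<close> of \<open>u\<close> below by
    \<open>l0\<close> times that of \<open>X\<close>, and squaring gives the constant
    \<open>k * l0\<^sup>2\<close>.\<close>
  have 3: "Re (R_sect A K C h q X) < - (k * l0\<^sup>2)"
    if l0: "l0 > 0" and q: "q \<in> N" and X: "X \<in> tspace A q" and u: "X - cv_unit A K C q \<in> ?U q - {0}"
      and l: "Re (h_M K C h q (X - cv_unit A K C q) (X - cv_unit A K C q)) > l0 * Re (h_M K C h q X X)" for l0 q X
  proof (rule R_sect_less[OF open_inD(3)[OF N(1) q] X])
    note m = open_inD(3)[OF N(1) q]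
    let ?u = "X - cv_unit A K C q"
    have ut': "?u \<in> ?U q" "?u \<noteq> 0" using u by auto
    note ut = subsetD[OF Ut ut'(1)] ut'
    \<comment> \<open>For X = 0 the difference would be minus the unit, a non-zero vector both of
      the cone and of the line spanned by the unit.\<close>
    show "X \<noteq> 0"
    proof
      assume "X = 0"
      then have "?u = tscl (-1) (cv_unit A K C q)" by (simp add: tscl_def fun_eq_iff vec_eq_iff)
      then have "?u \<in> range (\<lambda>z. tscl z (cv_unit A K C q)) \<inter> ?U q" using ut(2) by blast
      then show False using dec(2)[OF q] ut(3) by blast
    qed
    have "comm_norm q X = comm_norm q ?u"
      using comm_norm_unit_add[OF m ut(1)] by simp
    moreover have "(l0 * norm_M q X)\<^sup>2 < (norm_M q ?u)\<^sup>2"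
      by (rule power_strict_mono) (use l l0 norm_M_nonneg[OF m X] in \<open>simp_all add: norm_M_def\<close>)
    then have "k * (l0 * norm_M q X)\<^sup>2 < k * (norm_M q ?u)\<^sup>2" using k by simp
    moreover have "\<dots> < comm_norm q ?u" by (rule key[OF q ut(2,3)])
    ultimately show "k * l0\<^sup>2 * (norm_M q X)\<^sup>2 < comm_norm q X" by (simp add: power_mult_distrib mult.assoc)
  qed
  show ?thesis
  proof (rule exI[of _ N], rule exI[of _ ?U], intro conjI ballI allI impI)
    show "\<exists>k0>0. \<forall>q\<in>N. \<forall>X\<in>?U q - {0}. Re (R_sect A K C h q X) < - k0"
      by (intro exI[of _ k] conjI ballI k 2)
    fix l0 :: real assume l0: "l0 > 0"
    show "\<exists>k1>0. \<forall>q\<in>N. \<forall>X\<in>tspace A q.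
              X - cv_unit A K C q \<in> ?U q - {0} \<and>
              Re (h_M K C h q (X - cv_unit A K C q) (X - cv_unit A K C q)) > l0 * Re (h_M K C h q X X)
              \<longrightarrow> Re (R_sect A K C h q X) < - k1"
    proof (rule exI[of _ "k * l0\<^sup>2"], intro conjI ballI impI, goal_cases)
      case 1
      then show ?case using k l0 by simp
    next
      case (2 q X)
      then show ?case by (elim conjE) (rule 3[OF l0])
    qed
  qed (rule N Ut 1 dec neg_cone_scl[OF t irr c]; assumption)+
qed

lemma pos_def_C_image:
  assumes p: "p \<in> mfd A" shows "pos_def_form (end_scl K) (C p ` tspace A p) (h_end K h p)"
proof -
  have "C p ` tspace A p \<subseteq> fib_end K p" using C_end[OF p] by blast
  then show ?thesis using KB.pos_def_h_end[OF p] unfolding pos_def_form_def hermitian_form_def by blast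
qed

lemma max_ideal_splitting:
  assumes t: "t \<in> mfd A" and irr: "irreducible_algebra tscl (tspace A t) (cv_mult A K C t)"
  shows "tspace A t = {tscl z (cv_unit A K C t) + u | z u. u \<in> max_ideal tscl (tspace A t) (cv_mult A K C t)}"
    "range (\<lambda>z. tscl z (cv_unit A K C t)) \<inter> max_ideal tscl (tspace A t) (cv_mult A K C t) = {0}"
  by (rule irreducible_comm_alg.max_ideal_decomposition[OF irreducible_comm_alg_cv[OF t irr]])+

end

theorem theorem4p5:
  fixes A :: "('a::{t2_space, second_countable_topology}, 'm::finite) chart set"
    and K :: "('a, 'k::ab_group_add, 'n::finite) vbundle"
    and C :: "'a \<Rightarrow> ('a, 'm) tvec \<Rightarrow> 'k \<Rightarrow> 'k"
    and \<U> \<kappa> \<Q> :: "'a \<Rightarrow> 'k \<Rightarrow> 'k"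
    and g h :: "'a \<Rightarrow> 'k \<Rightarrow> 'k \<Rightarrow> complex"
    and D :: "('a, ('a, 'm) tvec, 'k) conn"
  assumes "CV_plus_structure A K C \<U> g \<kappa> h D \<Q>"
    and "unfolding_condition A K C"
  shows
    "(\<forall>p\<in>mfd A.
        pos_def_form (end_scl K) (fib_end K p) (h_end K h p) \<and>
        pos_def_form (end_scl K) (C p ` tspace A p) (h_end K h p) \<and>
        pos_def_form tscl (tspace A p) (h_M K C h p)) \<and>
     (\<forall>p\<in>mfd A.
        (\<forall>X\<in>tspace A p - {0}. Im (R_sect A K C h p X) = 0 \<and> Re (R_sect A K C h p X) \<le> 0) \<and>
        R_sect A K C h p (cv_unit A K C p) = 0) \<and>
     (\<forall>t\<in>mfd A. irreducible_algebra tscl (tspace A t) (cv_mult A K C t) \<longrightarrow>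
        tspace A t = {tscl z (cv_unit A K C t) + u | z u.
           u \<in> max_ideal tscl (tspace A t) (cv_mult A K C t)} \<and>
        range (\<lambda>z. tscl z (cv_unit A K C t)) \<inter> max_ideal tscl (tspace A t) (cv_mult A K C t) = {0} \<and>
        (\<exists>V U. open_in A V \<and> t \<in> V \<and>
           (\<forall>q\<in>V. U q \<subseteq> tspace A q \<and>
              tspace A q = {tscl z (cv_unit A K C q) + u | z u. u \<in> U q} \<and>
              range (\<lambda>z. tscl z (cv_unit A K C q)) \<inter> U q = {0}) \<and>
           (\<forall>q\<in>V. \<forall>r\<ge>0. \<forall>u\<in>U q. tscl (complex_of_real r) u \<in> U q) \<and>
           max_ideal tscl (tspace A t) (cv_mult A K C t) \<subseteq> U t \<and>
           (\<exists>k0>0. \<forall>q\<in>V. \<forall>X\<in>U q - {0}. Re (R_sect A K C h q X) < - k0) \<and>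
           (\<forall>l0>0. \<exists>k1>0. \<forall>q\<in>V. \<forall>X\<in>tspace A q.
              X - cv_unit A K C q \<in> U q - {0} \<and>
              Re (h_M K C h q (X - cv_unit A K C q) (X - cv_unit A K C q)) > l0 * Re (h_M K C h q X X)
              \<longrightarrow> Re (R_sect A K C h q X) < - k1)))"
proof -
  interpret cv_unfolding A K C \<U> g \<kappa> h D \<Q>
    using assms by (simp add: cv_unfolding_def cv_unfolding_axioms_def)
  show ?thesis
  proof (intro conjI ballI impI)
    fix p assume p: "p \<in> mfd A"
    show "pos_def_form (end_scl K) (fib_end K p) (h_end K h p)" by (rule KB.pos_def_h_end[OF p])
    show "pos_def_form (end_scl K) (C p ` tspace A p) (h_end K h p)" by (rule pos_def_C_image[OF p])
    show "pos_def_form tscl (tspace A p) (h_M K C h p)" by (rule pos_def_h_M[OF p])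
    show "R_sect A K C h p (cv_unit A K C p) = 0" by (rule R_sect_unit[OF p])
    fix X assume "X \<in> tspace A p - {0}"
    then have X: "X \<in> tspace A p" by simp
    show "Im (R_sect A K C h p X) = 0" by (rule R_sect_bound(1)[OF p X])
    have "- comm_norm p X / (norm_M p X)\<^sup>2 \<le> 0" using comm_norm_nonneg[OF p X] by simp
    then show "Re (R_sect A K C h p X) \<le> 0" using R_sect_bound(2)[OF p X] by linarith
  next
    fix t assume t: "t \<in> mfd A" and irr: "irreducible_algebra tscl (tspace A t) (cv_mult A K C t)"
    show "tspace A t = {tscl z (cv_unit A K C t) + u | z u. u \<in> max_ideal tscl (tspace A t) (cv_mult A K C t)}"
      "range (\<lambda>z. tscl z (cv_unit A K C t)) \<inter> max_ideal tscl (tspace A t) (cv_mult A K C t) = {0}"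
      by (rule max_ideal_splitting[OF t irr])+
    show "\<exists>V U. open_in A V \<and> t \<in> V \<and>
           (\<forall>q\<in>V. U q \<subseteq> tspace A q \<and>
              tspace A q = {tscl z (cv_unit A K C q) + u | z u. u \<in> U q} \<and>
              range (\<lambda>z. tscl z (cv_unit A K C q)) \<inter> U q = {0}) \<and>
           (\<forall>q\<in>V. \<forall>r\<ge>0. \<forall>u\<in>U q. tscl (complex_of_real r) u \<in> U q) \<and>
           max_ideal tscl (tspace A t) (cv_mult A K C t) \<subseteq> U t \<and>
           (\<exists>k0>0. \<forall>q\<in>V. \<forall>X\<in>U q - {0}. Re (R_sect A K C h q X) < - k0) \<and>
           (\<forall>l0>0. \<exists>k1>0. \<forall>q\<in>V. \<forall>X\<in>tspace A q.
              X - cv_unit A K C q \<in> U q - {0} \<and>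
              Re (h_M K C h q (X - cv_unit A K C q) (X - cv_unit A K C q)) > l0 * Re (h_M K C h q X X)
              \<longrightarrow> Re (R_sect A K C h q X) < - k1)"
      by (rule irreducible_point[OF t irr])
  qed
qed

end
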